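(* Let $E\to M$ be a Hermitian vector bundle over a compact smooth manifold without boundary, $I\subset\mathbb R$ a compact interval, $\rho>0$, and let $H(t)\in\Psi^{-\rho}(M,E)$, $t\in I$, be a continuous family of symmetric pseudodifferential operators of negative order $-\rho$. Suppose the equation $\mathrm i\partial_tu=H(t)u$ generates a well-defined unitary propagator $U(t,s)$, $s,t\in I$, on $L^2(M,E)$. Then the cut-off convergence assumptions hold with no loss of derivatives ($\mu=0$), that is: (i) each $H(t)$ extends to a bounded operator on $L^2(M,E)$; (ii) $t\mapsto H(t)$ is continuous from $I$ to $\mathcal L(L^2(M,E))$ in operator norm; (iii) for every $u\in L^2(M,E)$ the map $(t,s)\mapsto U(t,s)u$ is continuous from $I\times I$ to $L^2(M,E)$; (iv) for every $u\in L^2(M,E)$, $t\mapsto U(t,s)u$ is a strong solution of $\mathrm i\partial_tu(t)=H(t)u(t)$ in $L^2(M,E)$.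
   Context: $M$ carries a fixed smooth positive density and $L^2(M,E)$ is the corresponding Hilbert space. $\Psi^{-\rho}(M,E)$ is the space of pseudodifferential operators of order $-\rho$ on sections of $E$; "continuous family" means continuous in $t$ in its Fr\'echet topology, and "symmetric" means symmetric in $L^2(M,E)$ on $C^\infty(M,E)$. "Generates a unitary propagator" means: $U(t,s)$ are unitary, strongly continuous in $(t,s)\in I\times I$, satisfy $U(t,r)U(r,s)=U(t,s)$ and $U(s,s)=\mathbf 1$, and $t\mapsto U(t,s)u$ solves $\mathrm i\partial_tu=H(t)u$ strongly in $L^2(M,E)$ for $u\in C^\infty(M,E)$. *)

theory Defs
  imports "HOL-Analysis.Analysis"
begin

section \<open>Smooth functions on Euclidean space\<close>

text \<open>Multi-indices are lists of basis vectors; the order of the multi-index is the length of the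
  list.\<close>

primrec pderivs :: "'a list \<Rightarrow> ('a::euclidean_space \<Rightarrow> 'b::real_normed_vector) \<Rightarrow> 'a \<Rightarrow> 'b" where
  "pderivs [] f = f"
| "pderivs (v # vs) f = (\<lambda>x. frechet_derivative (pderivs vs f) (at x) v)"

text \<open>Only used for open \<open>S\<close>.\<close>

definition smooth_on :: "'a set \<Rightarrow> ('a::euclidean_space \<Rightarrow> 'b::real_normed_vector) \<Rightarrow> bool" where
  "smooth_on S f \<longleftrightarrow>
     (\<forall>vs. set vs \<subseteq> Basis \<longrightarrow> (\<forall>x\<in>S. pderivs vs f differentiable (at x)))"

definition supp :: "('a::topological_space \<Rightarrow> complex) \<Rightarrow> 'a set" where
  "supp f = closure {x. f x \<noteq> 0}"

definition test_function :: "('a::euclidean_space \<Rightarrow> complex) \<Rightarrow> bool" where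
  "test_function u \<longleftrightarrow> smooth_on UNIV u \<and> compact (supp u)"


section \<open>Symbols and quantization on Euclidean space\<close>

definition symbol_pderivs ::
  "'a list \<Rightarrow> 'a list \<Rightarrow> ('a::euclidean_space \<times> 'a \<Rightarrow> complex) \<Rightarrow> 'a \<times> 'a \<Rightarrow> complex" where
  "symbol_pderivs \<alpha> \<beta> a = pderivs (map (\<lambda>v. (v, 0)) \<alpha> @ map (\<lambda>v. (0, v)) \<beta>) a"

text \<open>The symbol class \<open>S\<^sup>m\<close> of type \<open>(1,0)\<close>, uniformly in \<open>x\<close>.\<close>

definition symbol_class :: "real \<Rightarrow> ('a::euclidean_space \<times> 'a \<Rightarrow> complex) set" where
  "symbol_class m = {a. smooth_on UNIV a \<and>
     (\<forall>\<alpha> \<beta>. set \<alpha> \<subseteq> Basis \<and> set \<beta> \<subseteq> Basis \<longrightarrow>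
        (\<exists>C. \<forall>x \<xi>. norm (symbol_pderivs \<alpha> \<beta> a (x, \<xi>))
                    \<le> C * (1 + norm \<xi>) powr (m - real (length \<beta>))))}"

definition symbol_seminorm ::
  "real \<Rightarrow> 'a list \<Rightarrow> 'a list \<Rightarrow> ('a::euclidean_space \<times> 'a \<Rightarrow> complex) \<Rightarrow> real" where
  "symbol_seminorm m \<alpha> \<beta> a =
     (SUP z. norm (symbol_pderivs \<alpha> \<beta> a z) / (1 + norm (snd z)) powr (m - real (length \<beta>)))"

definition fourier :: "('a::euclidean_space \<Rightarrow> complex) \<Rightarrow> 'a \<Rightarrow> complex" where
  "fourier u \<xi> = (LINT y|lborel. cis (- (y \<bullet> \<xi>)) * u y)"

definition Op :: "('a::euclidean_space \<times> 'a \<Rightarrow> complex) \<Rightarrow> ('a \<Rightarrow> complex) \<Rightarrow> 'a \<Rightarrow> complex" where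
  "Op a u x = complex_of_real (1 / (2 * pi) ^ DIM('a)) *
     (LINT \<xi>|lborel. cis (x \<bullet> \<xi>) * a (x, \<xi>) * fourier u \<xi>)"

definition kernel_seminorm ::
  "('a \<times> 'a) list \<Rightarrow> ('a::euclidean_space \<times> 'a \<Rightarrow> complex) \<Rightarrow> real" where
  "kernel_seminorm \<gamma> K = (SUP z. norm (pderivs \<gamma> K z))"


section \<open>Hermitian vector bundles over smooth manifolds\<close>

text \<open>The base manifold is the type \<open>'m\<close>.  Its fibres are complex subspaces of an ambient complex
  vector space \<open>'f\<close> without topology (every bundle is of this form: take the direct sum of all
  fibres), so that sections can be added pointwise.  A bundle chart consists of a coordinate
  system on \<open>patch\<close> with values in the model space \<open>'a\<close> and a trivialization over \<open>patch\<close>;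
  \<open>C^k\<close> is the set of sequences that vanish from index \<open>k\<close> on.\<close>

record ('m, 'a, 'f) bundle_chart =
  patch :: "'m set"
  coord :: "'m \<Rightarrow> 'a"
  rk :: nat
  triv :: "'m \<Rightarrow> 'f \<Rightarrow> nat \<Rightarrow> complex"

record ('m, 'a, 'f) hbundle =
  scal :: "complex \<Rightarrow> 'f \<Rightarrow> 'f"
  fib :: "'m \<Rightarrow> 'f set"
  atlas :: "('m, 'a, 'f) bundle_chart set"
  herm :: "'m \<Rightarrow> 'f \<Rightarrow> 'f \<Rightarrow> complex"
  dens :: "'m measure"

definition Cvec :: "nat \<Rightarrow> (nat \<Rightarrow> complex) set" where
  "Cvec k = {z. \<forall>p\<ge>k. z p = 0}"

definition img :: "('m, 'a, 'f) bundle_chart \<Rightarrow> 'a set" where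
  "img c = coord c ` patch c"

definition coord_inv :: "('m, 'a, 'f) bundle_chart \<Rightarrow> 'a \<Rightarrow> 'm" where
  "coord_inv c = inv_into (patch c) (coord c)"

definition frame ::
  "('m, 'a, 'f) hbundle \<Rightarrow> ('m, 'a, 'f) bundle_chart \<Rightarrow> nat \<Rightarrow> 'm \<Rightarrow> 'f" where
  "frame X c q x = inv_into (fib X x) (triv c x) (\<lambda>p. if p = q then 1 else 0)"

definition is_bundle_chart ::
  "('m::t2_space, 'a::euclidean_space, 'f::ab_group_add) hbundle \<Rightarrow>
   ('m, 'a, 'f) bundle_chart \<Rightarrow> bool" where
  "is_bundle_chart X c \<longleftrightarrow>
     open (patch c) \<and> open (img c) \<and>
     homeomorphism (patch c) (img c) (coord c) (coord_inv c) \<and>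
     (\<forall>x\<in>patch c.
        bij_betw (triv c x) (fib X x) (Cvec (rk c)) \<and>
        (\<forall>v\<in>fib X x. \<forall>w\<in>fib X x. \<forall>p. triv c x (v + w) p = triv c x v p + triv c x w p) \<and>
        (\<forall>z. \<forall>v\<in>fib X x. \<forall>p. triv c x (scal X z v) p = z * triv c x v p))"

definition compatible_charts ::
  "('m::t2_space, 'a::euclidean_space, 'f::ab_group_add) hbundle \<Rightarrow>
   ('m, 'a, 'f) bundle_chart \<Rightarrow> ('m, 'a, 'f) bundle_chart \<Rightarrow> bool" where
  "compatible_charts X c d \<longleftrightarrow>
     smooth_on (coord c ` (patch c \<inter> patch d)) (coord d \<circ> coord_inv c) \<and>
     (\<forall>q<rk c. \<forall>p<rk d. smooth_on (coord c ` (patch c \<inter> patch d))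
        (\<lambda>y. triv d (coord_inv c y) (frame X c q (coord_inv c y)) p))"

definition smooth_vector_bundle ::
  "('m::t2_space, 'a::euclidean_space, 'f::ab_group_add) hbundle \<Rightarrow> bool" where
  "smooth_vector_bundle X \<longleftrightarrow>
     vector_space (scal X) \<and>
     (\<forall>x. module.subspace (scal X) (fib X x)) \<and>
     (\<Union>c\<in>atlas X. patch c) = UNIV \<and>
     (\<forall>c\<in>atlas X. is_bundle_chart X c) \<and>
     (\<forall>c\<in>atlas X. \<forall>d\<in>atlas X. compatible_charts X c d)"

text \<open>Linear in the second argument.\<close>

definition hermitian_metric ::
  "('m::t2_space, 'a::euclidean_space, 'f::ab_group_add) hbundle \<Rightarrow> bool" where
  "hermitian_metric X \<longleftrightarrow>
     (\<forall>x. \<forall>u\<in>fib X x. \<forall>v\<in>fib X x. \<forall>w\<in>fib X x. \<forall>z.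
        herm X x u (v + w) = herm X x u v + herm X x u w \<and>
        herm X x u (scal X z v) = z * herm X x u v \<and>
        herm X x v u = cnj (herm X x u v)) \<and>
     (\<forall>x. \<forall>u\<in>fib X x. u \<noteq> 0 \<longrightarrow> Re (herm X x u u) > 0) \<and>
     (\<forall>c\<in>atlas X. \<forall>p<rk c. \<forall>q<rk c. smooth_on (img c)
        (\<lambda>y. herm X (coord_inv c y) (frame X c p (coord_inv c y)) (frame X c q (coord_inv c y))))"

definition smooth_positive_density ::
  "('m::t2_space, 'a::euclidean_space, 'f::ab_group_add) hbundle \<Rightarrow> bool" where
  "smooth_positive_density X \<longleftrightarrow>
     sets (dens X) = sets borel \<and>
     (\<forall>c\<in>atlas X. \<exists>w :: 'a \<Rightarrow> real. smooth_on (img c) w \<and> (\<forall>y\<in>img c. w y > 0) \<and>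
        (\<forall>B\<in>sets borel. B \<subseteq> patch c \<longrightarrow>
           emeasure (dens X) B = (\<integral>\<^sup>+y\<in>coord c ` B. ennreal (w y) \<partial>lborel)))"

definition smooth_sections ::
  "('m::t2_space, 'a::euclidean_space, 'f::ab_group_add) hbundle \<Rightarrow> ('m \<Rightarrow> 'f) set" where
  "smooth_sections X = {u. (\<forall>x. u x \<in> fib X x) \<and>
     (\<forall>c\<in>atlas X. \<forall>p<rk c.
        smooth_on (img c) (\<lambda>y. triv c (coord_inv c y) (u (coord_inv c y)) p))}"


section \<open>The Hilbert space of square integrable sections\<close>

text \<open>Elements of \<open>L\<^sup>2(M,E)\<close> are represented by measurable sections, and equality in
  \<open>L\<^sup>2(M,E)\<close> is equality almost everywhere.  Operators on \<open>L\<^sup>2(M,E)\<close> act on representatives;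
  their algebraic properties hold up to \<open>L2_eq\<close>, and a linear operator that is bounded in this
  sense respects \<open>L2_eq\<close>.\<close>

definition measurable_sections ::
  "('m::t2_space, 'a::euclidean_space, 'f::ab_group_add) hbundle \<Rightarrow> ('m \<Rightarrow> 'f) set" where
  "measurable_sections X = {u. (\<forall>x. u x \<in> fib X x) \<and>
     (\<forall>c\<in>atlas X. \<forall>p<rk c.
        (\<lambda>x. if x \<in> patch c then triv c x (u x) p else 0) \<in> borel_measurable borel)}"

definition L2 ::
  "('m::t2_space, 'a::euclidean_space, 'f::ab_group_add) hbundle \<Rightarrow> ('m \<Rightarrow> 'f) set" where
  "L2 X = {u \<in> measurable_sections X. integrable (dens X) (\<lambda>x. herm X x (u x) (u x))}"

definition L2_eq :: "('m, 'a, 'f) hbundle \<Rightarrow> ('m \<Rightarrow> 'f) \<Rightarrow> ('m \<Rightarrow> 'f) \<Rightarrow> bool" where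
  "L2_eq X u v \<longleftrightarrow> (AE x in dens X. u x = v x)"

definition L2_inner :: "('m, 'a, 'f) hbundle \<Rightarrow> ('m \<Rightarrow> 'f) \<Rightarrow> ('m \<Rightarrow> 'f) \<Rightarrow> complex" where
  "L2_inner X u v = (LINT x|dens X. herm X x (u x) (v x))"

definition L2_norm :: "('m, 'a, 'f) hbundle \<Rightarrow> ('m \<Rightarrow> 'f) \<Rightarrow> real" where
  "L2_norm X u = sqrt (Re (L2_inner X u u))"

definition L2_linear ::
  "('m::t2_space, 'a::euclidean_space, 'f::ab_group_add) hbundle \<Rightarrow>
   (('m \<Rightarrow> 'f) \<Rightarrow> 'm \<Rightarrow> 'f) \<Rightarrow> bool" where
  "L2_linear X T \<longleftrightarrow>
     (\<forall>u\<in>L2 X. T u \<in> L2 X) \<and>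
     (\<forall>u\<in>L2 X. \<forall>v\<in>L2 X. L2_eq X (T (\<lambda>x. u x + v x)) (\<lambda>x. T u x + T v x)) \<and>
     (\<forall>z. \<forall>u\<in>L2 X. L2_eq X (T (\<lambda>x. scal X z (u x))) (\<lambda>x. scal X z (T u x)))"

definition L2_bounded ::
  "('m::t2_space, 'a::euclidean_space, 'f::ab_group_add) hbundle \<Rightarrow>
   (('m \<Rightarrow> 'f) \<Rightarrow> 'm \<Rightarrow> 'f) \<Rightarrow> bool" where
  "L2_bounded X T \<longleftrightarrow>
     L2_linear X T \<and> (\<exists>C. \<forall>u\<in>L2 X. L2_norm X (T u) \<le> C * L2_norm X u)"

definition L2_onorm ::
  "('m::t2_space, 'a::euclidean_space, 'f::ab_group_add) hbundle \<Rightarrow>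
   (('m \<Rightarrow> 'f) \<Rightarrow> 'm \<Rightarrow> 'f) \<Rightarrow> real" where
  "L2_onorm X T = (SUP u\<in>{u \<in> L2 X. L2_norm X u \<le> 1}. L2_norm X (T u))"

definition L2_unitary ::
  "('m::t2_space, 'a::euclidean_space, 'f::ab_group_add) hbundle \<Rightarrow>
   (('m \<Rightarrow> 'f) \<Rightarrow> 'm \<Rightarrow> 'f) \<Rightarrow> bool" where
  "L2_unitary X T \<longleftrightarrow>
     L2_linear X T \<and>
     (\<forall>u\<in>L2 X. \<forall>v\<in>L2 X. L2_inner X (T u) (T v) = L2_inner X u v) \<and>
     (\<forall>v\<in>L2 X. \<exists>u\<in>L2 X. L2_eq X (T u) v)"

definition L2_continuous_on ::
  "('m, 'a, 'f::ab_group_add) hbundle \<Rightarrow> 'p::topological_space set \<Rightarrow> ('p \<Rightarrow> 'm \<Rightarrow> 'f) \<Rightarrow> bool" where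
  "L2_continuous_on X S v \<longleftrightarrow>
     (\<forall>p\<in>S. ((\<lambda>r. L2_norm X (\<lambda>x. v r x - v p x)) \<longlongrightarrow> 0) (at p within S))"

definition L2_has_derivative ::
  "('m, 'a, 'f::ab_group_add) hbundle \<Rightarrow> (real \<Rightarrow> 'm \<Rightarrow> 'f) \<Rightarrow> ('m \<Rightarrow> 'f) \<Rightarrow> real \<Rightarrow> real set \<Rightarrow> bool"
  where
  "L2_has_derivative X v g t S \<longleftrightarrow>
     ((\<lambda>r. L2_norm X (\<lambda>x. scal X (complex_of_real (1 / (r - t))) (v r x - v t x) - g x)) \<longlongrightarrow> 0)
       (at t within S)"

text \<open>\<open>v\<close> is a strong solution of \<open>i \<partial>\<^sub>t v = H(t) v\<close> on \<open>S\<close>, where \<open>R t w f\<close> expresses \<open>H(t) w = f\<close>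
  for \<open>w\<close> and \<open>f\<close> in \<open>L\<^sup>2(M,E)\<close>.\<close>

definition strong_solution ::
  "('m::t2_space, 'a::euclidean_space, 'f::ab_group_add) hbundle \<Rightarrow> real set \<Rightarrow>
   (real \<Rightarrow> ('m \<Rightarrow> 'f) \<Rightarrow> ('m \<Rightarrow> 'f) \<Rightarrow> bool) \<Rightarrow> (real \<Rightarrow> 'm \<Rightarrow> 'f) \<Rightarrow> bool" where
  "strong_solution X S R v \<longleftrightarrow>
     (\<forall>t\<in>S. v t \<in> L2 X \<and>
        (\<exists>g\<in>L2 X. L2_has_derivative X v g t S \<and> R t (v t) (\<lambda>x. scal X \<i> (g x))))"


section \<open>Pseudodifferential operators on sections\<close>

text \<open>\<open>C\<^sub>c\<^sup>\<infinity>(patch c)\<close>\<close>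

definition cutoff :: "('m::t2_space, 'a::euclidean_space, 'f) bundle_chart \<Rightarrow> ('m \<Rightarrow> complex) \<Rightarrow> bool"
  where
  "cutoff c \<phi> \<longleftrightarrow>
     smooth_on (img c) (\<phi> \<circ> coord_inv c) \<and> compact (supp \<phi>) \<and> supp \<phi> \<subseteq> patch c"

text \<open>The \<open>(p,q)\<close> matrix entry of \<open>\<phi> A \<psi>\<close>, written in the chart \<open>d\<close> in the domain and in the
  chart \<open>c\<close> in the range, and extended by zero to the whole Euclidean space.\<close>

definition localized ::
  "('m, 'a, 'f::ab_group_add) hbundle \<Rightarrow> ('m, 'a, 'f) bundle_chart \<Rightarrow> ('m, 'a, 'f) bundle_chart \<Rightarrow>
   ('m \<Rightarrow> complex) \<Rightarrow> ('m \<Rightarrow> complex) \<Rightarrow> nat \<Rightarrow> nat \<Rightarrow> (('m \<Rightarrow> 'f) \<Rightarrow> 'm \<Rightarrow> 'f) \<Rightarrow>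
   ('a \<Rightarrow> complex) \<Rightarrow> 'a \<Rightarrow> complex" where
  "localized X c d \<phi> \<psi> p q A u =
     (let s = (\<lambda>y. if y \<in> patch d then scal X (\<psi> y * u (coord d y)) (frame X d q y) else 0)
      in (\<lambda>y. if y \<in> img c
              then \<phi> (coord_inv c y) * triv c (coord_inv c y) (A s (coord_inv c y)) p
              else 0))"

definition local_symbol ::
  "('m, 'a::euclidean_space, 'f::ab_group_add) hbundle \<Rightarrow> real \<Rightarrow> ('m, 'a, 'f) bundle_chart \<Rightarrow>
   ('m \<Rightarrow> complex) \<Rightarrow> ('m \<Rightarrow> complex) \<Rightarrow> nat \<Rightarrow> nat \<Rightarrow> (('m \<Rightarrow> 'f) \<Rightarrow> 'm \<Rightarrow> 'f) \<Rightarrow>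
   ('a \<times> 'a \<Rightarrow> complex) \<Rightarrow> bool" where
  "local_symbol X m c \<phi> \<psi> p q A a \<longleftrightarrow>
     a \<in> symbol_class m \<and>
     (\<forall>u. test_function u \<longrightarrow> localized X c c \<phi> \<psi> p q A u = Op a u)"

definition local_kernel ::
  "('m, 'a::euclidean_space, 'f::ab_group_add) hbundle \<Rightarrow> ('m, 'a, 'f) bundle_chart \<Rightarrow>
   ('m, 'a, 'f) bundle_chart \<Rightarrow> ('m \<Rightarrow> complex) \<Rightarrow> ('m \<Rightarrow> complex) \<Rightarrow> nat \<Rightarrow> nat \<Rightarrow>
   (('m \<Rightarrow> 'f) \<Rightarrow> 'm \<Rightarrow> 'f) \<Rightarrow> ('a \<times> 'a \<Rightarrow> complex) \<Rightarrow> bool" where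
  "local_kernel X c d \<phi> \<psi> p q A K \<longleftrightarrow>
     test_function K \<and>
     (\<forall>u. test_function u \<longrightarrow>
        localized X c d \<phi> \<psi> p q A u = (\<lambda>x. LINT y|lborel. K (x, y) * u y))"

text \<open>The two localization data: a pair of cut-offs in one chart, and a pair of cut-offs with
  disjoint supports.\<close>

definition diagonal_data ::
  "('m::t2_space, 'a::euclidean_space, 'f::ab_group_add) hbundle \<Rightarrow> ('m, 'a, 'f) bundle_chart \<Rightarrow>
   ('m \<Rightarrow> complex) \<Rightarrow> ('m \<Rightarrow> complex) \<Rightarrow> nat \<Rightarrow> nat \<Rightarrow> bool" where
  "diagonal_data X c \<phi> \<psi> p q \<longleftrightarrow>
     c \<in> atlas X \<and> cutoff c \<phi> \<and> cutoff c \<psi> \<and> p < rk c \<and> q < rk c"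

definition off_diagonal_data ::
  "('m::t2_space, 'a::euclidean_space, 'f::ab_group_add) hbundle \<Rightarrow> ('m, 'a, 'f) bundle_chart \<Rightarrow>
   ('m, 'a, 'f) bundle_chart \<Rightarrow> ('m \<Rightarrow> complex) \<Rightarrow> ('m \<Rightarrow> complex) \<Rightarrow> nat \<Rightarrow> nat \<Rightarrow> bool" where
  "off_diagonal_data X c d \<phi> \<psi> p q \<longleftrightarrow>
     c \<in> atlas X \<and> d \<in> atlas X \<and> cutoff c \<phi> \<and> cutoff d \<psi> \<and> supp \<phi> \<inter> supp \<psi> = {} \<and>
     p < rk c \<and> q < rk d"

text \<open>\<open>\<Psi>\<^sup>m(M,E)\<close>: linear operators on smooth sections that are quantizations of symbols in local
  charts and whose Schwartz kernel is smooth off the diagonal.  The values of an operator outside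
  the space of smooth sections are irrelevant.\<close>

definition psido ::
  "('m::t2_space, 'a::euclidean_space, 'f::ab_group_add) hbundle \<Rightarrow> real \<Rightarrow>
   (('m \<Rightarrow> 'f) \<Rightarrow> 'm \<Rightarrow> 'f) set" where
  "psido X m = {A.
     (\<forall>u\<in>smooth_sections X. A u \<in> smooth_sections X) \<and>
     (\<forall>u\<in>smooth_sections X. \<forall>v\<in>smooth_sections X.
        A (\<lambda>x. u x + v x) = (\<lambda>x. A u x + A v x)) \<and>
     (\<forall>z. \<forall>u\<in>smooth_sections X. A (\<lambda>x. scal X z (u x)) = (\<lambda>x. scal X z (A u x))) \<and>
     (\<forall>c \<phi> \<psi> p q. diagonal_data X c \<phi> \<psi> p q \<longrightarrow> (\<exists>a. local_symbol X m c \<phi> \<psi> p q A a)) \<and>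
     (\<forall>c d \<phi> \<psi> p q. off_diagonal_data X c d \<phi> \<psi> p q \<longrightarrow>
        (\<exists>K. local_kernel X c d \<phi> \<psi> p q A K))}"

text \<open>The Frechet topology of \<open>\<Psi>\<^sup>m(M,E)\<close> is generated by the seminorms of the local symbols and of
  the local off-diagonal kernels.  A local symbol and a local kernel are uniquely determined by
  the operator, so that the sets below are the open balls of these seminorms.\<close>

definition symbol_ball ::
  "('m::t2_space, 'a::euclidean_space, 'f::ab_group_add) hbundle \<Rightarrow> real \<Rightarrow> ('m, 'a, 'f) bundle_chart \<Rightarrow>
   ('m \<Rightarrow> complex) \<Rightarrow> ('m \<Rightarrow> complex) \<Rightarrow> nat \<Rightarrow> nat \<Rightarrow> 'a list \<Rightarrow> 'a list \<Rightarrow>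
   (('m \<Rightarrow> 'f) \<Rightarrow> 'm \<Rightarrow> 'f) \<Rightarrow> real \<Rightarrow> (('m \<Rightarrow> 'f) \<Rightarrow> 'm \<Rightarrow> 'f) set" where
  "symbol_ball X m c \<phi> \<psi> p q \<alpha> \<beta> A \<epsilon> =
     {B \<in> psido X m. \<exists>a. local_symbol X m c \<phi> \<psi> p q (\<lambda>u x. B u x - A u x) a \<and>
                         symbol_seminorm m \<alpha> \<beta> a < \<epsilon>}"

definition kernel_ball ::
  "('m::t2_space, 'a::euclidean_space, 'f::ab_group_add) hbundle \<Rightarrow> real \<Rightarrow> ('m, 'a, 'f) bundle_chart \<Rightarrow>
   ('m, 'a, 'f) bundle_chart \<Rightarrow> ('m \<Rightarrow> complex) \<Rightarrow> ('m \<Rightarrow> complex) \<Rightarrow> nat \<Rightarrow> nat \<Rightarrow> ('a \<times> 'a) list \<Rightarrow>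
   (('m \<Rightarrow> 'f) \<Rightarrow> 'm \<Rightarrow> 'f) \<Rightarrow> real \<Rightarrow> (('m \<Rightarrow> 'f) \<Rightarrow> 'm \<Rightarrow> 'f) set" where
  "kernel_ball X m c d \<phi> \<psi> p q \<gamma> A \<epsilon> =
     {B \<in> psido X m. \<exists>K. local_kernel X c d \<phi> \<psi> p q (\<lambda>u x. B u x - A u x) K \<and>
                         kernel_seminorm \<gamma> K < \<epsilon>}"

definition psido_topology ::
  "('m::t2_space, 'a::euclidean_space, 'f::ab_group_add) hbundle \<Rightarrow> real \<Rightarrow>
   (('m \<Rightarrow> 'f) \<Rightarrow> 'm \<Rightarrow> 'f) topology" where
  "psido_topology X m = topology_generated_by
     ({psido X m} \<union>
      {symbol_ball X m c \<phi> \<psi> p q \<alpha> \<beta> A \<epsilon> | c \<phi> \<psi> p q \<alpha> \<beta> A \<epsilon>.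
         diagonal_data X c \<phi> \<psi> p q \<and> set \<alpha> \<subseteq> Basis \<and> set \<beta> \<subseteq> Basis \<and> A \<in> psido X m \<and> \<epsilon> > 0} \<union>
      {kernel_ball X m c d \<phi> \<psi> p q \<gamma> A \<epsilon> | c d \<phi> \<psi> p q \<gamma> A \<epsilon>.
         off_diagonal_data X c d \<phi> \<psi> p q \<and> set \<gamma> \<subseteq> Basis \<and> A \<in> psido X m \<and> \<epsilon> > 0})"

definition symmetric_operator ::
  "('m::t2_space, 'a::euclidean_space, 'f::ab_group_add) hbundle \<Rightarrow>
   (('m \<Rightarrow> 'f) \<Rightarrow> 'm \<Rightarrow> 'f) \<Rightarrow> bool" where
  "symmetric_operator X A \<longleftrightarrow>
     (\<forall>u\<in>smooth_sections X. \<forall>v\<in>smooth_sections X. L2_inner X (A u) v = L2_inner X u (A v))"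


section \<open>Unitary propagators\<close>

text \<open>\<open>A v = f\<close> in the sense of distributions, for \<open>v\<close> and \<open>f\<close> in \<open>L\<^sup>2(M,E)\<close> and a symmetric
  operator \<open>A\<close> on smooth sections.  In the definition of a propagator \<open>U(t,s) u\<close> is only known
  to be in \<open>L\<^sup>2(M,E)\<close>, so that \<open>H(t) U(t,s) u\<close> is a priori a distribution.\<close>

definition distributional_image ::
  "('m::t2_space, 'a::euclidean_space, 'f::ab_group_add) hbundle \<Rightarrow>
   (('m \<Rightarrow> 'f) \<Rightarrow> 'm \<Rightarrow> 'f) \<Rightarrow> ('m \<Rightarrow> 'f) \<Rightarrow> ('m \<Rightarrow> 'f) \<Rightarrow> bool" where
  "distributional_image X A v f \<longleftrightarrow>
     (\<forall>w\<in>smooth_sections X. L2_inner X (A w) v = L2_inner X w f)"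

definition generates_unitary_propagator ::
  "('m::t2_space, 'a::euclidean_space, 'f::ab_group_add) hbundle \<Rightarrow> real set \<Rightarrow>
   (real \<Rightarrow> ('m \<Rightarrow> 'f) \<Rightarrow> 'm \<Rightarrow> 'f) \<Rightarrow> (real \<Rightarrow> real \<Rightarrow> ('m \<Rightarrow> 'f) \<Rightarrow> 'm \<Rightarrow> 'f) \<Rightarrow> bool" where
  "generates_unitary_propagator X I H U \<longleftrightarrow>
     (\<forall>t\<in>I. \<forall>s\<in>I. L2_unitary X (U t s)) \<and>
     (\<forall>u\<in>L2 X. L2_continuous_on X (I \<times> I) (\<lambda>(t, s). U t s u)) \<and>
     (\<forall>t\<in>I. \<forall>r\<in>I. \<forall>s\<in>I. \<forall>u\<in>L2 X. L2_eq X (U t r (U r s u)) (U t s u)) \<and>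
     (\<forall>s\<in>I. \<forall>u\<in>L2 X. L2_eq X (U s s u) u) \<and>
     (\<forall>s\<in>I. \<forall>u\<in>smooth_sections X.
        strong_solution X I (\<lambda>t. distributional_image X (H t)) (\<lambda>t. U t s u))"

end

theory Submission
  imports Defs "HOL-Library.Function_Algebras"
begin

text \<open>
  Only the boundedness of operators of order \<open>-\<rho> < 0\<close> on \<open>L\<^sup>2\<close>, with a bound by finitely many symbol seminorms,
  needs the pseudodifferential calculus; the rest is abstract functional analysis.  In local coordinates, a
  dyadic decomposition in \<open>\<xi>\<close> writes the kernel as a sum of pieces dominated by
  \<open>2\<^bsup>-j\<rho>\<^esup> 2\<^bsup>jn\<^esup> \<kappa> (2\<^bsup>j\<^esup> (x - y))\<close> with \<open>\<kappa>\<close> integrable.  Since \<open>\<rho> > 0\<close> the sum converges, and Schur's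
  test replaces Plancherel's theorem.  The required bounds on lower order \<open>\<xi>\<close>-derivatives of the symbol follow
  from those on one higher derivative by integration from infinity.  Cut-off functions then reduce a global
  operator to finitely many local pieces and smoothing remainders, so that \<open>H(t)\<close> is norm continuous on smooth
  sections.  By density, \<open>H(t)\<close> extends to \<open>L\<^sup>2\<close> by duality, and the mean value inequality passes the differential
  equation from smooth sections to limits in \<open>L\<^sup>2\<close>, uniformly in time by unitarity.
\<close>

section \<open>Calculus of smooth functions\<close>

text \<open>The kernel estimate freezes the symbol at x and is uniform in x, so no x-derivatives
  enter and a single seminorm decides: the xi-derivative along the multi-index that contains every
  coordinate direction twice. Two derivatives per direction give the decay
  \<open>1 / (1 + (z . v)^2)\<close> in each coordinate v of z, a product that is integrable in
  every dimension.

  Elements of the Hilbert space are representatives, so the inner product is only semidefinite;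
  operators are linear and extensions are unique only up to norm zero. Hence differences are
  estimated through pairings instead of being pulled through an operator.

  The propagator is not known to preserve smooth sections: for smooth u, H(t) U(t,s) u is given only
  by testing against smooth sections. The extension by duality is characterized by the same
  pairings, which identifies the two. For general u the limit is taken in the increment of U(t,s) u,
  before dividing by the time step; the error from replacing u by a smooth section can then be sent
  to zero at a fixed step.\<close>

lemma pderivs_append: "pderivs (xs @ ys) f = pderivs xs (pderivs ys f)"
  by (induction xs) auto

lemma frechet_derivative_eqI: "(f has_derivative D) (at x) \<Longrightarrow> frechet_derivative f (at x) = D"
  using frechet_derivative_at by metis

lemma frechet_derivative_cong_open:
  assumes "open S" "x \<in> S" "\<And>y. y \<in> S \<Longrightarrow> f y = g y"
  shows "frechet_derivative f (at x) = frechet_derivative g (at x)"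
proof -
  have "(f has_derivative D) (at x) \<longleftrightarrow> (g has_derivative D) (at x)" for D
    using assms has_derivative_transform_within_open[of f D x UNIV S g]
      has_derivative_transform_within_open[of g D x UNIV S f] by auto
  then show ?thesis by (simp add: frechet_derivative_def)
qed

lemma differentiable_cong_open:
  assumes "open S" "x \<in> S" "\<And>y. y \<in> S \<Longrightarrow> f y = g y"
  shows "f differentiable (at x) \<longleftrightarrow> g differentiable (at x)"
  using assms has_derivative_transform_within_open[of f _ x UNIV S g]
      has_derivative_transform_within_open[of g _ x UNIV S f]
  unfolding differentiable_def by metis

lemma pderivs_cong_open:
  assumes "open S" "\<And>y. y \<in> S \<Longrightarrow> f y = g y" "x \<in> S"
  shows "pderivs vs f x = pderivs vs g x"
  using assms(3)
proof (induction vs arbitrary: x)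
  case Nil then show ?case using assms by simp
next
  case (Cons v vs)
  then show ?case
    using frechet_derivative_cong_open[OF assms(1) Cons.prems Cons.IH] by simp
qed

text \<open>Closure properties are proved by induction on the order, since the derivative of a
  product or of a composition involves functions with one derivative less to spare. The indexing is
  shifted: \<open>k\<close> means that all derivatives up to order \<open>k\<close> are again
  differentiable, so order 0 is differentiability.\<close>

definition Ck_on :: "nat \<Rightarrow> 'a set \<Rightarrow> ('a::euclidean_space \<Rightarrow> 'b::real_normed_vector) \<Rightarrow> bool" where
  "Ck_on k S f \<longleftrightarrow>
     (\<forall>vs. set vs \<subseteq> Basis \<longrightarrow> length vs \<le> k \<longrightarrow> (\<forall>x\<in>S. pderivs vs f differentiable (at x)))"

lemma smooth_on_iff_Ck: "smooth_on S f \<longleftrightarrow> (\<forall>k. Ck_on k S f)"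
  unfolding smooth_on_def Ck_on_def by blast

lemma Ck_on_differentiable: "Ck_on k S f \<Longrightarrow> x \<in> S \<Longrightarrow> f differentiable (at x)"
  unfolding Ck_on_def by (metis empty_subsetI empty_set list.size(3) pderivs.simps(1) zero_le)

lemma Ck_on_has_derivative:
  "Ck_on k S f \<Longrightarrow> x \<in> S \<Longrightarrow> (f has_derivative frechet_derivative f (at x)) (at x)"
  using Ck_on_differentiable frechet_derivative_works by blast

lemma Ck_on_mono: "Ck_on k S f \<Longrightarrow> j \<le> k \<Longrightarrow> T \<subseteq> S \<Longrightarrow> Ck_on j T f"
  unfolding Ck_on_def by (meson in_mono le_trans)

lemma Ck_on_0: "Ck_on 0 S f \<longleftrightarrow> (\<forall>x\<in>S. f differentiable (at x))"
  unfolding Ck_on_def by auto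

text \<open>The last entry of a multi-index is the derivative that is taken first, so it is split
  off at the end of the list. This recursion drives the inductions below.\<close>

lemma Ck_on_Suc:
  "Ck_on (Suc k) S f \<longleftrightarrow> (\<forall>x\<in>S. f differentiable (at x)) \<and>
     (\<forall>v\<in>Basis. Ck_on k S (\<lambda>x. frechet_derivative f (at x) v))" (is "_ \<longleftrightarrow> ?R")
proof
  assume L: "Ck_on (Suc k) S f"
  have "Ck_on k S (\<lambda>x. frechet_derivative f (at x) v)" if v: "v \<in> Basis" for v
    unfolding Ck_on_def
  proof (intro allI impI ballI)
    fix vs x assume *: "set vs \<subseteq> (Basis :: 'a set)" "length vs \<le> k" "x \<in> S"
    have "pderivs (vs @ [v]) f differentiable (at x)"
      using L v * unfolding Ck_on_def by auto
    then show "pderivs vs (\<lambda>x. frechet_derivative f (at x) v) differentiable (at x)"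
      by (simp add: pderivs_append)
  qed
  then show ?R using Ck_on_differentiable[OF L] by blast
next
  assume R: ?R
  show "Ck_on (Suc k) S f"
    unfolding Ck_on_def
  proof (intro allI impI ballI)
    fix vs x assume *: "set vs \<subseteq> (Basis :: 'a set)" "length vs \<le> Suc k" "x \<in> S"
    show "pderivs vs f differentiable (at x)"
    proof (cases vs rule: rev_cases)
      case Nil then show ?thesis using R * by simp
    next
      case (snoc ws w)
      then show ?thesis using R * unfolding Ck_on_def by (simp add: pderivs_append)
    qed
  qed
qed

lemma Ck_on_SucD:
  assumes "Ck_on (Suc k) S f"
  shows "Ck_on k S f" "v \<in> Basis \<Longrightarrow> Ck_on k S (\<lambda>x. frechet_derivative f (at x) v)"
  using assms Ck_on_mono[of "Suc k" S f k S] unfolding Ck_on_Suc by simp_all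

lemma Ck_on_cong:
  assumes "open S" "\<And>y. y \<in> S \<Longrightarrow> f y = g y" "Ck_on k S f"
  shows "Ck_on k S g"
  unfolding Ck_on_def
proof (intro allI impI ballI)
  fix vs x assume *: "set vs \<subseteq> (Basis :: 'a set)" "length vs \<le> k" "x \<in> S"
  then have "pderivs vs f differentiable (at x)" using assms(3) unfolding Ck_on_def by auto
  then show "pderivs vs g differentiable (at x)"
    using differentiable_cong_open[OF assms(1) *(3) pderivs_cong_open[OF assms(1,2)]] by simp
qed

lemma Ck_on_const: "Ck_on k S (\<lambda>x. c)"
proof (induction k arbitrary: c)
  case 0 show ?case by (simp add: Ck_on_0)
next
  case (Suc k)
  have "frechet_derivative (\<lambda>x. c) (at x) = (\<lambda>_. 0)" for x :: 'a
    by (metis frechet_derivative_at has_derivative_const)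
  then show ?case using Suc by (simp add: Ck_on_Suc)
qed

lemma Ck_on_add:
  assumes "open S"
  shows "Ck_on k S f \<Longrightarrow> Ck_on k S g \<Longrightarrow> Ck_on k S (\<lambda>x. f x + g x)"
proof (induction k arbitrary: f g)
  case 0 then show ?case by (simp add: Ck_on_0)
next
  case (Suc k)
  show ?case unfolding Ck_on_Suc
  proof (intro conjI ballI)
    fix x assume "x \<in> S" then show "(\<lambda>x. f x + g x) differentiable (at x)"
      using Suc.prems Ck_on_differentiable by (intro differentiable_add) blast+
  next
    fix v :: 'a assume v: "v \<in> Basis"
    show "Ck_on k S (\<lambda>x. frechet_derivative (\<lambda>x. f x + g x) (at x) v)"
    proof (rule Ck_on_cong[OF assms])
      show "Ck_on k S (\<lambda>x. frechet_derivative f (at x) v + frechet_derivative g (at x) v)"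
        using Suc.prems v by (intro Suc.IH) (auto dest: Ck_on_SucD)
      fix y assume "y \<in> S"
      then have "f differentiable (at y)" "g differentiable (at y)"
        using Suc.prems Ck_on_differentiable by blast+
      then show "frechet_derivative f (at y) v + frechet_derivative g (at y) v =
          frechet_derivative (\<lambda>x. f x + g x) (at y) v"
        by (subst frechet_derivative_eqI[OF has_derivative_add])
          (auto simp: frechet_derivative_works)
    qed
  qed
qed

lemma Ck_on_sum:
  assumes "open S"
  shows "(\<And>i. i \<in> A \<Longrightarrow> Ck_on k S (f i)) \<Longrightarrow> Ck_on k S (\<lambda>x. \<Sum>i\<in>A. f i x)"
  by (induction A rule: infinite_finite_induct) (auto intro: Ck_on_const Ck_on_add[OF assms])

lemma Ck_on_bilinear:
  assumes "open S" "bounded_bilinear pr"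
  shows "Ck_on k S f \<Longrightarrow> Ck_on k S g \<Longrightarrow> Ck_on k S (\<lambda>x. pr (f x) (g x))"
proof (induction k arbitrary: f g)
  case 0 then show ?case
    using bounded_bilinear.FDERIV[OF assms(2)] unfolding Ck_on_0 differentiable_def by blast
next
  case (Suc k)
  have d: "((\<lambda>x. pr (f x) (g x)) has_derivative (\<lambda>h. pr (f x) (frechet_derivative g (at x) h) +
      pr (frechet_derivative f (at x) h) (g x))) (at x)" if "x \<in> S" for x
    using Suc.prems that by (intro bounded_bilinear.FDERIV[OF assms(2)] Ck_on_has_derivative)
  show ?case unfolding Ck_on_Suc
  proof (intro conjI ballI)
    fix x assume "x \<in> S" then show "(\<lambda>x. pr (f x) (g x)) differentiable (at x)"
      using d differentiable_def by blast
  next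
    fix v :: 'a assume v: "v \<in> Basis"
    show "Ck_on k S (\<lambda>x. frechet_derivative (\<lambda>x. pr (f x) (g x)) (at x) v)"
    proof (rule Ck_on_cong[OF assms(1)])
      show "Ck_on k S (\<lambda>x. pr (f x) (frechet_derivative g (at x) v) +
          pr (frechet_derivative f (at x) v) (g x))"
        using Suc.prems v
        by (intro Ck_on_add[OF assms(1)] Suc.IH) (auto dest: Ck_on_SucD)
      fix y assume "y \<in> S"
      then show "pr (f y) (frechet_derivative g (at y) v) + pr (frechet_derivative f (at y) v) (g y) =
          frechet_derivative (\<lambda>x. pr (f x) (g x)) (at y) v"
        by (subst frechet_derivative_eqI[OF d]) auto
    qed
  qed
qed

lemma Ck_on_linear:
  assumes "open S" "bounded_linear L" "Ck_on k S f"
  shows "Ck_on k S (\<lambda>x. L (f x))"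
  using assms(3)
proof (induction k arbitrary: f)
  case 0 then show ?case
    using bounded_linear.has_derivative[OF assms(2)] unfolding Ck_on_0 differentiable_def by blast
next
  case (Suc k)
  have d: "((\<lambda>x. L (f x)) has_derivative (\<lambda>h. L (frechet_derivative f (at x) h))) (at x)"
    if "x \<in> S" for x
    using Suc.prems that by (intro bounded_linear.has_derivative[OF assms(2)] Ck_on_has_derivative)
  show ?case unfolding Ck_on_Suc
  proof (intro conjI ballI)
    fix x assume "x \<in> S" then show "(\<lambda>x. L (f x)) differentiable (at x)"
      using d differentiable_def by blast
  next
    fix v :: 'a assume v: "v \<in> Basis"
    show "Ck_on k S (\<lambda>x. frechet_derivative (\<lambda>x. L (f x)) (at x) v)"
    proof (rule Ck_on_cong[OF assms(1)])
      show "Ck_on k S (\<lambda>x. L (frechet_derivative f (at x) v))"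
        using Suc.prems v by (intro Suc.IH) (auto dest: Ck_on_SucD)
      fix y assume "y \<in> S"
      then show "L (frechet_derivative f (at y) v) = frechet_derivative (\<lambda>x. L (f x)) (at y) v"
        by (subst frechet_derivative_eqI[OF d]) auto
    qed
  qed
qed

lemma Ck_on_id: "Ck_on k S (\<lambda>x. x)"
proof (cases k)
  case 0 then show ?thesis by (simp add: Ck_on_0)
next
  case (Suc j)
  have "frechet_derivative (\<lambda>x. x) (at x) = (\<lambda>x. x)" for x :: 'a
    by (metis frechet_derivative_at has_derivative_ident)
  then show ?thesis by (simp add: Ck_on_Suc Suc Ck_on_const)
qed

lemma Ck_on_compose:
  fixes f :: "'b::euclidean_space \<Rightarrow> 'c::real_normed_vector" and g :: "'a::euclidean_space \<Rightarrow> 'b"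
  assumes "open S" "open T" "g ` S \<subseteq> T"
  shows "Ck_on k T f \<Longrightarrow> Ck_on k S g \<Longrightarrow> Ck_on k S (\<lambda>x. f (g x))"
proof (induction k arbitrary: f)
  case 0 then show ?case
    using assms unfolding Ck_on_0 using differentiable_chain_at[of g _ f, unfolded o_def] by blast
next
  case (Suc k)
  have d: "((\<lambda>x. f (g x)) has_derivative
      (\<lambda>h. frechet_derivative f (at (g x)) (frechet_derivative g (at x) h))) (at x)"
    and l: "linear (frechet_derivative f (at (g x)))" if "x \<in> S" for x
  proof -
    have "f differentiable (at (g x))" "g differentiable (at x)"
      using that Suc.prems Ck_on_differentiable assms by blast+
    then show "((\<lambda>x. f (g x)) has_derivative
      (\<lambda>h. frechet_derivative f (at (g x)) (frechet_derivative g (at x) h))) (at x)"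
      "linear (frechet_derivative f (at (g x)))"
      using has_derivative_compose[of g "frechet_derivative g (at x)" x UNIV f]
      by (auto simp: frechet_derivative_works intro: linear_frechet_derivative)
  qed
  show ?case unfolding Ck_on_Suc
  proof (intro conjI ballI)
    fix x assume "x \<in> S" then show "(\<lambda>x. f (g x)) differentiable (at x)"
      using d differentiable_def by blast
  next
    fix v :: 'a assume v: "v \<in> Basis"
    show "Ck_on k S (\<lambda>x. frechet_derivative (\<lambda>x. f (g x)) (at x) v)"
    proof (rule Ck_on_cong[OF assms(1)])
      \<comment> \<open>The derivative of \<open>f\<close> at \<open>g x\<close> acts on a vector
        that itself depends on \<open>x\<close>. Expanding that vector in the basis leaves
        compositions of partial derivatives of \<open>f\<close> with \<open>g\<close>, to which the
        induction hypothesis applies.\<close>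
      show "Ck_on k S (\<lambda>x. \<Sum>w\<in>Basis. (frechet_derivative g (at x) v \<bullet> w) *\<^sub>R
          frechet_derivative f (at (g x)) w)"
      proof (intro Ck_on_sum[OF assms(1)] Ck_on_bilinear[OF assms(1) bounded_bilinear_scaleR])
        fix w :: 'b assume w: "w \<in> Basis"
        show "Ck_on k S (\<lambda>x. frechet_derivative g (at x) v \<bullet> w)"
          using Suc.prems v by (intro Ck_on_linear[OF assms(1) bounded_linear_inner_left] Ck_on_SucD(2))
        show "Ck_on k S (\<lambda>x. frechet_derivative f (at (g x)) w)"
          using Suc.prems w by (intro Suc.IH) (auto dest: Ck_on_SucD)
      qed
      fix y assume y: "y \<in> S"
      have "frechet_derivative f (at (g y)) (frechet_derivative g (at y) v) =
        frechet_derivative f (at (g y)) (\<Sum>w\<in>Basis. (frechet_derivative g (at y) v \<bullet> w) *\<^sub>R w)"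
        by (simp add: euclidean_representation)
      also have "\<dots> = (\<Sum>w\<in>Basis. (frechet_derivative g (at y) v \<bullet> w) *\<^sub>R frechet_derivative f (at (g y)) w)"
        by (simp add: linear_sum[OF l[OF y]] linear_cmul[OF l[OF y]])
      finally show "(\<Sum>w\<in>Basis. (frechet_derivative g (at y) v \<bullet> w) *\<^sub>R frechet_derivative f (at (g y)) w)
          = frechet_derivative (\<lambda>x. f (g x)) (at y) v"
        by (subst frechet_derivative_eqI[OF d[OF y]]) auto
    qed
  qed
qed

section \<open>Closure properties of smooth functions\<close>

lemma smooth_on_differentiable: "smooth_on S f \<Longrightarrow> x \<in> S \<Longrightarrow> f differentiable (at x)"
  unfolding smooth_on_iff_Ck by (blast intro: Ck_on_differentiable)

lemma smooth_on_continuous: "smooth_on S f \<Longrightarrow> continuous_on S f"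
  by (auto intro!: continuous_at_imp_continuous_on differentiable_imp_continuous_within smooth_on_differentiable)

lemma smooth_on_subset: "smooth_on S f \<Longrightarrow> T \<subseteq> S \<Longrightarrow> smooth_on T f"
  unfolding smooth_on_def by blast

lemma smooth_on_cong:
  "open S \<Longrightarrow> (\<And>y. y \<in> S \<Longrightarrow> f y = g y) \<Longrightarrow> smooth_on S f \<Longrightarrow> smooth_on S g"
  unfolding smooth_on_iff_Ck by (blast intro: Ck_on_cong)

lemma smooth_on_Un: "smooth_on S f \<Longrightarrow> smooth_on T f \<Longrightarrow> smooth_on (S \<union> T) f"
  unfolding smooth_on_def by blast

lemma smooth_on_const: "smooth_on S (\<lambda>x. c)"
  unfolding smooth_on_iff_Ck by (blast intro: Ck_on_const)

lemma smooth_on_id: "smooth_on S (\<lambda>x. x)"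
  unfolding smooth_on_iff_Ck by (blast intro: Ck_on_id)

lemma smooth_on_add:
  "open S \<Longrightarrow> smooth_on S f \<Longrightarrow> smooth_on S g \<Longrightarrow> smooth_on S (\<lambda>x. f x + g x)"
  unfolding smooth_on_iff_Ck by (blast intro: Ck_on_add)

lemma smooth_on_linear:
  "open S \<Longrightarrow> bounded_linear L \<Longrightarrow> smooth_on S f \<Longrightarrow> smooth_on S (\<lambda>x. L (f x))"
  unfolding smooth_on_iff_Ck by (blast intro: Ck_on_linear)

lemma smooth_on_mult:
  fixes f g :: "_ \<Rightarrow> 'b::real_normed_algebra"
  shows "open S \<Longrightarrow> smooth_on S f \<Longrightarrow> smooth_on S g \<Longrightarrow> smooth_on S (\<lambda>x. f x * g x)"
  unfolding smooth_on_iff_Ck by (blast intro: Ck_on_bilinear[OF _ bounded_bilinear_mult])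

lemma smooth_on_diff:
  assumes "open S" "smooth_on S f" "smooth_on S g" shows "smooth_on S (\<lambda>x. f x - g x)"
  using smooth_on_add[OF assms(1,2) smooth_on_linear[OF assms(1) bounded_linear_minus[OF bounded_linear_ident] assms(3)]]
  by simp

lemma smooth_on_prod:
  fixes f :: "'i \<Rightarrow> _ \<Rightarrow> 'b::{real_normed_algebra, comm_ring_1}"
  shows "open S \<Longrightarrow> (\<And>i. i \<in> A \<Longrightarrow> smooth_on S (f i)) \<Longrightarrow> smooth_on S (\<lambda>x. \<Prod>i\<in>A. f i x)"
  by (induction A rule: infinite_finite_induct) (auto intro: smooth_on_const smooth_on_mult)

lemma smooth_on_inner:
  "open S \<Longrightarrow> smooth_on S f \<Longrightarrow> smooth_on S g \<Longrightarrow> smooth_on S (\<lambda>x. f x \<bullet> g x)"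
  unfolding smooth_on_iff_Ck by (blast intro: Ck_on_bilinear[OF _ bounded_bilinear_inner])

lemma smooth_on_compose:
  fixes f :: "'b::euclidean_space \<Rightarrow> 'c::real_normed_vector" and g :: "'a::euclidean_space \<Rightarrow> 'b"
  shows "open S \<Longrightarrow> open T \<Longrightarrow> g ` S \<subseteq> T \<Longrightarrow> smooth_on T f \<Longrightarrow> smooth_on S g \<Longrightarrow>
    smooth_on S (\<lambda>x. f (g x))"
  unfolding smooth_on_iff_Ck by (blast intro: Ck_on_compose)

lemma smooth_on_pderivs: "smooth_on S f \<Longrightarrow> set vs \<subseteq> Basis \<Longrightarrow> smooth_on S (pderivs vs f)"
  unfolding smooth_on_def by (auto simp: pderivs_append[symmetric])

lemma smooth_on_vanishing: "open S \<Longrightarrow> (\<And>y. y \<in> S \<Longrightarrow> f y = 0) \<Longrightarrow> smooth_on S f"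
  by (rule smooth_on_cong[of S "\<lambda>_. 0"]) (auto intro: smooth_on_const)

text \<open>The derivative is a polynomial in the function itself, so each order follows from the
  one below.\<close>

lemma smooth_on_inverse_real: "smooth_on {x::real. x \<noteq> 0} inverse"
proof -
  have o: "open {x::real. x \<noteq> 0}" by (simp add: open_Collect_neq)
  have "Ck_on k {x::real. x \<noteq> 0} inverse" for k
  proof (induction k)
    case 0 then show ?case by (auto simp: Ck_on_0 intro!: differentiable_inverse)
  next
    case (Suc k)
    have d: "(inverse has_derivative (\<lambda>h. - (inverse x * h * inverse x))) (at x)" if "x \<noteq> 0" for x :: real
      using has_derivative_inverse'[of x] that by simp
    show ?case unfolding Ck_on_Suc
    proof (intro conjI ballI)
      fix x :: real assume "x \<in> {x. x \<noteq> 0}" then show "inverse differentiable (at x)"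
        using d differentiable_def by blast
    next
      fix v :: real assume v: "v \<in> Basis"
      show "Ck_on k {x. x \<noteq> 0} (\<lambda>x::real. frechet_derivative inverse (at x) v)"
      proof (rule Ck_on_cong[OF o])
        show "Ck_on k {x. x \<noteq> 0} (\<lambda>x::real. - (inverse x * inverse x))"
          by (intro Ck_on_linear[OF o bounded_linear_minus[OF bounded_linear_ident]]
              Ck_on_bilinear[OF o bounded_bilinear_mult] Suc)
        fix y :: real assume "y \<in> {x. x \<noteq> 0}"
        then show "- (inverse y * inverse y) = frechet_derivative inverse (at y) v"
          using v by (subst frechet_derivative_eqI[OF d]) auto
      qed
    qed
  qed
  then show ?thesis by (simp add: smooth_on_iff_Ck)
qed

subsection \<open>Symmetry of mixed partial derivatives\<close>

text \<open>The mean value theorem in direction \<open>v\<close> is applied to the difference of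
  \<open>f\<close> in direction \<open>w\<close>, and then once more in direction \<open>w\<close>.
  The second difference on the left is symmetric in \<open>v\<close> and \<open>w\<close>, so it can
  be evaluated in either order.\<close>

lemma mixed_difference:
  fixes f :: "'a::real_normed_vector \<Rightarrow> real"
  assumes f: "\<And>y. f differentiable (at y)"
    and g: "\<And>y. (\<lambda>y. frechet_derivative f (at y) v) differentiable (at y)" and h: "h > 0"
  shows "\<exists>s t. 0 < s \<and> s < h \<and> 0 < t \<and> t < h \<and>
    f (x + h *\<^sub>R v + h *\<^sub>R w) - f (x + h *\<^sub>R v) - f (x + h *\<^sub>R w) + f x =
    h * h * frechet_derivative (\<lambda>y. frechet_derivative f (at y) v) (at (x + s *\<^sub>R v + t *\<^sub>R w)) w"
proof -
  define D where "D = (\<lambda>y. frechet_derivative f (at y) v)"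
  have line: "((\<lambda>s. F (p + s *\<^sub>R e)) has_real_derivative frechet_derivative F (at (p + s *\<^sub>R e)) e) (at s)"
    if "F differentiable (at (p + s *\<^sub>R e))" for F :: "'a \<Rightarrow> real" and p e s
  proof -
    have l: "linear (frechet_derivative F (at (p + s *\<^sub>R e)))"
      using that by (rule linear_frechet_derivative)
    have "((\<lambda>s. F (p + s *\<^sub>R e)) has_derivative (\<lambda>k. frechet_derivative F (at (p + s *\<^sub>R e)) (k *\<^sub>R e))) (at s)"
      using that frechet_derivative_works
      by (intro has_derivative_compose[where g=F and f="\<lambda>s. p + s *\<^sub>R e"]) (auto intro!: derivative_eq_intros)
    then show ?thesis
      unfolding has_field_derivative_def
      by (rule has_derivative_eq_rhs) (auto simp: linear_cmul[OF l])
  qed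
  have d1: "((\<lambda>s. f (x + h *\<^sub>R w + s *\<^sub>R v) - f (x + s *\<^sub>R v)) has_real_derivative
      (D (x + h *\<^sub>R w + s *\<^sub>R v) - D (x + s *\<^sub>R v))) (at s)" for s
    unfolding D_def by (intro DERIV_diff line f)
  obtain s where s: "0 < s" "s < h"
    "(f (x + h *\<^sub>R w + h *\<^sub>R v) - f (x + h *\<^sub>R v)) - (f (x + h *\<^sub>R w) - f x) =
      h * (D (x + h *\<^sub>R w + s *\<^sub>R v) - D (x + s *\<^sub>R v))"
    using MVT2[OF h d1] by auto
  have d2: "((\<lambda>t. D (x + s *\<^sub>R v + t *\<^sub>R w)) has_real_derivative
      frechet_derivative D (at (x + s *\<^sub>R v + t *\<^sub>R w)) w) (at t)" for t
    by (intro line) (use g in \<open>simp add: D_def\<close>)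
  obtain t where t: "0 < t" "t < h"
    "D (x + s *\<^sub>R v + h *\<^sub>R w) - D (x + s *\<^sub>R v) = h * frechet_derivative D (at (x + s *\<^sub>R v + t *\<^sub>R w)) w"
    using MVT2[OF h d2] by auto
  show ?thesis
    using s t by (intro exI[of _ s] exI[of _ t]) (auto simp: algebra_simps D_def)
qed

text \<open>Both mixed derivatives express the same second difference divided by the square of the
  step, at intermediate points that shrink to \<open>x\<close>. Continuity at \<open>x\<close> then
  gives equality there.\<close>

lemma frechet_derivative_commute_real:
  fixes f :: "'a::real_normed_vector \<Rightarrow> real"
  assumes f: "\<And>y. f differentiable (at y)"
    and v: "\<And>y. (\<lambda>y. frechet_derivative f (at y) v) differentiable (at y)"
    and w: "\<And>y. (\<lambda>y. frechet_derivative f (at y) w) differentiable (at y)"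
    and cvw: "isCont (\<lambda>y. frechet_derivative (\<lambda>y. frechet_derivative f (at y) v) (at y) w) x"
    and cwv: "isCont (\<lambda>y. frechet_derivative (\<lambda>y. frechet_derivative f (at y) w) (at y) v) x"
  shows "frechet_derivative (\<lambda>y. frechet_derivative f (at y) v) (at x) w =
    frechet_derivative (\<lambda>y. frechet_derivative f (at y) w) (at x) v"
proof -
  define P where "P = (\<lambda>y. frechet_derivative (\<lambda>y. frechet_derivative f (at y) v) (at y) w)"
  define Q where "Q = (\<lambda>y. frechet_derivative (\<lambda>y. frechet_derivative f (at y) w) (at y) v)"
  define h where "h n = inverse (real (Suc n))" for n
  have h0: "h n > 0" for n by (simp add: h_def)
  have hlim: "h \<longlonglongrightarrow> 0" unfolding h_def by (rule LIMSEQ_inverse_real_of_nat)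
  have ex: "\<exists>s t s' t'. 0 < s \<and> s < h n \<and> 0 < t \<and> t < h n \<and> 0 < s' \<and> s' < h n \<and> 0 < t' \<and> t' < h n \<and>
      P (x + s *\<^sub>R v + t *\<^sub>R w) = Q (x + s' *\<^sub>R w + t' *\<^sub>R v)" for n
  proof -
    obtain s t where st: "0 < s" "s < h n" "0 < t" "t < h n"
      "f (x + h n *\<^sub>R v + h n *\<^sub>R w) - f (x + h n *\<^sub>R v) - f (x + h n *\<^sub>R w) + f x =
        h n * h n * P (x + s *\<^sub>R v + t *\<^sub>R w)"
      using mixed_difference[OF f v h0, of n x w] unfolding P_def by blast
    obtain s' t' where st': "0 < s'" "s' < h n" "0 < t'" "t' < h n"
      "f (x + h n *\<^sub>R w + h n *\<^sub>R v) - f (x + h n *\<^sub>R w) - f (x + h n *\<^sub>R v) + f x =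
        h n * h n * Q (x + s' *\<^sub>R w + t' *\<^sub>R v)"
      using mixed_difference[OF f w h0, of n x v] unfolding Q_def by blast
    have "h n * h n * P (x + s *\<^sub>R v + t *\<^sub>R w) = h n * h n * Q (x + s' *\<^sub>R w + t' *\<^sub>R v)"
      unfolding st(5)[symmetric] st'(5)[symmetric] by (simp add: add_ac)
    then have "P (x + s *\<^sub>R v + t *\<^sub>R w) = Q (x + s' *\<^sub>R w + t' *\<^sub>R v)"
      using h0[of n] by simp
    then show ?thesis using st(1-4) st'(1-4) by blast
  qed
  define G where "G n = (\<lambda>(s, t, s', t'). 0 < s \<and> s < h n \<and> 0 < t \<and> t < h n \<and> 0 < s' \<and> s' < h n \<and> 0 < t' \<and> t' < h n \<and>
      P (x + s *\<^sub>R v + t *\<^sub>R w) = Q (x + s' *\<^sub>R w + t' *\<^sub>R v))" for n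
  have "\<forall>n. \<exists>q. G n q" using ex unfolding G_def split_paired_Ex case_prod_conv by blast
  then obtain q where q: "\<And>n. G n (q n)" by metis
  define s t s' t' where "s n = fst (q n)" and "t n = fst (snd (q n))"
    and "s' n = fst (snd (snd (q n)))" and "t' n = snd (snd (snd (q n)))" for n
  have st: "0 < s n" "s n < h n" "0 < t n" "t n < h n" "0 < s' n" "s' n < h n" "0 < t' n" "t' n < h n"
      "P (x + s n *\<^sub>R v + t n *\<^sub>R w) = Q (x + s' n *\<^sub>R w + t' n *\<^sub>R v)" for n
    using q[of n] unfolding G_def s_def t_def s'_def t'_def by (auto simp: case_prod_beta)
  have z: "u \<longlonglongrightarrow> 0" if "\<And>n. 0 < u n" "\<And>n. u n < h n" for u
    using that by (intro tendsto_sandwich[OF _ _ tendsto_const hlim] always_eventually allI) (auto intro: less_imp_le)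
  have l: "s \<longlonglongrightarrow> 0" "t \<longlonglongrightarrow> 0" "s' \<longlonglongrightarrow> 0" "t' \<longlonglongrightarrow> 0"
    using st by (auto intro: z)
  have "(\<lambda>n. P (x + s n *\<^sub>R v + t n *\<^sub>R w)) \<longlonglongrightarrow> P (x + 0 *\<^sub>R v + 0 *\<^sub>R w)"
    using cvw l by (intro isCont_tendsto_compose[where g=P] tendsto_intros) (simp add: P_def)
  moreover have "(\<lambda>n. Q (x + s' n *\<^sub>R w + t' n *\<^sub>R v)) \<longlonglongrightarrow> Q (x + 0 *\<^sub>R w + 0 *\<^sub>R v)"
    using cwv l by (intro isCont_tendsto_compose[where g=Q] tendsto_intros) (simp add: Q_def)
  ultimately have "P x = Q x"
    using st(9) LIMSEQ_unique by (simp add: fun_eq_iff)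
  then show ?thesis by (simp add: P_def Q_def)
qed

lemma frechet_derivative_linear_comp:
  assumes "bounded_linear L" "f differentiable (at x)"
  shows "frechet_derivative (\<lambda>x. L (f x)) (at x) v = L (frechet_derivative f (at x) v)"
  by (subst frechet_derivative_eqI[OF bounded_linear.has_derivative[OF assms(1)]])
    (use assms frechet_derivative_works in auto)

lemma pderivs_linear_comp:
  assumes "open S" "bounded_linear L" "smooth_on S f" "set vs \<subseteq> Basis"
  shows "x \<in> S \<Longrightarrow> pderivs vs (\<lambda>x. L (f x)) x = L (pderivs vs f x)"
  using assms(4)
proof (induction vs arbitrary: x)
  case Nil then show ?case by simp
next
  case (Cons v vs)
  have "frechet_derivative (pderivs vs (\<lambda>x. L (f x))) (at x) =
      frechet_derivative (\<lambda>x. L (pderivs vs f x)) (at x)"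
    using Cons by (intro frechet_derivative_cong_open[OF assms(1)]) auto
  then show ?case
    using Cons.prems assms(3) unfolding smooth_on_def
    by (auto simp: frechet_derivative_linear_comp[OF assms(2)])
qed

lemma pderivs_swap:
  fixes f :: "'a::euclidean_space \<Rightarrow> complex"
  assumes f: "smooth_on UNIV f" and vw: "v \<in> Basis" "w \<in> Basis"
  shows "pderivs [v, w] f = pderivs [w, v] f"
proof -
  \<comment> \<open>The mean value theorem concerns real values; the complex case is split into real
    and imaginary parts.\<close>
  have real: "pderivs [v, w] g = pderivs [w, v] g" if g: "smooth_on UNIV g" for g :: "'a \<Rightarrow> real"
  proof
    fix x
    have c: "isCont (pderivs vs g) x" if "set vs \<subseteq> Basis" for vs
      using smooth_on_continuous[OF smooth_on_pderivs[OF g that]]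
      by (simp add: continuous_on_eq_continuous_at)
    have d: "pderivs vs g differentiable (at y)" if "set vs \<subseteq> Basis" for vs y
      using g that unfolding smooth_on_def by blast
    show "pderivs [v, w] g x = pderivs [w, v] g x"
      using frechet_derivative_commute_real[of g w v x] d[of "[]"] d[of "[v]"] d[of "[w]"]
        c[of "[v, w]"] c[of "[w, v]"] vw by simp
  qed
  show ?thesis
  proof (rule ext, rule complex_eqI)
    fix x
    show "Re (pderivs [v, w] f x) = Re (pderivs [w, v] f x)"
      using pderivs_linear_comp[OF open_UNIV bounded_linear_Re f, of _ x]
        real[OF smooth_on_linear[OF open_UNIV bounded_linear_Re f]] vw
      by (metis UNIV_I empty_set empty_subsetI insert_subset list.simps(15))
    show "Im (pderivs [v, w] f x) = Im (pderivs [w, v] f x)"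
      using pderivs_linear_comp[OF open_UNIV bounded_linear_Im f, of _ x]
        real[OF smooth_on_linear[OF open_UNIV bounded_linear_Im f]] vw
      by (metis UNIV_I empty_set empty_subsetI insert_subset list.simps(15))
  qed
qed

text \<open>Transpositions of neighbours carry the head of a list to its end. The induction finds
  the head of \<open>vs\<close> inside \<open>ws\<close>, moves it through and removes it from both
  lists.\<close>

lemma pderivs_perm:
  fixes f :: "'a::euclidean_space \<Rightarrow> complex"
  assumes f: "smooth_on UNIV f" and "mset vs = mset ws" "set vs \<subseteq> Basis"
  shows "pderivs vs f = pderivs ws f"
proof -
  have move: "pderivs (v # vs) f = pderivs (vs @ [v]) f" if "set (v # vs) \<subseteq> Basis" for v vs
    using that
  proof (induction vs)
    case (Cons w vs)
    have "pderivs (v # w # vs) f = pderivs [v, w] (pderivs vs f)"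
      by (simp add: pderivs_append[symmetric])
    also have "\<dots> = pderivs [w, v] (pderivs vs f)"
      using Cons.prems by (intro pderivs_swap smooth_on_pderivs[OF f]) auto
    also have "\<dots> = pderivs [w] (pderivs (v # vs) f)" by simp
    finally show ?case using Cons by simp
  qed simp
  show ?thesis using assms(2,3)
  proof (induction vs arbitrary: ws)
    case (Cons v vs)
    then have "v \<in> set ws" by (metis list.set_intros(1) set_mset_mset)
    then obtain ys zs where ws: "ws = ys @ v # zs" by (meson split_list)
    have set: "set ws \<subseteq> Basis" using Cons.prems by (metis set_mset_mset)
    have "pderivs ws f = pderivs (ys @ zs @ [v]) f"
      using move[of v zs] set ws by (simp add: pderivs_append)
    also have "\<dots> = pderivs (v # ys @ zs) f"
      using move[of v "ys @ zs"] set ws by simp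
    also have "\<dots> = pderivs (v # vs) f"
      using Cons.IH[of "ys @ zs"] Cons.prems ws by simp
    finally show ?case by simp
  qed simp
qed

subsection \<open>Smooth plateau functions\<close>

text \<open>The powers of \<open>inverse x\<close> are included because derivatives of
  \<open>exp (- inverse x)\<close> produce them. With them the family is closed under
  differentiation up to linear combinations, which carries smoothness through an induction on the
  order.\<close>

definition flat :: "nat \<Rightarrow> real \<Rightarrow> real" where
  "flat m x = (if x > 0 then inverse x ^ m * exp (- inverse x) else 0)"

lemma flat_tendsto_0: "flat m \<midarrow>0\<rightarrow> 0"
proof -
  have "((\<lambda>x::real. x ^ m / exp x) \<longlongrightarrow> 0) at_top"
    by (rule tendsto_power_div_exp_0)
  then have "((\<lambda>x::real. inverse x ^ m / exp (inverse x)) \<longlongrightarrow> 0) (at_right 0)"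
    by (rule filterlim_compose) (rule filterlim_inverse_at_top_right)
  moreover have "eventually (\<lambda>x. inverse x ^ m / exp (inverse x) = flat m x) (at_right 0)"
    by (rule eventually_at_right_less[THEN eventually_mono]) (auto simp: flat_def exp_minus field_simps)
  ultimately have "(flat m \<longlongrightarrow> 0) (at_right 0)"
    by (rule Lim_transform_eventually)
  moreover have "eventually (\<lambda>x::real. 0 = flat m x) (at_left 0)"
    by (auto simp: flat_def eventually_at_filter)
  then have "(flat m \<longlongrightarrow> 0) (at_left 0)"
    by (rule Lim_transform_eventually[OF tendsto_const])
  ultimately show ?thesis by (simp add: filterlim_split_at_real)
qed

lemma flat_has_derivative:
  "(flat m has_real_derivative flat (m + 2) x - real m * flat (m + 1) x) (at x)"
proof -
  consider "x < 0" | "x = 0" | "x > 0" by linarith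
  then show ?thesis
  proof cases
    case 1
    have "((\<lambda>_. 0) has_real_derivative flat (m + 2) x - real m * flat (m + 1) x) (at x)"
      using 1 by (simp add: flat_def)
    then show ?thesis
      by (rule has_field_derivative_transform_within_open[of _ _ _ "{..<0}"]) (use 1 in \<open>auto simp: flat_def\<close>)
  next
    case 2
    \<comment> \<open>At 0 the difference quotient of \<open>flat m\<close> is
      \<open>flat (Suc m)\<close>, which tends to 0.\<close>
    have "(\<lambda>h. (flat m (0 + h) - flat m 0) / h) \<midarrow>0\<rightarrow> 0"
      by (rule Lim_transform_eventually[OF flat_tendsto_0[of "Suc m"]])
        (auto simp: eventually_at_filter flat_def divide_inverse mult_ac intro!: always_eventually)
    then show ?thesis using 2 by (simp add: DERIV_def flat_def)
  next
    case 3
    have "((\<lambda>x. inverse x ^ m * exp (- inverse x)) has_real_derivative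
        flat (m + 2) x - real m * flat (m + 1) x) (at x)"
      using 3 by (auto intro!: derivative_eq_intros simp: flat_def)
        (cases m, auto simp: field_simps power2_eq_square)
    then show ?thesis
      by (rule has_field_derivative_transform_within_open[of _ _ _ "{0<..}"]) (use 3 in \<open>auto simp: flat_def\<close>)
  qed
qed

lemma smooth_on_flat: "smooth_on UNIV (flat m)"
proof -
  have "Ck_on k UNIV (flat m)" for k
  proof (induction k arbitrary: m)
    case 0 then show ?case
      using flat_has_derivative by (auto simp: Ck_on_0 real_differentiable_def)
  next
    case (Suc k)
    show ?case unfolding Ck_on_Suc
    proof (intro conjI ballI)
      fix x show "flat m differentiable (at x)"
        using flat_has_derivative real_differentiable_def by blast
    next
      fix v :: real assume v: "v \<in> Basis"
      show "Ck_on k UNIV (\<lambda>x. frechet_derivative (flat m) (at x) v)"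
      proof (rule Ck_on_cong[OF open_UNIV])
        show "Ck_on k UNIV (\<lambda>x. flat (m + 2) x + (- real m) * flat (m + 1) x)"
          by (intro Ck_on_add[OF open_UNIV] Suc Ck_on_linear[OF open_UNIV bounded_linear_mult_right])
        fix y :: real
        show "flat (m + 2) y + (- real m) * flat (m + 1) y = frechet_derivative (flat m) (at y) v"
          using v by (subst frechet_derivative_eqI[OF flat_has_derivative[unfolded has_field_derivative_def]]) auto
      qed
    qed
  qed
  then show ?thesis by (simp add: smooth_on_iff_Ck)
qed

definition smooth_step :: "real \<Rightarrow> real" where
  "smooth_step t = flat 0 t * inverse (flat 0 t + flat 0 (1 - t))"

lemma smooth_step_denom: "flat 0 t + flat 0 (1 - t) > 0"
  by (auto simp: flat_def add_pos_pos)

lemma smooth_step_le: "t \<le> 0 \<Longrightarrow> smooth_step t = 0"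
  by (simp add: smooth_step_def flat_def)

lemma smooth_step_ge: "t \<ge> 1 \<Longrightarrow> smooth_step t = 1"
  by (simp add: smooth_step_def flat_def)

lemma smooth_step_bounds: "0 \<le> smooth_step t" "smooth_step t \<le> 1"
  using smooth_step_denom[of t] by (auto simp: smooth_step_def flat_def divide_inverse[symmetric])

lemma smooth_on_smooth_step: "smooth_on UNIV smooth_step"
proof -
  have d: "smooth_on UNIV (\<lambda>t. flat 0 t + flat 0 (1 - t))"
    by (intro smooth_on_add smooth_on_flat open_UNIV smooth_on_compose[of UNIV UNIV "\<lambda>t. 1 - t" "flat 0"]
        smooth_on_diff smooth_on_const smooth_on_id) auto
  have "smooth_on UNIV (\<lambda>t. inverse (flat 0 t + flat 0 (1 - t)))"
    by (rule smooth_on_compose[OF open_UNIV _ _ smooth_on_inverse_real d])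
      (use smooth_step_denom in \<open>auto simp: open_Collect_neq less_le\<close>)
  then show ?thesis
    unfolding smooth_step_def[abs_def] by (intro smooth_on_mult smooth_on_flat open_UNIV)
qed

text \<open>The argument of the step is affine in the squared distance, which unlike the distance is
  smooth at \<open>y0\<close>. It equals 1 at distance \<open>r\<close> and 0 at distance
  \<open>r'\<close>.\<close>

definition plateau :: "'a::euclidean_space \<Rightarrow> real \<Rightarrow> real \<Rightarrow> 'a \<Rightarrow> complex" where
  "plateau y0 r r' y = complex_of_real (smooth_step ((r'\<^sup>2 - (y - y0) \<bullet> (y - y0)) * (1 / (r'\<^sup>2 - r\<^sup>2))))"

lemma smooth_on_plateau: "smooth_on S (plateau y0 r r')"
proof -
  have "smooth_on UNIV (\<lambda>y. (r'\<^sup>2 - (y - y0) \<bullet> (y - y0)) * (1 / (r'\<^sup>2 - r\<^sup>2)))"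
    by (intro smooth_on_mult smooth_on_diff smooth_on_inner smooth_on_const smooth_on_id open_UNIV)
  from smooth_on_compose[OF open_UNIV open_UNIV _ smooth_on_smooth_step this]
  have "smooth_on UNIV (plateau y0 r r')"
    unfolding plateau_def[abs_def] by (intro smooth_on_linear[OF open_UNIV bounded_linear_of_real]) auto
  then show ?thesis by (rule smooth_on_subset) simp
qed

lemma plateau_eq_1:
  assumes "0 \<le> r" "r < r'" "dist y y0 \<le> r" shows "plateau y0 r r' y = 1"
proof -
  have "(y - y0) \<bullet> (y - y0) \<le> r\<^sup>2"
    using assms by (simp add: dist_norm power2_norm_eq_inner[symmetric] power_mono)
  moreover have "r\<^sup>2 < r'\<^sup>2" using assms by (simp add: power_strict_mono)
  ultimately show ?thesis by (simp add: plateau_def smooth_step_ge)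
qed

lemma plateau_eq_0:
  assumes "0 \<le> r" "r < r'" "r' \<le> dist y y0" shows "plateau y0 r r' y = 0"
proof -
  have "r'\<^sup>2 \<le> (y - y0) \<bullet> (y - y0)"
    using assms by (simp add: dist_norm power2_norm_eq_inner[symmetric] power_mono)
  moreover have "r\<^sup>2 < r'\<^sup>2" using assms by (simp add: power_strict_mono)
  ultimately show ?thesis by (simp add: plateau_def smooth_step_le divide_nonpos_pos)
qed

lemma norm_plateau_le_1: "norm (plateau y0 r r' y) \<le> 1"
  using smooth_step_bounds by (simp add: plateau_def del: of_real_mult)

section \<open>Operators with symbols of negative order\<close>

lemma smooth_on_has_derivative:
  "smooth_on S f \<Longrightarrow> x \<in> S \<Longrightarrow> (f has_derivative frechet_derivative f (at x)) (at x)"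
  using smooth_on_differentiable frechet_derivative_works by blast

lemma subset_mset_add_right: "A \<subseteq># B \<Longrightarrow> A \<subseteq># B + C"
  by (metis mset_subset_eq_add_left subset_mset.order_trans)

subsection \<open>Test functions and integration by parts\<close>

lemma pderivs_zero: "pderivs vs (\<lambda>_. 0) = (\<lambda>_. 0)"
  by (induction vs) (auto simp: frechet_derivative_eqI[OF has_derivative_const])

lemma pderivs_vanish:
  assumes "closed S" "\<And>x. x \<notin> S \<Longrightarrow> h x = 0" "x \<notin> S"
  shows "pderivs vs h x = 0"
  using pderivs_cong_open[of "- S" h "\<lambda>_. 0" x vs] assms by (simp add: pderivs_zero open_Compl)

lemma pderivs_add:
  assumes "smooth_on UNIV f" "smooth_on UNIV g" "set vs \<subseteq> Basis"
  shows "pderivs vs (\<lambda>x. f x + g x) = (\<lambda>x. pderivs vs f x + pderivs vs g x)"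
  using assms(3)
proof (induction vs)
  case (Cons v vs)
  have "frechet_derivative (\<lambda>x. pderivs vs f x + pderivs vs g x) (at x) v =
      frechet_derivative (pderivs vs f) (at x) v + frechet_derivative (pderivs vs g) (at x) v" for x
    using assms Cons.prems unfolding smooth_on_def
    by (subst frechet_derivative_eqI[OF has_derivative_add])
      (auto simp: frechet_derivative_works[symmetric])
  then show ?case using Cons by simp
qed simp

lemma pderivs_uminus:
  assumes "smooth_on UNIV f" "set vs \<subseteq> Basis"
  shows "pderivs vs (\<lambda>x. - f x) = (\<lambda>x. - pderivs vs f x)"
  using pderivs_linear_comp[OF open_UNIV bounded_linear_minus[OF bounded_linear_ident] assms] by auto

lemma smooth_on_uminus: "open S \<Longrightarrow> smooth_on S f \<Longrightarrow> smooth_on S (\<lambda>x. - f x)"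
  by (rule smooth_on_linear[OF _ bounded_linear_minus[OF bounded_linear_ident]])

lemma pderivs_diff:
  assumes "smooth_on UNIV f" "smooth_on UNIV g" "set vs \<subseteq> Basis"
  shows "pderivs vs (\<lambda>x. f x - g x) = (\<lambda>x. pderivs vs f x - pderivs vs g x)"
  using pderivs_add[OF assms(1) smooth_on_uminus[OF open_UNIV assms(2)] assms(3)]
    pderivs_uminus[OF assms(2,3)] by simp

lemma test_functionI:
  assumes "smooth_on UNIV h" "compact S" "\<And>x. x \<notin> S \<Longrightarrow> h x = 0"
  shows "test_function h"
proof -
  have "supp h \<subseteq> S"
    unfolding supp_def using assms by (intro closure_minimal) (auto intro: compact_imp_closed)
  then have "compact (supp h)"
    using assms(2) by (metis closed_closure compact_Int_closed inf.absorb_iff2 supp_def)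
  then show ?thesis using assms(1) by (simp add: test_function_def)
qed

lemma notin_supp: "x \<notin> supp h \<Longrightarrow> h x = 0"
  unfolding supp_def using closure_subset[of "{x. h x \<noteq> 0}"] by auto

lemma test_function_pderivs:
  assumes "test_function h" "set vs \<subseteq> Basis"
  shows "test_function (pderivs vs h)"
  using assms pderivs_vanish[of "supp h" h] notin_supp[of _ h]
  by (intro test_functionI[of _ "supp h"] smooth_on_pderivs) (auto simp: test_function_def compact_imp_closed)

lemma test_function_mult:
  assumes "test_function h" "smooth_on UNIV g"
  shows "test_function (\<lambda>x. g x * h x)"
  using assms notin_supp[of _ h]
  by (intro test_functionI[of _ "supp h"] smooth_on_mult) (auto simp: test_function_def)

lemma test_function_diff:
  assumes "test_function h" "test_function g"
  shows "test_function (\<lambda>x. h x - g x)"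
  using assms notin_supp[of _ h] notin_supp[of _ g]
  by (intro test_functionI[of _ "supp h \<union> supp g"] smooth_on_diff) (auto simp: test_function_def)

lemma integrable_compact_support:
  fixes h :: "'a::euclidean_space \<Rightarrow> complex"
  assumes "continuous_on UNIV h" "compact S" "\<And>x. x \<notin> S \<Longrightarrow> h x = 0"
  shows "integrable lborel h"
proof -
  have "integrable lborel (\<lambda>x. indicator S x *\<^sub>R h x)"
    using assms by (intro borel_integrable_compact) (auto intro: continuous_on_subset)
  moreover have "(\<lambda>x. indicator S x *\<^sub>R h x) = h" using assms(3) by (auto simp: indicator_def)
  ultimately show ?thesis by simp
qed

lemma test_function_continuous: "test_function h \<Longrightarrow> continuous_on S h"
  by (meson continuous_on_subset smooth_on_continuous subset_UNIV test_function_def)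

lemma test_function_integrable: "test_function h \<Longrightarrow> integrable lborel h"
  by (rule integrable_compact_support[of _ "supp h"]) (auto simp: test_function_continuous notin_supp test_function_def)

lemma test_function_bounded: "test_function h \<Longrightarrow> \<exists>B\<ge>0. \<forall>x. norm (h x) \<le> B"
proof -
  assume h: "test_function h"
  then have "bounded (h ` supp h)"
    by (intro compact_imp_bounded compact_continuous_image test_function_continuous) (auto simp: test_function_def)
  then obtain B where "\<forall>x\<in>supp h. norm (h x) \<le> B" by (auto simp: bounded_iff)
  then have "norm (h x) \<le> max B 0" for x
    using notin_supp[of x h] by (cases "x \<in> supp h") auto
  then show ?thesis by (intro exI[of _ "max B 0"]) auto
qed

lemma lborel_integral_translate:
  fixes h :: "'a::euclidean_space \<Rightarrow> complex"
  assumes "h \<in> borel_measurable borel"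
  shows "(LINT x|lborel. h (c + x)) = (LINT x|lborel. h x)"
proof -
  have "(LINT x|lborel. h x) = (LINT x|distr lborel borel ((+) c). h x)"
    by (simp add: lborel_distr_plus)
  also have "\<dots> = (LINT x|lborel. h (c + x))" using assms by (subst integral_distr) auto
  finally show ?thesis by simp
qed

text \<open>Difference quotients have integral 0 by translation invariance of Lebesgue measure, and
  they converge to the derivative under a common integrable bound.\<close>

lemma integral_pderiv_zero:
  assumes h: "test_function h" and v: "v \<in> Basis"
  shows "(LINT x|lborel. pderivs [v] h x) = 0"
proof -
  obtain B where B: "B \<ge> 0" "\<And>x. norm (pderivs [v] h x) \<le> B"
    using test_function_bounded[OF test_function_pderivs[OF h, of "[v]"]] v by auto
  have d: "(h has_derivative frechet_derivative h (at x)) (at x)" for x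
    using h by (intro smooth_on_has_derivative[of UNIV]) (auto simp: test_function_def)
  have line: "((\<lambda>s. h (x + s *\<^sub>R v)) has_vector_derivative pderivs [v] h (x + s *\<^sub>R v)) (at s within T)" for x s T
  proof -
    have "((\<lambda>s. h (x + s *\<^sub>R v)) has_derivative (\<lambda>k. frechet_derivative h (at (x + s *\<^sub>R v)) (k *\<^sub>R v))) (at s within T)"
      by (rule has_derivative_compose[OF _ d]) (auto intro!: derivative_eq_intros)
    then show ?thesis
      unfolding has_vector_derivative_def
      by (rule has_derivative_eq_rhs) (auto simp: linear_cmul[OF has_derivative_linear[OF d]])
  qed
  obtain R where R: "supp h \<subseteq> cball 0 R"
  proof -
    have "bounded (supp h)" using h by (simp add: test_function_def compact_imp_bounded)
    then show thesis using that by (auto simp: bounded_iff subset_iff)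
  qed
  define q where "q n x = real (Suc n) *\<^sub>R (h (inverse (real (Suc n)) *\<^sub>R v + x) - h x)" for n x
  have hm: "h \<in> borel_measurable borel"
    using h by (intro borel_measurable_continuous_onI test_function_continuous)
  have q0: "(LINT x|lborel. q n x) = 0" for n
  proof -
    have hi: "integrable lborel h" using h by (rule test_function_integrable)
    have "integrable (distr lborel borel ((+) (inverse (real (Suc n)) *\<^sub>R v))) h"
      using hi by (simp add: lborel_distr_plus)
    then have "integrable lborel (\<lambda>x. h (inverse (real (Suc n)) *\<^sub>R v + x))"
      using hm by (subst (asm) integrable_distr_eq) auto
    then have "(LINT x|lborel. q n x) = real (Suc n) *\<^sub>R
        ((LINT x|lborel. h (inverse (real (Suc n)) *\<^sub>R v + x)) - (LINT x|lborel. h x))"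
      unfolding q_def using hi by (subst integral_scaleR_right) (subst Bochner_Integration.integral_diff, auto)
    then show ?thesis by (simp add: lborel_integral_translate[OF hm])
  qed
  have "(\<lambda>n. LINT x|lborel. q n x) \<longlonglongrightarrow> (LINT x|lborel. pderivs [v] h x)"
  \<comment> \<open>The steps \<open>inverse (real (Suc n))\<close> have length at most 1, so all
    quotients vanish outside the ball of radius \<open>R + 1\<close>; the mean value inequality
    bounds them by \<open>B\<close>.\<close>
  proof (rule integral_dominated_convergence[where w="\<lambda>x. B * indicator (cball 0 (R + 1)) x"])
    show "pderivs [v] h \<in> borel_measurable lborel"
      using test_function_continuous[OF test_function_pderivs[OF h, of "[v]"]] v
        borel_measurable_continuous_onI[of "pderivs [v] h"] by simp
    show "q n \<in> borel_measurable lborel" for n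
      using hm unfolding q_def by simp
    show "integrable lborel (\<lambda>x. B * indicator (cball 0 (R + 1)) (x :: 'a))"
      by (intro integrable_mult_right integrable_real_indicator) (use emeasure_lborel_cball_finite[of 0 "R + 1"] in auto)
    have "(\<lambda>n. q n x) \<longlonglongrightarrow> pderivs [v] h x" for x
    proof -
      have "((\<lambda>s. h (x + s *\<^sub>R v)) has_vector_derivative pderivs [v] h (x + 0 *\<^sub>R v)) (at 0)"
        by (rule line)
      then have "((\<lambda>s. (1 / s) *\<^sub>R (h (x + s *\<^sub>R v) - h x)) \<longlongrightarrow> pderivs [v] h x) (at 0)"
      proof -
        assume "((\<lambda>s. h (x + s *\<^sub>R v)) has_vector_derivative pderivs [v] h (x + 0 *\<^sub>R v)) (at 0)"
        then have l: "((\<lambda>s. norm (h (x + s *\<^sub>R v) - h x - s *\<^sub>R pderivs [v] h x) / norm s) \<longlongrightarrow> 0) (at 0)"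
          unfolding has_vector_derivative_def has_derivative_at by simp
        have e: "norm (h (x + s *\<^sub>R v) - h x - s *\<^sub>R pderivs [v] h x) / norm s =
            norm ((1 / s) *\<^sub>R (h (x + s *\<^sub>R v) - h x) - pderivs [v] h x)" if "s \<noteq> 0" for s
        proof -
          have "(1 / s) *\<^sub>R (h (x + s *\<^sub>R v) - h x) - pderivs [v] h x =
              (1 / s) *\<^sub>R (h (x + s *\<^sub>R v) - h x - s *\<^sub>R pderivs [v] h x)"
            using that by (simp add: scaleR_diff_right)
          then show ?thesis by (simp add: divide_inverse_commute)
        qed
        have "((\<lambda>s. norm ((1 / s) *\<^sub>R (h (x + s *\<^sub>R v) - h x) - pderivs [v] h x)) \<longlongrightarrow> 0) (at 0)"
          by (rule Lim_transform_eventually[OF l]) (use e in \<open>simp add: eventually_at_filter\<close>)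
        then show ?thesis
          by (subst Lim_null) (erule tendsto_norm_zero_cancel)
      qed
      then have "(\<lambda>n. (1 / inverse (real (Suc n))) *\<^sub>R (h (x + inverse (real (Suc n)) *\<^sub>R v) - h x)) \<longlonglongrightarrow> pderivs [v] h x"
        by (rule filterlim_compose) (use LIMSEQ_inverse_real_of_nat in \<open>auto simp: filterlim_at intro!: always_eventually\<close>)
      then show ?thesis by (simp add: q_def add.commute inverse_eq_divide)
    qed
    then show "AE x in lborel. (\<lambda>n. q n x) \<longlonglongrightarrow> pderivs [v] h x" by simp
    have "norm (q n x) \<le> B * indicator (cball 0 (R + 1)) x" for n x
    proof (cases "x \<in> cball 0 (R + 1)")
      case False
      have "norm x > R + 1" using False by simp
      moreover have "norm (inverse (real (Suc n)) *\<^sub>R v) \<le> 1"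
        using v by (simp add: inverse_le_1_iff)
      ultimately have "norm (inverse (real (Suc n)) *\<^sub>R v + x) > R"
        using norm_diff_ineq[of x "inverse (real (Suc n)) *\<^sub>R v"] by (simp add: add.commute)
      then have "inverse (real (Suc n)) *\<^sub>R v + x \<notin> supp h" "x \<notin> supp h"
        using R \<open>norm x > R + 1\<close> by auto
      then show ?thesis using False by (simp add: q_def notin_supp)
    next
      case True
      let ?e = "inverse (real (Suc n))"
      have "norm (h (x + ?e *\<^sub>R v) - h (x + 0 *\<^sub>R v)) \<le> B * ?e - B * 0"
      proof (rule differentiable_bound_general[where f="\<lambda>s. h (x + s *\<^sub>R v)" and
            f'="\<lambda>s. pderivs [v] h (x + s *\<^sub>R v)" and \<phi>'="\<lambda>_. B" and \<phi>="\<lambda>s. B * s"])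
        show "continuous_on {0..?e} (\<lambda>s. h (x + s *\<^sub>R v))"
          using line by (intro continuous_at_imp_continuous_on ballI has_vector_derivative_continuous) blast
        show "((*) B has_vector_derivative B) (at s)" for s
          by (auto intro!: derivative_eq_intros simp: has_real_derivative_iff_has_vector_derivative[symmetric])
      qed (use B line in \<open>auto intro!: continuous_intros\<close>)
      then have "norm (q n x) \<le> real (Suc n) * (B * ?e)"
        unfolding q_def norm_scaleR by (intro mult_mono) (auto simp: add.commute)
      also have "\<dots> = B" by simp
      finally show ?thesis using True by simp
    qed
    then show "AE x in lborel. norm (q n x) \<le> B * indicator (cball 0 (R + 1)) x" for n by simp
  qed
  then have "(\<lambda>n::nat. 0) \<longlonglongrightarrow> (LINT x|lborel. pderivs [v] h x)" unfolding q0 .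
  then show ?thesis by (simp add: tendsto_const_iff)
qed

text \<open>The inverse Fourier transform without the factor \<open>(2 pi)^(-n)\<close>, which
  \<open>Op\<close> carries instead.\<close>

definition invFT :: "('a::euclidean_space \<Rightarrow> complex) \<Rightarrow> 'a \<Rightarrow> complex" where
  "invFT h z = (LINT \<xi>|lborel. cis (z \<bullet> \<xi>) * h \<xi>)"

lemma smooth_on_cis: "smooth_on UNIV (\<lambda>\<xi>. cis (z \<bullet> \<xi>))"
proof -
  \<comment> \<open>The constant \<open>c\<close> is kept free because every derivative multiplies
    by \<open>\<i>\<close> and a component of \<open>z\<close>.\<close>
  have "Ck_on k UNIV (\<lambda>\<xi>. c * cis (z \<bullet> \<xi>))" for k c
  proof (induction k arbitrary: c)
    case 0 show ?case unfolding Ck_on_0 differentiable_def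
      by (auto intro!: exI derivative_eq_intros)
  next
    case (Suc k)
    have d: "((\<lambda>\<xi>. c * cis (z \<bullet> \<xi>)) has_derivative (\<lambda>h. c * ((z \<bullet> h) *\<^sub>R (\<i> * cis (z \<bullet> \<xi>))))) (at \<xi>)" for \<xi>
      by (auto intro!: derivative_eq_intros)
    show ?case unfolding Ck_on_Suc frechet_derivative_eqI[OF d]
    proof (intro conjI ballI)
      show "(\<lambda>\<xi>. c * cis (z \<bullet> \<xi>)) differentiable at x" for x
        using d differentiable_def by blast
      show "Ck_on k UNIV (\<lambda>x. c * ((z \<bullet> v) *\<^sub>R (\<i> * cis (z \<bullet> x))))" for v
        using Suc[of "c * (z \<bullet> v) * \<i>"] by (simp add: scaleR_conv_of_real mult.assoc)
    qed
  qed
  from this[of _ 1] show ?thesis by (simp add: smooth_on_iff_Ck)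
qed

lemma invFT_pderiv:
  assumes h: "test_function h" and v: "v \<in> Basis"
  shows "invFT (pderivs [v] h) z = - (\<i> * complex_of_real (z \<bullet> v)) * invFT h z"
proof -
  have d: "((\<lambda>\<xi>. cis (z \<bullet> \<xi>) * h \<xi>) has_derivative
      (\<lambda>k. cis (z \<bullet> \<xi>) * frechet_derivative h (at \<xi>) k + ((z \<bullet> k) *\<^sub>R (\<i> * cis (z \<bullet> \<xi>))) * h \<xi>)) (at \<xi>)" for \<xi>
    using h smooth_on_has_derivative[of UNIV h \<xi>]
    by (auto intro!: derivative_eq_intros simp: test_function_def)
  have t: "test_function (\<lambda>\<xi>. cis (z \<bullet> \<xi>) * h \<xi>)" "test_function (\<lambda>\<xi>. cis (z \<bullet> \<xi>) * pderivs [v] h \<xi>)"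
    by (intro test_function_mult h smooth_on_cis test_function_pderivs; use v in simp)+
  have "0 = (LINT \<xi>|lborel. pderivs [v] (\<lambda>\<xi>. cis (z \<bullet> \<xi>) * h \<xi>) \<xi>)"
    using integral_pderiv_zero[OF t(1) v] by simp
  also have "\<dots> = (LINT \<xi>|lborel. cis (z \<bullet> \<xi>) * pderivs [v] h \<xi> + (\<i> * complex_of_real (z \<bullet> v)) * (cis (z \<bullet> \<xi>) * h \<xi>))"
    by (simp add: frechet_derivative_eqI[OF d] scaleR_conv_of_real mult_ac del: mult.commute)
  also have "\<dots> = invFT (pderivs [v] h) z + (\<i> * complex_of_real (z \<bullet> v)) * invFT h z"
    unfolding invFT_def using t
    by (subst Bochner_Integration.integral_add) (auto intro: test_function_integrable)
  finally show ?thesis by (simp add: add_eq_0_iff)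
qed

text \<open>The composition of the operators 1 minus the second derivative along \<open>v\<close>,
  over the entries \<open>v\<close> of the list. \<open>invFT\<close> turns each of them into
  multiplication by \<open>1 + (z \<bullet> v)^2\<close>, so a bound on the result is a decay
  estimate in every listed direction.\<close>

primrec one_minus_squares :: "'a::euclidean_space list \<Rightarrow> ('a \<Rightarrow> complex) \<Rightarrow> 'a \<Rightarrow> complex" where
  "one_minus_squares [] h = h"
| "one_minus_squares (v # vs) h = one_minus_squares vs (\<lambda>x. h x - pderivs [v, v] h x)"

lemma test_function_one_minus_squares:
  "test_function h \<Longrightarrow> set vs \<subseteq> Basis \<Longrightarrow> test_function (one_minus_squares vs h)"
proof (induction vs arbitrary: h)
  case (Cons v vs)
  then show ?case
    using test_function_diff[OF Cons.prems(1) test_function_pderivs[OF Cons.prems(1), of "[v, v]"]] by simp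
qed simp

lemma invFT_one_minus_squares:
  "test_function h \<Longrightarrow> set vs \<subseteq> Basis \<Longrightarrow>
    invFT (one_minus_squares vs h) z = complex_of_real (\<Prod>v\<leftarrow>vs. 1 + (z \<bullet> v)\<^sup>2) * invFT h z"
proof (induction vs arbitrary: h)
  case (Cons v vs)
  have v: "v \<in> Basis" using Cons by simp
  let ?k = "pderivs [v, v] h"
  have t: "test_function ?k" "test_function (pderivs [v] h)"
    by (intro test_function_pderivs Cons.prems(1); use v in simp)+
  have "?k = pderivs [v] (pderivs [v] h)" by simp
  then have "invFT ?k z = - (\<i> * complex_of_real (z \<bullet> v)) * (- (\<i> * complex_of_real (z \<bullet> v)) * invFT h z)"
    using invFT_pderiv[OF t(2) v] invFT_pderiv[OF Cons.prems(1) v] by simp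
  then have k: "invFT ?k z = - complex_of_real ((z \<bullet> v)\<^sup>2) * invFT h z"
  proof -
    have e: "- x * (- x * F) = x\<^sup>2 * F" for x F :: complex by (simp add: power2_eq_square)
    assume "invFT ?k z = - (\<i> * complex_of_real (z \<bullet> v)) * (- (\<i> * complex_of_real (z \<bullet> v)) * invFT h z)"
    then show ?thesis unfolding e by (simp add: power_mult_distrib)
  qed
  have "invFT (\<lambda>x. h x - ?k x) z = invFT h z - invFT ?k z"
    unfolding invFT_def right_diff_distrib
    by (intro Bochner_Integration.integral_diff test_function_integrable test_function_mult smooth_on_cis t Cons.prems)
  also have "\<dots> = complex_of_real (1 + (z \<bullet> v)\<^sup>2) * invFT h z"
    unfolding k by (simp add: algebra_simps)
  finally show ?case
    using Cons.IH[OF test_function_diff[OF Cons.prems(1) t(1)]] Cons.prems by (simp add: mult_ac)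
qed simp

definition twice :: "'a list \<Rightarrow> 'a list" where
  "twice vs = concat (map (\<lambda>v. [v, v]) vs)"

text \<open>Each factor at most doubles the number of terms, and every term differentiates along a
  sub-multiset of \<open>twice vs\<close>.\<close>

lemma norm_one_minus_squares_le:
  assumes "test_function h" "set vs \<subseteq> Basis"
    "\<And>l. mset l \<subseteq># mset (twice vs) \<Longrightarrow> norm (pderivs l h \<xi>) \<le> B"
  shows "norm (one_minus_squares vs h \<xi>) \<le> 2 ^ length vs * B"
  using assms
proof (induction vs arbitrary: h B)
  case Nil then show ?case using Nil(3)[of "[]"] by simp
next
  case (Cons v vs)
  let ?h = "\<lambda>x. h x - pderivs [v, v] h x"
  have t: "test_function (pderivs [v, v] h)"
    using test_function_pderivs[OF Cons.prems(1), of "[v, v]"] Cons.prems by simp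
  have "norm (one_minus_squares vs ?h \<xi>) \<le> 2 ^ length vs * (2 * B)"
  proof (rule Cons.IH)
    show "test_function ?h" using test_function_diff[OF Cons.prems(1) t] .
    show "set vs \<subseteq> Basis" using Cons.prems by simp
    fix l assume l: "mset l \<subseteq># mset (twice vs)"
    have tw: "mset (twice (v # vs)) = mset (twice vs) + {#v, v#}" by (simp add: twice_def)
    have "set (twice vs) \<subseteq> Basis" using Cons.prems by (auto simp: twice_def)
    then have sl: "set l \<subseteq> Basis" using l by (metis order_trans set_mset_mono set_mset_mset)
    have "pderivs l ?h \<xi> = pderivs l h \<xi> - pderivs (l @ [v, v]) h \<xi>"
      using Cons.prems t sl by (subst pderivs_diff) (auto simp: test_function_def pderivs_append)
    also have "norm \<dots> \<le> norm (pderivs l h \<xi>) + norm (pderivs (l @ [v, v]) h \<xi>)"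
      by (rule norm_triangle_ineq4)
    also have "\<dots> \<le> B + B"
    proof (intro add_mono Cons.prems(3))
      show "mset l \<subseteq># mset (twice (v # vs))" unfolding tw using l by (rule subset_mset_add_right)
      show "mset (l @ [v, v]) \<subseteq># mset (twice (v # vs))" unfolding tw using l by simp
    qed
    finally show "norm (pderivs l ?h \<xi>) \<le> 2 * B" by simp
  qed
  then show ?case by simp
qed

text \<open>The Leibniz rule without binomial coefficients: each derivative splits every term in
  two, and the entries of the multi-index are distributed over the two factors.\<close>

lemma norm_pderivs_mult_le:
  fixes f g :: "'a::euclidean_space \<Rightarrow> complex"
  assumes "smooth_on UNIV f" "smooth_on UNIV g" "set l \<subseteq> Basis"
    "\<And>k. mset k \<subseteq># mset l \<Longrightarrow> norm (pderivs k f \<xi>) \<le> A"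
    "\<And>k. mset k \<subseteq># mset l \<Longrightarrow> norm (pderivs k g \<xi>) \<le> B" "0 \<le> A" "0 \<le> B"
  shows "norm (pderivs l (\<lambda>x. f x * g x) \<xi>) \<le> 2 ^ length l * (A * B)"
  using assms
proof (induction l arbitrary: f g rule: rev_induct)
  case Nil
  then show ?case using Nil(4)[of "[]"] Nil(5)[of "[]"] by (simp add: norm_mult mult_mono)
next
  case (snoc v l)
  have v: "v \<in> Basis" "set l \<subseteq> Basis" using snoc.prems by auto
  have sm: "smooth_on UNIV (pderivs [v] f)" "smooth_on UNIV (pderivs [v] g)"
    by (intro smooth_on_pderivs snoc.prems; use v in simp)+
  have sub: "mset k \<subseteq># mset (l @ [v])" "mset (k @ [v]) \<subseteq># mset (l @ [v])" if "mset k \<subseteq># mset l" for k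
    using that subset_mset_add_right[of "mset k" "mset l" "{#v#}"] by auto
  have "pderivs [v] (\<lambda>x. f x * g x) = (\<lambda>x. f x * pderivs [v] g x + pderivs [v] f x * g x)"
  proof
    fix x
    have "((\<lambda>x. f x * g x) has_derivative (\<lambda>h. f x * frechet_derivative g (at x) h +
        frechet_derivative f (at x) h * g x)) (at x)"
      using snoc.prems(1,2) by (intro has_derivative_mult smooth_on_has_derivative[of UNIV]) auto
    then show "pderivs [v] (\<lambda>x. f x * g x) x = f x * pderivs [v] g x + pderivs [v] f x * g x"
      by (simp add: frechet_derivative_eqI)
  qed
  then have "pderivs (l @ [v]) (\<lambda>x. f x * g x) \<xi> =
      pderivs l (\<lambda>x. f x * pderivs [v] g x) \<xi> + pderivs l (\<lambda>x. pderivs [v] f x * g x) \<xi>"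
    unfolding pderivs_append using snoc.prems(1,2) sm v
    by (simp add: pderivs_add smooth_on_mult)
  also have "norm \<dots> \<le> norm (pderivs l (\<lambda>x. f x * pderivs [v] g x) \<xi>) + norm (pderivs l (\<lambda>x. pderivs [v] f x * g x) \<xi>)"
    by (rule norm_triangle_ineq)
  also have "\<dots> \<le> 2 ^ length l * (A * B) + 2 ^ length l * (A * B)"
    using snoc.prems sm v sub
    by (intro add_mono snoc.IH) (auto simp: pderivs_append[symmetric] simp del: pderivs.simps)
  finally show ?case by (simp add: mult_ac)
qed

subsection \<open>Control of a symbol by a single seminorm\<close>

text \<open>The constants in this definition are qualitative and only serve to make derivatives
  vanish at infinity. The size of a symbol is measured by \<open>decay_bound\<close>, for one
  multi-index.\<close>

definition decaying_symbol :: "real \<Rightarrow> ('a::euclidean_space \<Rightarrow> complex) \<Rightarrow> bool" where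
  "decaying_symbol \<rho> f \<longleftrightarrow> smooth_on UNIV f \<and>
     (\<forall>l. set l \<subseteq> Basis \<longrightarrow> (\<exists>C. \<forall>\<xi>. norm (pderivs l f \<xi>) \<le> C * (1 + norm \<xi>) powr (- \<rho> - real (length l))))"

definition decay_bound :: "real \<Rightarrow> 'a list \<Rightarrow> real \<Rightarrow> ('a::euclidean_space \<Rightarrow> complex) \<Rightarrow> bool" where
  "decay_bound \<rho> l \<epsilon> f \<longleftrightarrow> (\<forall>\<xi>. norm (pderivs l f \<xi>) \<le> \<epsilon> * (1 + norm \<xi>) powr (- \<rho> - real (length l)))"

text \<open>Integrates the derivative along the ray from \<open>\<xi>\<close> to infinity in the direction \<open>\<plusminus>v\<close> that
  leads away from the origin.\<close>

lemma decay_from_infinity: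
  fixes g :: "'a::euclidean_space \<Rightarrow> complex"
  assumes g: "smooth_on UNIV g" and v: "v \<in> Basis" and m: "m > 0"
    and dg: "\<And>\<xi>. norm (pderivs [v] g \<xi>) \<le> \<epsilon> * (1 + norm \<xi>) powr (- m - 1)"
    and gC: "\<And>\<xi>. norm (g \<xi>) \<le> C * (1 + norm \<xi>) powr (- m)"
  shows "norm (g \<xi>) \<le> \<epsilon> * (2 powr (m + 1) / m) * (1 + norm \<xi>) powr (- m)"
proof -
  have e0: "\<epsilon> \<ge> 0" using dg[of 0] norm_ge_zero[of "pderivs [v] g 0"] by (simp del: pderivs.simps norm_ge_zero)
  have C0: "C \<ge> 0" using gC[of 0] norm_ge_zero[of "g 0"] by (simp del: norm_ge_zero)
  define \<sigma> :: real where "\<sigma> = (if \<xi> \<bullet> v \<ge> 0 then 1 else -1)"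
  define w where "w = \<sigma> *\<^sub>R v"
  have w: "norm w = 1" "\<xi> \<bullet> w \<ge> 0" using v by (auto simp: w_def \<sigma>_def)
  \<comment> \<open>Since \<open>\<xi> \<bullet> w \<ge> 0\<close>, the squared norm along the ray
    is at least \<open>(norm \<xi>)^2 + s^2\<close>, which dominates the square of the mean of
    \<open>norm \<xi>\<close> and \<open>s\<close>.\<close>
  have lower: "(1 + norm \<xi> + s) / 2 \<le> 1 + norm (\<xi> + s *\<^sub>R w)" if "s \<ge> 0" for s
  proof -
    have ww: "w \<bullet> w = 1" using w(1) by (simp add: norm_eq_1)
    have "((norm \<xi> + s) / 2)\<^sup>2 \<le> (norm \<xi>)\<^sup>2 + s\<^sup>2"
    proof -
      have "(norm \<xi>)\<^sup>2 + s\<^sup>2 - ((norm \<xi> + s) / 2)\<^sup>2 = ((norm \<xi> - s)\<^sup>2 + 2 * (norm \<xi>)\<^sup>2 + 2 * s\<^sup>2) / 4"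
        by (simp add: power2_eq_square field_simps)
      also have "\<dots> \<ge> 0" by (intro divide_nonneg_nonneg add_nonneg_nonneg mult_nonneg_nonneg) auto
      finally show ?thesis by simp
    qed
    also have "\<dots> \<le> (norm (\<xi> + s *\<^sub>R w))\<^sup>2"
      using w(2) that unfolding power2_norm_eq_inner
      by (simp add: inner_add_left inner_add_right inner_commute ww power2_eq_square)
    finally have "(norm \<xi> + s) / 2 \<le> norm (\<xi> + s *\<^sub>R w)"
      by (rule power2_le_imp_le) simp
    then show ?thesis by (simp add: add_divide_distrib)
  qed
  have powr_le: "(1 + norm (\<xi> + s *\<^sub>R w)) powr (- p) \<le> 2 powr p * (1 + norm \<xi> + s) powr (- p)"
    if "s \<ge> 0" "p \<ge> 0" for s p
  proof -
    have "(1 + norm (\<xi> + s *\<^sub>R w)) powr (- p) \<le> ((1 + norm \<xi> + s) / 2) powr (- p)"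
      using that lower[OF that(1)] by (intro powr_mono2') (auto simp: add_pos_nonneg)
    also have "\<dots> = 2 powr p * (1 + norm \<xi> + s) powr (- p)"
      using that by (simp add: powr_divide powr_minus field_simps)
    finally show ?thesis .
  qed
  \<comment> \<open>A majorant that increases along the ray at least as fast as \<open>g\<close> can
    vary; its total increase from 0 to infinity is the asserted bound. The factor
    \<open>2 powr (m + 1)\<close> comes from \<open>powr_le\<close> with exponent
    \<open>m + 1\<close>.\<close>
  define \<phi> where "\<phi> s = - (\<epsilon> * (2 powr (m + 1) / m) * (1 + norm \<xi> + s) powr (- m))" for s
  define \<phi>' where "\<phi>' s = \<epsilon> * (2 powr (m + 1) * (1 + norm \<xi> + s) powr (- (m + 1)))" for s
  have phi: "(\<phi> has_real_derivative \<phi>' s) (at s)" if "s > - 1" for s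
  proof -
    have "1 + norm \<xi> + s > 0" using that norm_ge_zero[of \<xi>] by linarith
    then show ?thesis
    proof -
      have c: "- m - 1 = - 1 - m" by simp
      assume "1 + norm \<xi> + s > 0"
      then show ?thesis unfolding \<phi>_def \<phi>'_def using m
        by (auto intro!: derivative_eq_intros simp: field_simps c)
    qed
  qed
  have line: "((\<lambda>s. g (\<xi> + s *\<^sub>R w)) has_vector_derivative \<sigma> *\<^sub>R pderivs [v] g (\<xi> + s *\<^sub>R w)) (at s)" for s
  proof -
    have d: "(g has_derivative frechet_derivative g (at y)) (at y)" for y
      using g by (rule smooth_on_has_derivative) simp
    have "((\<lambda>s. g (\<xi> + s *\<^sub>R w)) has_derivative (\<lambda>k. frechet_derivative g (at (\<xi> + s *\<^sub>R w)) (k *\<^sub>R w))) (at s)"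
      by (rule has_derivative_compose[OF _ d]) (auto intro!: derivative_eq_intros)
    then show ?thesis
      unfolding has_vector_derivative_def w_def
      by (rule has_derivative_eq_rhs) (auto simp: linear_cmul[OF has_derivative_linear[OF d]])
  qed
  have step: "norm (g \<xi>) \<le> C * (2 powr m * (1 + norm \<xi> + S) powr (- m)) +
      \<epsilon> * (2 powr (m + 1) / m) * (1 + norm \<xi>) powr (- m)" if S: "S > 0" for S
  proof -
    have "norm (g (\<xi> + S *\<^sub>R w) - g (\<xi> + 0 *\<^sub>R w)) \<le> \<phi> S - \<phi> 0"
    proof (rule differentiable_bound_general[OF S, where f'="\<lambda>s. \<sigma> *\<^sub>R pderivs [v] g (\<xi> + s *\<^sub>R w)"
          and \<phi>'=\<phi>' and f="\<lambda>s. g (\<xi> + s *\<^sub>R w)"])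
      show "continuous_on {0..S} (\<lambda>s. g (\<xi> + s *\<^sub>R w))"
        using line by (intro continuous_at_imp_continuous_on ballI has_vector_derivative_continuous) blast
      show "continuous_on {0..S} \<phi>"
        by (intro continuous_at_imp_continuous_on ballI DERIV_isCont[OF phi]) auto
      fix s assume s: "0 < s" "s < S"
      show "(\<phi> has_vector_derivative \<phi>' s) (at s)"
        using phi s by (simp add: has_real_derivative_iff_has_vector_derivative)
      have "norm (pderivs [v] g (\<xi> + s *\<^sub>R w)) \<le> \<epsilon> * (1 + norm (\<xi> + s *\<^sub>R w)) powr (- (m + 1))"
        using dg[of "\<xi> + s *\<^sub>R w"] by simp
      also have "\<dots> \<le> \<epsilon> * (2 powr (m + 1) * (1 + norm \<xi> + s) powr (- (m + 1)))"
        using s m e0 by (intro mult_left_mono powr_le) auto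
      finally show "norm (\<sigma> *\<^sub>R pderivs [v] g (\<xi> + s *\<^sub>R w)) \<le> \<phi>' s"
        by (simp add: \<phi>'_def \<sigma>_def)
    qed (use line in blast)
    also have "\<dots> \<le> - \<phi> 0" using e0 m by (simp add: \<phi>_def)
    finally have "norm (g \<xi>) \<le> norm (g (\<xi> + S *\<^sub>R w)) - \<phi> 0"
      using norm_triangle_ineq2[of "g \<xi>" "g (\<xi> + S *\<^sub>R w)"] by (simp add: norm_minus_commute)
    also have "norm (g (\<xi> + S *\<^sub>R w)) \<le> C * (1 + norm (\<xi> + S *\<^sub>R w)) powr (- m)"
      by (rule gC)
    also have "\<dots> \<le> C * (2 powr m * (1 + norm \<xi> + S) powr (- m))"
      using S m C0 by (intro mult_left_mono powr_le) auto
    finally show ?thesis by (simp add: \<phi>_def)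
  qed
  \<comment> \<open>The a priori constant \<open>C\<close> only enters through the value of
    \<open>g\<close> at distance \<open>S\<close>. That contribution tends to 0 because
    \<open>m > 0\<close>.\<close>
  have "((\<lambda>S. C * (2 powr m * (1 + norm \<xi> + S) powr (- m)) +
      \<epsilon> * (2 powr (m + 1) / m) * (1 + norm \<xi>) powr (- m)) \<longlongrightarrow>
      C * (2 powr m * 0) + \<epsilon> * (2 powr (m + 1) / m) * (1 + norm \<xi>) powr (- m)) at_top"
    using m by (intro tendsto_intros tendsto_neg_powr filterlim_tendsto_add_at_top filterlim_ident) auto
  then have "norm (g \<xi>) \<le> C * (2 powr m * 0) + \<epsilon> * (2 powr (m + 1) / m) * (1 + norm \<xi>) powr (- m)"
    by (rule tendsto_lowerbound) (use step in \<open>auto intro: eventually_at_top_linorderI[of 1]\<close>)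
  then show ?thesis by simp
qed

text \<open>Each entry of \<open>r\<close> is removed by integrating from infinity. This requires
  decay of strictly positive order at every stage; the last stage may reach the symbol itself, whose
  order of decay is \<open>\<rho>\<close>.\<close>

lemma decay_bound_suffix:
  fixes r l :: "'a::euclidean_space list"
  assumes "\<rho> > 0" "set (r @ l) \<subseteq> Basis"
  shows "\<exists>K\<ge>0. \<forall>(f :: 'a \<Rightarrow> complex) \<epsilon>. decaying_symbol \<rho> f \<longrightarrow> decay_bound \<rho> (r @ l) \<epsilon> f \<longrightarrow> decay_bound \<rho> l (K * \<epsilon>) f"
  using assms(2)
proof (induction r)
  case Nil show ?case by (intro exI[of _ 1]) auto
next
  case (Cons v r)
  then obtain K where K: "K \<ge> 0" "\<And>(f :: 'a \<Rightarrow> complex) \<epsilon>. decaying_symbol \<rho> f \<Longrightarrow> decay_bound \<rho> (r @ l) \<epsilon> f \<Longrightarrow> decay_bound \<rho> l (K * \<epsilon>) f"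
    by auto
  define m where "m = \<rho> + real (length (r @ l))"
  have m: "m > 0" using assms(1) by (simp add: m_def)
  have "decay_bound \<rho> l (K * (2 powr (m + 1) / m) * \<epsilon>) f"
    if f: "decaying_symbol \<rho> f" and b: "decay_bound \<rho> ((v # r) @ l) \<epsilon> f" for f :: "'a \<Rightarrow> complex" and \<epsilon>
  proof -
    have rl: "set (r @ l) \<subseteq> Basis" "v \<in> Basis" using Cons.prems by auto
    obtain C where C: "\<And>\<xi>. norm (pderivs (r @ l) f \<xi>) \<le> C * (1 + norm \<xi>) powr (- \<rho> - real (length (r @ l)))"
      using f rl unfolding decaying_symbol_def by blast
    have "norm (pderivs (r @ l) f \<xi>) \<le> \<epsilon> * (2 powr (m + 1) / m) * (1 + norm \<xi>) powr (- m)" for \<xi>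
    proof (rule decay_from_infinity[OF _ rl(2) m, where C=C])
      show "smooth_on UNIV (pderivs (r @ l) f)"
        using f rl by (intro smooth_on_pderivs) (auto simp: decaying_symbol_def)
      show "norm (pderivs [v] (pderivs (r @ l) f) \<xi>) \<le> \<epsilon> * (1 + norm \<xi>) powr (- m - 1)" for \<xi>
        using b unfolding decay_bound_def m_def by (auto simp: algebra_simps)
      show "norm (pderivs (r @ l) f \<xi>) \<le> C * (1 + norm \<xi>) powr (- m)" for \<xi>
        using C[of \<xi>] unfolding m_def by (simp only: minus_add_distrib diff_conv_add_uminus)
    qed
    then have "decay_bound \<rho> (r @ l) ((2 powr (m + 1) / m) * \<epsilon>) f"
    proof -
      have mm: "- \<rho> - real (length (r @ l)) = - m" by (simp add: m_def)
      assume "\<And>\<xi>. norm (pderivs (r @ l) f \<xi>) \<le> \<epsilon> * (2 powr (m + 1) / m) * (1 + norm \<xi>) powr (- m)"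
      then show ?thesis unfolding decay_bound_def mm by (simp add: mult.commute mult.left_commute)
    qed
    from K(2)[OF f this] show ?thesis by (simp add: mult.assoc)
  qed
  then show ?case using K(1) m by (intro exI[of _ "K * (2 powr (m + 1) / m)"]) auto
qed

text \<open>Permuting the derivatives turns a sub-multiset into a suffix. Only finitely many lists
  occur, and the sum of their constants serves for all of them.\<close>

lemma decay_bound_subset:
  fixes bs :: "'a::euclidean_space list"
  assumes "\<rho> > 0" "set bs \<subseteq> Basis"
  shows "\<exists>K\<ge>0. \<forall>l (f :: 'a \<Rightarrow> complex) \<epsilon>. mset l \<subseteq># mset bs \<longrightarrow> decaying_symbol \<rho> f \<longrightarrow> decay_bound \<rho> bs \<epsilon> f \<longrightarrow>
    decay_bound \<rho> l (K * \<epsilon>) f"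
proof -
  define A where "A = {l. mset l \<subseteq># mset bs}"
  have "A \<subseteq> {l. set l \<subseteq> set bs \<and> length l \<le> length bs}"
    unfolding A_def by (metis (no_types, lifting) mem_Collect_eq set_mset_mono set_mset_mset size_mset size_mset_mono subsetI)
  then have fin: "finite A" using finite_lists_length_le finite_subset by blast
  have "\<exists>K\<ge>0. \<forall>(f :: 'a \<Rightarrow> complex) \<epsilon>. decaying_symbol \<rho> f \<longrightarrow> decay_bound \<rho> bs \<epsilon> f \<longrightarrow> decay_bound \<rho> l (K * \<epsilon>) f"
    if l: "l \<in> A" for l
  proof -
    \<comment> \<open>\<open>r\<close> lists the entries of \<open>bs\<close> that are missing in
      \<open>l\<close>.\<close>
    obtain r where r: "mset (r @ l) = mset bs"
      using l unfolding A_def by (metis ex_mset mem_Collect_eq mset_append subset_mset.diff_add)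
    have set: "set (r @ l) \<subseteq> Basis" using assms(2) r by (metis set_mset_mset)
    obtain K where "K \<ge> 0" and K: "\<And>(f :: 'a \<Rightarrow> complex) \<epsilon>. decaying_symbol \<rho> f \<Longrightarrow> decay_bound \<rho> (r @ l) \<epsilon> f \<Longrightarrow> decay_bound \<rho> l (K * \<epsilon>) f"
      using decay_bound_suffix[OF assms(1) set] by blast
    have "decay_bound \<rho> (r @ l) \<epsilon> f" if "decaying_symbol \<rho> f" "decay_bound \<rho> bs \<epsilon> f" for f :: "'a \<Rightarrow> complex" and \<epsilon>
      using that pderivs_perm[of f "r @ l" bs] r set unfolding decay_bound_def decaying_symbol_def
      by (metis size_mset)
    then show ?thesis using K \<open>K \<ge> 0\<close> by blast
  qed
  then obtain K where K: "\<And>l. l \<in> A \<Longrightarrow> K l \<ge> 0"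
    "\<And>l (f :: 'a \<Rightarrow> complex) \<epsilon>. l \<in> A \<Longrightarrow> decaying_symbol \<rho> f \<Longrightarrow> decay_bound \<rho> bs \<epsilon> f \<Longrightarrow> decay_bound \<rho> l (K l * \<epsilon>) f"
    by metis
  have "decay_bound \<rho> l ((\<Sum>l\<in>A. K l) * \<epsilon>) f"
    if l: "mset l \<subseteq># mset bs" and f: "decaying_symbol \<rho> f" and b: "decay_bound \<rho> bs \<epsilon> f" for l and f :: "'a \<Rightarrow> complex" and \<epsilon>
  proof -
    have e0: "\<epsilon> \<ge> 0" using b norm_ge_zero[of "pderivs bs f 0"] unfolding decay_bound_def
      by (metis add.right_neutral mult.right_neutral norm_zero order_trans powr_one_eq_one)
    have "K l \<le> (\<Sum>l\<in>A. K l)" using l fin K(1) by (intro member_le_sum) (auto simp: A_def)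
    then have "K l * \<epsilon> * t \<le> (\<Sum>l\<in>A. K l) * \<epsilon> * t" if "t \<ge> 0" for t
      using e0 that by (intro mult_right_mono) auto
    moreover have "decay_bound \<rho> l (K l * \<epsilon>) f" using K(2)[OF _ f b, of l] l by (simp add: A_def)
    ultimately show ?thesis unfolding decay_bound_def by (blast intro: order_trans[OF _ _] powr_ge_zero)
  qed
  then show ?thesis using K(1) by (intro exI[of _ "\<Sum>l\<in>A. K l"]) (auto intro: sum_nonneg)
qed

subsection \<open>Dyadic decomposition of the kernel\<close>

lemma lborel_integral_scale:
  fixes h :: "'a::euclidean_space \<Rightarrow> complex"
  assumes [measurable]: "h \<in> borel_measurable borel" and c: "c > 0"
  shows "(LINT x|lborel. h x) = complex_of_real (c ^ DIM('a)) * (LINT x|lborel. h (c *\<^sub>R x))"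
proof -
  have "(LINT x|lborel. h x) = (LINT x|density (distr lborel borel (\<lambda>x. 0 + c *\<^sub>R x)) (\<lambda>_. \<bar>c\<bar>^DIM('a)). h x)"
    using c by (subst lborel_affine[of c 0]) auto
  also have "\<dots> = (LINT x|lborel. c ^ DIM('a) *\<^sub>R h (c *\<^sub>R x))"
    using c by (subst integral_density) (auto simp: integral_distr)
  finally show ?thesis by (simp add: scaleR_conv_of_real)
qed

lemma nn_integral_affine:
  fixes h :: "'a::euclidean_space \<Rightarrow> ennreal"
  assumes [measurable]: "h \<in> borel_measurable borel" and c: "c \<noteq> 0"
  shows "(\<integral>\<^sup>+x. h x \<partial>lborel) = ennreal (\<bar>c\<bar> ^ DIM('a)) * (\<integral>\<^sup>+x. h (t + c *\<^sub>R x) \<partial>lborel)"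
proof -
  have "(\<integral>\<^sup>+x. h x \<partial>lborel) = (\<integral>\<^sup>+x. h x \<partial>density (distr lborel borel (\<lambda>x. t + c *\<^sub>R x)) (\<lambda>_. \<bar>c\<bar>^DIM('a)))"
    using c by (subst lborel_affine[of c t]) auto
  also have "\<dots> = (\<integral>\<^sup>+x. ennreal (\<bar>c\<bar> ^ DIM('a)) * h (t + c *\<^sub>R x) \<partial>lborel)"
    by (subst nn_integral_density) (auto simp: nn_integral_distr)
  also have "\<dots> = ennreal (\<bar>c\<bar> ^ DIM('a)) * (\<integral>\<^sup>+x. h (t + c *\<^sub>R x) \<partial>lborel)"
    by (subst nn_integral_cmult) auto
  finally show ?thesis .
qed

lemma smooth_on_scale:
  "smooth_on UNIV f \<Longrightarrow> smooth_on UNIV (\<lambda>\<xi>. f (c *\<^sub>R \<xi>))"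
  by (rule smooth_on_compose[where g="\<lambda>\<xi>. c *\<^sub>R \<xi>" and T=UNIV])
    (auto intro: smooth_on_linear[OF open_UNIV bounded_linear_scaleR_right smooth_on_id])

lemma pderivs_scale:
  fixes f :: "'a::euclidean_space \<Rightarrow> complex"
  assumes "smooth_on UNIV f" "set l \<subseteq> Basis"
  shows "pderivs l (\<lambda>\<xi>. f (c *\<^sub>R \<xi>)) = (\<lambda>\<xi>. complex_of_real (c ^ length l) * pderivs l f (c *\<^sub>R \<xi>))"
  using assms(2)
proof (induction l)
  case (Cons v l)
  have d: "(pderivs l f has_derivative frechet_derivative (pderivs l f) (at y)) (at y)" for y
    using assms(1) Cons.prems by (intro smooth_on_has_derivative[of UNIV] smooth_on_pderivs) auto
  have D: "((\<lambda>\<xi>. complex_of_real (c ^ length l) * pderivs l f (c *\<^sub>R \<xi>)) has_derivative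
      (\<lambda>k. complex_of_real (c ^ length l) * frechet_derivative (pderivs l f) (at (c *\<^sub>R \<xi>)) (c *\<^sub>R k))) (at \<xi>)" for \<xi>
    by (intro has_derivative_mult_right has_derivative_compose[OF _ d]) (auto intro!: derivative_eq_intros)
  show ?case
    using Cons by (simp add: frechet_derivative_eqI[OF D] linear_cmul[OF has_derivative_linear[OF d]] scaleR_conv_of_real mult_ac del: of_real_power)
qed simp

text \<open>Littlewood-Paley cut-offs, rescaled to unit frequency. All \<open>j > 0\<close> share
  one profile, supported in the annulus \<open>1 / 2 \<le> norm \<xi> \<le> 2\<close>, so bounds on
  its derivatives are uniform in \<open>j\<close>. The difference of two dilated plateaus makes the
  partial sums telescope.\<close>

definition dyadic_profile :: "nat \<Rightarrow> 'a::euclidean_space \<Rightarrow> complex" where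
  "dyadic_profile j \<xi> = (if j = 0 then plateau 0 1 2 \<xi> else plateau 0 1 2 \<xi> - plateau 0 1 2 (2 *\<^sub>R \<xi>))"

definition dyadic_cutoff :: "nat \<Rightarrow> 'a::euclidean_space \<Rightarrow> complex" where
  "dyadic_cutoff j \<xi> = dyadic_profile j ((1 / 2) ^ j *\<^sub>R \<xi>)"

lemma smooth_dyadic_profile: "smooth_on UNIV (dyadic_profile j)"
  unfolding dyadic_profile_def[abs_def]
  by (cases "j = 0") (auto intro!: smooth_on_diff smooth_on_plateau smooth_on_scale)

lemma sum_dyadic_cutoff: "(\<Sum>j\<le>J. dyadic_cutoff j \<xi>) = plateau 0 1 2 ((1 / 2) ^ J *\<^sub>R \<xi>)"
  by (induction J) (auto simp: dyadic_cutoff_def dyadic_profile_def)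

lemma dyadic_profile_vanish:
  assumes "\<not> (norm \<xi> \<le> 2 \<and> (j = 0 \<or> norm \<xi> \<ge> 1 / 2))"
  shows "dyadic_profile j \<xi> = 0"
proof (cases "norm \<xi> \<le> 2")
  case True
  then show ?thesis using assms by (simp add: dyadic_profile_def plateau_eq_1)
next
  case False
  then show ?thesis by (simp add: dyadic_profile_def plateau_eq_0)
qed

lemma test_function_dyadic_profile: "test_function (dyadic_profile j)"
  by (rule test_functionI[OF smooth_dyadic_profile compact_cball[of 0 2]])
    (auto intro!: dyadic_profile_vanish)

lemma norm_dyadic_cutoff_le: "norm (dyadic_cutoff j \<xi>) \<le> 2"
proof -
  have "norm (dyadic_profile j x) \<le> 1 + 1" for x
    unfolding dyadic_profile_def
    using norm_plateau_le_1[of 0 1 2 x] norm_plateau_le_1[of 0 1 2 "2 *\<^sub>R x"]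
      norm_triangle_ineq4[of "plateau 0 1 2 x" "plateau 0 1 2 (2 *\<^sub>R x)"] by (auto split: if_split)
  then show ?thesis by (simp add: dyadic_cutoff_def)
qed

lemma dyadic_profile_pderivs_bounded:
  fixes bs :: "'a::euclidean_space list"
  assumes "set bs \<subseteq> Basis"
  shows "\<exists>B\<ge>0. \<forall>l j (\<xi>::'a). mset l \<subseteq># mset bs \<longrightarrow> norm (pderivs l (dyadic_profile j) \<xi>) \<le> B"
proof -
  define A where "A = {l. mset l \<subseteq># mset bs}"
  have sub: "A \<subseteq> {l. set l \<subseteq> set bs \<and> length l \<le> length bs}"
    unfolding A_def by (metis (no_types, lifting) mem_Collect_eq set_mset_mono set_mset_mset size_mset size_mset_mono subsetI)
  then have fin: "finite A" using finite_lists_length_le finite_subset by blast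
  have "\<exists>B\<ge>0. \<forall>\<xi>. norm (pderivs l (dyadic_profile j) \<xi>) \<le> B" if "l \<in> A" for l and j :: nat
    using that sub assms by (intro test_function_bounded test_function_pderivs test_function_dyadic_profile) auto
  then obtain B where B: "\<And>l j. l \<in> A \<Longrightarrow> B l j \<ge> 0"
      "\<And>l j \<xi>. l \<in> A \<Longrightarrow> norm (pderivs l (dyadic_profile j) \<xi>) \<le> B l j" by metis
  have "norm (pderivs l (dyadic_profile j) \<xi>) \<le> (\<Sum>l\<in>A. B l 0 + B l 1)" if l: "l \<in> A" for l j \<xi>
  proof -
    \<comment> \<open>Only two profiles occur, those of index 0 and 1.\<close>
    have "(dyadic_profile j :: 'a \<Rightarrow> complex) = dyadic_profile (if j = 0 then 0 else 1)"
      by (auto simp: dyadic_profile_def)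
    then have "norm (pderivs l (dyadic_profile j) \<xi>) \<le> B l (if j = 0 then 0 else 1)"
      using B(2)[OF l] by simp
    also have "\<dots> \<le> B l 0 + B l 1" using B(1)[OF l] by auto
    also have "\<dots> \<le> (\<Sum>l\<in>A. B l 0 + B l 1)"
      using B(1) fin l by (intro member_le_sum) auto
    finally show ?thesis .
  qed
  then show ?thesis using B(1) unfolding A_def
    by (intro exI[of _ "\<Sum>l\<in>{l. mset l \<subseteq># mset bs}. B l 0 + B l 1"]) (auto intro!: sum_nonneg)
qed

text \<open>Rescaling to unit frequency multiplies a derivative of order L by
  \<open>2^(j L)\<close>. On the annulus the symbol's own derivative is of size
  \<open>2^(-j (\<rho> + L))\<close>, so \<open>2^(-j \<rho>)\<close> remains for every L.
  Differentiating twice in each direction under the integral then yields the product weight in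
  \<open>z\<close>.\<close>

lemma dyadic_kernel_bound:
  fixes bs :: "'a::euclidean_space list"
  assumes \<rho>: "\<rho> > 0" and bs: "set bs = Basis" "distinct bs"
  shows "\<exists>C\<ge>0. \<forall>(f :: 'a \<Rightarrow> complex) \<epsilon> j z. decaying_symbol \<rho> f \<longrightarrow> decay_bound \<rho> (twice bs) \<epsilon> f \<longrightarrow>
    norm (invFT (\<lambda>\<xi>. f (2 ^ j *\<^sub>R \<xi>) * dyadic_profile j \<xi>) z) * (\<Prod>v\<in>Basis. 1 + (z \<bullet> v)\<^sup>2) \<le>
      C * \<epsilon> * (2 powr - \<rho>) ^ j"
proof -
  have tw: "set (twice bs) \<subseteq> Basis" using bs by (auto simp: twice_def)
  define N where "N = length (twice bs)"
  obtain K where K: "K \<ge> 0" "\<And>l (f :: 'a \<Rightarrow> complex) \<epsilon>. mset l \<subseteq># mset (twice bs) \<Longrightarrow> decaying_symbol \<rho> f \<Longrightarrow>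
      decay_bound \<rho> (twice bs) \<epsilon> f \<Longrightarrow> decay_bound \<rho> l (K * \<epsilon>) f"
    using decay_bound_subset[OF \<rho> tw] by blast
  obtain B where B: "B \<ge> 0" "\<And>l j (\<xi>::'a). mset l \<subseteq># mset (twice bs) \<Longrightarrow> norm (pderivs l (dyadic_profile j) \<xi>) \<le> B"
    using dyadic_profile_pderivs_bounded[OF tw] by blast
  define V where "V = measure lborel (cball (0::'a) 2)"
  \<comment> \<open>In this order: the number of terms of \<open>one_minus_squares\<close>, the
    Leibniz factor, the passage to lower derivatives, the loss from replacing
    \<open>1 + norm\<close> by \<open>2 ^ j / 2\<close>, the bound on the profile, and the volume of
    the ball that contains its support.\<close>
  define C where "C = 2 ^ length bs * (2 ^ N * (K * 2 powr (\<rho> + N) * B)) * V"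
  have C0: "C \<ge> 0" using K B by (auto simp: C_def V_def)
  have "norm (invFT (\<lambda>\<xi>. f (2 ^ j *\<^sub>R \<xi>) * dyadic_profile j \<xi>) z) * (\<Prod>v\<in>Basis. 1 + (z \<bullet> v)\<^sup>2) \<le>
      C * \<epsilon> * (2 powr - \<rho>) ^ j"
    if f: "decaying_symbol \<rho> f" and b: "decay_bound \<rho> (twice bs) \<epsilon> f" for f :: "'a \<Rightarrow> complex" and \<epsilon> j z
  proof -
    have e0: "\<epsilon> \<ge> 0" using b norm_ge_zero[of "pderivs (twice bs) f 0"] unfolding decay_bound_def
      by (metis add.right_neutral mult.right_neutral norm_zero order_trans powr_one_eq_one)
    define g where "g \<xi> = f (2 ^ j *\<^sub>R \<xi>)" for \<xi>
    define q where "q = (2 powr - \<rho>) ^ j"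
    define A where "A = K * \<epsilon> * (q * 2 powr (\<rho> + N))"
    have A0: "A \<ge> 0" using K e0 by (simp add: A_def q_def)
    have fs: "smooth_on UNIV f" using f by (simp add: decaying_symbol_def)
    have gs: "smooth_on UNIV g" unfolding g_def by (rule smooth_on_scale[OF fs])
    \<comment> \<open>A closed set outside which the profile vanishes; on it the point
      \<open>2 ^ j *\<^sub>R \<xi>\<close> has norm at least \<open>2 ^ j / 2\<close> unless
      \<open>j = 0\<close>.\<close>
    define S where "S = {\<xi>::'a. norm \<xi> \<le> 2 \<and> (j = 0 \<or> norm \<xi> \<ge> 1 / 2)}"
    have Sc: "closed S"
      unfolding S_def by (intro closed_Collect_conj closed_Collect_disj closed_Collect_le continuous_intros closed_Collect_const)
    have gb: "norm (pderivs l g \<xi>) \<le> A" if l: "mset l \<subseteq># mset (twice bs)" and \<xi>: "\<xi> \<in> S" for l \<xi>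
    proof -
      have lB: "set l \<subseteq> Basis" using l tw by (metis order_trans set_mset_mono set_mset_mset)
      have lN: "length l \<le> N" using l unfolding N_def by (metis size_mset size_mset_mono)
      define L where "L = real (length l)"
      have "norm (pderivs l g \<xi>) = (2 ^ j) ^ length l * norm (pderivs l f (2 ^ j *\<^sub>R \<xi>))"
        unfolding g_def by (simp add: pderivs_scale[OF fs lB] norm_mult norm_power)
      also have "\<dots> \<le> (2 ^ j) ^ length l * (K * \<epsilon> * (1 + norm (2 ^ j *\<^sub>R \<xi>)) powr (- \<rho> - L))"
        unfolding L_def by (intro mult_left_mono K(2)[OF l f b, unfolded decay_bound_def, rule_format]) simp
      also have "\<dots> = K * \<epsilon> * ((2 ^ j) powr L * (1 + norm (2 ^ j *\<^sub>R \<xi>)) powr (- \<rho> - L))"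
        by (simp add: powr_realpow L_def)
      also have "\<dots> \<le> K * \<epsilon> * ((2 ^ j) powr L * ((2 ^ j / 2) powr (- \<rho> - L)))"
      proof (intro mult_left_mono powr_mono2')
        show "- \<rho> - L \<le> 0" using \<rho> by (simp add: L_def)
        show "2 ^ j / 2 \<le> 1 + norm (2 ^ j *\<^sub>R \<xi>)"
        proof (cases "j = 0")
          case False
          then have "2 ^ j * (1 / 2) \<le> 2 ^ j * norm \<xi>" using \<xi> by (intro mult_left_mono) (auto simp: S_def)
          moreover have "norm (2 ^ j *\<^sub>R \<xi>) = 2 ^ j * norm \<xi>" by simp
          ultimately show ?thesis by linarith
        qed (use norm_ge_zero[of \<xi>] in simp)
      qed (use K e0 in auto)
      also have "(2 ^ j) powr L * ((2 ^ j / 2) powr (- \<rho> - L)) = q * 2 powr (\<rho> + L)"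
      proof -
        have p: "(2::real) ^ j = 2 powr j" by (simp add: powr_realpow)
        have "(2 ^ j) powr L = 2 powr (j * L)" unfolding p by (simp add: powr_powr)
        moreover have "(2::real) ^ j / 2 = 2 powr (real j - 1)" by (simp add: powr_diff powr_realpow)
        then have "((2::real) ^ j / 2) powr (- \<rho> - L) = 2 powr ((real j - 1) * (- \<rho> - L))"
          by (simp only: powr_powr)
        ultimately have "(2 ^ j) powr L * ((2 ^ j / 2) powr (- \<rho> - L)) = 2 powr (j * L + (real j - 1) * (- \<rho> - L))"
          by (simp only: powr_add)
        also have "j * L + (real j - 1) * (- \<rho> - L) = - \<rho> * j + (\<rho> + L)" by (simp add: algebra_simps)
        also have "2 powr (- \<rho> * j + (\<rho> + L)) = q * 2 powr (\<rho> + L)"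
        proof -
          have "q = (2 powr - \<rho>) powr real j" unfolding q_def by (simp add: powr_realpow)
          then have "q = 2 powr (- \<rho> * j)" by (simp only: powr_powr)
          then show ?thesis by (simp only: powr_add)
        qed
        finally show ?thesis .
      qed
      also have "K * \<epsilon> * (q * 2 powr (\<rho> + L)) \<le> A"
        unfolding A_def using K e0 lN by (intro mult_left_mono powr_mono) (auto simp: q_def L_def)
      finally show ?thesis .
    qed
    define h where "h \<xi> = g \<xi> * dyadic_profile j \<xi>" for \<xi>
    have ht: "test_function h"
      unfolding h_def by (intro test_function_mult test_function_dyadic_profile gs)
    have hS: "h \<xi> = 0" if "\<xi> \<notin> S" for \<xi>
      using that dyadic_profile_vanish[of \<xi> j] by (auto simp: S_def h_def)
    define D where "D = 2 ^ length bs * (2 ^ N * (A * B))"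
    have D0: "D \<ge> 0" using A0 B by (simp add: D_def)
    have "norm (pderivs l h \<xi>) \<le> 2 ^ N * (A * B) * indicator S \<xi>" if l: "mset l \<subseteq># mset (twice bs)" for l \<xi>
    proof (cases "\<xi> \<in> S")
      case False
      then show ?thesis using pderivs_vanish[OF Sc hS] by simp
    next
      case True
      have lB: "set l \<subseteq> Basis" using l tw by (metis order_trans set_mset_mono set_mset_mset)
      have lN: "length l \<le> N" using l unfolding N_def by (metis size_mset size_mset_mono)
      have "norm (pderivs l h \<xi>) \<le> 2 ^ length l * (A * B)"
        unfolding h_def using l True A0 B
        by (intro norm_pderivs_mult_le[OF gs smooth_dyadic_profile lB] gb)
          (auto intro: subset_mset.order_trans)
      also have "\<dots> \<le> 2 ^ N * (A * B)" using lN A0 B by (intro mult_right_mono power_increasing) auto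
      finally show ?thesis using True by simp
    qed
    then have oms: "norm (one_minus_squares bs h \<xi>) \<le> D * indicator S \<xi>" for \<xi>
      using norm_one_minus_squares_le[OF ht, of bs \<xi> "2 ^ N * (A * B) * indicator S \<xi>"] bs
      by (simp add: D_def mult.assoc)
    have ot: "test_function (one_minus_squares bs h)"
      using bs by (intro test_function_one_minus_squares ht) auto
    have "norm (invFT (one_minus_squares bs h) z) \<le> (LINT \<xi>|lborel. norm (cis (z \<bullet> \<xi>) * one_minus_squares bs h \<xi>))"
      unfolding invFT_def by (rule integral_norm_bound)
    also have "\<dots> \<le> (LINT \<xi>|lborel. D * indicator (cball (0::'a) 2) \<xi>)"
    proof (rule integral_mono)
      show "integrable lborel (\<lambda>\<xi>. norm (cis (z \<bullet> \<xi>) * one_minus_squares bs h \<xi>))"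
        by (intro integrable_norm test_function_integrable test_function_mult ot smooth_on_cis)
      show "integrable lborel (\<lambda>\<xi>. D * indicator (cball (0::'a) 2) \<xi>)"
        by (intro integrable_mult_right integrable_real_indicator) (use emeasure_lborel_cball_finite in auto)
      show "norm (cis (z \<bullet> \<xi>) * one_minus_squares bs h \<xi>) \<le> D * indicator (cball 0 2) \<xi>" for \<xi>
        using oms[of \<xi>] D0 by (auto simp: norm_mult S_def indicator_def split: if_splits intro: order_trans)
    qed
    also have "\<dots> = D * V" by (simp add: V_def)
    finally have "norm (invFT (one_minus_squares bs h) z) \<le> D * V" .
    moreover have "(\<Prod>v\<leftarrow>bs. 1 + (z \<bullet> v)\<^sup>2) = (\<Prod>v\<in>Basis. 1 + (z \<bullet> v)\<^sup>2)"
      using bs prod.distinct_set_conv_list by metis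
    moreover have "(\<Prod>v\<in>Basis. 1 + (z \<bullet> v)\<^sup>2) \<ge> 0" by (intro prod_nonneg) auto
    moreover have "invFT (one_minus_squares bs h) z = complex_of_real (\<Prod>v\<leftarrow>bs. 1 + (z \<bullet> v)\<^sup>2) * invFT h z"
      using bs by (intro invFT_one_minus_squares[OF ht]) auto
    ultimately have "(\<Prod>v\<in>Basis. 1 + (z \<bullet> v)\<^sup>2) * norm (invFT h z) \<le> D * V"
      by (simp only: norm_mult norm_of_real abs_of_nonneg)
    then show ?thesis
      unfolding h_def g_def by (simp add: D_def C_def A_def q_def mult_ac)
  qed
  then show ?thesis using C0 by blast
qed

subsection \<open>Boundedness on square integrable functions\<close>

text \<open>The Bochner integral of a function that is not integrable is 0, so the bound covers that
  case too.\<close>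

lemma norm_integral_le_nn_integral:
  fixes f :: "'a \<Rightarrow> complex"
  shows "ennreal (norm (LINT x|M. f x)) \<le> (\<integral>\<^sup>+x. ennreal (norm (f x)) \<partial>M)"
proof (cases "integrable M f")
  case True
  then show ?thesis by (rule integral_norm_bound_ennreal)
qed (simp add: not_integrable_integral_eq)

text \<open>The reciprocal of the multiplier of \<open>one_minus_squares\<close> over the basis. Its
  product form reduces its integral to the derivative of arctan in each coordinate.\<close>

definition bump_kernel :: "'a::euclidean_space \<Rightarrow> real" where
  "bump_kernel z = (\<Prod>v\<in>Basis. inverse (1 + (z \<bullet> v)\<^sup>2))"

lemma bump_kernel_nonneg: "bump_kernel z \<ge> 0"
  unfolding bump_kernel_def by (intro prod_nonneg) (auto intro: add_nonneg_nonneg)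

lemma bump_kernel_measurable [measurable]: "bump_kernel \<in> borel_measurable borel"
  unfolding bump_kernel_def[abs_def] by measurable

lemma nn_integral_arctan_deriv: "(\<integral>\<^sup>+x. ennreal (inverse (1 + x\<^sup>2)) \<partial>lborel) < \<infinity>"
proof -
  have pos: "(\<integral>\<^sup>+x. ennreal (inverse (1 + x\<^sup>2)) * indicator {0..} x \<partial>lborel) = ennreal (pi / 2 - arctan 0)"
    by (rule nn_integral_FTC_atLeast)
      (auto intro!: DERIV_arctan tendsto_arctan_at_top add_nonneg_nonneg)
  have neg: "(\<integral>\<^sup>+x. ennreal (inverse (1 + x\<^sup>2)) * indicator {..0} x \<partial>lborel) = ennreal (pi / 2 - arctan 0)"
    unfolding pos[symmetric]
    by (subst nn_integral_real_affine[where c="-1" and t=0])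
      (auto simp: indicator_def intro!: nn_integral_cong)
  have "(\<integral>\<^sup>+x. ennreal (inverse (1 + x\<^sup>2)) \<partial>lborel) \<le>
      (\<integral>\<^sup>+x. ennreal (inverse (1 + x\<^sup>2)) * indicator {0..} x + ennreal (inverse (1 + x\<^sup>2)) * indicator {..0} x \<partial>lborel)"
    by (intro nn_integral_mono) (auto simp: indicator_def)
  also have "\<dots> = ennreal (pi / 2 - arctan 0) + ennreal (pi / 2 - arctan 0)"
    by (subst nn_integral_add) (auto simp: pos neg)
  also have "\<dots> < \<infinity>" by simp
  finally show ?thesis .
qed

lemma nn_integral_bump_kernel: "(\<integral>\<^sup>+z. ennreal (bump_kernel (z :: 'a::euclidean_space)) \<partial>lborel) < \<infinity>"
proof -
  have "(\<integral>\<^sup>+z. ennreal (bump_kernel (z :: 'a)) \<partial>lborel) =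
      (\<integral>\<^sup>+z. (\<Prod>v\<in>(Basis::'a set). ennreal (inverse (1 + (z \<bullet> v)\<^sup>2))) \<partial>lborel)"
    unfolding bump_kernel_def by (subst prod_ennreal) (auto intro: add_nonneg_nonneg)
  also have "\<dots> = (\<Prod>v\<in>(Basis::'a set). (\<integral>\<^sup>+x. ennreal (inverse (1 + x\<^sup>2)) \<partial>lborel))"
    by (rule nn_integral_lborel_prod) auto
  also have "\<dots> < \<infinity>"
    using nn_integral_arctan_deriv by (simp add: power_less_top_ennreal)
  finally show ?thesis .
qed

text \<open>The common majorant of the kernels of all operators under consideration, as a function
  of the difference of the two points. The values are extended because the series may diverge at
  \<open>z = 0\<close>.\<close>

definition dyadic_envelope :: "real \<Rightarrow> 'a::euclidean_space \<Rightarrow> ennreal" where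
  "dyadic_envelope \<rho> z =
    (\<Sum>j. ennreal ((2 powr - \<rho>) ^ j * (2 ^ j) ^ DIM('a) * bump_kernel (2 ^ j *\<^sub>R z)))"

lemma dyadic_envelope_measurable [measurable]: "dyadic_envelope \<rho> \<in> borel_measurable borel"
  unfolding dyadic_envelope_def[abs_def] by measurable

text \<open>By scaling, the piece of index \<open>j\<close> has \<open>2^(-j \<rho>)\<close> times
  the integral of \<open>bump_kernel\<close>, and the geometric series converges because
  \<open>\<rho> > 0\<close>.\<close>

lemma nn_integral_dyadic_envelope:
  assumes "\<rho> > 0"
  shows "(\<integral>\<^sup>+z. dyadic_envelope \<rho> (z :: 'a::euclidean_space) \<partial>lborel) < \<infinity>"
proof -
  let ?q = "2 powr - \<rho> :: real"
  let ?I = "\<integral>\<^sup>+z. ennreal (bump_kernel (z :: 'a)) \<partial>lborel"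
  have q: "0 \<le> ?q" "?q < 1" using assms by (auto simp: powr_less_one)
  have "(\<integral>\<^sup>+z. dyadic_envelope \<rho> (z :: 'a) \<partial>lborel) =
      (\<Sum>j. \<integral>\<^sup>+z. ennreal (?q ^ j * (2 ^ j) ^ DIM('a) * bump_kernel (2 ^ j *\<^sub>R (z :: 'a))) \<partial>lborel)"
    unfolding dyadic_envelope_def by (rule nn_integral_suminf) measurable
  also have "\<dots> = (\<Sum>j. ennreal (?q ^ j) * ?I)"
  proof (rule suminf_cong)
    fix j
    have "(\<integral>\<^sup>+z. ennreal (?q ^ j * (2 ^ j) ^ DIM('a) * bump_kernel (2 ^ j *\<^sub>R (z :: 'a))) \<partial>lborel) =
      ennreal (?q ^ j) * (ennreal (\<bar>2 ^ j\<bar> ^ DIM('a)) * (\<integral>\<^sup>+z. ennreal (bump_kernel (0 + 2 ^ j *\<^sub>R (z :: 'a))) \<partial>lborel))"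
      by (simp add: ennreal_mult bump_kernel_nonneg nn_integral_cmult mult.assoc)
    also have "\<dots> = ennreal (?q ^ j) * ?I"
      by (subst nn_integral_affine[where c="2 ^ j" and t=0, symmetric]) auto
    finally show "(\<integral>\<^sup>+z. ennreal (?q ^ j * (2 ^ j) ^ DIM('a) * bump_kernel (2 ^ j *\<^sub>R (z :: 'a))) \<partial>lborel) = ennreal (?q ^ j) * ?I" .
  qed
  also have "\<dots> = (\<Sum>j. ennreal (?q ^ j)) * ?I" by simp
  also have "(\<Sum>j. ennreal (?q ^ j)) = ennreal (\<Sum>j. ?q ^ j)"
    using q by (intro suminf_ennreal2 summable_geometric) auto
  also have "ennreal (\<Sum>j. ?q ^ j) * ?I < \<infinity>"
    using nn_integral_bump_kernel[where 'a='a] by (auto simp: ennreal_mult_less_top)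
  finally show ?thesis .
qed

lemma decaying_symbol_continuous: "decaying_symbol \<rho> f \<Longrightarrow> continuous_on S f"
  unfolding decaying_symbol_def by (meson continuous_on_subset smooth_on_continuous subset_UNIV)

text \<open>The cut-off is compactly supported in \<open>\<xi>\<close> and \<open>u\<close> in
  \<open>y\<close>, so Fubini applies to a continuous function with compact support. The
  substitution by \<open>2 ^ j\<close> then contributes the Jacobian.\<close>

lemma dyadic_piece_kernel:
  fixes f u :: "'a::euclidean_space \<Rightarrow> complex"
  assumes f: "continuous_on UNIV f" and u: "test_function u"
  shows "(LINT \<xi>|lborel. cis (x \<bullet> \<xi>) * f \<xi> * dyadic_cutoff j \<xi> * fourier u \<xi>) =
    (LINT y|lborel. u y * (complex_of_real ((2 ^ j) ^ DIM('a)) *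
       invFT (\<lambda>\<xi>. f (2 ^ j *\<^sub>R \<xi>) * dyadic_profile j \<xi>) (2 ^ j *\<^sub>R (x - y))))"
proof -
  define F where "F = (\<lambda>(\<xi>, y). cis ((x - y) \<bullet> \<xi>) * f \<xi> * dyadic_cutoff j \<xi> * u y)"
  have cd: "continuous_on S (dyadic_cutoff j :: 'a \<Rightarrow> complex)" for S
    unfolding dyadic_cutoff_def[abs_def]
    by (intro continuous_on_compose2[OF smooth_on_continuous[OF smooth_dyadic_profile]] continuous_intros) auto
  have cf: "continuous_on S f" for S using f continuous_on_subset by blast
  have vd: "dyadic_cutoff j \<xi> = 0" if "\<xi> \<notin> cball 0 (2 * 2 ^ j)" for \<xi> :: 'a
    unfolding dyadic_cutoff_def using that
    by (intro dyadic_profile_vanish) (auto simp: power_divide field_simps)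
  have "continuous_on UNIV F"
    unfolding F_def case_prod_beta
    by (intro continuous_intros continuous_on_compose2[OF cf] continuous_on_compose2[OF cd]
        continuous_on_compose2[OF test_function_continuous[OF u]]) auto
  then have "integrable lborel F"
  proof (rule integrable_compact_support[where S="cball 0 (2 * 2 ^ j) \<times> supp u"])
    show "compact (cball (0::'a) (2 * 2 ^ j) \<times> supp u)"
      using u by (auto simp: test_function_def intro!: compact_Times)
    show "F p = 0" if "p \<notin> cball 0 (2 * 2 ^ j) \<times> supp u" for p
      using that vd[of "fst p"] notin_supp[of "snd p" u] by (cases p) (auto simp: F_def)
  qed
  then have iF: "integrable (lborel \<Otimes>\<^sub>M lborel) F" by (simp add: lborel_prod)
  have "(LINT \<xi>|lborel. cis (x \<bullet> \<xi>) * f \<xi> * dyadic_cutoff j \<xi> * fourier u \<xi>) = (LINT \<xi>|lborel. LINT y|lborel. F (\<xi>, y))"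
  proof (rule Bochner_Integration.integral_cong[OF refl])
    fix \<xi>
    have c: "cis ((x - y) \<bullet> \<xi>) = cis (x \<bullet> \<xi>) * cis (- (y \<bullet> \<xi>))" for y
      by (simp add: cis_mult inner_diff_left)
    show "cis (x \<bullet> \<xi>) * f \<xi> * dyadic_cutoff j \<xi> * fourier u \<xi> = (LINT y|lborel. F (\<xi>, y))"
      unfolding fourier_def F_def integral_mult_right_zero[symmetric] prod.case c
      by (rule Bochner_Integration.integral_cong[OF refl]) (simp only: mult_ac)
  qed
  also have "\<dots> = (LINT y|lborel. LINT \<xi>|lborel. F (\<xi>, y))"
    by (rule lborel_pair.Fubini_integral[symmetric]) (use iF in \<open>simp add: case_prod_beta'\<close>)
  also have "\<dots> = (LINT y|lborel. u y * (complex_of_real ((2 ^ j) ^ DIM('a)) *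
       invFT (\<lambda>\<xi>. f (2 ^ j *\<^sub>R \<xi>) * dyadic_profile j \<xi>) (2 ^ j *\<^sub>R (x - y))))"
  proof (rule Bochner_Integration.integral_cong[OF refl])
    fix y
    have "(LINT \<xi>|lborel. F (\<xi>, y)) = u y * (LINT \<xi>|lborel. cis ((x - y) \<bullet> \<xi>) * f \<xi> * dyadic_cutoff j \<xi>)"
      unfolding F_def by (simp add: mult.commute)
    also have "(LINT \<xi>|lborel. cis ((x - y) \<bullet> \<xi>) * f \<xi> * dyadic_cutoff j \<xi>) = complex_of_real ((2 ^ j) ^ DIM('a)) *
        (LINT \<xi>|lborel. cis ((x - y) \<bullet> (2 ^ j *\<^sub>R \<xi>)) * f (2 ^ j *\<^sub>R \<xi>) * dyadic_cutoff j (2 ^ j *\<^sub>R \<xi>))"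
      by (rule lborel_integral_scale) (auto intro!: borel_measurable_continuous_onI continuous_intros cf cd)
    also have "(LINT \<xi>|lborel. cis ((x - y) \<bullet> (2 ^ j *\<^sub>R \<xi>)) * f (2 ^ j *\<^sub>R \<xi>) * dyadic_cutoff j (2 ^ j *\<^sub>R \<xi>)) =
        invFT (\<lambda>\<xi>. f (2 ^ j *\<^sub>R \<xi>) * dyadic_profile j \<xi>) (2 ^ j *\<^sub>R (x - y))"
      unfolding invFT_def dyadic_cutoff_def by (simp add: power_divide mult.assoc)
    finally show "(LINT \<xi>|lborel. F (\<xi>, y)) = u y * (complex_of_real ((2 ^ j) ^ DIM('a)) *
       invFT (\<lambda>\<xi>. f (2 ^ j *\<^sub>R \<xi>) * dyadic_profile j \<xi>) (2 ^ j *\<^sub>R (x - y)))" .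
  qed
  finally show ?thesis .
qed

text \<open>Here \<open>f\<close> is the symbol frozen at \<open>x\<close>. Partial sums of dyadic
  pieces are integrals with one large plateau as cut-off; each is bounded by the full series, and
  dominated convergence removes the plateau.\<close>

lemma quantization_pointwise_bound:
  fixes f u :: "'a::euclidean_space \<Rightarrow> complex"
  assumes f: "continuous_on UNIV f" and u: "test_function u" and D: "D \<ge> 0"
    and K: "\<And>j z. norm (invFT (\<lambda>\<xi>. f (2 ^ j *\<^sub>R \<xi>) * dyadic_profile j \<xi>) z) \<le> D * (2 powr - \<rho>) ^ j * bump_kernel z"
  shows "ennreal (norm (LINT \<xi>|lborel. cis (x \<bullet> \<xi>) * f \<xi> * fourier u \<xi>)) \<le>
    ennreal D * (\<integral>\<^sup>+y. dyadic_envelope \<rho> (x - y) * ennreal (norm (u y)) \<partial>lborel)"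
\<comment> \<open>An integrand that is not integrable has integral 0 by convention, so the decay of
  \<open>fourier u\<close> need not be established.\<close>
proof (cases "integrable lborel (\<lambda>\<xi>. cis (x \<bullet> \<xi>) * f \<xi> * fourier u \<xi>)")
  case False
  then show ?thesis by (simp add: not_integrable_integral_eq)
next
  case True
  define G where "G \<xi> = cis (x \<bullet> \<xi>) * f \<xi> * fourier u \<xi>" for \<xi>
  have G: "integrable lborel G" using True by (simp add: G_def[abs_def])
  have [measurable]: "u \<in> borel_measurable borel"
    using u by (intro borel_measurable_continuous_onI test_function_continuous)
  have cdm [measurable]: "(dyadic_cutoff j :: 'a \<Rightarrow> complex) \<in> borel_measurable borel" for j
    unfolding dyadic_cutoff_def[abs_def]
    by (intro borel_measurable_continuous_onI
        continuous_on_compose2[OF smooth_on_continuous[OF smooth_dyadic_profile]] continuous_intros) auto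
  define P where "P j = (LINT \<xi>|lborel. dyadic_cutoff j \<xi> * G \<xi>)" for j
  have iP: "integrable lborel (\<lambda>\<xi>. dyadic_cutoff j \<xi> * G \<xi>)" for j
  proof (rule Bochner_Integration.integrable_bound)
    show "integrable lborel (\<lambda>\<xi>. 2 * G \<xi>)" using G by simp
    show "(\<lambda>\<xi>. dyadic_cutoff j \<xi> * G \<xi>) \<in> borel_measurable lborel"
      using cdm G by (intro borel_measurable_times) auto
    show "AE \<xi> in lborel. norm (dyadic_cutoff j \<xi> * G \<xi>) \<le> norm (2 * G \<xi>)"
      by (auto simp: norm_mult intro!: mult_right_mono norm_dyadic_cutoff_le)
  qed
  define w where "w j y = ennreal ((2 powr - \<rho>) ^ j * (2 ^ j) ^ DIM('a) * bump_kernel (2 ^ j *\<^sub>R (x - y))) * ennreal (norm (u y))" for j y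
  have wm [measurable]: "w j \<in> borel_measurable borel" for j unfolding w_def[abs_def] by measurable
  have Pb: "ennreal (norm (P j)) \<le> ennreal D * (\<integral>\<^sup>+y. w j y \<partial>lborel)" for j
  proof -
    define k where "k y = u y * (complex_of_real ((2 ^ j) ^ DIM('a)) *
       invFT (\<lambda>\<xi>. f (2 ^ j *\<^sub>R \<xi>) * dyadic_profile j \<xi>) (2 ^ j *\<^sub>R (x - y)))" for y
    have "P j = (LINT y|lborel. k y)"
      unfolding k_def dyadic_piece_kernel[OF f u, symmetric] P_def G_def by (simp add: mult_ac)
    then have "ennreal (norm (P j)) \<le> (\<integral>\<^sup>+y. ennreal (norm (k y)) \<partial>lborel)"
      using norm_integral_le_nn_integral[of lborel k] by simp
    also have "\<dots> \<le> (\<integral>\<^sup>+y. ennreal D * w j y \<partial>lborel)"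
    proof (rule nn_integral_mono)
      fix y
      have "norm (k y) = norm (u y) * ((2 ^ j) ^ DIM('a) * norm (invFT (\<lambda>\<xi>. f (2 ^ j *\<^sub>R \<xi>) * dyadic_profile j \<xi>) (2 ^ j *\<^sub>R (x - y))))"
        unfolding k_def by (simp add: norm_mult norm_power)
      also have "\<dots> \<le> norm (u y) * ((2 ^ j) ^ DIM('a) * (D * (2 powr - \<rho>) ^ j * bump_kernel (2 ^ j *\<^sub>R (x - y))))"
        by (intro mult_left_mono K) auto
      finally have "ennreal (norm (k y)) \<le> ennreal (norm (u y) * ((2 ^ j) ^ DIM('a) * (D * (2 powr - \<rho>) ^ j * bump_kernel (2 ^ j *\<^sub>R (x - y)))))"
        by (rule ennreal_leI)
      also have "\<dots> = ennreal D * w j y"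
        unfolding w_def using D by (simp add: ennreal_mult[symmetric] bump_kernel_nonneg mult_ac)
      finally show "ennreal (norm (k y)) \<le> ennreal D * w j y" .
    qed
    also have "\<dots> = ennreal D * (\<integral>\<^sup>+y. w j y \<partial>lborel)" by (rule nn_integral_cmult) measurable
    finally show ?thesis .
  qed
  define R where "R = ennreal D * (\<integral>\<^sup>+y. dyadic_envelope \<rho> (x - y) * ennreal (norm (u y)) \<partial>lborel)"
  have Rs: "R = (\<Sum>j. ennreal D * (\<integral>\<^sup>+y. w j y \<partial>lborel))"
  proof -
    have "(\<integral>\<^sup>+y. dyadic_envelope \<rho> (x - y) * ennreal (norm (u y)) \<partial>lborel) = (\<integral>\<^sup>+y. (\<Sum>j. w j y) \<partial>lborel)"
      unfolding dyadic_envelope_def w_def by (intro nn_integral_cong) (simp add: ennreal_suminf_multc)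
    also have "\<dots> = (\<Sum>j. \<integral>\<^sup>+y. w j y \<partial>lborel)" by (rule nn_integral_suminf) measurable
    finally show ?thesis unfolding R_def by (simp add: ennreal_suminf_cmult)
  qed
  have part: "ennreal (norm (LINT \<xi>|lborel. plateau 0 1 2 ((1 / 2) ^ J *\<^sub>R \<xi>) * G \<xi>)) \<le> R" for J
  proof -
    have "(LINT \<xi>|lborel. plateau 0 1 2 ((1 / 2) ^ J *\<^sub>R \<xi>) * G \<xi>) = (\<Sum>j\<le>J. P j)"
      unfolding P_def sum_dyadic_cutoff[symmetric] sum_distrib_right
      by (rule Bochner_Integration.integral_sum) (rule iP)
    then have "ennreal (norm (LINT \<xi>|lborel. plateau 0 1 2 ((1 / 2) ^ J *\<^sub>R \<xi>) * G \<xi>)) \<le> ennreal (\<Sum>j\<le>J. norm (P j))"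
      by (simp add: norm_sum ennreal_leI)
    also have "\<dots> = (\<Sum>j\<le>J. ennreal (norm (P j)))" by (rule sum_ennreal[symmetric]) simp
    also have "\<dots> \<le> (\<Sum>j\<le>J. ennreal D * (\<integral>\<^sup>+y. w j y \<partial>lborel))" by (intro sum_mono Pb)
    also have "\<dots> \<le> R" unfolding Rs by (rule sum_le_suminf) auto
    finally show ?thesis .
  qed
  have "(\<lambda>J. LINT \<xi>|lborel. plateau 0 1 2 ((1 / 2) ^ J *\<^sub>R \<xi>) * G \<xi>) \<longlonglongrightarrow> (LINT \<xi>|lborel. G \<xi>)"
  proof (rule integral_dominated_convergence[where w="\<lambda>\<xi>. norm (G \<xi>)"])
    show "integrable lborel (\<lambda>\<xi>. norm (G \<xi>))" using G by simp
    show "G \<in> borel_measurable lborel" using G by simp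
    have "(\<lambda>\<xi>. (\<Sum>j\<le>J. dyadic_cutoff j \<xi>) * G \<xi>) \<in> borel_measurable lborel" for J
      using cdm G by (intro borel_measurable_times borel_measurable_sum) auto
    then show "(\<lambda>\<xi>. plateau 0 1 2 ((1 / 2) ^ J *\<^sub>R \<xi>) * G \<xi>) \<in> borel_measurable lborel" for J
      by (simp add: sum_dyadic_cutoff)
    have "(\<lambda>J. plateau 0 1 2 ((1 / 2) ^ J *\<^sub>R \<xi>) * G \<xi>) \<longlonglongrightarrow> G \<xi>" for \<xi> :: 'a
    proof -
      have "(\<lambda>J. (1 / 2) ^ J * norm \<xi>) \<longlonglongrightarrow> 0 * norm \<xi>"
        by (intro tendsto_mult LIMSEQ_realpow_zero tendsto_const) auto
      then have "eventually (\<lambda>J. (1 / 2) ^ J * norm \<xi> < 1) sequentially"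
        by (rule order_tendstoD) simp
      then have "eventually (\<lambda>J. G \<xi> = plateau 0 1 2 ((1 / 2) ^ J *\<^sub>R \<xi>) * G \<xi>) sequentially"
        by eventually_elim (simp add: plateau_eq_1)
      then show ?thesis by (rule Lim_transform_eventually[OF tendsto_const])
    qed
    then show "AE \<xi> in lborel. (\<lambda>J. plateau 0 1 2 ((1 / 2) ^ J *\<^sub>R \<xi>) * G \<xi>) \<longlonglongrightarrow> G \<xi>" by simp
    show "AE \<xi> in lborel. norm (plateau 0 1 2 ((1 / 2) ^ J *\<^sub>R \<xi>) * G \<xi>) \<le> norm (G \<xi>)" for J
      by (auto simp: norm_mult intro!: mult_left_le_one_le norm_plateau_le_1)
  qed
  then have "(\<lambda>J. ennreal (norm (LINT \<xi>|lborel. plateau 0 1 2 ((1 / 2) ^ J *\<^sub>R \<xi>) * G \<xi>))) \<longlonglongrightarrow> ennreal (norm (LINT \<xi>|lborel. G \<xi>))"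
    by (intro tendsto_ennrealI tendsto_norm)
  then have "ennreal (norm (LINT \<xi>|lborel. G \<xi>)) \<le> R"
    by (rule LIMSEQ_le_const2) (use part in blast)
  then show ?thesis unfolding R_def G_def .
qed

text \<open>Schur's test for a convolution: the Cauchy-Schwarz inequality for the measure with
  density \<open>k (x - y)\<close> leaves one factor \<open>k1\<close>, and integration over
  \<open>x\<close> produces the second.\<close>

lemma convolution_L2_bound:
  fixes k v :: "'a::euclidean_space \<Rightarrow> ennreal"
  assumes [measurable]: "k \<in> borel_measurable borel" "v \<in> borel_measurable borel"
  shows "(\<integral>\<^sup>+x. (\<integral>\<^sup>+y. k (x - y) * v y \<partial>lborel)\<^sup>2 \<partial>lborel) \<le>
    (\<integral>\<^sup>+z. k z \<partial>lborel)\<^sup>2 * (\<integral>\<^sup>+y. (v y)\<^sup>2 \<partial>lborel)"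
proof -
  define k1 where "k1 = (\<integral>\<^sup>+z. k z \<partial>lborel)"
  have refl: "(\<integral>\<^sup>+y. k (x - y) \<partial>lborel) = k1" for x
    unfolding k1_def by (subst nn_integral_affine[where c="-1" and t=x]) auto
  have trans: "(\<integral>\<^sup>+x. k (x - y) \<partial>lborel) = k1" for y
    unfolding k1_def by (subst nn_integral_affine[where c="1" and t="-y"]) auto
  have "(\<integral>\<^sup>+y. k (x - y) * v y \<partial>lborel)\<^sup>2 \<le> (\<integral>\<^sup>+y. k (x - y) * (v y)\<^sup>2 \<partial>lborel) * k1" for x
  proof -
    have "(\<integral>\<^sup>+y. v y * 1 \<partial>density lborel (\<lambda>y. k (x - y)))\<^sup>2 \<le>
      (\<integral>\<^sup>+y. (v y)\<^sup>2 \<partial>density lborel (\<lambda>y. k (x - y))) * (\<integral>\<^sup>+y. 1\<^sup>2 \<partial>density lborel (\<lambda>y. k (x - y)))"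
      by (rule Cauchy_Schwarz_nn_integral) auto
    then show ?thesis by (subst (asm) (1 2 3) nn_integral_density) (auto simp: refl)
  qed
  then have "(\<integral>\<^sup>+x. (\<integral>\<^sup>+y. k (x - y) * v y \<partial>lborel)\<^sup>2 \<partial>lborel) \<le>
      (\<integral>\<^sup>+x. (\<integral>\<^sup>+y. k (x - y) * (v y)\<^sup>2 \<partial>lborel) * k1 \<partial>lborel)"
    by (rule nn_integral_mono)
  also have "\<dots> = (\<integral>\<^sup>+x. (\<integral>\<^sup>+y. k (x - y) * (v y)\<^sup>2 \<partial>lborel) \<partial>lborel) * k1"
    by (rule nn_integral_multc) measurable
  also have "(\<integral>\<^sup>+x. (\<integral>\<^sup>+y. k (x - y) * (v y)\<^sup>2 \<partial>lborel) \<partial>lborel) =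
      (\<integral>\<^sup>+y. (\<integral>\<^sup>+x. k (x - y) * (v y)\<^sup>2 \<partial>lborel) \<partial>lborel)"
    by (rule lborel_pair.Fubini') measurable
  also have "\<dots> = k1 * (\<integral>\<^sup>+y. (v y)\<^sup>2 \<partial>lborel)"
    by (simp add: nn_integral_multc nn_integral_cmult trans)
  finally show ?thesis by (simp add: k1_def power2_eq_square mult_ac)
qed

theorem Op_L2_bound:
  assumes \<rho>: "\<rho> > 0"
  shows "\<exists>(bs :: 'a::euclidean_space list) C. set bs \<subseteq> Basis \<and> 0 \<le> C \<and>
    (\<forall>a \<epsilon> u. a \<in> symbol_class (- \<rho>) \<longrightarrow>
      (\<forall>x \<xi>. norm (symbol_pderivs [] bs a (x, \<xi>)) \<le> \<epsilon> * (1 + norm \<xi>) powr (- \<rho> - real (length bs))) \<longrightarrow>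
      test_function u \<longrightarrow>
      (\<integral>\<^sup>+x. ennreal (norm (Op a u x)) ^ 2 \<partial>lborel) \<le> ennreal (C * \<epsilon>) ^ 2 * (\<integral>\<^sup>+y. ennreal (norm (u y)) ^ 2 \<partial>lborel))"
proof -
  obtain bs0 :: "'a list" where bs0: "set bs0 = Basis" "distinct bs0"
    using finite_distinct_list[OF finite_Basis] by blast
  have tw: "set (twice bs0) \<subseteq> Basis" using bs0 by (auto simp: twice_def)
  obtain C where C: "C \<ge> 0" "\<And>(f :: 'a \<Rightarrow> complex) \<epsilon> j z. decaying_symbol \<rho> f \<Longrightarrow> decay_bound \<rho> (twice bs0) \<epsilon> f \<Longrightarrow>
    norm (invFT (\<lambda>\<xi>. f (2 ^ j *\<^sub>R \<xi>) * dyadic_profile j \<xi>) z) * (\<Prod>v\<in>Basis. 1 + (z \<bullet> v)\<^sup>2) \<le>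
      C * \<epsilon> * (2 powr - \<rho>) ^ j"
    using dyadic_kernel_bound[OF \<rho> bs0] by blast
  define k1 where "k1 = enn2real (\<integral>\<^sup>+z. dyadic_envelope \<rho> (z :: 'a) \<partial>lborel)"
  have k1: "(\<integral>\<^sup>+z. dyadic_envelope \<rho> (z :: 'a) \<partial>lborel) = ennreal k1" "k1 \<ge> 0"
    using nn_integral_dyadic_envelope[OF \<rho>, where 'a='a] unfolding k1_def by auto
  define c where "c = 1 / (2 * pi) ^ DIM('a)"
  have c: "c \<ge> 0" by (simp add: c_def)
  have "(\<integral>\<^sup>+x. ennreal (norm (Op a u x)) ^ 2 \<partial>lborel) \<le> ennreal ((c * C * k1) * \<epsilon>) ^ 2 * (\<integral>\<^sup>+y. ennreal (norm (u y)) ^ 2 \<partial>lborel)"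
    if a: "a \<in> symbol_class (- \<rho>)" and
      b: "\<And>x \<xi>. norm (symbol_pderivs [] (twice bs0) a (x, \<xi>)) \<le> \<epsilon> * (1 + norm \<xi>) powr (- \<rho> - real (length (twice bs0)))" and
      u: "test_function u" for a :: "'a \<times> 'a \<Rightarrow> complex" and \<epsilon> u
  proof -
    have e0: "\<epsilon> \<ge> 0" using b[of 0 0] norm_ge_zero[of "symbol_pderivs [] (twice bs0) a (0, 0)"]
      by (simp del: norm_ge_zero)
    have as: "smooth_on UNIV a" using a by (simp add: symbol_class_def)
    have slice: "pderivs (map (\<lambda>v. (0, v)) l) a (x, \<xi>) = pderivs l (\<lambda>\<xi>. a (x, \<xi>)) \<xi>" if "set l \<subseteq> Basis" for l x \<xi>
      using that
    proof (induction l arbitrary: \<xi>)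
      case (Cons v l)
      let ?g = "pderivs (map (\<lambda>v. (0, v)) l) a"
      have d: "(?g has_derivative frechet_derivative ?g (at (x, y))) (at (x, y))" for y
        using Cons.prems by (intro smooth_on_has_derivative[of UNIV] smooth_on_pderivs as) (auto simp: Basis_prod_def)
      have "((\<lambda>\<xi>. ?g (x, \<xi>)) has_derivative (\<lambda>h. frechet_derivative ?g (at (x, \<xi>)) (0, h))) (at \<xi>)"
        by (rule has_derivative_compose[where g="?g" and f="\<lambda>\<xi>. (x, \<xi>)", OF _ d]) (auto intro!: derivative_eq_intros)
      then have "frechet_derivative (\<lambda>\<xi>. ?g (x, \<xi>)) (at \<xi>) v = pderivs (map (\<lambda>v. (0, v)) (v # l)) a (x, \<xi>)"
        by (simp add: frechet_derivative_eqI)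
      moreover have "(\<lambda>\<xi>. ?g (x, \<xi>)) = pderivs l (\<lambda>\<xi>. a (x, \<xi>))" using Cons by auto
      ultimately show ?case by simp
    qed simp
    have ax: "decaying_symbol \<rho> (\<lambda>\<xi>. a (x, \<xi>))" for x
      unfolding decaying_symbol_def
    proof (intro conjI allI impI)
      have "smooth_on UNIV (\<lambda>\<xi>. (x, 0) + (0, \<xi> :: 'a))"
        by (intro smooth_on_add smooth_on_const open_UNIV smooth_on_linear[OF open_UNIV _ smooth_on_id]
            bounded_linear_Pair bounded_linear_zero bounded_linear_ident)
      then show "smooth_on UNIV (\<lambda>\<xi>. a (x, \<xi>))"
        by (intro smooth_on_compose[where f=a and T=UNIV and g="\<lambda>\<xi>. (x, \<xi>)"] as) auto
      fix l :: "'a list" assume l: "set l \<subseteq> Basis"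
      then obtain C where "\<forall>x \<xi>. norm (symbol_pderivs [] l a (x, \<xi>)) \<le> C * (1 + norm \<xi>) powr (- \<rho> - real (length l))"
      proof -
        have "\<forall>\<alpha> \<beta>. set \<alpha> \<subseteq> Basis \<and> set \<beta> \<subseteq> Basis \<longrightarrow>
            (\<exists>C. \<forall>x \<xi>. norm (symbol_pderivs \<alpha> \<beta> a (x, \<xi>)) \<le> C * (1 + norm \<xi>) powr (- \<rho> - real (length \<beta>)))"
          using a unfolding symbol_class_def by simp
        from this[rule_format, of "[]" l] show thesis using l that by auto
      qed
      then show "\<exists>C. \<forall>\<xi>. norm (pderivs l (\<lambda>\<xi>. a (x, \<xi>)) \<xi>) \<le> C * (1 + norm \<xi>) powr (- \<rho> - real (length l))"
        using l by (auto simp: symbol_pderivs_def slice)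
    qed
    have db: "decay_bound \<rho> (twice bs0) \<epsilon> (\<lambda>\<xi>. a (x, \<xi>))" for x
      unfolding decay_bound_def using b tw by (auto simp: symbol_pderivs_def slice)
    have [measurable]: "u \<in> borel_measurable borel"
      using u by (intro borel_measurable_continuous_onI test_function_continuous)
    have pw: "ennreal (norm (Op a u x)) \<le> ennreal (c * (C * \<epsilon>)) *
        (\<integral>\<^sup>+y. dyadic_envelope \<rho> (x - y) * ennreal (norm (u y)) \<partial>lborel)" for x
    proof -
      have "ennreal (norm (LINT \<xi>|lborel. cis (x \<bullet> \<xi>) * a (x, \<xi>) * fourier u \<xi>)) \<le>
        ennreal (C * \<epsilon>) * (\<integral>\<^sup>+y. dyadic_envelope \<rho> (x - y) * ennreal (norm (u y)) \<partial>lborel)"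
      proof (rule quantization_pointwise_bound[OF decaying_symbol_continuous[OF ax] u])
        show "0 \<le> C * \<epsilon>" using C e0 by simp
        fix j and z :: 'a
        have pos: "(\<Prod>v\<in>Basis. 1 + (z \<bullet> v)\<^sup>2) > 0" by (intro prod_pos) (auto intro: add_pos_nonneg)
        have bk: "bump_kernel z = inverse (\<Prod>v\<in>Basis. 1 + (z \<bullet> v)\<^sup>2)"
          unfolding bump_kernel_def using prod_inversef[of "\<lambda>v. 1 + (z \<bullet> v)\<^sup>2" Basis] by (simp add: o_def)
        show "norm (invFT (\<lambda>\<xi>. a (x, 2 ^ j *\<^sub>R \<xi>) * dyadic_profile j \<xi>) z) \<le> C * \<epsilon> * (2 powr - \<rho>) ^ j * bump_kernel z"
          using C(2)[OF ax[of x] db[of x], of j z] pos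
          unfolding bk divide_inverse[symmetric] by (simp add: pos_le_divide_eq)
      qed
      then have "ennreal c * ennreal (norm (LINT \<xi>|lborel. cis (x \<bullet> \<xi>) * a (x, \<xi>) * fourier u \<xi>)) \<le>
        ennreal c * (ennreal (C * \<epsilon>) * (\<integral>\<^sup>+y. dyadic_envelope \<rho> (x - y) * ennreal (norm (u y)) \<partial>lborel))"
        by (intro mult_left_mono) auto
      then show ?thesis
        unfolding Op_def c_def[symmetric] using c C e0
        by (simp add: norm_mult ennreal_mult mult.assoc)
    qed
    have "(\<integral>\<^sup>+x. ennreal (norm (Op a u x)) ^ 2 \<partial>lborel) \<le> (\<integral>\<^sup>+x. (ennreal (c * (C * \<epsilon>)))\<^sup>2 *
        (\<integral>\<^sup>+y. dyadic_envelope \<rho> (x - y) * ennreal (norm (u y)) \<partial>lborel)\<^sup>2 \<partial>lborel)"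
      unfolding power_mult_distrib[symmetric] by (intro nn_integral_mono power_mono pw) auto
    also have "\<dots> = (ennreal (c * (C * \<epsilon>)))\<^sup>2 * (\<integral>\<^sup>+x. (\<integral>\<^sup>+y. dyadic_envelope \<rho> (x - y) * ennreal (norm (u y)) \<partial>lborel)\<^sup>2 \<partial>lborel)"
      by (rule nn_integral_cmult) measurable
    also have "\<dots> \<le> (ennreal (c * (C * \<epsilon>)))\<^sup>2 * ((ennreal k1)\<^sup>2 * (\<integral>\<^sup>+y. ennreal (norm (u y)) ^ 2 \<partial>lborel))"
      unfolding k1(1)[symmetric] by (intro mult_left_mono convolution_L2_bound) auto
    also have "\<dots> = ennreal ((c * C * k1) * \<epsilon>) ^ 2 * (\<integral>\<^sup>+y. ennreal (norm (u y)) ^ 2 \<partial>lborel)"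
      using c C e0 k1(2) by (simp add: ennreal_power ennreal_mult[symmetric] mult.assoc[symmetric] power_mult_distrib[symmetric]) (simp add: mult_ac)
    finally show ?thesis .
  qed
  moreover have "0 \<le> c * C * k1" using c C k1 by simp
  ultimately show ?thesis using tw by (intro exI[of _ "twice bs0"] exI[of _ "c * C * k1"]) blast
qed

section \<open>Evolution equations with bounded generators in a semi-Hilbert space\<close>

text \<open>Interpreted twice, for the fibres of the bundle and for the square integrable sections.
  Sections that agree almost everywhere are not identified, so the form is only assumed
  semidefinite, and \<open>V\<close> is a subset because sections and fibres sit inside larger
  spaces.\<close>

locale semi_inner_space = vector_space sc
  for sc :: "complex \<Rightarrow> 'v::ab_group_add \<Rightarrow> 'v" +
  fixes V :: "'v set" and ip :: "'v \<Rightarrow> 'v \<Rightarrow> complex"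
  assumes V_sub: "subspace V"
    and ip_add: "u \<in> V \<Longrightarrow> v \<in> V \<Longrightarrow> w \<in> V \<Longrightarrow> ip u (v + w) = ip u v + ip u w"
    and ip_sc: "u \<in> V \<Longrightarrow> v \<in> V \<Longrightarrow> ip u (sc z v) = z * ip u v"
    and ip_cnj: "u \<in> V \<Longrightarrow> v \<in> V \<Longrightarrow> ip v u = cnj (ip u v)"
    and ip_nonneg: "u \<in> V \<Longrightarrow> Re (ip u u) \<ge> 0"
begin

definition nrm :: "'v \<Rightarrow> real" where "nrm u = sqrt (Re (ip u u))"

lemma V_add: "u \<in> V \<Longrightarrow> v \<in> V \<Longrightarrow> u + v \<in> V" and V_sc: "u \<in> V \<Longrightarrow> sc z u \<in> V"
  and V_0: "0 \<in> V" and V_diff: "u \<in> V \<Longrightarrow> v \<in> V \<Longrightarrow> u - v \<in> V" and V_minus: "u \<in> V \<Longrightarrow> - u \<in> V"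
  using V_sub by (auto intro: subspace_add subspace_scale subspace_0 subspace_diff subspace_neg)

lemma ip_add_left: "u \<in> V \<Longrightarrow> v \<in> V \<Longrightarrow> w \<in> V \<Longrightarrow> ip (u + v) w = ip u w + ip v w"
  using ip_cnj[of w "u + v"] ip_cnj[of w u] ip_cnj[of w v] ip_add[of w u v] V_add by simp

lemma ip_sc_left: "u \<in> V \<Longrightarrow> v \<in> V \<Longrightarrow> ip (sc z u) v = cnj z * ip u v"
  using ip_cnj[of v "sc z u"] ip_cnj[of v u] ip_sc[of v u z] V_sc by simp

lemma ip_minus: "u \<in> V \<Longrightarrow> v \<in> V \<Longrightarrow> ip u (- v) = - ip u v"
  using ip_sc[of u v "-1"] by simp

lemma ip_minus_left: "u \<in> V \<Longrightarrow> v \<in> V \<Longrightarrow> ip (- u) v = - ip u v"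
  using ip_sc_left[of u v "-1"] by simp

lemma ip_diff: "u \<in> V \<Longrightarrow> v \<in> V \<Longrightarrow> w \<in> V \<Longrightarrow> ip u (v - w) = ip u v - ip u w"
  using ip_add[of u v "- w"] V_minus ip_minus by simp

lemma ip_diff_left: "u \<in> V \<Longrightarrow> v \<in> V \<Longrightarrow> w \<in> V \<Longrightarrow> ip (u - v) w = ip u w - ip v w"
  using ip_add_left[of u "- v" w] V_minus ip_minus_left by simp

lemma nrm_nonneg: "u \<in> V \<Longrightarrow> nrm u \<ge> 0" by (simp add: nrm_def ip_nonneg)

lemma nrm_sq: "u \<in> V \<Longrightarrow> (nrm u)\<^sup>2 = Re (ip u u)" by (simp add: nrm_def ip_nonneg)

lemma nrm_sc: "u \<in> V \<Longrightarrow> nrm (sc z u) = norm z * nrm u"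
proof -
  assume u: "u \<in> V"
  have "ip (sc z u) (sc z u) = (cnj z * z) * ip u u"
    using u by (simp add: ip_sc ip_sc_left V_sc mult_ac)
  also have "cnj z * z = complex_of_real ((norm z)\<^sup>2)" using complex_norm_square[of z] by (simp add: mult.commute)
  finally show ?thesis by (simp add: nrm_def real_sqrt_mult)
qed

lemma nrm_minus: "u \<in> V \<Longrightarrow> nrm (- u) = nrm u"
  using nrm_sc[of u "-1"] by simp

lemma nrm_diff_commute: "u \<in> V \<Longrightarrow> v \<in> V \<Longrightarrow> nrm (u - v) = nrm (v - u)"
  using nrm_minus[of "u - v"] V_diff by simp

lemma Cauchy_Schwarz:
  assumes u: "u \<in> V" and v: "v \<in> V" shows "norm (ip u v) \<le> nrm u * nrm v"
proof -
  define P where "P = (norm (ip u v))\<^sup>2"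
  have key: "0 \<le> (nrm u)\<^sup>2 - 2 * t * P + t\<^sup>2 * P * (nrm v)\<^sup>2" for t :: real
  proof -
    \<comment> \<open>With this phase both cross terms are real and equal to
      \<open>- t * P\<close>.\<close>
    define z where "z = - (complex_of_real t * cnj (ip u v))"
    have "(nrm (u + sc z v))\<^sup>2 = Re (ip u u + z * ip u v + (cnj z * cnj (ip u v)) + cnj z * z * ip v v)"
      using u v by (simp add: nrm_sq V_add V_sc ip_add ip_add_left ip_sc ip_sc_left ip_cnj[of u v] algebra_simps)
    also have "z * ip u v = - complex_of_real (t * P)"
      using complex_norm_square[of "ip u v"] by (simp add: z_def P_def mult_ac)
    also have "cnj z * cnj (ip u v) = - complex_of_real (t * P)"
      using complex_norm_square[of "ip u v"] by (simp add: z_def P_def mult_ac)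
    also have "cnj z * z = complex_of_real (t\<^sup>2 * P)"
      using complex_norm_square[of "ip u v"] by (simp add: z_def P_def power2_eq_square mult_ac)
    finally have "(nrm (u + sc z v))\<^sup>2 = (nrm u)\<^sup>2 - 2 * t * P + t\<^sup>2 * P * (nrm v)\<^sup>2"
      using u v by (simp add: nrm_sq algebra_simps)
    then show ?thesis by (metis zero_le_power2)
  qed
  have "P \<le> (nrm u)\<^sup>2 * (nrm v)\<^sup>2"
  proof (cases "nrm v = 0")
    \<comment> \<open>For a vector \<open>v\<close> of norm zero the quadratic in \<open>t\<close>
      degenerates to a linear function, which becomes negative for large \<open>t\<close> unless
      \<open>P = 0\<close>.\<close>
    case True
    show ?thesis
    proof (rule ccontr)
      assume "\<not> ?thesis"
      then have "P > 0" using True by simp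
      then show False
        using key[of "((nrm u)\<^sup>2 + 1) / P"] True zero_le_power2[of "nrm u"] by (simp del: zero_le_power2)
    qed
  next
    case False
    then have "0 \<le> (nrm u)\<^sup>2 - P / (nrm v)\<^sup>2"
      using key[of "1 / (nrm v)\<^sup>2"] by (simp add: power2_eq_square field_simps)
    then show ?thesis using False by (simp add: field_simps)
  qed
  then have "(norm (ip u v))\<^sup>2 \<le> (nrm u * nrm v)\<^sup>2" by (simp add: P_def power_mult_distrib)
  then show ?thesis by (rule power2_le_imp_le) (simp add: u v nrm_nonneg)
qed

lemma nrm_triangle: assumes u: "u \<in> V" and v: "v \<in> V" shows "nrm (u + v) \<le> nrm u + nrm v"
proof -
  have "(nrm (u + v))\<^sup>2 = (nrm u)\<^sup>2 + 2 * Re (ip u v) + (nrm v)\<^sup>2"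
    using u v by (simp add: nrm_sq V_add ip_add ip_add_left ip_cnj[of u v])
  also have "Re (ip u v) \<le> nrm u * nrm v"
    using Cauchy_Schwarz[OF u v] complex_Re_le_cmod order_trans by blast
  finally have "(nrm (u + v))\<^sup>2 \<le> (nrm u + nrm v)\<^sup>2" by (simp add: power2_eq_square algebra_simps)
  then show ?thesis by (rule power2_le_imp_le) (simp add: u v nrm_nonneg)
qed

lemma nrm_triangle_diff:
  assumes "u \<in> V" "v \<in> V" "w \<in> V" shows "nrm (u - w) \<le> nrm (u - v) + nrm (v - w)"
  using nrm_triangle[of "u - v" "v - w"] assms V_diff by simp

text \<open>\<open>T\<close> is additive only up to norm zero, so the difference of images is
  expanded in the inner product instead of being pulled inside \<open>T\<close>.\<close>

lemma nrm_isometry: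
  assumes "\<And>u v. u \<in> V \<Longrightarrow> v \<in> V \<Longrightarrow> ip (T u) (T v) = ip u v" "\<And>u. u \<in> V \<Longrightarrow> T u \<in> V" "u \<in> V" "v \<in> V"
  shows "nrm (T u - T v) = nrm (u - v)"
  using assms by (simp add: nrm_def V_diff ip_diff ip_diff_left)

section \<open>Strong derivatives and the mean value inequality\<close>

definition has_deriv :: "(real \<Rightarrow> 'v) \<Rightarrow> 'v \<Rightarrow> real \<Rightarrow> real set \<Rightarrow> bool" where
  "has_deriv v g t S \<longleftrightarrow>
    ((\<lambda>r. nrm (sc (complex_of_real (1 / (r - t))) (v r - v t) - g)) \<longlongrightarrow> 0) (at t within S)"

lemma has_deriv_ip:
  assumes w: "w \<in> V" and v: "\<And>r. r \<in> S \<Longrightarrow> v r \<in> V" and g: "g \<in> V" and t: "t \<in> S" and d: "has_deriv v g t S"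
  shows "((\<lambda>r. Re (ip w (v r))) has_real_derivative Re (ip w g)) (at t within S)"
proof -
  have "((\<lambda>r. (Re (ip w (v r)) - Re (ip w (v t))) / (r - t) - Re (ip w g)) \<longlongrightarrow> 0) (at t within S)"
  proof (rule Lim_null_comparison)
    show "((\<lambda>r. nrm w * nrm (sc (complex_of_real (1 / (r - t))) (v r - v t) - g)) \<longlongrightarrow> 0) (at t within S)"
      using tendsto_mult_right_zero[OF d[unfolded has_deriv_def]] by blast
    show "eventually (\<lambda>r. norm ((Re (ip w (v r)) - Re (ip w (v t))) / (r - t) - Re (ip w g)) \<le>
        nrm w * nrm (sc (complex_of_real (1 / (r - t))) (v r - v t) - g)) (at t within S)"
      unfolding eventually_at_filter
    proof (intro always_eventually allI impI)
      fix r assume r: "r \<noteq> t" "r \<in> S"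
      have mem: "v r - v t \<in> V" "sc (complex_of_real (1 / (r - t))) (v r - v t) \<in> V"
        using v t r by (auto intro: V_diff V_sc)
      have "(Re (ip w (v r)) - Re (ip w (v t))) / (r - t) - Re (ip w g) =
          Re (ip w (sc (complex_of_real (1 / (r - t))) (v r - v t) - g))"
        using mem w g v t r by (simp add: ip_diff ip_sc)
      also have "norm \<dots> \<le> norm (ip w (sc (complex_of_real (1 / (r - t))) (v r - v t) - g))"
        using abs_Re_le_cmod by simp
      also have "\<dots> \<le> nrm w * nrm (sc (complex_of_real (1 / (r - t))) (v r - v t) - g)"
        using mem w g by (intro Cauchy_Schwarz V_diff)
      finally show "norm ((Re (ip w (v r)) - Re (ip w (v t))) / (r - t) - Re (ip w g)) \<le>
        nrm w * nrm (sc (complex_of_real (1 / (r - t))) (v r - v t) - g)" .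
    qed
  qed
  then show ?thesis
    unfolding has_field_derivative_iff by (subst Lim_null) simp
qed

text \<open>The curve is paired with the very vector \<open>w\<close> whose norm is to be bounded,
  so that the scalar mean value theorem gives \<open>(nrm w)^2\<close> as the increment of a real
  function; one factor \<open>nrm w\<close> then cancels. The intermediate time is no farther from
  \<open>t\<close> than \<open>r\<close>, which is why \<open>M\<close> is required only
  there.\<close>

lemma mean_value_inequality:
  assumes v: "\<And>\<tau>. \<tau> \<in> {a..b} \<Longrightarrow> v \<tau> \<in> V" and g: "\<And>\<tau>. \<tau> \<in> {a..b} \<Longrightarrow> g \<tau> \<in> V"
    and d: "\<And>\<tau>. \<tau> \<in> {a..b} \<Longrightarrow> has_deriv v (g \<tau>) \<tau> {a..b}" and g0: "g0 \<in> V"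
    and rt: "r \<in> {a..b}" "t \<in> {a..b}"
    and M: "\<And>\<tau>. \<tau> \<in> {a..b} \<Longrightarrow> \<bar>\<tau> - t\<bar> \<le> \<bar>r - t\<bar> \<Longrightarrow> nrm (g \<tau> - g0) \<le> M"
  shows "nrm (v r - v t - sc (complex_of_real (r - t)) g0) \<le> \<bar>r - t\<bar> * M"
proof -
  define w where "w = v r - v t - sc (complex_of_real (r - t)) g0"
  have w: "w \<in> V" unfolding w_def using v rt g0 by (intro V_diff V_sc) auto
  define F where "F \<tau> = Re (ip w (v \<tau>)) - \<tau> * Re (ip w g0)" for \<tau>
  have F: "(F has_real_derivative Re (ip w (g \<tau>)) - Re (ip w g0)) (at \<tau> within {a..b})" if "\<tau> \<in> {a..b}" for \<tau>
  proof -
    have "((\<lambda>\<tau>. \<tau> * Re (ip w g0)) has_real_derivative Re (ip w g0)) (at \<tau> within {a..b})"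
      by (auto intro!: derivative_eq_intros)
    from DERIV_diff[OF has_deriv_ip[OF w v g[OF that] that d[OF that]] this] show ?thesis
      unfolding F_def by blast
  qed
  have mvt: "\<exists>\<xi>\<in>{x..y}. F y - F x = (y - x) * (Re (ip w (g \<xi>)) - Re (ip w g0))"
    if xy: "x < y" "x \<in> {a..b}" "y \<in> {a..b}" for x y
  proof -
    have "\<exists>\<xi>\<in>{x<..<y}. F y - F x = (\<lambda>h. (Re (ip w (g \<xi>)) - Re (ip w g0)) * h) (y - x)"
    proof (rule mvt_simple[OF xy(1)])
      fix \<xi> assume "x \<le> \<xi>" "\<xi> \<le> y"
      then show "(F has_derivative (*) (Re (ip w (g \<xi>)) - Re (ip w g0))) (at \<xi> within {x..y})"
        using has_derivative_subset[OF F[unfolded has_field_derivative_def]] xy by auto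
    qed
    then show ?thesis by (auto simp: mult.commute intro: less_imp_le)
  qed
  have "\<exists>\<xi>\<in>{a..b}. \<bar>\<xi> - t\<bar> \<le> \<bar>r - t\<bar> \<and> F r - F t = (r - t) * (Re (ip w (g \<xi>)) - Re (ip w g0))"
  proof -
    consider "r = t" | "t < r" | "r < t" by linarith
    then show ?thesis
    proof cases
      case 1 then show ?thesis using rt by auto
    next
      case 2
      then obtain \<xi> where \<xi>: "\<xi> \<in> {t..r}" "F r - F t = (r - t) * (Re (ip w (g \<xi>)) - Re (ip w g0))"
        using mvt[of t r] rt by auto
      then show ?thesis using rt 2 by (intro bexI[of _ \<xi>]) auto
    next
      case 3
      then obtain \<xi> where \<xi>: "\<xi> \<in> {r..t}" "F t - F r = (t - r) * (Re (ip w (g \<xi>)) - Re (ip w g0))"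
        using mvt[of r t] rt by auto
      then show ?thesis using rt 3 by (intro bexI[of _ \<xi>]) (auto simp: algebra_simps)
    qed
  qed
  then obtain \<xi> where \<xi>: "\<xi> \<in> {a..b}" "\<bar>\<xi> - t\<bar> \<le> \<bar>r - t\<bar>"
    "F r - F t = (r - t) * (Re (ip w (g \<xi>)) - Re (ip w g0))" by blast
  have "(nrm w)\<^sup>2 = Re (ip w (v r - v t - sc (complex_of_real (r - t)) g0))"
    by (simp only: nrm_sq[OF w] w_def[symmetric])
  also have "\<dots> = F r - F t"
    using w v rt g0 by (simp add: ip_diff ip_sc V_diff V_sc F_def left_diff_distrib)
  also have "\<dots> = (r - t) * Re (ip w (g \<xi> - g0))"
    using \<xi> w g g0 by (simp add: ip_diff)
  also have "\<dots> \<le> \<bar>r - t\<bar> * norm (ip w (g \<xi> - g0))"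
    by (rule order_trans[OF abs_ge_self]) (simp add: abs_mult mult_left_mono abs_Re_le_cmod)
  also have "\<dots> \<le> \<bar>r - t\<bar> * (nrm w * nrm (g \<xi> - g0))"
    using \<xi> w g g0 by (intro mult_left_mono Cauchy_Schwarz V_diff) auto
  also have "\<dots> \<le> \<bar>r - t\<bar> * (nrm w * M)"
    using M[OF \<xi>(1,2)] nrm_nonneg[OF w] by (intro mult_left_mono) auto
  finally have le: "nrm w * nrm w \<le> nrm w * (\<bar>r - t\<bar> * M)" by (simp add: power2_eq_square mult_ac)
  \<comment> \<open>Cancelling \<open>nrm w\<close> is impossible if it is 0; then nonnegativity of
    the right side decides.\<close>
  have "0 \<le> M" using M[OF \<xi>(1,2)] nrm_nonneg[of "g \<xi> - g0"] g \<xi> g0 V_diff by force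
  then have "nrm w \<le> \<bar>r - t\<bar> * M"
    using le nrm_nonneg[OF w] by (cases "nrm w = 0") (auto simp: mult_le_cancel_left)
  then show ?thesis by (simp add: w_def)
qed

end

text \<open>Completeness is stated for sequences with geometrically decreasing increments.
  Approximants from \<open>D\<close> can be chosen with errors \<open>(1 / 2) ^ n\<close>, and a
  bounded operator preserves this rate up to a constant.\<close>

locale dense_subspace = semi_inner_space +
  fixes D :: "'a set"
  assumes D_sub: "subspace D" and DV: "D \<subseteq> V"
    and dense: "u \<in> V \<Longrightarrow> e > 0 \<Longrightarrow> \<exists>w\<in>D. nrm (u - w) < e"
    and complete: "(\<And>n::nat. x n \<in> V) \<Longrightarrow> (\<And>n. nrm (x (Suc n) - x n) \<le> c * (1 / 2) ^ n) \<Longrightarrow>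
      \<exists>l\<in>V. (\<lambda>n. nrm (x n - l)) \<longlonglongrightarrow> 0"
begin

text \<open>The norm of \<open>f\<close> is attained by pairing \<open>f\<close> with itself, and
  density replaces one copy by a nearby \<open>w\<close> in \<open>D\<close>. All bounds on
  extensions reduce to this.\<close>

lemma dense_bound:
  assumes f: "f \<in> V" and M: "M \<ge> 0" and b: "\<And>w. w \<in> D \<Longrightarrow> norm (ip w f) \<le> M * nrm w"
  shows "nrm f \<le> M"
proof (rule field_le_epsilon)
  have "(nrm f)\<^sup>2 \<le> M * nrm f"
  proof (rule field_le_epsilon)
    fix e :: real assume e: "e > 0"
    define d where "d = e / (M + nrm f + 1)"
    have pos: "M + nrm f + 1 > 0" using M nrm_nonneg[OF f] by linarith
    have d: "d > 0" using e pos by (simp add: d_def)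
    obtain w where w: "w \<in> D" "nrm (f - w) < d" using dense[OF f d] by blast
    have wV: "w \<in> V" using w DV by blast
    have "(nrm f)\<^sup>2 = Re (ip w f) + Re (ip (f - w) f)" using f wV by (simp add: nrm_sq ip_diff_left)
    also have "\<dots> \<le> norm (ip w f) + norm (ip (f - w) f)"
      by (intro add_mono complex_Re_le_cmod)
    also have "\<dots> \<le> M * nrm w + nrm (f - w) * nrm f"
      using f wV w by (intro add_mono b Cauchy_Schwarz V_diff) auto
    also have "\<dots> \<le> M * (nrm f + d) + d * nrm f"
    proof (intro add_mono mult_left_mono mult_right_mono)
      have "nrm w \<le> nrm (w - f) + nrm f" using nrm_triangle[of "w - f" f] f wV V_diff by simp
      then show "nrm w \<le> nrm f + d" using w nrm_diff_commute[OF f wV] by simp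
    qed (use M w nrm_nonneg[OF f] in auto)
    also have "\<dots> = M * nrm f + d * (M + nrm f)" by (simp add: algebra_simps)
    also have "d * (M + nrm f) \<le> d * (M + nrm f + 1)" using d by simp
    also have "d * (M + nrm f + 1) = e" using pos by (simp add: d_def)
    finally show "(nrm f)\<^sup>2 \<le> M * nrm f + e" by simp
  qed
  then have "nrm f \<le> M"
    using nrm_nonneg[OF f] M by (cases "nrm f = 0") (auto simp: power2_eq_square)
  then show "nrm f \<le> M + e" if "e > 0" for e using that by simp
qed

text \<open>The continuous extension of a symmetric operator, given by duality.  The value is unique only up to
  vectors of norm zero.\<close>

definition weak_ext :: "('a \<Rightarrow> 'a) \<Rightarrow> 'a \<Rightarrow> 'a" where
  "weak_ext A u = (SOME f. f \<in> V \<and> (\<forall>w\<in>D. ip (A w) u = ip w f))"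

definition bounded_symmetric :: "('a \<Rightarrow> 'a) \<Rightarrow> bool" where
  "bounded_symmetric A \<longleftrightarrow> (\<forall>u\<in>D. A u \<in> D) \<and> (\<forall>u\<in>D. \<forall>v\<in>D. A (u - v) = A u - A v) \<and>
    (\<forall>u\<in>D. \<forall>v\<in>D. ip (A u) v = ip u (A v)) \<and> (\<exists>C. \<forall>u\<in>D. nrm (A u) \<le> C * nrm u)"

text \<open>Existence: the images of fast approximants form a fast Cauchy sequence by boundedness,
  and symmetry on \<open>D\<close> passes to the limit in both slots.\<close>

lemma weak_ext:
  assumes A: "bounded_symmetric A" and u: "u \<in> V"
  shows "weak_ext A u \<in> V" "w \<in> D \<Longrightarrow> ip (A w) u = ip w (weak_ext A u)"
proof -
  obtain C where C: "\<And>u. u \<in> D \<Longrightarrow> nrm (A u) \<le> C * nrm u" "C \<ge> 0"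
  proof -
    obtain C where "\<And>u. u \<in> D \<Longrightarrow> nrm (A u) \<le> C * nrm u" using A unfolding bounded_symmetric_def by blast
    then have "nrm (A u) \<le> \<bar>C\<bar> * nrm u" if "u \<in> D" for u
      using that DV nrm_nonneg[of u] by (meson abs_ge_self mult_right_mono order_trans subsetD)
    then show thesis using that[of "\<bar>C\<bar>"] by simp
  qed
  have "\<exists>w\<in>D. nrm (u - w) < (1 / 2) ^ n" for n using dense[OF u] by simp
  then obtain x where x: "\<And>n. x n \<in> D" "\<And>n. nrm (u - x n) < (1 / 2) ^ n" by metis
  have xV: "x n \<in> V" and AD: "A (x n) \<in> D" and AV: "A (x n) \<in> V" for n
    using x(1)[of n] DV A unfolding bounded_symmetric_def by auto
  have "nrm (A (x (Suc n)) - A (x n)) \<le> (C * 2) * (1 / 2) ^ n" for n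
  proof -
    have "nrm (A (x (Suc n)) - A (x n)) = nrm (A (x (Suc n) - x n))"
      using A x(1) unfolding bounded_symmetric_def by simp
    also have "\<dots> \<le> C * nrm (x (Suc n) - x n)" using x(1) D_sub by (intro C subspace_diff) auto
    also have "nrm (x (Suc n) - x n) \<le> nrm (x (Suc n) - u) + nrm (u - x n)"
      using xV u by (intro nrm_triangle_diff)
    also have "\<dots> \<le> (1 / 2) ^ n + (1 / 2) ^ n"
      using x(2)[of n] x(2)[of "Suc n"] nrm_diff_commute[OF u xV[of "Suc n"]]
        nrm_nonneg[OF V_diff[OF u xV[of "Suc n"]]] unfolding power_Suc by linarith
    finally show ?thesis using C(2) by (simp add: mult_left_mono)
  qed
  from complete[OF AV this] obtain l where l: "l \<in> V" "(\<lambda>n. nrm (A (x n) - l)) \<longlonglongrightarrow> 0" by blast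
  have tendsto_ip: "(\<lambda>n. ip w (y n)) \<longlonglongrightarrow> ip w m"
    if "w \<in> V" "\<And>n. y n \<in> V" "m \<in> V" "(\<lambda>n. nrm (y n - m)) \<longlonglongrightarrow> 0" for w y m
  proof (subst Lim_null, rule Lim_null_comparison)
    show "eventually (\<lambda>n. norm (ip w (y n) - ip w m) \<le> nrm w * nrm (y n - m)) sequentially"
      using that Cauchy_Schwarz[of w "y _ - m"] by (simp add: ip_diff V_diff)
    show "(\<lambda>n. nrm w * nrm (y n - m)) \<longlonglongrightarrow> 0" using that tendsto_mult_right_zero by blast
  qed
  have xu: "(\<lambda>n. nrm (x n - u)) \<longlonglongrightarrow> 0"
  proof (rule Lim_null_comparison)
    show "eventually (\<lambda>n. norm (nrm (x n - u)) \<le> (1 / 2) ^ n) sequentially"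
      using x(2) nrm_diff_commute[OF u xV] nrm_nonneg[OF V_diff[OF u xV]] by (simp add: less_imp_le)
    show "(\<lambda>n. (1 / 2 :: real) ^ n) \<longlonglongrightarrow> 0" by (rule LIMSEQ_realpow_zero) auto
  qed
  have "ip (A w) u = ip w l" if w: "w \<in> D" for w
  proof -
    have wV: "w \<in> V" "A w \<in> V" using w DV A unfolding bounded_symmetric_def by auto
    have "(\<lambda>n. ip (A w) (x n)) \<longlonglongrightarrow> ip (A w) u" by (rule tendsto_ip[OF wV(2) xV u xu])
    moreover have "(\<lambda>n. ip w (A (x n))) \<longlonglongrightarrow> ip w l" by (rule tendsto_ip[OF wV(1) AV l])
    moreover have "ip (A w) (x n) = ip w (A (x n))" for n
      using A w x(1) unfolding bounded_symmetric_def by blast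
    ultimately show ?thesis using LIMSEQ_unique by simp
  qed
  then have "\<exists>f. f \<in> V \<and> (\<forall>w\<in>D. ip (A w) u = ip w f)" using l by blast
  from someI_ex[OF this] show "weak_ext A u \<in> V" "w \<in> D \<Longrightarrow> ip (A w) u = ip w (weak_ext A u)"
    unfolding weak_ext_def by blast+
qed

lemma weak_unique:
  assumes "f \<in> V" "g \<in> V" "\<And>w. w \<in> D \<Longrightarrow> ip w f = ip w g"
  shows "nrm (f - g) = 0"
proof -
  have "nrm (f - g) \<le> 0" using assms DV by (intro dense_bound) (auto simp: ip_diff V_diff)
  then show ?thesis using nrm_nonneg[OF V_diff[OF assms(1,2)]] by simp
qed

lemma weak_ext_unique:
  assumes A: "bounded_symmetric A" and u: "u \<in> V" and f: "f \<in> V" "\<And>w. w \<in> D \<Longrightarrow> ip (A w) u = ip w f"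
  shows "nrm (weak_ext A u - f) = 0"
  using weak_unique[OF weak_ext(1)[OF A u] f(1)] weak_ext(2)[OF A u] f(2) by simp

text \<open>The operator is moved onto the test vector, where its bound on \<open>D\<close> applies.
  Differences are estimated directly because the values of \<open>weak_ext\<close> are chosen
  separately for each vector. The two bounds that follow use the same transfer.\<close>

lemma weak_ext_bound:
  assumes A: "bounded_symmetric A" and C: "C \<ge> 0" "\<And>u. u \<in> D \<Longrightarrow> nrm (A u) \<le> C * nrm u" and u: "u \<in> V" and v: "v \<in> V"
  shows "nrm (weak_ext A u - weak_ext A v) \<le> C * nrm (u - v)"
proof (rule dense_bound)
  show "weak_ext A u - weak_ext A v \<in> V" using A u v by (intro V_diff weak_ext)
  show "0 \<le> C * nrm (u - v)" using C nrm_nonneg[OF V_diff[OF u v]] by simp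
  fix w assume w: "w \<in> D"
  have wV: "w \<in> V" "A w \<in> V" using w DV A unfolding bounded_symmetric_def by auto
  have "ip w (weak_ext A u - weak_ext A v) = ip (A w) (u - v)"
    using weak_ext[OF A u] weak_ext[OF A v] w wV u v by (simp add: ip_diff)
  also have "norm \<dots> \<le> nrm (A w) * nrm (u - v)" using wV u v by (intro Cauchy_Schwarz V_diff)
  also have "\<dots> \<le> (C * nrm w) * nrm (u - v)"
    using C(2)[OF w] nrm_nonneg[OF V_diff[OF u v]] by (rule mult_right_mono)
  finally show "norm (ip w (weak_ext A u - weak_ext A v)) \<le> C * nrm (u - v) * nrm w" by (simp add: mult_ac)
qed

lemma weak_ext_bound_0:
  assumes A: "bounded_symmetric A" and C: "C \<ge> 0" "\<And>u. u \<in> D \<Longrightarrow> nrm (A u) \<le> C * nrm u" and u: "u \<in> V"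
  shows "nrm (weak_ext A u) \<le> C * nrm u"
proof (rule dense_bound)
  show "weak_ext A u \<in> V" using A u by (intro weak_ext)
  show "0 \<le> C * nrm u" using C nrm_nonneg[OF u] by simp
  fix w assume w: "w \<in> D"
  have wV: "A w \<in> V" using w DV A unfolding bounded_symmetric_def by auto
  have "norm (ip w (weak_ext A u)) \<le> nrm (A w) * nrm u"
    using weak_ext(2)[OF A u w] Cauchy_Schwarz[OF wV u] by simp
  also have "\<dots> \<le> (C * nrm w) * nrm u"
    using C(2)[OF w] nrm_nonneg[OF u] by (rule mult_right_mono)
  finally show "norm (ip w (weak_ext A u)) \<le> C * nrm u * nrm w" by (simp add: mult_ac)
qed

lemma weak_ext_diff_bound:
  assumes A: "bounded_symmetric A" and B: "bounded_symmetric B"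
    and C: "C \<ge> 0" "\<And>u. u \<in> D \<Longrightarrow> nrm (A u - B u) \<le> C * nrm u" and u: "u \<in> V"
  shows "nrm (weak_ext A u - weak_ext B u) \<le> C * nrm u"
proof (rule dense_bound)
  show "weak_ext A u - weak_ext B u \<in> V" using A B u by (intro V_diff weak_ext)
  show "0 \<le> C * nrm u" using C nrm_nonneg[OF u] by simp
  fix w assume w: "w \<in> D"
  have wV: "w \<in> V" "A w \<in> V" "B w \<in> V" using w DV A B unfolding bounded_symmetric_def by auto
  have "ip w (weak_ext A u - weak_ext B u) = ip (A w - B w) u"
    using weak_ext[OF A u] weak_ext[OF B u] w wV u by (simp add: ip_diff ip_diff_left)
  also have "norm \<dots> \<le> nrm (A w - B w) * nrm u" using wV u by (intro Cauchy_Schwarz V_diff)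
  also have "\<dots> \<le> (C * nrm w) * nrm u"
    using C(2)[OF w] nrm_nonneg[OF u] by (rule mult_right_mono)
  finally show "norm (ip w (weak_ext A u - weak_ext B u)) \<le> C * nrm u * nrm w" by (simp add: mult_ac)
qed

text \<open>For initial data in \<open>D\<close> the given derivative agrees with the extension up
  to norm zero, and the mean value inequality bounds the remainder of the increment. Near
  \<open>t\<close> the generators have a common bound and \<open>U\<close> is isometric, so
  replacing \<open>u\<close> by \<open>w\<close> in \<open>D\<close> costs an amount proportional to
  \<open>nrm (u - w)\<close>, uniformly in time. Letting \<open>w\<close> approach \<open>u\<close>
  gives the remainder estimate for \<open>u\<close>.\<close>

theorem strong_derivative:
  fixes A :: "real \<Rightarrow> 'a \<Rightarrow> 'a" and U :: "real \<Rightarrow> 'a \<Rightarrow> 'a"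
  assumes A: "\<And>t. t \<in> {a..b} \<Longrightarrow> bounded_symmetric (A t)"
    and cont: "\<And>t e. t \<in> {a..b} \<Longrightarrow> e > 0 \<Longrightarrow>
      eventually (\<lambda>r. \<forall>u\<in>D. nrm (A r u - A t u) \<le> e * nrm u) (at t within {a..b})"
    and UV: "\<And>t u. t \<in> {a..b} \<Longrightarrow> u \<in> V \<Longrightarrow> U t u \<in> V"
    and iso: "\<And>t u v. t \<in> {a..b} \<Longrightarrow> u \<in> V \<Longrightarrow> v \<in> V \<Longrightarrow> ip (U t u) (U t v) = ip u v"
    and Uc: "\<And>t u. t \<in> {a..b} \<Longrightarrow> u \<in> V \<Longrightarrow> ((\<lambda>r. nrm (U r u - U t u)) \<longlongrightarrow> 0) (at t within {a..b})"
    and sol: "\<And>t u. t \<in> {a..b} \<Longrightarrow> u \<in> D \<Longrightarrow> \<exists>g\<in>V. has_deriv (\<lambda>t. U t u) g t {a..b} \<and>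
      (\<forall>w\<in>D. ip (A t w) (U t u) = ip w (sc \<i> g))"
    and u: "u \<in> V" and t: "t \<in> {a..b}"
  shows "has_deriv (\<lambda>t. U t u) (sc (- \<i>) (weak_ext (A t) (U t u))) t {a..b}"
proof -
  define B where "B \<tau> = weak_ext (A \<tau>)" for \<tau>
  have BV: "B \<tau> v \<in> V" if "\<tau> \<in> {a..b}" "v \<in> V" for \<tau> v
    using that A weak_ext(1) unfolding B_def by blast
  define g where "g \<tau> v = sc (- \<i>) (B \<tau> (U \<tau> v))" for \<tau> v
  have gV: "g \<tau> v \<in> V" if "\<tau> \<in> {a..b}" "v \<in> V" for \<tau> v
    using that BV UV V_sc unfolding g_def by blast
  have gdiff: "nrm (g \<tau> v - g \<sigma> w) = nrm (B \<tau> (U \<tau> v) - B \<sigma> (U \<sigma> w))"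
    if "\<tau> \<in> {a..b}" "\<sigma> \<in> {a..b}" "v \<in> V" "w \<in> V" for \<tau> \<sigma> v w
    unfolding g_def scale_right_diff_distrib[symmetric] using that BV UV by (subst nrm_sc) (auto intro: V_diff)
  obtain C where C: "C \<ge> 0" "\<And>u. u \<in> D \<Longrightarrow> nrm (A t u) \<le> C * nrm u"
  proof -
    obtain C where "\<And>u. u \<in> D \<Longrightarrow> nrm (A t u) \<le> C * nrm u" using A[OF t] unfolding bounded_symmetric_def by blast
    then have "nrm (A t u) \<le> \<bar>C\<bar> * nrm u" if "u \<in> D" for u
      using that DV nrm_nonneg[of u] by (meson abs_ge_self mult_right_mono order_trans subsetD)
    then show thesis using that[of "\<bar>C\<bar>"] by simp
  qed
  have "((\<lambda>r. nrm (sc (complex_of_real (1 / (r - t))) (U r u - U t u) - g t u)) \<longlongrightarrow> 0) (at t within {a..b})"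
  proof (rule tendstoI)
    fix e0 :: real assume e0: "e0 > 0"
    \<comment> \<open>The final bound is \<open>2 * e\<close>, which is strictly below
      \<open>e0\<close>.\<close>
    define e where "e = e0 / 4"
    have e: "e > 0" using e0 by (simp add: e_def)
    \<comment> \<open>The bound 1 keeps \<open>A r\<close> below \<open>C + 1\<close> near
      \<open>t\<close>; the other one makes the variation of the generator on a vector of norm
      \<open>nrm u\<close> at most \<open>e\<close>.\<close>
    define e1 where "e1 = min 1 (e / (nrm u + 1))"
    have nu: "nrm u + 1 > 0" using nrm_nonneg[OF u] by linarith
    have e1: "e1 > 0" "e1 \<le> 1" "e1 * nrm u \<le> e"
    proof -
      show "e1 > 0" "e1 \<le> 1" using e nu by (auto simp: e1_def)
      have "e1 * nrm u \<le> e / (nrm u + 1) * (nrm u + 1)"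
        using e nu nrm_nonneg[OF u] by (intro mult_mono) (auto simp: e1_def)
      then show "e1 * nrm u \<le> e" using nu by simp
    qed
    have "e / (C + 1) > 0" using e C by simp
    then have "eventually (\<lambda>r. nrm (U r u - U t u) < e / (C + 1)) (at t within {a..b})"
      using order_tendstoD(2)[OF Uc[OF t u]] by blast
    from eventually_conj[OF cont[OF t e1(1)] this] obtain \<delta> where \<delta>: "\<delta> > 0"
      "\<And>r. r \<in> {a..b} \<Longrightarrow> r \<noteq> t \<Longrightarrow> dist r t < \<delta> \<Longrightarrow> (\<forall>u\<in>D. nrm (A r u - A t u) \<le> e1 * nrm u) \<and> nrm (U r u - U t u) < e / (C + 1)"
      unfolding eventually_at by auto
    have near: "nrm (A r v) \<le> (C + 1) * nrm v" "nrm (A r v - A t v) \<le> e1 * nrm v"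
      if r: "r \<in> {a..b}" "\<bar>r - t\<bar> < \<delta>" and v: "v \<in> D" for r v
    proof -
      have mem: "v \<in> V" "A r v \<in> V" "A t v \<in> V"
        using v r A[OF r(1)] A[OF t] DV unfolding bounded_symmetric_def by auto
      show 1: "nrm (A r v - A t v) \<le> e1 * nrm v"
      proof (cases "r = t")
        case True
        then show ?thesis using e1 nrm_nonneg[OF mem(1)] nrm_sc[OF V_0, of 0] by simp
      next
        case False
        then show ?thesis using \<delta>(2)[OF r(1)] r v by (auto simp: dist_real_def)
      qed
      have "nrm (A r v) \<le> nrm (A r v - A t v) + nrm (A t v)"
        using nrm_triangle[of "A r v - A t v" "A t v"] mem V_diff by simp
      also have "\<dots> \<le> 1 * nrm v + C * nrm v"
        using 1 C(2)[OF v] e1(2) mult_right_mono[OF e1(2) nrm_nonneg[OF mem(1)]] by linarith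
      finally show "nrm (A r v) \<le> (C + 1) * nrm v" by (simp add: algebra_simps)
    qed
    have nU: "nrm (U r v) = nrm v" if "r \<in> {a..b}" "v \<in> V" for r v
      using iso[OF that(1) that(2) that(2)] by (simp add: nrm_def)
    \<comment> \<open>One \<open>e\<close> is due to the change of the generator and one to the
      motion of \<open>U r u\<close>, on which the extension of the fixed operator
      \<open>A t\<close> has bound \<open>C\<close>.\<close>
    have gnear: "nrm (g r u - g t u) \<le> 2 * e" if r: "r \<in> {a..b}" "\<bar>r - t\<bar> < \<delta>" for r
    proof -
      have mem: "U r u \<in> V" "U t u \<in> V" "B r (U r u) \<in> V" "B t (U r u) \<in> V" "B t (U t u) \<in> V"
        using UV BV r t u by auto
      have "nrm (g r u - g t u) = nrm (B r (U r u) - B t (U t u))" using r t u by (intro gdiff)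
      also have "\<dots> \<le> nrm (B r (U r u) - B t (U r u)) + nrm (B t (U r u) - B t (U t u))"
        using mem by (intro nrm_triangle_diff)
      also have "nrm (B r (U r u) - B t (U r u)) \<le> e1 * nrm (U r u)"
        unfolding B_def using near(2)[OF r] e1 by (intro weak_ext_diff_bound A r t mem) auto
      also have "\<dots> \<le> e" using e1(3) nU[OF r(1) u] by simp
      also have "nrm (B t (U r u) - B t (U t u)) \<le> C * nrm (U r u - U t u)"
        unfolding B_def by (intro weak_ext_bound A t C mem)
      also have "\<dots> \<le> e"
      proof (cases "r = t")
        case True
        then show ?thesis using e nrm_sc[OF V_0, of 0] by simp
      next
        case False
        then have "C * nrm (U r u - U t u) \<le> (C + 1) * (e / (C + 1))"
          using \<delta>(2)[OF r(1) False] r C nrm_nonneg[OF V_diff[OF mem(1,2)]]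
          by (intro mult_mono) (auto simp: dist_real_def)
        then show ?thesis using C by simp
      qed
      finally show ?thesis by simp
    qed
    \<comment> \<open>The estimate is proved before division by \<open>r - t\<close>. For fixed
      \<open>r\<close> the approximation error \<open>\<eta>\<close> can be made arbitrarily small
      without depending on that quotient.\<close>
    have main: "nrm (U r u - U t u - sc (complex_of_real (r - t)) (g t u)) \<le> \<bar>r - t\<bar> * (2 * e)"
      if r: "r \<in> {a..b}" "\<bar>r - t\<bar> < \<delta>" for r
    proof (rule field_le_epsilon)
      fix \<epsilon> :: real assume \<epsilon>: "\<epsilon> > 0"
      \<comment> \<open>The total cost per unit of \<open>\<eta>\<close>: the two endpoints
        contribute 1 each by isometry, and the derivative contributes \<open>C + 1\<close> over the
        time \<open>\<bar>r - t\<bar>\<close>.\<close>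
      define Q where "Q = 2 + \<bar>r - t\<bar> * (C + 1)"
      have Q: "Q > 0" using C by (simp add: Q_def add_pos_nonneg)
      define \<eta> where "\<eta> = \<epsilon> / Q"
      have \<eta>: "\<eta> > 0" using \<epsilon> Q by (simp add: \<eta>_def)
      obtain w where w: "w \<in> D" "nrm (u - w) < \<eta>" using dense[OF u \<eta>] by blast
      have wV: "w \<in> V" using w DV by blast
      have "\<exists>k. \<forall>\<tau>\<in>{a..b}. k \<tau> \<in> V \<and> has_deriv (\<lambda>t. U t w) (k \<tau>) \<tau> {a..b} \<and>
          (\<forall>z\<in>D. ip (A \<tau> z) (U \<tau> w) = ip z (sc \<i> (k \<tau>)))"
        using sol[OF _ w(1)] by (intro bchoice) blast
      then obtain k where k: "\<And>\<tau>. \<tau> \<in> {a..b} \<Longrightarrow> k \<tau> \<in> V" "\<And>\<tau>. \<tau> \<in> {a..b} \<Longrightarrow> has_deriv (\<lambda>t. U t w) (k \<tau>) \<tau> {a..b}"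
          "\<And>\<tau> z. \<tau> \<in> {a..b} \<Longrightarrow> z \<in> D \<Longrightarrow> ip (A \<tau> z) (U \<tau> w) = ip z (sc \<i> (k \<tau>))" by blast
      \<comment> \<open>The derivative supplied for smooth data is known only through pairings with
        \<open>D\<close>; these determine it up to norm zero.\<close>
      have kg: "nrm (k \<tau> - g \<tau> w) = 0" if \<tau>: "\<tau> \<in> {a..b}" for \<tau>
      proof -
        have "nrm (B \<tau> (U \<tau> w) - sc \<i> (k \<tau>)) = 0"
          unfolding B_def using k \<tau> wV by (intro weak_ext_unique A UV V_sc) auto
        moreover have "k \<tau> - g \<tau> w = sc \<i> (B \<tau> (U \<tau> w) - sc \<i> (k \<tau>))"
          by (simp add: g_def scale_right_diff_distrib)
        ultimately show ?thesis
          using nrm_sc[of "B \<tau> (U \<tau> w) - sc \<i> (k \<tau>)" \<i>] V_diff BV UV V_sc k(1) \<tau> wV by simp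
      qed
      have "nrm (U r w - U t w - sc (complex_of_real (r - t)) (g t u)) \<le> \<bar>r - t\<bar> * ((C + 1) * \<eta> + 2 * e)"
      proof (rule mean_value_inequality[where g=k and v="\<lambda>t. U t w", OF _ k(1) k(2) gV[OF t u] r(1) t])
        show "U \<tau> w \<in> V" if "\<tau> \<in> {a..b}" for \<tau> using that wV by (rule UV)
        fix \<tau> assume \<tau>: "\<tau> \<in> {a..b}" and "\<bar>\<tau> - t\<bar> \<le> \<bar>r - t\<bar>"
        then have \<tau>2: "\<bar>\<tau> - t\<bar> < \<delta>" using r by linarith
        have mem: "k \<tau> \<in> V" "g \<tau> w \<in> V" "g t u \<in> V" "g \<tau> u \<in> V" "U \<tau> w \<in> V" "U \<tau> u \<in> V"
          using k(1) gV UV \<tau> t u wV by auto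
        have "nrm (k \<tau> - g t u) \<le> nrm (k \<tau> - g \<tau> w) + nrm (g \<tau> w - g t u)"
          using mem by (intro nrm_triangle_diff)
        also have "nrm (g \<tau> w - g t u) \<le> nrm (g \<tau> w - g \<tau> u) + nrm (g \<tau> u - g t u)"
          using mem by (intro nrm_triangle_diff)
        also have "nrm (g \<tau> w - g \<tau> u) = nrm (B \<tau> (U \<tau> w) - B \<tau> (U \<tau> u))"
          using \<tau> u wV by (intro gdiff)
        also have "\<dots> \<le> (C + 1) * nrm (U \<tau> w - U \<tau> u)"
          unfolding B_def using near(1)[OF \<tau> \<tau>2] C by (intro weak_ext_bound A \<tau> mem) auto
        also have "nrm (U \<tau> w - U \<tau> u) = nrm (w - u)"
          using iso[OF \<tau>] UV[OF \<tau>] wV u by (intro nrm_isometry) auto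
        also have "(C + 1) * nrm (w - u) \<le> (C + 1) * \<eta>"
          using w(2) nrm_diff_commute[OF u wV] C by (intro mult_left_mono) auto
        finally show "nrm (k \<tau> - g t u) \<le> (C + 1) * \<eta> + 2 * e"
          using kg[OF \<tau>] gnear[OF \<tau> \<tau>2] by simp
      qed
      moreover have "nrm (U r u - U t u - sc (complex_of_real (r - t)) (g t u)) \<le>
          nrm (U r u - U r w) + nrm (U t w - U t u) + nrm (U r w - U t w - sc (complex_of_real (r - t)) (g t u))"
      proof -
        let ?x = "U r u - U r w" and ?y = "U t w - U t u" and ?z = "U r w - U t w - sc (complex_of_real (r - t)) (g t u)"
        have mem: "?x \<in> V" "?y \<in> V" "?z \<in> V"
          using UV[OF r(1)] UV[OF t] u wV gV[OF t u] by (auto intro!: V_diff V_sc)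
        have "U r u - U t u - sc (complex_of_real (r - t)) (g t u) = (?x + ?y) + ?z" by simp
        then show ?thesis
          using nrm_triangle[OF V_add[OF mem(1,2)] mem(3)] nrm_triangle[OF mem(1,2)] by simp
      qed
      moreover have "nrm (U r u - U r w) = nrm (u - w)" "nrm (U t w - U t u) = nrm (w - u)"
        using iso UV r t u wV by (auto intro!: nrm_isometry)
      ultimately have "nrm (U r u - U t u - sc (complex_of_real (r - t)) (g t u)) \<le> 2 * \<eta> + \<bar>r - t\<bar> * ((C + 1) * \<eta> + 2 * e)"
        using w(2) nrm_diff_commute[OF u wV] by linarith
      also have "\<dots> = \<bar>r - t\<bar> * (2 * e) + Q * \<eta>" by (simp add: Q_def algebra_simps)
      also have "Q * \<eta> = \<epsilon>" using Q by (simp add: \<eta>_def)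
      finally show "nrm (U r u - U t u - sc (complex_of_real (r - t)) (g t u)) \<le> \<bar>r - t\<bar> * (2 * e) + \<epsilon>" .
    qed
    have "dist (nrm (sc (complex_of_real (1 / (r - t))) (U r u - U t u) - g t u)) 0 < e0"
      if r: "r \<in> {a..b}" "r \<noteq> t" "dist r t < \<delta>" for r
    proof -
      have mem: "U r u - U t u - sc (complex_of_real (r - t)) (g t u) \<in> V"
        "sc (complex_of_real (1 / (r - t))) (U r u - U t u) - g t u \<in> V"
        using UV r t u gV by (auto intro!: V_diff V_sc)
      have "sc (complex_of_real (1 / (r - t))) (U r u - U t u) - g t u =
          sc (complex_of_real (1 / (r - t))) (U r u - U t u - sc (complex_of_real (r - t)) (g t u))"
        using r(2) by (simp add: scale_right_diff_distrib flip: of_real_mult)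
      then have "nrm (sc (complex_of_real (1 / (r - t))) (U r u - U t u) - g t u) =
          1 / \<bar>r - t\<bar> * nrm (U r u - U t u - sc (complex_of_real (r - t)) (g t u))"
        using nrm_sc[OF mem(1), of "complex_of_real (1 / (r - t))"] by (simp only: norm_of_real abs_divide abs_one)
      also have "\<dots> \<le> 1 / \<bar>r - t\<bar> * (\<bar>r - t\<bar> * (2 * e))"
        using main[OF r(1)] r(3) by (intro mult_left_mono) (auto simp: dist_real_def)
      also have "\<dots> = 2 * e" using r(2) by simp
      finally show ?thesis using nrm_nonneg[OF mem(2)] e0 by (simp add: e_def dist_real_def)
    qed
    then show "eventually (\<lambda>r. dist (nrm (sc (complex_of_real (1 / (r - t))) (U r u - U t u) - g t u)) 0 < e0) (at t within {a..b})"
      unfolding eventually_at using \<delta>(1) by blast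
  qed
  then show ?thesis unfolding has_deriv_def g_def B_def .
qed

end

section \<open>Hermitian bundles in local coordinates\<close>

locale hermitian_bundle =
  fixes X :: "('m::t2_space, 'a::euclidean_space, 'f::ab_group_add) hbundle"
  assumes cpt: "compact (UNIV :: 'm set)"
    and vbundle: "smooth_vector_bundle X"
    and metric: "hermitian_metric X"
    and dens_X: "smooth_positive_density X"
begin

sublocale vs: vector_space "scal X"
  using vbundle by (simp add: smooth_vector_bundle_def)

lemma fib_subspace: "vs.subspace (fib X x)"
  using vbundle by (simp add: smooth_vector_bundle_def)

sublocale fibre: semi_inner_space "scal X" "fib X x" "herm X x" for x
proof (unfold_locales)
  show "vs.subspace (fib X x)" by (rule fib_subspace)
  fix u v w z assume u: "u \<in> fib X x" and v: "v \<in> fib X x"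
  then show "herm X x u (scal X z v) = z * herm X x u v" "herm X x v u = cnj (herm X x u v)"
    using metric unfolding hermitian_metric_def by blast+
  show "herm X x u (v + w) = herm X x u v + herm X x u w" if "w \<in> fib X x"
    using metric u v that unfolding hermitian_metric_def by blast
  show "0 \<le> Re (herm X x u u)"
  proof (cases "u = 0")
    case True
    have "herm X x 0 (scal X 0 0) = 0 * herm X x 0 0"
      using metric vs.subspace_0[OF fib_subspace] unfolding hermitian_metric_def by blast
    then show ?thesis using True by simp
  next
    case False
    then have "Re (herm X x u u) > 0" using metric u unfolding hermitian_metric_def by blast
    then show ?thesis by simp
  qed
qed

definition fsq :: "'m \<Rightarrow> 'f \<Rightarrow> real" where "fsq x v = Re (herm X x v v)"

lemma fsq_nonneg: "v \<in> fib X x \<Longrightarrow> fsq x v \<ge> 0"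
  by (simp add: fsq_def fibre.ip_nonneg)

lemma fsq_pos: "v \<in> fib X x \<Longrightarrow> v \<noteq> 0 \<Longrightarrow> fsq x v > 0"
  using metric unfolding hermitian_metric_def fsq_def by blast

lemma herm_self: "v \<in> fib X x \<Longrightarrow> herm X x v v = complex_of_real (fsq x v)"
  using fibre.ip_cnj[of v x v] by (simp add: fsq_def complex_eq_iff)

lemma fsq_0: "fsq x 0 = 0"
proof -
  have "herm X x 0 (scal X 0 0) = 0 * herm X x 0 0" by (intro fibre.ip_sc fibre.V_0)
  then show ?thesis by (simp add: fsq_def)
qed

lemma fsq_scal: "v \<in> fib X x \<Longrightarrow> fsq x (scal X z v) = (norm z)\<^sup>2 * fsq x v"
proof -
  assume v: "v \<in> fib X x"
  have "fsq x (scal X z v) = (fibre.nrm x (scal X z v))\<^sup>2"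
    using v by (simp add: fibre.nrm_sq fibre.V_sc fsq_def)
  also have "\<dots> = (norm z)\<^sup>2 * (fibre.nrm x v)\<^sup>2" by (simp add: fibre.nrm_sc[OF v] power_mult_distrib)
  finally show ?thesis using v by (simp add: fibre.nrm_sq fsq_def)
qed

lemma norm_herm_le:
  assumes "u \<in> fib X x" "v \<in> fib X x" shows "norm (herm X x u v) \<le> fsq x u + fsq x v"
proof -
  have "norm (herm X x u v) \<le> fibre.nrm x u * fibre.nrm x v"
    using assms by (rule fibre.Cauchy_Schwarz)
  also have "\<dots> \<le> (fibre.nrm x u)\<^sup>2 + (fibre.nrm x v)\<^sup>2"
    using sum_squares_bound[of "fibre.nrm x u" "fibre.nrm x v"]
      mult_nonneg_nonneg[OF fibre.nrm_nonneg[OF assms(1)] fibre.nrm_nonneg[OF assms(2)]] by linarith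
  finally show ?thesis using assms by (simp add: fibre.nrm_sq fsq_def)
qed

lemma fsq_sum_le:
  assumes "finite A" "\<And>i. i \<in> A \<Longrightarrow> v i \<in> fib X x"
  shows "fsq x (\<Sum>i\<in>A. v i) \<le> real (card A) * (\<Sum>i\<in>A. fsq x (v i))"
proof -
  have mem: "(\<Sum>i\<in>B. v i) \<in> fib X x" if "B \<subseteq> A" for B
    using that assms(2) by (intro vs.subspace_sum[OF fib_subspace]) auto
  have "fibre.nrm x (\<Sum>i\<in>B. v i) \<le> (\<Sum>i\<in>B. fibre.nrm x (v i))" if "B \<subseteq> A" for B
  proof -
    have "finite B" using that assms(1) finite_subset by blast
    then show ?thesis using that
    proof (induction B)
      case empty then show ?case by (simp add: fibre.nrm_def fsq_0[unfolded fsq_def])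
    next
      case (insert i B)
      then have "fibre.nrm x (v i + (\<Sum>i\<in>B. v i)) \<le> fibre.nrm x (v i) + fibre.nrm x (\<Sum>i\<in>B. v i)"
        using assms(2) mem by (intro fibre.nrm_triangle) auto
      then show ?case using insert by auto
    qed
  qed
  then have "fibre.nrm x (\<Sum>i\<in>A. v i) \<le> (\<Sum>i\<in>A. fibre.nrm x (v i))" by blast
  then have "(fibre.nrm x (\<Sum>i\<in>A. v i))\<^sup>2 \<le> (\<Sum>i\<in>A. fibre.nrm x (v i))\<^sup>2"
    by (rule power_mono) (intro fibre.nrm_nonneg mem subset_refl)
  also have "\<dots> \<le> (\<Sum>i\<in>A. 1\<^sup>2) * (\<Sum>i\<in>A. (fibre.nrm x (v i))\<^sup>2)"
    using Cauchy_Schwarz_ineq_sum[of "\<lambda>_. 1" "\<lambda>i. fibre.nrm x (v i)" A] by simp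
  also have "(\<Sum>i\<in>A. (fibre.nrm x (v i))\<^sup>2) = (\<Sum>i\<in>A. fsq x (v i))"
    using assms(2) by (intro sum.cong) (auto simp: fibre.nrm_sq fsq_def)
  finally show ?thesis using mem[of A] by (simp add: fibre.nrm_sq fsq_def)
qed

lemma fsq_add_le:
  assumes "u \<in> fib X x" "v \<in> fib X x" shows "fsq x (u + v) \<le> 2 * fsq x u + 2 * fsq x v"
  using fsq_sum_le[of "{0::nat, 1}" "\<lambda>i. if i = 0 then u else v" x] assms by simp

subsection \<open>Charts\<close>

lemma chart_coordinates:
  assumes c: "c \<in> atlas X"
  shows open_patch: "open (patch c)" and open_img: "open (img c)"
    and coord_inv_coord: "x \<in> patch c \<Longrightarrow> coord_inv c (coord c x) = x"
    and coord_coord_inv: "y \<in> img c \<Longrightarrow> coord c (coord_inv c y) = y"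
    and coord_inv_patch: "y \<in> img c \<Longrightarrow> coord_inv c y \<in> patch c"
    and coord_img: "x \<in> patch c \<Longrightarrow> coord c x \<in> img c"
    and continuous_coord: "continuous_on (patch c) (coord c)"
    and continuous_coord_inv: "continuous_on (img c) (coord_inv c)"
proof -
  have "is_bundle_chart X c" using vbundle c by (simp add: smooth_vector_bundle_def)
  then have h: "open (patch c)" "open (img c)" "homeomorphism (patch c) (img c) (coord c) (coord_inv c)"
    by (auto simp: is_bundle_chart_def)
  then show "open (patch c)" "open (img c)" "x \<in> patch c \<Longrightarrow> coord_inv c (coord c x) = x"
     "y \<in> img c \<Longrightarrow> coord c (coord_inv c y) = y" "y \<in> img c \<Longrightarrow> coord_inv c y \<in> patch c"
     "x \<in> patch c \<Longrightarrow> coord c x \<in> img c" "continuous_on (patch c) (coord c)" "continuous_on (img c) (coord_inv c)"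
    by (auto simp: homeomorphism_def)
qed

lemma
  assumes c: "c \<in> atlas X" and x: "x \<in> patch c"
  shows triv_bij: "bij_betw (triv c x) (fib X x) (Cvec (rk c))"
    and triv_add: "v \<in> fib X x \<Longrightarrow> w \<in> fib X x \<Longrightarrow> triv c x (v + w) p = triv c x v p + triv c x w p"
    and triv_scal: "v \<in> fib X x \<Longrightarrow> triv c x (scal X z v) p = z * triv c x v p"
proof -
  have "is_bundle_chart X c" using vbundle c by (simp add: smooth_vector_bundle_def)
  then have "bij_betw (triv c x) (fib X x) (Cvec (rk c)) \<and>
        (\<forall>v\<in>fib X x. \<forall>w\<in>fib X x. \<forall>p. triv c x (v + w) p = triv c x v p + triv c x w p) \<and>
        (\<forall>z. \<forall>v\<in>fib X x. \<forall>p. triv c x (scal X z v) p = z * triv c x v p)"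
    using x unfolding is_bundle_chart_def by blast
  then show "bij_betw (triv c x) (fib X x) (Cvec (rk c))"
    "v \<in> fib X x \<Longrightarrow> w \<in> fib X x \<Longrightarrow> triv c x (v + w) p = triv c x v p + triv c x w p"
    "v \<in> fib X x \<Longrightarrow> triv c x (scal X z v) p = z * triv c x v p" by blast+
qed

lemma triv_0: "c \<in> atlas X \<Longrightarrow> x \<in> patch c \<Longrightarrow> triv c x 0 p = 0"
  using triv_scal[of c x 0 0 p] fibre.V_0[of x] by simp

lemma triv_ge_rk: "c \<in> atlas X \<Longrightarrow> x \<in> patch c \<Longrightarrow> v \<in> fib X x \<Longrightarrow> p \<ge> rk c \<Longrightarrow> triv c x v p = 0"
  using triv_bij[of c x] unfolding bij_betw_def Cvec_def by blast

lemma triv_sum: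
  "c \<in> atlas X \<Longrightarrow> x \<in> patch c \<Longrightarrow> (\<And>i. i \<in> A \<Longrightarrow> v i \<in> fib X x) \<Longrightarrow>
    triv c x (\<Sum>i\<in>A. v i) p = (\<Sum>i\<in>A. triv c x (v i) p)"
proof (induction A rule: infinite_finite_induct)
  case (insert i A)
  then show ?case using vs.subspace_sum[OF fib_subspace, of A v x] by (simp add: triv_add)
qed (auto simp: triv_0)

lemma triv_diff: "c \<in> atlas X \<Longrightarrow> x \<in> patch c \<Longrightarrow> v \<in> fib X x \<Longrightarrow> w \<in> fib X x \<Longrightarrow>
    triv c x (v - w) p = triv c x v p - triv c x w p"
  using triv_add[of c x "v - w" w p] fibre.V_diff[of v x w] by simp

lemma
  assumes c: "c \<in> atlas X" and x: "x \<in> patch c" and q: "q < rk c"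
  shows frame_fib: "frame X c q x \<in> fib X x"
    and triv_frame: "triv c x (frame X c q x) p = (if p = q then 1 else 0)"
proof -
  have m: "(\<lambda>p. if p = q then 1 else 0) \<in> triv c x ` fib X x"
    using triv_bij[OF c x] q by (auto simp: bij_betw_def Cvec_def)
  show "frame X c q x \<in> fib X x" unfolding frame_def using m by (rule inv_into_into)
  show "triv c x (frame X c q x) p = (if p = q then 1 else 0)"
    unfolding frame_def using f_inv_into_f[OF m] by metis
qed

lemma frame_expansion:
  assumes c: "c \<in> atlas X" and x: "x \<in> patch c" and v: "v \<in> fib X x"
  shows "v = (\<Sum>q<rk c. scal X (triv c x v q) (frame X c q x))" (is "v = ?w")
proof -
  have mem: "scal X (triv c x v q) (frame X c q x) \<in> fib X x" if "q < rk c" for q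
    using frame_fib[OF c x that] by (rule fibre.V_sc)
  then have w: "?w \<in> fib X x" by (intro vs.subspace_sum[OF fib_subspace]) auto
  have "triv c x ?w p = triv c x v p" for p
  proof -
    have "triv c x ?w p = (\<Sum>q<rk c. if p = q then triv c x v q else 0)"
    proof (subst triv_sum[OF c x])
      show "(\<Sum>q<rk c. triv c x (scal X (triv c x v q) (frame X c q x)) p) = (\<Sum>q<rk c. if p = q then triv c x v q else 0)"
        by (intro sum.cong refl) (auto simp: triv_scal[OF c x frame_fib[OF c x]] triv_frame[OF c x])
    qed (use mem in auto)
    also have "\<dots> = triv c x v p" using triv_ge_rk[OF c x v, of p] by (cases "p < rk c") auto
    finally show ?thesis .
  qed
  then have "triv c x ?w = triv c x v" by (rule ext)
  from inj_onD[OF bij_betw_imp_inj_on[OF triv_bij[OF c x]] this w v] show ?thesis by (rule sym)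
qed

definition gram :: "('m, 'a, 'f) bundle_chart \<Rightarrow> nat \<Rightarrow> nat \<Rightarrow> 'm \<Rightarrow> complex" where
  "gram c p q x = herm X x (frame X c p x) (frame X c q x)"

lemma continuous_gram:
  assumes c: "c \<in> atlas X" and "p < rk c" "q < rk c"
  shows "continuous_on (img c) (\<lambda>y. gram c p q (coord_inv c y))" "continuous_on (patch c) (gram c p q)"
proof -
  show 1: "continuous_on (img c) (\<lambda>y. gram c p q (coord_inv c y))"
    unfolding gram_def using metric assms unfolding hermitian_metric_def
    by (intro smooth_on_continuous) blast
  have "continuous_on (patch c) (\<lambda>x. gram c p q (coord_inv c (coord c x)))"
    by (rule continuous_on_compose2[OF 1 continuous_coord[OF c]]) (auto simp: coord_img[OF c])
  then show "continuous_on (patch c) (gram c p q)"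
    by (rule continuous_on_eq) (simp add: coord_inv_coord[OF c])
qed

lemma ip_sum_left: "u \<in> fib X x \<Longrightarrow> (\<And>i. i \<in> A \<Longrightarrow> v i \<in> fib X x) \<Longrightarrow> herm X x (\<Sum>i\<in>A. v i) u = (\<Sum>i\<in>A. herm X x (v i) u)"
proof (induction A rule: infinite_finite_induct)
  case (insert i A)
  then show ?case using vs.subspace_sum[OF fib_subspace, of A v x] by (simp add: fibre.ip_add_left)
qed (use fibre.ip_sc_left[OF fibre.V_0, of u x 0] in auto)

lemma ip_sum_right: "u \<in> fib X x \<Longrightarrow> (\<And>i. i \<in> A \<Longrightarrow> v i \<in> fib X x) \<Longrightarrow> herm X x u (\<Sum>i\<in>A. v i) = (\<Sum>i\<in>A. herm X x u (v i))"
proof (induction A rule: infinite_finite_induct)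
  case (insert i A)
  then show ?case using vs.subspace_sum[OF fib_subspace, of A v x] by (simp add: fibre.ip_add)
qed (use fibre.ip_sc[OF _ fibre.V_0, of u x 0] in auto)

lemma herm_frames:
  assumes c: "c \<in> atlas X" and x: "x \<in> patch c"
  shows "herm X x (\<Sum>p<rk c. scal X (z p) (frame X c p x)) (\<Sum>q<rk c. scal X (w q) (frame X c q x)) =
    (\<Sum>p<rk c. \<Sum>q<rk c. cnj (z p) * w q * gram c p q x)"
proof -
  have mem: "scal X z (frame X c q x) \<in> fib X x" if "q < rk c" for q z
    using frame_fib[OF c x that] by (rule fibre.V_sc)
  have sm: "(\<Sum>q<rk c. scal X (w q) (frame X c q x)) \<in> fib X x"
    using mem by (intro vs.subspace_sum[OF fib_subspace]) auto
  show ?thesis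
  proof (subst ip_sum_left)
    show "(\<Sum>p<rk c. herm X x (scal X (z p) (frame X c p x)) (\<Sum>q<rk c. scal X (w q) (frame X c q x))) =
      (\<Sum>p<rk c. \<Sum>q<rk c. cnj (z p) * w q * gram c p q x)"
    proof (intro sum.cong refl)
      fix p assume p: "p \<in> {..<rk c}"
      have "herm X x (scal X (z p) (frame X c p x)) (\<Sum>q<rk c. scal X (w q) (frame X c q x)) =
          (\<Sum>q<rk c. herm X x (scal X (z p) (frame X c p x)) (scal X (w q) (frame X c q x)))"
        using mem p by (intro ip_sum_right) auto
      also have "\<dots> = (\<Sum>q<rk c. cnj (z p) * w q * gram c p q x)"
        using p frame_fib[OF c x]
        by (intro sum.cong refl) (simp add: fibre.ip_sc fibre.ip_sc_left fibre.V_sc gram_def)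
      finally show "herm X x (scal X (z p) (frame X c p x)) (\<Sum>q<rk c. scal X (w q) (frame X c q x)) =
          (\<Sum>q<rk c. cnj (z p) * w q * gram c p q x)" .
    qed
  qed (use mem sm in auto)
qed

lemma herm_components:
  assumes c: "c \<in> atlas X" and x: "x \<in> patch c" and v: "v \<in> fib X x" and w: "w \<in> fib X x"
  shows "herm X x v w = (\<Sum>p<rk c. \<Sum>q<rk c. cnj (triv c x v p) * triv c x w q * gram c p q x)"
  using herm_frames[OF c x, of "triv c x v" "triv c x w"] frame_expansion[OF c x v] frame_expansion[OF c x w] by simp

text \<open>The Gram matrix of the frame is continuous, hence bounded above the compact set
  \<open>K\<close>, and products of two components are bounded by the sum of all squares.\<close>

lemma fsq_upper:
  assumes c: "c \<in> atlas X" and K: "compact K" "K \<subseteq> img c"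
  shows "\<exists>C>0. \<forall>x\<in>patch c. coord c x \<in> K \<longrightarrow> (\<forall>v\<in>fib X x. fsq x v \<le> C * (\<Sum>p<rk c. (norm (triv c x v p))\<^sup>2))"
proof -
  have "\<exists>B. \<forall>y\<in>K. norm (gram c p q (coord_inv c y)) \<le> B" if "p < rk c" "q < rk c" for p q
  proof -
    have "bounded ((\<lambda>y. gram c p q (coord_inv c y)) ` K)"
      using continuous_gram(1)[OF c that] K
      by (intro compact_imp_bounded compact_continuous_image) (auto intro: continuous_on_subset)
    then show ?thesis by (auto simp: bounded_iff)
  qed
  then obtain B where B: "\<And>p q y. p < rk c \<Longrightarrow> q < rk c \<Longrightarrow> y \<in> K \<Longrightarrow> norm (gram c p q (coord_inv c y)) \<le> B p q" by metis
  define C where "C = (\<Sum>p<rk c. \<Sum>q<rk c. \<bar>B p q\<bar>) + 1"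
  have "fsq x v \<le> C * (\<Sum>p<rk c. (norm (triv c x v p))\<^sup>2)" if x: "x \<in> patch c" "coord c x \<in> K" and v: "v \<in> fib X x" for x v
  proof -
    let ?S = "\<Sum>p<rk c. (norm (triv c x v p))\<^sup>2"
    have nz: "(norm (triv c x v p))\<^sup>2 \<le> ?S" if "p < rk c" for p using that by (intro member_le_sum) auto
    have S0: "?S \<ge> 0" by (intro sum_nonneg) auto
    have "fsq x v \<le> norm (herm X x v v)" unfolding fsq_def by (rule complex_Re_le_cmod)
    also have "\<dots> \<le> (\<Sum>p<rk c. \<Sum>q<rk c. norm (cnj (triv c x v p) * triv c x v q * gram c p q x))"
      unfolding herm_components[OF c x(1) v v] by (intro sum_norm_le) auto
    also have "\<dots> \<le> (\<Sum>p<rk c. \<Sum>q<rk c. ?S * \<bar>B p q\<bar>)"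
    proof (intro sum_mono)
      fix p q assume pq: "p \<in> {..<rk c}" "q \<in> {..<rk c}"
      have "norm (triv c x v p) * norm (triv c x v q) \<le> ?S"
        using nz[of p] nz[of q] pq sum_squares_bound[of "norm (triv c x v p)" "norm (triv c x v q)"] by auto
      moreover have "norm (gram c p q x) \<le> \<bar>B p q\<bar>"
        using B[of p q "coord c x"] pq x coord_inv_coord[OF c x(1)] by auto
      ultimately show "norm (cnj (triv c x v p) * triv c x v q * gram c p q x) \<le> ?S * \<bar>B p q\<bar>"
        using S0 by (simp add: norm_mult mult_mono)
    qed
    also have "\<dots> = ?S * (\<Sum>p<rk c. \<Sum>q<rk c. \<bar>B p q\<bar>)" by (simp add: sum_distrib_left)
    also have "\<dots> \<le> ?S * C" using S0 by (intro mult_left_mono) (auto simp: C_def)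
    finally show ?thesis by (simp add: mult.commute)
  qed
  moreover have "C > 0" unfolding C_def by (intro add_nonneg_pos sum_nonneg) auto
  ultimately show ?thesis by blast
qed

text \<open>Minimizes the metric over the compact unit sphere bundle above \<open>K\<close>.\<close>

lemma fsq_lower:
  assumes c: "c \<in> atlas X" and K: "compact K" "K \<subseteq> img c"
  shows "\<exists>C>0. \<forall>x\<in>patch c. coord c x \<in> K \<longrightarrow> (\<forall>v\<in>fib X x. (\<Sum>p<rk c. (norm (triv c x v p))\<^sup>2) \<le> C * fsq x v)"
proof -
  \<comment> \<open>Components are sequences, so the factors beyond the rank are set to
    \<open>{0}\<close>; by Tychonoff the product is compact, and it contains the components of all
    unit vectors.\<close>
  define P :: "(nat \<Rightarrow> complex) set" where "P = PiE UNIV (\<lambda>p. if p < rk c then cball 0 1 else {0})"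
  have "compactin (product_topology (\<lambda>_. euclidean) UNIV) P"
    unfolding P_def by (subst compactin_PiE) auto
  then have "compact P" by (simp add: euclidean_product_topology)
  then have KP: "compact (K \<times> P)" using K by (intro compact_Times)
  define N2 :: "(nat \<Rightarrow> complex) \<Rightarrow> real" where "N2 z = (\<Sum>p<rk c. (norm (z p))\<^sup>2)" for z
  have cz: "continuous_on S (\<lambda>w :: 'a \<times> (nat \<Rightarrow> complex). snd w p)" for S p
    by (rule continuous_on_product_then_coordinatewise[OF continuous_on_snd[OF continuous_on_id]])
  define S where "S = K \<times> P \<inter> (\<lambda>w. N2 (snd w)) -` {1}"
  have "closed ((\<lambda>w :: 'a \<times> (nat \<Rightarrow> complex). N2 (snd w)) -` {1})"
    unfolding N2_def by (intro closed_vimage) (auto intro!: continuous_intros cz)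
  then have S: "compact S" unfolding S_def using KP by (intro compact_Int_closed)
  define h where "h w = Re (\<Sum>p<rk c. \<Sum>q<rk c. cnj (snd w p) * snd w q * gram c p q (coord_inv c (fst w)))" for w :: "'a \<times> (nat \<Rightarrow> complex)"
  have "continuous_on S h"
    unfolding h_def
    by (intro continuous_intros cz continuous_on_compose2[OF continuous_gram(1)[OF c]])
      (use K in \<open>auto simp: S_def\<close>)
  have hv: "h (y, z) = fsq (coord_inv c y) (\<Sum>p<rk c. scal X (z p) (frame X c p (coord_inv c y)))" if "y \<in> img c" for y z
    unfolding h_def fsq_def using herm_frames[OF c coord_inv_patch[OF c that]] by simp
  have comb: "(\<Sum>p<rk c. scal X (z p) (frame X c p x)) \<in> fib X x" if "x \<in> patch c" for x z
    using frame_fib[OF c that] by (intro vs.subspace_sum[OF fib_subspace] fibre.V_sc) auto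
  have hpos: "h w > 0" if wS: "w \<in> S" for w
  proof -
    obtain y z where w: "w = (y, z)" "y \<in> K" "z \<in> P" "N2 z = 1" using wS by (cases w) (auto simp: S_def)
    let ?x = "coord_inv c y" let ?v = "\<Sum>p<rk c. scal X (z p) (frame X c p ?x)"
    have x: "?x \<in> patch c" using coord_inv_patch[OF c] w K by blast
    have "?v \<noteq> 0"
    proof
      assume 0: "?v = 0"
      have "z q = 0" if q: "q < rk c" for q
      proof -
        have "triv c ?x ?v q = (\<Sum>p<rk c. if q = p then z p else 0)"
        proof (subst triv_sum[OF c x])
          show "(\<Sum>p<rk c. triv c ?x (scal X (z p) (frame X c p ?x)) q) = (\<Sum>p<rk c. if q = p then z p else 0)"
            by (intro sum.cong refl) (auto simp: triv_scal[OF c x frame_fib[OF c x]] triv_frame[OF c x])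
        qed (auto intro!: fibre.V_sc frame_fib[OF c x])
        then show ?thesis using q triv_0[OF c x, of q] 0 by simp
      qed
      then have "N2 z = 0" by (simp add: N2_def)
      then show False using w by simp
    qed
    then show ?thesis using hv w K fsq_pos[OF comb[OF x]] by auto
  qed
  \<comment> \<open>There are no unit vectors if the rank is 0 or \<open>K\<close> is empty; then
    any positive \<open>m\<close> will do.\<close>
  obtain m where m: "m > 0" "\<And>w. w \<in> S \<Longrightarrow> m \<le> h w"
  proof (cases "S = {}")
    case True
    then show thesis using that[of 1] by auto
  next
    case False
    then obtain w0 where "w0 \<in> S" "\<forall>w\<in>S. h w0 \<le> h w"
      using continuous_attains_inf[OF S False \<open>continuous_on S h\<close>] by blast
    then show thesis using that[of "h w0"] hpos by auto
  qed
  have "(\<Sum>p<rk c. (norm (triv c x v p))\<^sup>2) \<le> (1 / m) * fsq x v" if x: "x \<in> patch c" "coord c x \<in> K" and v: "v \<in> fib X x" for x v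
  proof (cases "N2 (triv c x v) = 0")
    case True
    then show ?thesis using fsq_nonneg[OF v] m by (simp add: N2_def)
  next
    case False
    define s where "s = N2 (triv c x v)"
    have s: "s > 0" using False unfolding s_def N2_def by (metis less_eq_real_def sum_nonneg zero_le_power2)
    define z where "z p = complex_of_real (1 / sqrt s) * triv c x v p" for p
    have nz: "(norm (z p))\<^sup>2 = (norm (triv c x v p))\<^sup>2 / s" for p
      using s by (simp add: z_def norm_mult power_divide norm_divide)
    have "N2 z = 1" unfolding N2_def nz sum_divide_distrib[symmetric] using s by (simp add: s_def N2_def)
    moreover have "z \<in> P"
    proof -
      have "norm (z p) \<le> 1" if "p < rk c" for p
      proof -
        have "(norm (z p))\<^sup>2 \<le> N2 z" unfolding N2_def using that by (intro member_le_sum) auto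
        then show ?thesis using \<open>N2 z = 1\<close> by (simp add: abs_square_le_1)
      qed
      moreover have "z p = 0" if "\<not> p < rk c" for p
        using triv_ge_rk[OF c x(1) v, of p] that by (simp add: z_def)
      ultimately show ?thesis by (auto simp: P_def)
    qed
    ultimately have "m \<le> h (coord c x, z)" using x by (intro m) (auto simp: S_def)
    also have "\<dots> = fsq x (scal X (complex_of_real (1 / sqrt s)) v)"
    proof -
      have "(\<Sum>p<rk c. scal X (z p) (frame X c p x)) = scal X (complex_of_real (1 / sqrt s)) v"
        unfolding arg_cong[OF frame_expansion[OF c x(1) v], of "scal X (complex_of_real (1 / sqrt s))"]
        by (simp add: vs.scale_sum_right z_def)
      then show ?thesis using hv[OF coord_img[OF c x(1)]] coord_inv_coord[OF c x(1)] by simp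
    qed
    also have "\<dots> = fsq x v / s"
      using s by (simp add: fsq_scal[OF v] norm_divide power_divide)
    finally show ?thesis using s m by (simp add: field_simps s_def N2_def)
  qed
  then show ?thesis using m by (intro exI[of _ "1 / m"]) auto
qed

end

subsection \<open>Finite covers by coordinate balls\<close>

context hermitian_bundle
begin

lemma compact_preimage:
  assumes c: "c \<in> atlas X" and K: "compact K" "K \<subseteq> img c"
  shows "compact {x \<in> patch c. coord c x \<in> K}" "closed {x \<in> patch c. coord c x \<in> K}"
proof -
  have "{x \<in> patch c. coord c x \<in> K} = coord_inv c ` K"
    using K coord_coord_inv[OF c] coord_inv_patch[OF c] coord_inv_coord[OF c] by force
  moreover have "compact (coord_inv c ` K)"
    using continuous_coord_inv[OF c] K by (intro compact_continuous_image) (auto intro: continuous_on_subset)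
  ultimately show "compact {x \<in> patch c. coord c x \<in> K}" "closed {x \<in> patch c. coord c x \<in> K}"
    by (auto intro: compact_imp_closed)
qed

lemma open_preimage:
  assumes c: "c \<in> atlas X" and W: "open W"
  shows "open {x \<in> patch c. coord c x \<in> W}"
  using continuous_open_preimage[OF continuous_coord[OF c] open_patch[OF c] W]
  by (simp add: vimage_def Int_def)

text \<open>The factor 7 leaves room for nested cut-offs, in units of \<open>rad k\<close>: the
  balls of radius 1 cover, \<open>phi\<close> reaches to 2, \<open>psi\<close> equals 1 up to 3 and
  reaches to 4, components are cut off between 5 and 6, and metric and density are compared with the
  Euclidean ones on radius 7.\<close>

lemma ex_cover:
  "\<exists>N ch ctr rad. (\<forall>k<N. ch k \<in> atlas X \<and> rad k > 0 \<and> cball (ctr k) (7 * rad k) \<subseteq> img (ch k)) \<and>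
     (\<forall>x. \<exists>k<N::nat. x \<in> patch (ch k) \<and> dist (ctr k) (coord (ch k) x) < rad k)"
proof -
  have "\<exists>c r. c \<in> atlas X \<and> x \<in> patch c \<and> r > 0 \<and> cball (coord c x) (7 * r) \<subseteq> img c" for x
  proof -
    have "x \<in> (\<Union>c\<in>atlas X. patch c)" using vbundle by (simp add: smooth_vector_bundle_def)
    then obtain c where c: "c \<in> atlas X" "x \<in> patch c" by blast
    obtain e where e: "e > 0" "cball (coord c x) e \<subseteq> img c"
      using open_img[OF c(1)] coord_img[OF c] open_contains_cball by blast
    then show ?thesis using c by (intro exI[of _ c] exI[of _ "e / 7"]) auto
  qed
  then obtain c r where cr: "\<And>x. c x \<in> atlas X" "\<And>x. x \<in> patch (c x)" "\<And>x. r x > 0"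
      "\<And>x. cball (coord (c x) x) (7 * r x) \<subseteq> img (c x)" by metis
  define W where "W x = {z \<in> patch (c x). coord (c x) z \<in> ball (coord (c x) x) (r x)}" for x
  have "open (W x)" for x unfolding W_def by (intro open_preimage cr) auto
  moreover have "UNIV \<subseteq> (\<Union>x\<in>UNIV. W x)" using cr by (auto simp: W_def)
  ultimately obtain F where F: "finite F" "UNIV \<subseteq> (\<Union>x\<in>F. W x)"
    using compactE_image[OF cpt, of UNIV W] by metis
  obtain xs where xs: "set xs = F" using finite_list[OF F(1)] by blast
  show ?thesis
  proof (rule exI[of _ "length xs"], rule exI[of _ "\<lambda>k. c (xs ! k)"],
      rule exI[of _ "\<lambda>k. coord (c (xs ! k)) (xs ! k)"], rule exI[of _ "\<lambda>k. r (xs ! k)"], intro conjI allI impI)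
    fix k assume "k < length xs"
    show "c (xs ! k) \<in> atlas X" "r (xs ! k) > 0" "cball (coord (c (xs ! k)) (xs ! k)) (7 * r (xs ! k)) \<subseteq> img (c (xs ! k))"
      using cr by auto
  next
    fix x
    obtain z where "z \<in> F" "x \<in> W z" using F by blast
    then obtain k where "k < length xs" "xs ! k = z" using xs by (metis in_set_conv_nth)
    then show "\<exists>k<length xs. x \<in> patch (c (xs ! k)) \<and> dist (coord (c (xs ! k)) (xs ! k)) (coord (c (xs ! k)) x) < r (xs ! k)"
      using \<open>x \<in> W z\<close> by (intro exI[of _ k]) (auto simp: W_def)
  qed
qed

section \<open>Integration in coordinates\<close>

lemma sets_dens: "sets (dens X) = sets borel"
  using dens_X by (simp add: smooth_positive_density_def)

lemma borel_measurable_dens: "borel_measurable (dens X) = borel_measurable borel"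
  by (rule measurable_cong_sets[OF sets_dens refl])

definition weight :: "('m, 'a, 'f) bundle_chart \<Rightarrow> 'a \<Rightarrow> real" where
  "weight c = (SOME w. smooth_on (img c) w \<and> (\<forall>y\<in>img c. w y > 0) \<and>
        (\<forall>B\<in>sets borel. B \<subseteq> patch c \<longrightarrow>
           emeasure (dens X) B = (\<integral>\<^sup>+y\<in>coord c ` B. ennreal (w y) \<partial>lborel)))"

lemma weight:
  assumes c: "c \<in> atlas X"
  shows "smooth_on (img c) (weight c)" "y \<in> img c \<Longrightarrow> weight c y > 0"
    "B \<in> sets borel \<Longrightarrow> B \<subseteq> patch c \<Longrightarrow> emeasure (dens X) B = (\<integral>\<^sup>+y\<in>coord c ` B. ennreal (weight c y) \<partial>lborel)"
proof -
  have "\<exists>w. smooth_on (img c) w \<and> (\<forall>y\<in>img c. w y > 0) \<and>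
        (\<forall>B\<in>sets borel. B \<subseteq> patch c \<longrightarrow>
           emeasure (dens X) B = (\<integral>\<^sup>+y\<in>coord c ` B. ennreal (w y) \<partial>lborel))"
    using dens_X c unfolding smooth_positive_density_def by blast
  from someI_ex[OF this, folded weight_def]
  show "smooth_on (img c) (weight c)" "y \<in> img c \<Longrightarrow> weight c y > 0"
    "B \<in> sets borel \<Longrightarrow> B \<subseteq> patch c \<Longrightarrow> emeasure (dens X) B = (\<integral>\<^sup>+y\<in>coord c ` B. ennreal (weight c y) \<partial>lborel)"
    by blast+
qed

lemma measurable_if_continuous:
  fixes f :: "'b::topological_space \<Rightarrow> 'c::topological_space"
  assumes "open S" "continuous_on S f"
  shows "(\<lambda>x. if x \<in> S then f x else z) \<in> borel_measurable borel"
  using assms by (intro borel_measurable_continuous_on_if) auto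

lemma weight_measurable:
  assumes c: "c \<in> atlas X"
  shows "(\<lambda>y. ennreal (weight c y) * indicator (img c) y) \<in> borel_measurable borel"
proof -
  have "(\<lambda>y. ennreal (if y \<in> img c then weight c y else 0)) \<in> borel_measurable borel"
    using measurable_if_continuous[OF open_img[OF c] smooth_on_continuous[OF weight(1)[OF c]], of 0] by simp
  also have "(\<lambda>y. ennreal (if y \<in> img c then weight c y else 0)) = (\<lambda>y. ennreal (weight c y) * indicator (img c) y)"
    by (auto simp: indicator_def)
  finally show ?thesis .
qed

text \<open>The condition on the density concerns Borel subsets of the patch. As an identity of
  measures it says that the image of weighted Lebesgue measure under the inverse coordinates is the
  density restricted to the patch; the formula for functions follows.\<close>

lemma nn_integral_patch:
  fixes f :: "'m \<Rightarrow> ennreal"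
  assumes c: "c \<in> atlas X" and f: "f \<in> borel_measurable borel"
  shows "(\<integral>\<^sup>+x. f x * indicator (patch c) x \<partial>dens X) =
    (\<integral>\<^sup>+y. (ennreal (weight c y) * indicator (img c) y) * f (coord_inv c y) \<partial>lborel)"
proof -
  \<comment> \<open>\<open>coord_inv\<close> is arbitrary outside \<open>img c\<close>; this version
    is constant there and therefore Borel.\<close>
  define ci where "ci y = (if y \<in> img c then coord_inv c y else undefined)" for y
  have ci: "ci \<in> borel_measurable borel"
    unfolding ci_def by (rule measurable_if_continuous[OF open_img[OF c] continuous_coord_inv[OF c]])
  note wm = weight_measurable[OF c]
  have pm: "patch c \<in> sets borel" using open_patch[OF c] by simp
  let ?D = "density lborel (\<lambda>y. ennreal (weight c y) * indicator (img c) y)"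
  have "distr ?D borel ci = density (dens X) (indicator (patch c))"
  proof (rule measure_eqI)
    show "sets (distr ?D borel ci) = sets (density (dens X) (indicator (patch c)))" by (simp add: sets_dens)
    fix A assume "A \<in> sets (distr ?D borel ci)"
    then have A: "A \<in> sets borel" by simp
    have "emeasure (distr ?D borel ci) A = (\<integral>\<^sup>+y. (ennreal (weight c y) * indicator (img c) y) * indicator (ci -` A) y \<partial>lborel)"
      using A ci wm measurable_sets[OF ci A] by (subst emeasure_distr) (auto simp: emeasure_density)
    also have "\<dots> = (\<integral>\<^sup>+y\<in>coord c ` (A \<inter> patch c). ennreal (weight c y) \<partial>lborel)"
    proof (rule nn_integral_cong)
      fix y
      have "y \<in> coord c ` (A \<inter> patch c) \<longleftrightarrow> y \<in> img c \<and> ci y \<in> A"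
        using coord_inv_coord[OF c] coord_coord_inv[OF c] coord_inv_patch[OF c] coord_img[OF c]
        unfolding ci_def by (metis (no_types, lifting) Int_iff image_iff)
      then show "(ennreal (weight c y) * indicator (img c) y) * indicator (ci -` A) y =
          ennreal (weight c y) * indicator (coord c ` (A \<inter> patch c)) y"
        by (auto simp: indicator_def)
    qed
    also have "\<dots> = emeasure (dens X) (A \<inter> patch c)"
      using A pm by (intro weight(3)[OF c, symmetric]) auto
    also have "\<dots> = emeasure (density (dens X) (indicator (patch c))) A"
      using A pm by (simp add: emeasure_density sets_dens borel_measurable_dens Int_commute
          flip: indicator_inter_arith)
    finally show "emeasure (distr ?D borel ci) A = emeasure (density (dens X) (indicator (patch c))) A" .
  qed
  then have eq: "(\<integral>\<^sup>+x. f x \<partial>distr ?D borel ci) = (\<integral>\<^sup>+x. f x \<partial>density (dens X) (indicator (patch c)))" by simp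
  have "(\<integral>\<^sup>+x. f x \<partial>density (dens X) (indicator (patch c))) = (\<integral>\<^sup>+x. f x * indicator (patch c) x \<partial>dens X)"
    using f pm by (subst nn_integral_density) (auto simp: borel_measurable_dens mult.commute)
  moreover have "(\<integral>\<^sup>+x. f x \<partial>distr ?D borel ci) = (\<integral>\<^sup>+y. (ennreal (weight c y) * indicator (img c) y) * f (ci y) \<partial>lborel)"
    using f ci wm by (subst nn_integral_distr) (auto simp: nn_integral_density)
  moreover have "\<dots> = (\<integral>\<^sup>+y. (ennreal (weight c y) * indicator (img c) y) * f (coord_inv c y) \<partial>lborel)"
    by (intro nn_integral_cong) (auto simp: ci_def indicator_def)
  ultimately show ?thesis using eq by simp
qed

lemma weight_bounds:
  assumes c: "c \<in> atlas X" and K: "compact K" "K \<subseteq> img c"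
  shows "\<exists>w0>0. \<exists>w1>0. \<forall>y\<in>K. w0 \<le> weight c y \<and> weight c y \<le> w1"
proof (cases "K = {}")
  case True
  then show ?thesis by (intro exI[of _ 1] conjI) auto
next
  case False
  have cont: "continuous_on K (weight c)"
    using smooth_on_continuous[OF weight(1)[OF c]] K continuous_on_subset by blast
  obtain y0 where y0: "y0 \<in> K" "\<forall>y\<in>K. weight c y0 \<le> weight c y"
    using continuous_attains_inf[OF K(1) False cont] by blast
  obtain y1 where y1: "y1 \<in> K" "\<forall>y\<in>K. weight c y \<le> weight c y1"
    using continuous_attains_sup[OF K(1) False cont] by blast
  show ?thesis
    using y0 y1 weight(2)[OF c] K by (intro exI[of _ "weight c y0"] exI[of _ "weight c y1"] conjI) auto
qed

definition lcomp :: "('m, 'a, 'f) bundle_chart \<Rightarrow> nat \<Rightarrow> ('m \<Rightarrow> 'f) \<Rightarrow> 'a \<Rightarrow> complex" where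
  "lcomp c p u y = triv c (coord_inv c y) (u (coord_inv c y)) p"

lemma measurable_sections_fib: "u \<in> measurable_sections X \<Longrightarrow> u x \<in> fib X x"
  by (simp add: measurable_sections_def)

lemma measurable_sections_triv:
  "u \<in> measurable_sections X \<Longrightarrow> c \<in> atlas X \<Longrightarrow>
    (\<lambda>x. if x \<in> patch c then triv c x (u x) p else 0) \<in> borel_measurable borel"
proof (cases "p < rk c")
  case False
  assume u: "u \<in> measurable_sections X" and c: "c \<in> atlas X"
  have "(\<lambda>x. if x \<in> patch c then triv c x (u x) p else 0) = (\<lambda>x. 0)"
    using triv_ge_rk[OF c _ measurable_sections_fib[OF u]] False by auto
  then show ?thesis by simp
qed (auto simp: measurable_sections_def)

lemma measurable_lcomp:
  assumes u: "u \<in> measurable_sections X" and c: "c \<in> atlas X"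
  shows "(\<lambda>y. if y \<in> img c then lcomp c p u y else 0) \<in> borel_measurable borel"
proof -
  define ci where "ci y = (if y \<in> img c then coord_inv c y else undefined)" for y
  have ci: "ci \<in> borel_measurable borel"
    unfolding ci_def by (rule measurable_if_continuous[OF open_img[OF c] continuous_coord_inv[OF c]])
  have "(\<lambda>y. if y \<in> img c then (\<lambda>x. if x \<in> patch c then triv c x (u x) p else 0) (ci y) else 0) \<in> borel_measurable borel"
    using open_img[OF c]
    by (intro measurable_If_set measurable_compose[OF ci measurable_sections_triv[OF u c]]) auto
  also have "(\<lambda>y. if y \<in> img c then (\<lambda>x. if x \<in> patch c then triv c x (u x) p else 0) (ci y) else 0) =
      (\<lambda>y. if y \<in> img c then lcomp c p u y else 0)"
    using coord_inv_patch[OF c] by (auto simp: ci_def lcomp_def)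
  finally show ?thesis .
qed

lemma measurable_lcomp_on:
  assumes u: "u \<in> measurable_sections X" and c: "c \<in> atlas X" and S: "S \<in> sets borel" "S \<subseteq> img c"
  shows "(\<lambda>y. ennreal ((norm (lcomp c p u y))\<^sup>2) * indicator S y) \<in> borel_measurable borel"
proof -
  have "(\<lambda>y. ennreal ((norm (if y \<in> img c then lcomp c p u y else 0))\<^sup>2) * indicator S y) \<in> borel_measurable borel"
    using measurable_lcomp[OF u c, of p] S by measurable
  also have "(\<lambda>y. ennreal ((norm (if y \<in> img c then lcomp c p u y else 0))\<^sup>2) * indicator S y) =
      (\<lambda>y. ennreal ((norm (lcomp c p u y))\<^sup>2) * indicator S y)"
    by (rule ext) (use S in \<open>auto simp: indicator_def\<close>)
  finally show ?thesis .
qed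

end

locale bundle_cover = hermitian_bundle X
  for X :: "('m::t2_space, 'a::euclidean_space, 'f::ab_group_add) hbundle" +
  fixes N :: nat and ch :: "nat \<Rightarrow> ('m, 'a, 'f) bundle_chart" and ctr :: "nat \<Rightarrow> 'a" and rad :: "nat \<Rightarrow> real"
  assumes ch: "k < N \<Longrightarrow> ch k \<in> atlas X" and rad: "k < N \<Longrightarrow> rad k > 0"
    and balls: "k < N \<Longrightarrow> cball (ctr k) (7 * rad k) \<subseteq> img (ch k)"
    and cover: "\<exists>k<N. x \<in> patch (ch k) \<and> dist (ctr k) (coord (ch k) x) < rad k"
begin

definition zone :: "nat \<Rightarrow> 'a set \<Rightarrow> 'm set" where
  "zone k S = {x \<in> patch (ch k). coord (ch k) x \<in> S}"

lemma cball_img: "k < N \<Longrightarrow> s \<le> 7 \<Longrightarrow> cball (ctr k) (s * rad k) \<subseteq> img (ch k)"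
  using balls[of k] rad[of k] by (meson cball_subset_cball_iff less_imp_le mult_right_mono order_trans subset_cball)

text \<open>Preimages are finite unions of pieces in the covering patches, so measurability may be
  checked in each chart with extension by zero.\<close>

lemma measurable_patchwise:
  fixes f :: "'m \<Rightarrow> 'b::{topological_space, zero}"
  assumes "\<And>k. k < N \<Longrightarrow> (\<lambda>x. if x \<in> patch (ch k) then f x else 0) \<in> borel_measurable borel"
  shows "f \<in> borel_measurable borel"
proof (rule measurableI)
  fix A :: "'b set" assume A: "A \<in> sets borel"
  have "f -` A = (\<Union>k<N. patch (ch k) \<inter> (\<lambda>x. if x \<in> patch (ch k) then f x else 0) -` A)"
    using cover by (fastforce split: if_splits)
  also have "\<dots> \<in> sets borel"
    using measurable_sets[OF assms A] open_patch[OF ch]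
    by (intro sets.finite_UN sets.Int) auto
  finally show "f -` A \<inter> space borel \<in> sets borel" by simp
qed simp

lemma measurable_herm:
  assumes u: "u \<in> measurable_sections X" and v: "v \<in> measurable_sections X"
  shows "(\<lambda>x. herm X x (u x) (v x)) \<in> borel_measurable borel"
proof (rule measurable_patchwise)
  fix k assume k: "k < N"
  define c where "c = ch k"
  have c: "c \<in> atlas X" using ch[OF k] by (simp add: c_def)
  have gm: "(\<lambda>x. if x \<in> patch c then gram c p q x else 0) \<in> borel_measurable borel" if "p < rk c" "q < rk c" for p q
    using that by (intro measurable_if_continuous open_patch continuous_gram c)
  have "(\<lambda>x. \<Sum>p<rk c. \<Sum>q<rk c. cnj (if x \<in> patch c then triv c x (u x) p else 0) *
      (if x \<in> patch c then triv c x (v x) q else 0) * (if x \<in> patch c then gram c p q x else 0)) \<in> borel_measurable borel"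
    by (intro borel_measurable_sum borel_measurable_times measurable_sections_triv u v c gm
        measurable_compose[OF measurable_sections_triv[OF u c] borel_measurable_continuous_onI]) (auto intro: continuous_intros)
  also have "(\<lambda>x. \<Sum>p<rk c. \<Sum>q<rk c. cnj (if x \<in> patch c then triv c x (u x) p else 0) *
      (if x \<in> patch c then triv c x (v x) q else 0) * (if x \<in> patch c then gram c p q x else 0)) =
      (\<lambda>x. if x \<in> patch c then herm X x (u x) (v x) else 0)"
    using herm_components[OF c] measurable_sections_fib[OF u] measurable_sections_fib[OF v] by auto
  finally show "(\<lambda>x. if x \<in> patch (ch k) then herm X x (u x) (v x) else 0) \<in> borel_measurable borel"
    by (simp add: c_def)
qed

lemma measurable_fsq: "u \<in> measurable_sections X \<Longrightarrow> (\<lambda>x. fsq x (u x)) \<in> borel_measurable borel"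
  unfolding fsq_def using measurable_herm[of u u] borel_measurable_continuous_onI[OF continuous_on_Re[OF continuous_on_id]]
  by (auto intro: measurable_compose)

lemma zone_measurable:
  assumes "k < N" "S \<in> sets borel" shows "zone k S \<in> sets borel"
proof -
  have "(\<lambda>x. if x \<in> patch (ch k) then coord (ch k) x else 0) \<in> borel_measurable borel"
    using assms ch by (intro measurable_if_continuous open_patch continuous_coord)
  from measurable_sets[OF this assms(2)] have "patch (ch k) \<inter> (\<lambda>x. if x \<in> patch (ch k) then coord (ch k) x else 0) -` S \<in> sets borel"
    using open_patch[OF ch[OF assms(1)]] by auto
  also have "patch (ch k) \<inter> (\<lambda>x. if x \<in> patch (ch k) then coord (ch k) x else 0) -` S = zone k S"
    by (auto simp: zone_def)
  finally show ?thesis .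
qed

lemma nn_integral_zone:
  fixes f :: "'m \<Rightarrow> ennreal"
  assumes k: "k < N" and S: "S \<in> sets borel" "S \<subseteq> img (ch k)" and f: "f \<in> borel_measurable borel"
  shows "(\<integral>\<^sup>+x. f x * indicator (zone k S) x \<partial>dens X) =
    (\<integral>\<^sup>+y. ennreal (weight (ch k) y) * f (coord_inv (ch k) y) * indicator S y \<partial>lborel)"
proof -
  have "(\<integral>\<^sup>+x. f x * indicator (zone k S) x \<partial>dens X) = (\<integral>\<^sup>+x. (f x * indicator (zone k S) x) * indicator (patch (ch k)) x \<partial>dens X)"
    by (intro nn_integral_cong) (auto simp: indicator_def zone_def)
  also have "\<dots> = (\<integral>\<^sup>+y. (ennreal (weight (ch k) y) * indicator (img (ch k)) y) * (f (coord_inv (ch k) y) * indicator (zone k S) (coord_inv (ch k) y)) \<partial>lborel)"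
    using f zone_measurable[OF k S(1)] by (intro nn_integral_patch ch k) auto
  also have "\<dots> = (\<integral>\<^sup>+y. ennreal (weight (ch k) y) * f (coord_inv (ch k) y) * indicator S y \<partial>lborel)"
    using S coord_coord_inv[OF ch[OF k]] coord_inv_patch[OF ch[OF k]]
    by (intro nn_integral_cong) (auto simp: indicator_def zone_def)
  finally show ?thesis .
qed

definition local_norm :: "nat \<Rightarrow> 'a set \<Rightarrow> ('m \<Rightarrow> 'f) \<Rightarrow> ennreal" where
  "local_norm k S u = (\<Sum>p<rk (ch k). \<integral>\<^sup>+y. ennreal ((norm (lcomp (ch k) p u y))\<^sup>2) * indicator S y \<partial>lborel)"

text \<open>On the compact ball of factor 7 both the metric and the density are comparable with
  their Euclidean counterparts. The constant does not depend on the subset \<open>S\<close>, so one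
  constant serves all the radii used below.\<close>

lemma local_norm_bounds:
  assumes k: "k < N"
  shows "\<exists>C>0. \<forall>u\<in>measurable_sections X. \<forall>S\<in>sets borel. S \<subseteq> cball (ctr k) (7 * rad k) \<longrightarrow>
    (\<integral>\<^sup>+x. ennreal (fsq x (u x)) * indicator (zone k S) x \<partial>dens X) \<le> ennreal C * local_norm k S u \<and>
    local_norm k S u \<le> ennreal C * (\<integral>\<^sup>+x. ennreal (fsq x (u x)) * indicator (zone k S) x \<partial>dens X)"
proof -
  define c where "c = ch k"
  define K where "K = cball (ctr k) (7 * rad k)"
  have c: "c \<in> atlas X" using ch[OF k] by (simp add: c_def)
  have K: "compact K" "K \<subseteq> img c" using balls[OF k] by (auto simp: K_def c_def)
  obtain C1 where C1: "C1 > 0" "\<And>x v. x \<in> patch c \<Longrightarrow> coord c x \<in> K \<Longrightarrow> v \<in> fib X x \<Longrightarrow> fsq x v \<le> C1 * (\<Sum>p<rk c. (norm (triv c x v p))\<^sup>2)"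
    using fsq_upper[OF c K] by blast
  obtain C2 where C2: "C2 > 0" "\<And>x v. x \<in> patch c \<Longrightarrow> coord c x \<in> K \<Longrightarrow> v \<in> fib X x \<Longrightarrow> (\<Sum>p<rk c. (norm (triv c x v p))\<^sup>2) \<le> C2 * fsq x v"
    using fsq_lower[OF c K] by blast
  obtain w0 w1 where w: "w0 > 0" "w1 > 0" "\<And>y. y \<in> K \<Longrightarrow> w0 \<le> weight c y \<and> weight c y \<le> w1"
    using weight_bounds[OF c K] by blast
  \<comment> \<open>The first summand serves the upper estimate and the second the lower
    one.\<close>
  define C where "C = w1 * C1 + C2 / w0"
  have C: "C > 0" "w1 * C1 \<le> C" "C2 / w0 \<le> C" using w C1 C2 by (auto simp: C_def add_pos_pos less_imp_le)
  have "(\<integral>\<^sup>+x. ennreal (fsq x (u x)) * indicator (zone k S) x \<partial>dens X) \<le> ennreal C * local_norm k S u \<and>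
    local_norm k S u \<le> ennreal C * (\<integral>\<^sup>+x. ennreal (fsq x (u x)) * indicator (zone k S) x \<partial>dens X)"
    if u: "u \<in> measurable_sections X" and S: "S \<in> sets borel" "S \<subseteq> K" for u S
  proof -
    have Sc: "S \<subseteq> img c" using S K by blast
    let ?ci = "coord_inv c"
    have lm: "local_norm k S u = (\<integral>\<^sup>+y. ennreal (\<Sum>p<rk c. (norm (lcomp c p u y))\<^sup>2) * indicator S y \<partial>lborel)"
    proof -
      have "local_norm k S u = (\<integral>\<^sup>+y. (\<Sum>p<rk c. ennreal ((norm (lcomp c p u y))\<^sup>2) * indicator S y) \<partial>lborel)"
        unfolding local_norm_def c_def[symmetric] using measurable_lcomp_on[OF u c S(1) Sc]
        by (subst nn_integral_sum) auto
      then show ?thesis by (simp add: sum_distrib_right[symmetric] sum_ennreal)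
    qed
    have mS: "(\<lambda>y. ennreal (\<Sum>p<rk c. (norm (lcomp c p u y))\<^sup>2) * indicator S y) \<in> borel_measurable lborel"
    proof -
      have "(\<lambda>y. (\<Sum>p<rk c. ennreal ((norm (lcomp c p u y))\<^sup>2) * indicator S y)) \<in> borel_measurable lborel"
        using measurable_lcomp_on[OF u c S(1) Sc] by (intro borel_measurable_sum) auto
      then show ?thesis by (simp add: sum_distrib_right[symmetric] sum_ennreal)
    qed
    have fm: "(\<lambda>x. ennreal (fsq x (u x))) \<in> borel_measurable borel" using measurable_fsq[OF u] by simp
    have zi: "(\<integral>\<^sup>+x. ennreal (fsq x (u x)) * indicator (zone k S) x \<partial>dens X) =
        (\<integral>\<^sup>+y. ennreal (weight c y) * ennreal (fsq (?ci y) (u (?ci y))) * indicator S y \<partial>lborel)"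
      using nn_integral_zone[OF k S(1) Sc[unfolded c_def] fm] by (simp add: c_def)
    have fib: "u (?ci y) \<in> fib X (?ci y)" for y using measurable_sections_fib[OF u] .
    have pt: "?ci y \<in> patch c" "coord c (?ci y) = y" if "y \<in> S" for y
      using that Sc coord_inv_patch[OF c] coord_coord_inv[OF c] by auto
    show ?thesis
    proof
      have "(\<integral>\<^sup>+x. ennreal (fsq x (u x)) * indicator (zone k S) x \<partial>dens X) \<le>
          (\<integral>\<^sup>+y. ennreal C * (ennreal (\<Sum>p<rk c. (norm (lcomp c p u y))\<^sup>2) * indicator S y) \<partial>lborel)"
        unfolding zi
      proof (rule nn_integral_mono)
        fix y
        show "ennreal (weight c y) * ennreal (fsq (?ci y) (u (?ci y))) * indicator S y \<le>
          ennreal C * (ennreal (\<Sum>p<rk c. (norm (lcomp c p u y))\<^sup>2) * indicator S y)"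
        proof (cases "y \<in> S")
          case True
          let ?s = "\<Sum>p<rk c. (norm (lcomp c p u y))\<^sup>2"
          have s0: "?s \<ge> 0" by (intro sum_nonneg) auto
          have f0: "fsq (?ci y) (u (?ci y)) \<ge> 0" by (rule fsq_nonneg[OF fib])
          have "weight c y * fsq (?ci y) (u (?ci y)) \<le> w1 * (C1 * ?s)"
            using w(2) w(3)[of y] True S C1(2)[OF pt(1)[OF True] _ fib] pt(2)[OF True] f0
            by (intro mult_mono) (auto simp: lcomp_def)
          also have "\<dots> \<le> C * ?s" using C s0 by (simp add: mult.assoc[symmetric] mult_right_mono)
          finally show ?thesis using True w(1) w(3)[of y] S f0 s0 C
            by (subst ennreal_mult[symmetric]) (auto simp: ennreal_mult[symmetric] intro!: ennreal_leI)
        qed simp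
      qed
      also have "\<dots> = ennreal C * local_norm k S u" unfolding lm using mS by (rule nn_integral_cmult)
      finally show "(\<integral>\<^sup>+x. ennreal (fsq x (u x)) * indicator (zone k S) x \<partial>dens X) \<le> ennreal C * local_norm k S u" .
    next
      have "local_norm k S u \<le> (\<integral>\<^sup>+y. ennreal C * (ennreal (weight c y) * ennreal (fsq (?ci y) (u (?ci y))) * indicator S y) \<partial>lborel)"
        unfolding lm
      proof (rule nn_integral_mono)
        fix y
        show "ennreal (\<Sum>p<rk c. (norm (lcomp c p u y))\<^sup>2) * indicator S y \<le>
          ennreal C * (ennreal (weight c y) * ennreal (fsq (?ci y) (u (?ci y))) * indicator S y)"
        proof (cases "y \<in> S")
          case True
          have f0: "fsq (?ci y) (u (?ci y)) \<ge> 0" by (rule fsq_nonneg[OF fib])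
          have wy: "w0 \<le> weight c y" using w(3)[of y] True S by auto
          have "(\<Sum>p<rk c. (norm (lcomp c p u y))\<^sup>2) \<le> C2 * fsq (?ci y) (u (?ci y))"
            using C2(2)[OF pt(1)[OF True] _ fib] pt(2)[OF True] True S by (auto simp: lcomp_def)
          also have "\<dots> = (C2 / w0) * (w0 * fsq (?ci y) (u (?ci y)))" using w(1) by simp
          also have "\<dots> \<le> C * (weight c y * fsq (?ci y) (u (?ci y)))"
            using C wy w(1) f0 C2(1) by (intro mult_mono) auto
          finally show ?thesis using True w(1) wy f0 C
            by (simp add: ennreal_mult[symmetric] ennreal_leI)
        qed simp
      qed
      also have "\<dots> = ennreal C * (\<integral>\<^sup>+y. ennreal (weight c y) * ennreal (fsq (?ci y) (u (?ci y))) * indicator S y \<partial>lborel)"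
      proof (rule nn_integral_cmult)
        have "(\<lambda>y. (ennreal (weight c y) * indicator (img c) y) * (ennreal (fsq (if y \<in> img c then ?ci y else undefined) (u (if y \<in> img c then ?ci y else undefined))) * indicator S y)) \<in> borel_measurable lborel"
          using weight_measurable[OF c] S
            measurable_compose[OF measurable_if_continuous[OF open_img[OF c] continuous_coord_inv[OF c]] fm, of undefined]
          by measurable
        also have "(\<lambda>y. (ennreal (weight c y) * indicator (img c) y) * (ennreal (fsq (if y \<in> img c then ?ci y else undefined) (u (if y \<in> img c then ?ci y else undefined))) * indicator S y)) =
          (\<lambda>y. ennreal (weight c y) * ennreal (fsq (?ci y) (u (?ci y))) * indicator S y)"
          by (rule ext) (use Sc in \<open>auto simp: indicator_def\<close>)
        finally show "(\<lambda>y. ennreal (weight c y) * ennreal (fsq (?ci y) (u (?ci y))) * indicator S y) \<in> borel_measurable lborel" .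
      qed
      finally show "local_norm k S u \<le> ennreal C * (\<integral>\<^sup>+x. ennreal (fsq x (u x)) * indicator (zone k S) x \<partial>dens X)"
        unfolding zi .
    qed
  qed
  then show ?thesis using C(1) unfolding K_def by blast
qed

end

subsection \<open>The space of square integrable sections\<close>

context bundle_cover
begin

lemma L2_iff:
  "u \<in> L2 X \<longleftrightarrow> u \<in> measurable_sections X \<and> (\<integral>\<^sup>+x. ennreal (fsq x (u x)) \<partial>dens X) < \<infinity>"
proof -
  have "integrable (dens X) (\<lambda>x. herm X x (u x) (u x)) \<longleftrightarrow> (\<integral>\<^sup>+x. ennreal (fsq x (u x)) \<partial>dens X) < \<infinity>"
    if u: "u \<in> measurable_sections X"
  proof -
    have "norm (herm X x (u x) (u x)) = fsq x (u x)" for x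
      using herm_self[OF measurable_sections_fib[OF u]] fsq_nonneg[OF measurable_sections_fib[OF u]] by simp
    then show ?thesis
      using measurable_herm[OF u u] by (simp add: integrable_iff_bounded borel_measurable_dens)
  qed
  then show ?thesis by (auto simp: L2_def)
qed

lemma L2_measurable: "u \<in> L2 X \<Longrightarrow> u \<in> measurable_sections X" and L2_fib: "u \<in> L2 X \<Longrightarrow> u x \<in> fib X x"
  by (auto simp: L2_def measurable_sections_fib)

lemma L2_norm_eq:
  assumes u: "u \<in> L2 X"
  shows "ennreal ((L2_norm X u)\<^sup>2) = (\<integral>\<^sup>+x. ennreal (fsq x (u x)) \<partial>dens X)" "L2_norm X u \<ge> 0"
proof -
  have m: "(\<lambda>x. fsq x (u x)) \<in> borel_measurable (dens X)"
    using measurable_fsq[OF L2_measurable[OF u]] by (simp add: borel_measurable_dens)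
  have nn: "fsq x (u x) \<ge> 0" for x by (rule fsq_nonneg[OF L2_fib[OF u]])
  have i: "integrable (dens X) (\<lambda>x. fsq x (u x))"
    using u m nn by (simp add: integrable_iff_bounded L2_iff)
  have "L2_inner X u u = complex_of_real (LINT x|dens X. fsq x (u x))"
    unfolding L2_inner_def herm_self[OF L2_fib[OF u]] by (rule integral_complex_of_real)
  then have e: "L2_norm X u = sqrt (LINT x|dens X. fsq x (u x))" by (simp add: L2_norm_def)
  have nn2: "(LINT x|dens X. fsq x (u x)) \<ge> 0" using nn by (intro Bochner_Integration.integral_nonneg) auto
  then show "L2_norm X u \<ge> 0" unfolding e by simp
  show "ennreal ((L2_norm X u)\<^sup>2) = (\<integral>\<^sup>+x. ennreal (fsq x (u x)) \<partial>dens X)"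
    unfolding e using nn2 nn_integral_eq_integral[OF i] nn by simp
qed

lemma L2_norm_le:
  assumes u: "u \<in> L2 X" and "M \<ge> 0" "(\<integral>\<^sup>+x. ennreal (fsq x (u x)) \<partial>dens X) \<le> ennreal (M\<^sup>2)"
  shows "L2_norm X u \<le> M"
proof -
  have "(L2_norm X u)\<^sup>2 \<le> M\<^sup>2"
    using assms(3) unfolding L2_norm_eq(1)[OF u, symmetric] by (simp add: ennreal_le_iff)
  then show ?thesis using assms(2) by (rule power2_le_imp_le)
qed

lemma measurable_sections_add:
  assumes u: "u \<in> measurable_sections X" and v: "v \<in> measurable_sections X"
  shows "u + v \<in> measurable_sections X"
  unfolding measurable_sections_def
proof (intro CollectI conjI ballI allI impI)
  show "(u + v) x \<in> fib X x" for x using measurable_sections_fib[OF u] measurable_sections_fib[OF v] fibre.V_add by simp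
  fix c p assume c: "c \<in> atlas X" "p < rk c"
  have "(\<lambda>x. (if x \<in> patch c then triv c x (u x) p else 0) + (if x \<in> patch c then triv c x (v x) p else 0)) \<in> borel_measurable borel"
    by (intro borel_measurable_add measurable_sections_triv u v c)
  also have "(\<lambda>x. (if x \<in> patch c then triv c x (u x) p else 0) + (if x \<in> patch c then triv c x (v x) p else 0)) =
      (\<lambda>x. if x \<in> patch c then triv c x ((u + v) x) p else 0)"
    using measurable_sections_fib[OF u] measurable_sections_fib[OF v] by (auto simp: triv_add[OF c(1)])
  finally show "(\<lambda>x. if x \<in> patch c then triv c x ((u + v) x) p else 0) \<in> borel_measurable borel" .
qed

lemma measurable_sections_scal:
  assumes u: "u \<in> measurable_sections X"
  shows "(\<lambda>x. scal X z (u x)) \<in> measurable_sections X"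
  unfolding measurable_sections_def
proof (intro CollectI conjI ballI allI impI)
  show "scal X z (u x) \<in> fib X x" for x using measurable_sections_fib[OF u] fibre.V_sc by simp
  fix c p assume c: "c \<in> atlas X" "p < rk c"
  have "(\<lambda>x. z * (if x \<in> patch c then triv c x (u x) p else 0)) \<in> borel_measurable borel"
    by (intro borel_measurable_times measurable_sections_triv u c) auto
  also have "(\<lambda>x. z * (if x \<in> patch c then triv c x (u x) p else 0)) = (\<lambda>x. if x \<in> patch c then triv c x (scal X z (u x)) p else 0)"
    using measurable_sections_fib[OF u] by (auto simp: triv_scal[OF c(1)])
  finally show "(\<lambda>x. if x \<in> patch c then triv c x (scal X z (u x)) p else 0) \<in> borel_measurable borel" .
qed

lemma measurable_sections_0: "0 \<in> measurable_sections X"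
proof -
  have "(\<lambda>x. if x \<in> patch c then triv c x 0 p else 0) = (\<lambda>x. 0)" if "c \<in> atlas X" for c p
    using triv_0[OF that] by auto
  then show ?thesis by (simp add: measurable_sections_def fibre.V_0 zero_fun_def)
qed

definition sscal :: "complex \<Rightarrow> ('m \<Rightarrow> 'f) \<Rightarrow> 'm \<Rightarrow> 'f" where "sscal z u = (\<lambda>x. scal X z (u x))"

lemma vector_space_sscal: "vector_space sscal"
  by unfold_locales (auto simp: sscal_def fun_eq_iff vs.scale_right_distrib vs.scale_left_distrib)

lemma herm_integrable:
  assumes u: "u \<in> L2 X" and v: "v \<in> L2 X"
  shows "integrable (dens X) (\<lambda>x. herm X x (u x) (v x))"
proof (rule Bochner_Integration.integrable_bound)
  show "integrable (dens X) (\<lambda>x. herm X x (u x) (u x) + herm X x (v x) (v x))"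
    using u v by (simp add: L2_def)
  show "(\<lambda>x. herm X x (u x) (v x)) \<in> borel_measurable (dens X)"
    using measurable_herm[OF L2_measurable[OF u] L2_measurable[OF v]] by (simp add: borel_measurable_dens)
  have "norm (herm X x (u x) (v x)) \<le> norm (herm X x (u x) (u x) + herm X x (v x) (v x))" for x
  proof -
    have "norm (herm X x (u x) (v x)) \<le> fsq x (u x) + fsq x (v x)"
      by (intro norm_herm_le L2_fib u v)
    also have "\<dots> = norm (complex_of_real (fsq x (u x) + fsq x (v x)))"
      using fsq_nonneg[OF L2_fib[OF u]] fsq_nonneg[OF L2_fib[OF v]] by (simp only: norm_of_real abs_of_nonneg add_nonneg_nonneg)
    finally show ?thesis by (simp add: herm_self[OF L2_fib[OF u]] herm_self[OF L2_fib[OF v]])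
  qed
  then show "AE x in dens X. norm (herm X x (u x) (v x)) \<le> norm (herm X x (u x) (u x) + herm X x (v x) (v x))" by simp
qed

lemma L2_add: assumes u: "u \<in> L2 X" and v: "v \<in> L2 X" shows "u + v \<in> L2 X"
proof -
  have m: "(\<lambda>x. fsq x (w x)) \<in> borel_measurable (dens X)" if "w \<in> L2 X" for w
    using measurable_fsq[OF L2_measurable[OF that]] by (simp add: borel_measurable_dens)
  have "(\<integral>\<^sup>+x. ennreal (fsq x ((u + v) x)) \<partial>dens X) \<le> (\<integral>\<^sup>+x. 2 * ennreal (fsq x (u x)) + 2 * ennreal (fsq x (v x)) \<partial>dens X)"
  proof (rule nn_integral_mono)
    fix x
    have "ennreal (fsq x ((u + v) x)) \<le> ennreal (2 * fsq x (u x) + 2 * fsq x (v x))"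
      using fsq_add_le[OF L2_fib[OF u] L2_fib[OF v]] by (intro ennreal_leI) simp
    then show "ennreal (fsq x ((u + v) x)) \<le> 2 * ennreal (fsq x (u x)) + 2 * ennreal (fsq x (v x))"
      using fsq_nonneg[OF L2_fib[OF u]] fsq_nonneg[OF L2_fib[OF v]] by (simp add: ennreal_mult)
  qed
  also have "\<dots> = 2 * (\<integral>\<^sup>+x. ennreal (fsq x (u x)) \<partial>dens X) + 2 * (\<integral>\<^sup>+x. ennreal (fsq x (v x)) \<partial>dens X)"
    using m[OF u] m[OF v] by (simp add: nn_integral_add nn_integral_cmult)
  also have "\<dots> < \<infinity>" using u v by (auto simp: L2_iff ennreal_mult_less_top)
  finally show ?thesis using measurable_sections_add[OF L2_measurable[OF u] L2_measurable[OF v]] by (simp add: L2_iff)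
qed

lemma L2_scal: assumes u: "u \<in> L2 X" shows "sscal z u \<in> L2 X"
proof -
  have m: "(\<lambda>x. fsq x (u x)) \<in> borel_measurable (dens X)"
    using measurable_fsq[OF L2_measurable[OF u]] by (simp add: borel_measurable_dens)
  have "(\<integral>\<^sup>+x. ennreal (fsq x (sscal z u x)) \<partial>dens X) = (\<integral>\<^sup>+x. ennreal ((norm z)\<^sup>2) * ennreal (fsq x (u x)) \<partial>dens X)"
    by (intro nn_integral_cong) (simp add: sscal_def fsq_scal[OF L2_fib[OF u]] ennreal_mult fsq_nonneg[OF L2_fib[OF u]])
  also have "\<dots> = ennreal ((norm z)\<^sup>2) * (\<integral>\<^sup>+x. ennreal (fsq x (u x)) \<partial>dens X)"
    using m by (intro nn_integral_cmult) auto
  also have "\<dots> < \<infinity>" using u by (auto simp: L2_iff ennreal_mult_less_top)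
  finally show ?thesis using measurable_sections_scal[OF L2_measurable[OF u], of z] by (simp add: L2_iff sscal_def)
qed

lemma L2_0: "0 \<in> L2 X"
  by (simp add: L2_iff measurable_sections_0 fsq_0)

sublocale L2: semi_inner_space sscal "L2 X" "L2_inner X"
proof -
  interpret S: vector_space sscal by (rule vector_space_sscal)
  show "semi_inner_space sscal (L2 X) (L2_inner X)"
  proof (unfold_locales)
    show "S.subspace (L2 X)" unfolding S.subspace_def using L2_0 L2_add L2_scal by blast
    fix u v w z assume u: "u \<in> L2 X"
    show "0 \<le> Re (L2_inner X u u)"
      unfolding L2_inner_def herm_self[OF L2_fib[OF u]] integral_complex_of_real
      using fsq_nonneg[OF L2_fib[OF u]] by (auto intro!: Bochner_Integration.integral_nonneg)
    assume v: "v \<in> L2 X"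
    show "L2_inner X u (sscal z v) = z * L2_inner X u v"
      unfolding L2_inner_def sscal_def by (simp add: fibre.ip_sc[OF L2_fib[OF u] L2_fib[OF v]])
    show "L2_inner X v u = cnj (L2_inner X u v)"
      unfolding L2_inner_def fibre.ip_cnj[OF L2_fib[OF u] L2_fib[OF v]] by simp
    assume w: "w \<in> L2 X"
    show "L2_inner X u (v + w) = L2_inner X u v + L2_inner X u w"
      unfolding L2_inner_def using herm_integrable[OF u v] herm_integrable[OF u w]
      by (simp add: fibre.ip_add[OF L2_fib[OF u] L2_fib[OF v] L2_fib[OF w]])
  qed
qed

lemma L2_nrm: "L2.nrm u = L2_norm X u"
  by (simp add: L2.nrm_def L2_norm_def)

text \<open>The bridge between the seminorm and equality in the Hilbert space: the metric is
  definite on each fibre, so norm zero means vanishing almost everywhere.\<close>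

lemma L2_eq_iff:
  assumes u: "u \<in> L2 X" and v: "v \<in> L2 X"
  shows "L2_eq X u v \<longleftrightarrow> L2_norm X (u - v) = 0"
proof -
  have d: "u - v \<in> L2 X" using u v by (rule L2.V_diff)
  have m: "(\<lambda>x. ennreal (fsq x ((u - v) x))) \<in> borel_measurable (dens X)"
    using measurable_fsq[OF L2_measurable[OF d]] by (simp add: borel_measurable_dens)
  have "L2_norm X (u - v) = 0 \<longleftrightarrow> ennreal ((L2_norm X (u - v))\<^sup>2) = 0"
    by (simp add: ennreal_eq_0_iff)
  also have "\<dots> \<longleftrightarrow> (AE x in dens X. ennreal (fsq x ((u - v) x)) = 0)"
    unfolding L2_norm_eq(1)[OF d] using m by (rule nn_integral_0_iff_AE)
  also have "\<dots> \<longleftrightarrow> (AE x in dens X. u x = v x)"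
  proof (rule AE_cong)
    fix x
    have "fsq x ((u - v) x) \<le> 0 \<longleftrightarrow> (u - v) x = 0"
      using fsq_pos[OF L2_fib[OF d], of x] fsq_0[of x] by force
    then show "(ennreal (fsq x ((u - v) x)) = 0) = (u x = v x)" by (simp add: ennreal_eq_0_iff)
  qed
  finally show ?thesis by (simp add: L2_eq_def)
qed

text \<open>The weights \<open>2^n\<close> make the pointwise increments decay geometrically almost everywhere, so no
  Minkowski inequality is needed.\<close>

lemma L2_complete:
  fixes x :: "nat \<Rightarrow> 'm \<Rightarrow> 'f"
  assumes x: "\<And>n. x n \<in> L2 X" and xc: "\<And>n. L2_norm X (x (Suc n) - x n) \<le> c * (1 / 2) ^ n"
  shows "\<exists>l\<in>L2 X. (\<lambda>n. L2_norm X (x n - l)) \<longlonglongrightarrow> 0"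
proof -
  define d where "d n = x (Suc n) - x n" for n
  have d: "d n \<in> L2 X" for n unfolding d_def by (intro L2.V_diff x)
  have c0: "c \<ge> 0" using xc[of 0] L2_norm_eq(2)[OF d[of 0]] by (simp add: d_def)
  have fm: "(\<lambda>z. ennreal (fsq z (w z))) \<in> borel_measurable (dens X)" "(\<lambda>z. ennreal (fsq z (w z))) \<in> borel_measurable borel"
    if "w \<in> measurable_sections X" for w
    using measurable_fsq[OF that] by (auto simp: borel_measurable_dens)
  define G where "G z = (\<Sum>n. ennreal (2 ^ n) * ennreal (fsq z (d n z)))" for z
  have Gm: "G \<in> borel_measurable borel" unfolding G_def using fm(2)[OF L2_measurable[OF d]] by measurable
  have "(\<integral>\<^sup>+z. G z \<partial>dens X) = (\<Sum>n. \<integral>\<^sup>+z. ennreal (2 ^ n) * ennreal (fsq z (d n z)) \<partial>dens X)"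
    unfolding G_def by (rule nn_integral_suminf) (use fm(1)[OF L2_measurable[OF d]] in measurable)
  also have "\<dots> = (\<Sum>n. ennreal (2 ^ n) * ennreal ((L2_norm X (d n))\<^sup>2))"
    unfolding L2_norm_eq(1)[OF d] using fm(1)[OF L2_measurable[OF d]] by (simp add: nn_integral_cmult)
  also have "\<dots> \<le> (\<Sum>n. ennreal (c\<^sup>2 * (1 / 2) ^ n))"
  proof (rule suminf_le)
    fix n
    have "(L2_norm X (d n))\<^sup>2 \<le> (c * (1 / 2) ^ n)\<^sup>2"
      using xc[of n] L2_norm_eq(2)[OF d[of n]] by (intro power_mono) (auto simp: d_def)
    then have "2 ^ n * (L2_norm X (d n))\<^sup>2 \<le> 2 ^ n * (c * (1 / 2) ^ n)\<^sup>2" by (intro mult_left_mono) auto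
    also have "\<dots> = c\<^sup>2 * (1 / 2) ^ n" by (simp add: power2_eq_square power_divide)
    finally show "ennreal (2 ^ n) * ennreal ((L2_norm X (d n))\<^sup>2) \<le> ennreal (c\<^sup>2 * (1 / 2) ^ n)"
      by (subst ennreal_mult[symmetric]) (auto intro: ennreal_leI)
  qed auto
  also have "\<dots> = ennreal (\<Sum>n. c\<^sup>2 * (1 / 2) ^ n)"
    by (intro suminf_ennreal2 summable_mult summable_geometric) auto
  also have "\<dots> < \<infinity>" by simp
  finally have "(\<integral>\<^sup>+z. G z \<partial>dens X) < \<infinity>" .
  then have "AE z in dens X. G z \<noteq> \<infinity>"
    using Gm by (intro nn_integral_PInf_AE) (auto simp: borel_measurable_dens)
  define E where "E = {z. G z \<noteq> \<infinity>}"
  have Em: "E \<in> sets borel" unfolding E_def using Gm by measurable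
  have incr: "\<exists>g. \<forall>n. fsq z (d n z) \<le> g * (1 / 2) ^ n" if z: "z \<in> E" for z
  proof -
    have "fsq z (d n z) \<le> enn2real (G z) * (1 / 2) ^ n" for n
    proof -
      have "ennreal (2 ^ n) * ennreal (fsq z (d n z)) \<le> G z"
        unfolding G_def using sum_le_suminf[of "\<lambda>n. ennreal (2 ^ n) * ennreal (fsq z (d n z))" "{n}"] by simp
      also have "G z = ennreal (enn2real (G z))" using z by (simp add: E_def less_top)
      finally have "2 ^ n * fsq z (d n z) \<le> enn2real (G z)"
        using fsq_nonneg[OF L2_fib[OF d]] by (subst (asm) ennreal_mult[symmetric]) (auto simp: ennreal_le_iff)
      then show ?thesis by (simp add: field_simps power_divide)
    qed
    then show ?thesis by blast
  qed
  have ex_lim: "\<exists>v\<in>fib X z. (\<lambda>n. fsq z (x n z - v)) \<longlonglongrightarrow> 0" if z: "z \<in> E" for z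
  proof -
    obtain k where k: "k < N" "z \<in> patch (ch k)" using cover by blast
    define e where "e = ch k"
    have e: "e \<in> atlas X" "z \<in> patch e" using k ch by (auto simp: e_def)
    have K: "compact {coord e z}" "{coord e z} \<subseteq> img e" using coord_img[OF e] by auto
    obtain C1 where C1: "C1 > 0" "\<And>v. v \<in> fib X z \<Longrightarrow> fsq z v \<le> C1 * (\<Sum>p<rk e. (norm (triv e z v p))\<^sup>2)"
      using fsq_upper[OF e(1) K] e(2) by blast
    obtain C2 where C2: "C2 > 0" "\<And>v. v \<in> fib X z \<Longrightarrow> (\<Sum>p<rk e. (norm (triv e z v p))\<^sup>2) \<le> C2 * fsq z v"
      using fsq_lower[OF e(1) K] e(2) by blast
    obtain g where g: "\<And>n. fsq z (d n z) \<le> g * (1 / 2) ^ n" using incr[OF z] by blast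
    have g0: "g \<ge> 0" using g[of 0] fsq_nonneg[OF L2_fib[OF d], of z 0] by simp
    have conv: "convergent (\<lambda>n. triv e z (x n z) p)" if p: "p < rk e" for p
    proof -
      \<comment> \<open>\<open>fsq\<close> is quadratic, so the rate \<open>1 / 2\<close> becomes
        \<open>sqrt (1 / 2)\<close> for the components, which is still summable.\<close>
      have "norm (triv e z (x (Suc n) z) p - triv e z (x n z) p) \<le> sqrt (C2 * g) * (sqrt (1 / 2)) ^ n" for n
      proof -
        have "(norm (triv e z (d n z) p))\<^sup>2 \<le> (\<Sum>p<rk e. (norm (triv e z (d n z) p))\<^sup>2)"
          using p by (intro member_le_sum) auto
        also have "\<dots> \<le> C2 * fsq z (d n z)" by (rule C2(2)[OF L2_fib[OF d]])
        also have "\<dots> \<le> C2 * (g * (1 / 2) ^ n)" using C2(1) g by (intro mult_left_mono) auto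
        finally have "norm (triv e z (d n z) p) \<le> sqrt (C2 * (g * (1 / 2) ^ n))" by (rule real_le_rsqrt)
        then show ?thesis
          using triv_diff[OF e L2_fib[OF x] L2_fib[OF x]]
          by (simp add: d_def real_sqrt_mult real_sqrt_power mult.assoc)
      qed
      then have "summable (\<lambda>n. triv e z (x (Suc n) z) p - triv e z (x n z) p)"
        by (intro summable_comparison_test'[OF summable_mult[OF summable_geometric]]) (auto simp: real_sqrt_divide)
      then have "convergent (\<lambda>n. triv e z (x n z) p - triv e z (x 0 z) p)"
        unfolding summable_iff_convergent sum_lessThan_telescope[of "\<lambda>n. triv e z (x n z) p"] .
      then show ?thesis by (simp add: convergent_diff_const_right_iff)
    qed
    define \<zeta> where "\<zeta> p = lim (\<lambda>n. triv e z (x n z) p)" for p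
    define v where "v = (\<Sum>p<rk e. scal X (\<zeta> p) (frame X e p z))"
    have v: "v \<in> fib X z" unfolding v_def
      using frame_fib[OF e] by (intro vs.subspace_sum[OF fib_subspace] fibre.V_sc) auto
    have tv: "triv e z v p = \<zeta> p" if p: "p < rk e" for p
    proof -
      have "triv e z v p = (\<Sum>q<rk e. if p = q then \<zeta> q else 0)" unfolding v_def
      proof (subst triv_sum[OF e])
        show "(\<Sum>q<rk e. triv e z (scal X (\<zeta> q) (frame X e q z)) p) = (\<Sum>q<rk e. if p = q then \<zeta> q else 0)"
          by (intro sum.cong refl) (auto simp: triv_scal[OF e frame_fib[OF e]] triv_frame[OF e])
      qed (auto intro!: fibre.V_sc frame_fib[OF e])
      then show ?thesis using p by simp
    qed
    have "(\<lambda>n. C1 * (\<Sum>p<rk e. (norm (triv e z (x n z) p - \<zeta> p))\<^sup>2)) \<longlonglongrightarrow> C1 * (\<Sum>p<rk e. (norm (\<zeta> p - \<zeta> p))\<^sup>2)"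
      using conv unfolding \<zeta>_def convergent_LIMSEQ_iff by (intro tendsto_intros) auto
    then have "(\<lambda>n. C1 * (\<Sum>p<rk e. (norm (triv e z (x n z) p - \<zeta> p))\<^sup>2)) \<longlonglongrightarrow> 0" by simp
    moreover have "fsq z (x n z - v) \<le> C1 * (\<Sum>p<rk e. (norm (triv e z (x n z) p - \<zeta> p))\<^sup>2)" for n
      using C1(2)[OF fibre.V_diff[OF L2_fib[OF x] v], of n] triv_diff[OF e L2_fib[OF x] v] tv by simp
    moreover have "fsq z (x n z - v) \<ge> 0" for n by (intro fsq_nonneg fibre.V_diff L2_fib x v)
    ultimately have "(\<lambda>n. fsq z (x n z - v)) \<longlonglongrightarrow> 0"
      by (intro Lim_null_comparison[of "\<lambda>n. fsq z (x n z - v)"] always_eventually allI) simp_all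
    then show ?thesis using v by blast
  qed
  define l where "l z = (if z \<in> E then SOME v. v \<in> fib X z \<and> (\<lambda>n. fsq z (x n z - v)) \<longlonglongrightarrow> 0 else 0)" for z
  have lE: "l z \<in> fib X z \<and> (\<lambda>n. fsq z (x n z - l z)) \<longlonglongrightarrow> 0" if z: "z \<in> E" for z
  proof -
    have "\<exists>v. v \<in> fib X z \<and> (\<lambda>n. fsq z (x n z - v)) \<longlonglongrightarrow> 0" using ex_lim[OF z] by blast
    from someI_ex[OF this] show ?thesis using z by (simp add: l_def)
  qed
  have lfib: "l z \<in> fib X z" for z using lE[of z] by (cases "z \<in> E") (auto simp: l_def fibre.V_0)
  \<comment> \<open>The values of \<open>l\<close> are chosen point by point, but in every chart its
    components are limits of the measurable components of \<open>x n\<close>.\<close>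
  have lm: "l \<in> measurable_sections X"
    unfolding measurable_sections_def
  proof (intro CollectI conjI ballI allI impI)
    show "l z \<in> fib X z" for z by (rule lfib)
    fix e p assume e: "e \<in> atlas X" "p < rk e"
    show "(\<lambda>z. if z \<in> patch e then triv e z (l z) p else 0) \<in> borel_measurable borel"
    proof (rule borel_measurable_LIMSEQ_metric)
      show "(\<lambda>z. if z \<in> E then (if z \<in> patch e then triv e z (x n z) p else 0) else 0) \<in> borel_measurable borel" for n
        by (rule measurable_If_set) (use Em measurable_sections_triv[OF L2_measurable[OF x] e(1)] in auto)
      fix z :: 'm
      show "(\<lambda>n. if z \<in> E then (if z \<in> patch e then triv e z (x n z) p else 0) else 0) \<longlonglongrightarrow>
          (if z \<in> patch e then triv e z (l z) p else 0)"
      proof (cases "z \<in> E \<and> z \<in> patch e")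
        case False
        then show ?thesis using triv_0[OF e(1)] by (auto simp: l_def)
      next
        case True
        have K: "compact {coord e z}" "{coord e z} \<subseteq> img e" using coord_img[OF e(1)] True by auto
        obtain C2 where C2: "C2 > 0" "\<And>v. v \<in> fib X z \<Longrightarrow> (\<Sum>p<rk e. (norm (triv e z v p))\<^sup>2) \<le> C2 * fsq z v"
          using fsq_lower[OF e(1) K] True by blast
        have "(\<lambda>n. triv e z (x n z) p - triv e z (l z) p) \<longlonglongrightarrow> 0"
        proof (rule Lim_null_comparison)
          have "norm (triv e z (x n z) p - triv e z (l z) p) \<le> sqrt (C2 * fsq z (x n z - l z))" for n
          proof (rule real_le_rsqrt)
            have "(norm (triv e z (x n z - l z) p))\<^sup>2 \<le> (\<Sum>p<rk e. (norm (triv e z (x n z - l z) p))\<^sup>2)"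
              using e(2) by (intro member_le_sum) auto
            also have "\<dots> \<le> C2 * fsq z (x n z - l z)" by (intro C2(2) fibre.V_diff L2_fib x lfib)
            finally show "(norm (triv e z (x n z) p - triv e z (l z) p))\<^sup>2 \<le> C2 * fsq z (x n z - l z)"
              using triv_diff[OF e(1) _ L2_fib[OF x] lfib] True by simp
          qed
          then show "eventually (\<lambda>n. norm (triv e z (x n z) p - triv e z (l z) p) \<le> sqrt (C2 * fsq z (x n z - l z))) sequentially"
            by simp
          have "(\<lambda>n. sqrt (C2 * fsq z (x n z - l z))) \<longlonglongrightarrow> sqrt (C2 * 0)"
            using lE True by (intro tendsto_intros) auto
          then show "(\<lambda>n. sqrt (C2 * fsq z (x n z - l z))) \<longlonglongrightarrow> 0" by simp
        qed
        then show ?thesis using True by (simp flip: Lim_null)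
      qed
    qed
  qed
  \<comment> \<open>The induction keeps the difference of two powers, which absorbs the next
    increment exactly.\<close>
  have dist: "L2_norm X (x m - x n) \<le> c * 2 * (1 / 2) ^ n" if "n \<le> m" for m n
  proof -
    have "L2_norm X (x m - x n) \<le> c * 2 * ((1 / 2) ^ n - (1 / 2) ^ m)"
      using that
    proof (induction m rule: dec_induct)
      case base then show ?case using L2.nrm_sc[OF L2_0, of 0] by (simp add: L2_nrm zero_fun_def)
    next
      case (step m)
      have "L2_norm X (x (Suc m) - x n) \<le> L2_norm X (x (Suc m) - x m) + L2_norm X (x m - x n)"
        using L2.nrm_triangle_diff[OF x x x] by (simp add: L2_nrm)
      moreover have e: "c * 2 * ((1 / 2) ^ n - (1 / 2) ^ k) = 2 * (c * (1 / 2) ^ n) - 2 * (c * (1 / 2) ^ k)" for k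
        by (simp add: right_diff_distrib)
      moreover have "c * (1 / 2) ^ Suc m = c * (1 / 2) ^ m / 2" by simp
      ultimately show ?case using step.IH xc[of m] unfolding e by linarith
    qed
    also have "\<dots> \<le> c * 2 * (1 / 2) ^ n" using c0 by (intro mult_left_mono) auto
    finally show ?thesis .
  qed
  have minus_sec: "x n - l \<in> measurable_sections X" for n
  proof -
    have "x n + sscal (-1) l \<in> measurable_sections X"
      unfolding sscal_def by (intro measurable_sections_add measurable_sections_scal lm L2_measurable x)
    moreover have "x n + sscal (-1) l = x n - l" by (simp add: fun_eq_iff sscal_def)
    ultimately show ?thesis by simp
  qed
  \<comment> \<open>Fatou's lemma carries the distance estimate from the later terms
    \<open>x (n + m)\<close> to the pointwise limit.\<close>
  have fatou: "(\<integral>\<^sup>+z. ennreal (fsq z ((x n - l) z)) \<partial>dens X) \<le> ennreal ((c * 2 * (1 / 2) ^ n)\<^sup>2)" for n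
  proof -
    have "AE z in dens X. ennreal (fsq z ((x n - l) z)) = liminf (\<lambda>m. ennreal (fsq z ((x (n + m) - x n) z)))"
      using \<open>AE z in dens X. G z \<noteq> \<infinity>\<close>
    proof eventually_elim
      fix z assume "G z \<noteq> \<infinity>"
      then have z: "z \<in> E" by (simp add: E_def)
      have mem: "x k z \<in> fib X z" for k by (rule L2_fib[OF x])
      have sq: "fsq z v = (fibre.nrm z v)\<^sup>2" if "v \<in> fib X z" for v
        using that by (simp add: fibre.nrm_sq fsq_def)
      have "(\<lambda>m. fibre.nrm z (x (n + m) z - x n z) - fibre.nrm z (l z - x n z)) \<longlonglongrightarrow> 0"
      proof (rule Lim_null_comparison)
        have "norm (fibre.nrm z (x (n + m) z - x n z) - fibre.nrm z (l z - x n z)) \<le> sqrt (fsq z (x (m + n) z - l z))" for m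
          using fibre.nrm_triangle_diff[OF mem[of "n + m"] lfib mem[of n]]
            fibre.nrm_triangle_diff[OF lfib mem[of "n + m"] mem[of n]]
            fibre.nrm_diff_commute[OF lfib mem[of "n + m"]]
          by (simp add: fibre.nrm_def fsq_def add.commute abs_le_iff)
        then show "eventually (\<lambda>m. norm (fibre.nrm z (x (n + m) z - x n z) - fibre.nrm z (l z - x n z)) \<le> sqrt (fsq z (x (m + n) z - l z))) sequentially"
          by simp
        have "(\<lambda>m. sqrt (fsq z (x (m + n) z - l z))) \<longlonglongrightarrow> sqrt 0"
          using lE[OF z] by (intro tendsto_real_sqrt LIMSEQ_ignore_initial_segment[of "\<lambda>m. fsq z (x m z - l z)"]) auto
        then show "(\<lambda>m. sqrt (fsq z (x (m + n) z - l z))) \<longlonglongrightarrow> 0" by simp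
      qed
      then have "(\<lambda>m. fibre.nrm z (x (n + m) z - x n z)) \<longlonglongrightarrow> fibre.nrm z (l z - x n z)" by (simp flip: Lim_null)
      then have "(\<lambda>m. (fibre.nrm z (x (n + m) z - x n z))\<^sup>2) \<longlonglongrightarrow> (fibre.nrm z (l z - x n z))\<^sup>2" by (rule tendsto_power)
      then have "(\<lambda>m. fsq z ((x (n + m) - x n) z)) \<longlonglongrightarrow> fsq z ((x n - l) z)"
        using fibre.nrm_diff_commute[OF lfib mem[of n]]
        by (simp add: sq fibre.V_diff L2_fib x lfib)
      then have "(\<lambda>m. ennreal (fsq z ((x (n + m) - x n) z))) \<longlonglongrightarrow> ennreal (fsq z ((x n - l) z))" by (rule tendsto_ennrealI)
      then show "ennreal (fsq z ((x n - l) z)) = liminf (\<lambda>m. ennreal (fsq z ((x (n + m) - x n) z)))"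
        by (intro lim_imp_Liminf[symmetric]) auto
    qed
    then have "(\<integral>\<^sup>+z. ennreal (fsq z ((x n - l) z)) \<partial>dens X) = (\<integral>\<^sup>+z. liminf (\<lambda>m. ennreal (fsq z ((x (n + m) - x n) z))) \<partial>dens X)"
      by (rule nn_integral_cong_AE)
    also have "\<dots> \<le> liminf (\<lambda>m. \<integral>\<^sup>+z. ennreal (fsq z ((x (n + m) - x n) z)) \<partial>dens X)"
      by (intro nn_integral_liminf fm L2_measurable L2.V_diff x)
    also have "\<dots> \<le> ennreal ((c * 2 * (1 / 2) ^ n)\<^sup>2)"
    proof (rule Liminf_le, simp, intro always_eventually allI)
      fix m
      have "(L2_norm X (x (n + m) - x n))\<^sup>2 \<le> (c * 2 * (1 / 2) ^ n)\<^sup>2"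
        using dist[of n "n + m"] by (intro power_mono L2_norm_eq(2) L2.V_diff x) auto
      then show "(\<integral>\<^sup>+z. ennreal (fsq z ((x (n + m) - x n) z)) \<partial>dens X) \<le> ennreal ((c * 2 * (1 / 2) ^ n)\<^sup>2)"
        unfolding L2_norm_eq(1)[OF L2.V_diff[OF x x], symmetric] by (rule ennreal_leI)
    qed
    finally show ?thesis .
  qed
  have mem: "x n - l \<in> L2 X" for n
    using fatou[of n] minus_sec[of n] by (auto simp: L2_iff intro: le_less_trans)
  have "l \<in> L2 X" using L2.V_diff[OF x[of 0] mem[of 0]] by simp
  moreover have "(\<lambda>n. L2_norm X (x n - l)) \<longlonglongrightarrow> 0"
  proof (rule Lim_null_comparison)
    have "norm (L2_norm X (x n - l)) \<le> c * 2 * (1 / 2) ^ n" for n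
    proof -
      have "L2_norm X (x n - l) \<le> c * 2 * (1 / 2) ^ n" by (rule L2_norm_le[OF mem _ fatou]) (use c0 in simp)
      then show ?thesis using L2_norm_eq(2)[OF mem[of n]] by simp
    qed
    then show "eventually (\<lambda>n. norm (L2_norm X (x n - l)) \<le> c * 2 * (1 / 2) ^ n) sequentially" by simp
    show "(\<lambda>n. c * 2 * (1 / 2) ^ n) \<longlonglongrightarrow> 0" by (intro tendsto_mult_right_zero LIMSEQ_realpow_zero) auto
  qed
  ultimately show ?thesis by blast
qed

end

section \<open>Density of smooth sections\<close>

subsection \<open>Density of test functions on Euclidean space\<close>

text \<open>One minus the product of \<open>1 - plateau\<close> over a finite cover of
  \<open>K\<close>: it is 1 as soon as one plateau is 1, and 0 where all of them vanish.\<close>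

lemma smooth_urysohn:
  fixes K U :: "'a::euclidean_space set"
  assumes K: "compact K" and U: "open U" and KU: "K \<subseteq> U"
  shows "\<exists>h. smooth_on UNIV (\<lambda>x. complex_of_real (h x)) \<and> (\<forall>x. 0 \<le> h x \<and> h x \<le> 1) \<and>
    (\<forall>x\<in>K. h x = 1) \<and> (\<forall>x. x \<notin> U \<longrightarrow> h x = 0)"
proof -
  have "\<exists>r>0. cball x (2 * r) \<subseteq> U" if "x \<in> K" for x
  proof -
    obtain e where "e > 0" "cball x e \<subseteq> U" using U KU \<open>x \<in> K\<close> open_contains_cball by blast
    then show ?thesis by (intro exI[of _ "e / 2"]) auto
  qed
  then obtain r where r: "\<And>x. x \<in> K \<Longrightarrow> r x > 0" "\<And>x. x \<in> K \<Longrightarrow> cball x (2 * r x) \<subseteq> U" by metis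
  have "K \<subseteq> (\<Union>x\<in>K. ball x (r x))" using r by force
  then obtain F where F: "F \<subseteq> K" "finite F" "K \<subseteq> (\<Union>x\<in>F. ball x (r x))"
    using compactE_image[OF K, of K "\<lambda>x. ball x (r x)"] by blast
  define h where "h x = 1 - (\<Prod>z\<in>F. 1 - Re (plateau z (r z) (2 * r z) x))" for x
  have re: "complex_of_real (Re (plateau z s s' x)) = plateau z s s' x" for z x :: 'a and s s'
    by (simp add: plateau_def)
  have fac: "0 \<le> 1 - Re (plateau z (r z) (2 * r z) x)" "1 - Re (plateau z (r z) (2 * r z) x) \<le> 1" for z x
    using smooth_step_bounds by (auto simp: plateau_def simp del: of_real_mult)
  have p01: "0 \<le> (\<Prod>z\<in>F. 1 - Re (plateau z (r z) (2 * r z) x))" "(\<Prod>z\<in>F. 1 - Re (plateau z (r z) (2 * r z) x)) \<le> 1" for x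
    using fac by (auto intro: prod_nonneg prod_le_1)
  have "smooth_on UNIV (\<lambda>x. 1 - (\<Prod>z\<in>F. 1 - plateau z (r z) (2 * r z) x))"
    by (intro smooth_on_diff smooth_on_prod smooth_on_const smooth_on_plateau open_UNIV)
  also have "(\<lambda>x. 1 - (\<Prod>z\<in>F. 1 - plateau z (r z) (2 * r z) x)) = (\<lambda>x. complex_of_real (h x))"
    unfolding h_def of_real_diff of_real_prod re by simp
  finally have "smooth_on UNIV (\<lambda>x. complex_of_real (h x))" .
  moreover have "\<forall>x. 0 \<le> h x \<and> h x \<le> 1" using p01 by (simp add: h_def)
  moreover have "h x = 1" if xK: "x \<in> K" for x
  proof -
    obtain z where z: "z \<in> F" "x \<in> ball z (r z)" using F xK by blast
    then have "plateau z (r z) (2 * r z) x = 1"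
      using r(1)[of z] F by (intro plateau_eq_1) (auto simp: dist_commute)
    then have "\<exists>z\<in>F. 1 - Re (plateau z (r z) (2 * r z) x) = 0" using z by (intro bexI[of _ z]) auto
    then show ?thesis using F(2) by (simp add: h_def)
  qed
  moreover have "h x = 0" if "x \<notin> U" for x
  proof -
    have "plateau z (r z) (2 * r z) x = 0" if z: "z \<in> F" for z
    proof -
      have "x \<notin> cball z (2 * r z)" using r(2)[of z] F z \<open>x \<notin> U\<close> by blast
      then show ?thesis using r(1)[of z] F z by (intro plateau_eq_0) (auto simp: dist_commute)
    qed
    then show ?thesis by (simp add: h_def)
  qed
  ultimately show ?thesis by blast
qed

text \<open>The error is a squared distance. The approximants must vanish outside \<open>S\<close>
  so that a chart can carry them to the manifold and extend them by zero.\<close>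

definition L2_approximable :: "'a::euclidean_space set \<Rightarrow> ('a \<Rightarrow> complex) \<Rightarrow> bool" where
  "L2_approximable S f \<longleftrightarrow> (\<forall>e>0. \<exists>g. test_function g \<and> (\<forall>x. x \<notin> S \<longrightarrow> g x = 0) \<and>
     (\<integral>\<^sup>+x. ennreal ((norm (f x - g x))\<^sup>2) \<partial>lborel) \<le> ennreal e)"

lemma norm_add_squared_le: "(norm (a + b :: complex))\<^sup>2 \<le> 2 * (norm a)\<^sup>2 + 2 * (norm b)\<^sup>2"
proof -
  have "(norm (a + b))\<^sup>2 \<le> (norm a + norm b)\<^sup>2" by (intro power_mono norm_triangle_ineq) auto
  also have "\<dots> \<le> 2 * (norm a)\<^sup>2 + 2 * (norm b)\<^sup>2"
    using sum_squares_bound[of "norm a" "norm b"] by (simp add: power2_sum)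
  finally show ?thesis .
qed

lemma nn_integral_norm_add_squared_le:
  fixes f g :: "'a \<Rightarrow> complex"
  assumes [measurable]: "f \<in> borel_measurable M" "g \<in> borel_measurable M"
  shows "(\<integral>\<^sup>+x. ennreal ((norm (f x + g x))\<^sup>2) \<partial>M) \<le>
    2 * (\<integral>\<^sup>+x. ennreal ((norm (f x))\<^sup>2) \<partial>M) + 2 * (\<integral>\<^sup>+x. ennreal ((norm (g x))\<^sup>2) \<partial>M)"
proof -
  have "(\<integral>\<^sup>+x. ennreal ((norm (f x + g x))\<^sup>2) \<partial>M) \<le> (\<integral>\<^sup>+x. 2 * ennreal ((norm (f x))\<^sup>2) + 2 * ennreal ((norm (g x))\<^sup>2) \<partial>M)"
  proof (rule nn_integral_mono)
    fix x
    have "ennreal ((norm (f x + g x))\<^sup>2) \<le> ennreal (2 * (norm (f x))\<^sup>2 + 2 * (norm (g x))\<^sup>2)"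
      by (intro ennreal_leI norm_add_squared_le)
    then show "ennreal ((norm (f x + g x))\<^sup>2) \<le> 2 * ennreal ((norm (f x))\<^sup>2) + 2 * ennreal ((norm (g x))\<^sup>2)"
      by (simp add: ennreal_mult)
  qed
  also have "\<dots> = 2 * (\<integral>\<^sup>+x. ennreal ((norm (f x))\<^sup>2) \<partial>M) + 2 * (\<integral>\<^sup>+x. ennreal ((norm (g x))\<^sup>2) \<partial>M)"
    by (simp add: nn_integral_add nn_integral_cmult)
  finally show ?thesis .
qed

lemma four_quarters: "e > 0 \<Longrightarrow> 2 * ennreal (e / 4) + 2 * ennreal (e / 4) = ennreal e"
proof -
  assume e: "e > 0"
  have "ennreal (2 * (e / 4)) = ennreal 2 * ennreal (e / 4)" using e by (intro ennreal_mult) auto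
  then have "2 * ennreal (e / 4) = ennreal (e / 2)" by simp
  then show ?thesis using e by (simp add: ennreal_plus[symmetric] del: ennreal_plus)
qed

lemma test_function_measurable: "test_function g \<Longrightarrow> g \<in> borel_measurable borel"
  by (intro borel_measurable_continuous_onI test_function_continuous)

lemma L2_approximable_0: "L2_approximable S (\<lambda>_. 0)"
  unfolding L2_approximable_def
  by (auto intro!: exI[of _ "\<lambda>_. 0"] test_functionI[of _ "{}"] smooth_on_const)

lemma test_function_add:
  assumes "test_function h" "test_function g" shows "test_function (\<lambda>x. h x + g x)"
  using assms notin_supp[of _ h] notin_supp[of _ g]
  by (intro test_functionI[of _ "supp h \<union> supp g"] smooth_on_add) (auto simp: test_function_def)

lemma L2_approximable_add:
  assumes f: "L2_approximable S f" "f \<in> borel_measurable borel" and g: "L2_approximable S g" "g \<in> borel_measurable borel"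
  shows "L2_approximable S (\<lambda>x. f x + g x)"
  unfolding L2_approximable_def
proof (intro allI impI)
  fix e :: real assume e: "e > 0"
  obtain f' where f': "test_function f'" "\<And>x. x \<notin> S \<Longrightarrow> f' x = 0" "(\<integral>\<^sup>+x. ennreal ((norm (f x - f' x))\<^sup>2) \<partial>lborel) \<le> ennreal (e / 4)"
    using f(1) e unfolding L2_approximable_def by (meson divide_pos_pos zero_less_numeral)
  obtain g' where g': "test_function g'" "\<And>x. x \<notin> S \<Longrightarrow> g' x = 0" "(\<integral>\<^sup>+x. ennreal ((norm (g x - g' x))\<^sup>2) \<partial>lborel) \<le> ennreal (e / 4)"
    using g(1) e unfolding L2_approximable_def by (meson divide_pos_pos zero_less_numeral)
  have "(\<integral>\<^sup>+x. ennreal ((norm ((f x - f' x) + (g x - g' x)))\<^sup>2) \<partial>lborel) \<le>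
      2 * (\<integral>\<^sup>+x. ennreal ((norm (f x - f' x))\<^sup>2) \<partial>lborel) + 2 * (\<integral>\<^sup>+x. ennreal ((norm (g x - g' x))\<^sup>2) \<partial>lborel)"
    using f(2) g(2) test_function_measurable[OF f'(1)] test_function_measurable[OF g'(1)]
    by (intro nn_integral_norm_add_squared_le borel_measurable_diff) auto
  also have "\<dots> \<le> 2 * ennreal (e / 4) + 2 * ennreal (e / 4)"
    by (intro add_mono mult_left_mono f' g') auto
  also have "\<dots> = ennreal e"
  using e by (rule four_quarters)
  finally have "(\<integral>\<^sup>+x. ennreal ((norm (f x + g x - (f' x + g' x)))\<^sup>2) \<partial>lborel) \<le> ennreal e"
    by (simp add: algebra_simps)
  then show "\<exists>h. test_function h \<and> (\<forall>x. x \<notin> S \<longrightarrow> h x = 0) \<and> (\<integral>\<^sup>+x. ennreal ((norm (f x + g x - h x))\<^sup>2) \<partial>lborel) \<le> ennreal e"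
    using f' g' by (intro exI[of _ "\<lambda>x. f' x + g' x"]) (auto intro: test_function_add)
qed

lemma L2_approximable_sum:
  assumes "finite A" "\<And>i. i \<in> A \<Longrightarrow> L2_approximable S (f i)" "\<And>i. i \<in> A \<Longrightarrow> f i \<in> borel_measurable borel"
  shows "L2_approximable S (\<lambda>x. \<Sum>i\<in>A. f i x)"
  using assms
proof (induction A)
  case empty then show ?case using L2_approximable_0 by simp
next
  case (insert i A)
  have "L2_approximable S (\<lambda>x. f i x + (\<Sum>i\<in>A. f i x))"
    using insert by (intro L2_approximable_add borel_measurable_sum) auto
  then show ?case using insert by simp
qed

lemma L2_approximable_cmult:
  assumes f: "L2_approximable S f" "f \<in> borel_measurable borel"
  shows "L2_approximable S (\<lambda>x. c * f x)"
proof (cases "c = 0")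
  case True then show ?thesis using L2_approximable_0 by simp
next
  case False
  show ?thesis unfolding L2_approximable_def
  proof (intro allI impI)
    fix e :: real assume e: "e > 0"
    have c: "(norm c)\<^sup>2 > 0" using False by simp
    obtain f' where f': "test_function f'" "\<And>x. x \<notin> S \<Longrightarrow> f' x = 0"
        "(\<integral>\<^sup>+x. ennreal ((norm (f x - f' x))\<^sup>2) \<partial>lborel) \<le> ennreal (e / (norm c)\<^sup>2)"
      using f(1) e c unfolding L2_approximable_def by (meson divide_pos_pos)
    have "(\<integral>\<^sup>+x. ennreal ((norm (c * f x - c * f' x))\<^sup>2) \<partial>lborel) =
        (\<integral>\<^sup>+x. ennreal ((norm c)\<^sup>2) * ennreal ((norm (f x - f' x))\<^sup>2) \<partial>lborel)"
      by (intro nn_integral_cong) (simp add: right_diff_distrib[symmetric] norm_mult power_mult_distrib ennreal_mult)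
    also have "\<dots> = ennreal ((norm c)\<^sup>2) * (\<integral>\<^sup>+x. ennreal ((norm (f x - f' x))\<^sup>2) \<partial>lborel)"
      using f(2) test_function_measurable[OF f'(1)] by (intro nn_integral_cmult) auto
    also have "\<dots> \<le> ennreal ((norm c)\<^sup>2) * ennreal (e / (norm c)\<^sup>2)" by (intro mult_left_mono f') auto
    also have "\<dots> = ennreal e" using c e by (simp add: ennreal_mult[symmetric])
    finally show "\<exists>g. test_function g \<and> (\<forall>x. x \<notin> S \<longrightarrow> g x = 0) \<and> (\<integral>\<^sup>+x. ennreal ((norm (c * f x - g x))\<^sup>2) \<partial>lborel) \<le> ennreal e"
      using f' test_function_mult[OF f'(1) smooth_on_const, of c] by (intro exI[of _ "\<lambda>x. c * f' x"]) auto
  qed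
qed

text \<open>Outer regularity of \<open>A\<close> and of its complement in the closed ball traps
  \<open>A\<close> between a compact \<open>K\<close> and an open \<open>U\<close>. A smooth
  function that is 1 on \<open>K\<close> and 0 off \<open>U\<close> differs from the indicator only
  on two sets of small measure.\<close>

lemma L2_approximable_indicator:
  fixes A :: "'a::euclidean_space set"
  assumes A: "A \<in> sets borel" "A \<subseteq> ball c R"
  shows "L2_approximable (cball c R) (indicator A)"
  unfolding L2_approximable_def
proof (intro allI impI)
  fix e :: real assume e: "e > 0"
  obtain U0 where U0: "open U0" "A \<subseteq> U0" "emeasure lborel (U0 - A) < ennreal (e / 2)"
    using outer_regular_lborel[OF A(1), of "e / 2"] e by auto
  have B: "cball c R - A \<in> sets borel" using A by auto
  obtain W where W: "open W" "cball c R - A \<subseteq> W" "emeasure lborel (W - (cball c R - A)) < ennreal (e / 2)"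
    using outer_regular_lborel[OF B, of "e / 2"] e by auto
  define U where "U = U0 \<inter> ball c R"
  define K where "K = cball c R - W"
  have K: "compact K" unfolding K_def using W by (intro compact_diff) auto
  have KA: "K \<subseteq> A" and AU: "A \<subseteq> U" and U: "open U" using W U0 A by (auto simp: K_def U_def)
  obtain h where h: "smooth_on UNIV (\<lambda>x. complex_of_real (h x))" "\<And>x. 0 \<le> h x \<and> h x \<le> 1"
      "\<And>x. x \<in> K \<Longrightarrow> h x = 1" "\<And>x. x \<notin> U \<Longrightarrow> h x = 0"
    using smooth_urysohn[OF K U] KA AU by blast
  have hb: "h x = 0" if "x \<notin> cball c R" for x using that by (intro h(4)) (auto simp: U_def)
  have sm: "U0 - A \<in> sets borel" "W - (cball c R - A) \<in> sets borel" using U0 W A B by auto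
  have "(\<integral>\<^sup>+x. ennreal ((norm (indicator A x - complex_of_real (h x)))\<^sup>2) \<partial>lborel) \<le>
      (\<integral>\<^sup>+x. indicator (U0 - A) x + indicator (W - (cball c R - A)) x \<partial>lborel)"
  proof (rule nn_integral_mono)
    fix x
    have n1: "norm (1 - complex_of_real (h x)) \<le> 1" "norm (complex_of_real (h x)) \<le> 1"
    proof -
      have "1 - complex_of_real (h x) = complex_of_real (1 - h x)" by simp
      then have "norm (1 - complex_of_real (h x)) = \<bar>1 - h x\<bar>" by (simp only: norm_of_real)
      then show "norm (1 - complex_of_real (h x)) \<le> 1" "norm (complex_of_real (h x)) \<le> 1"
        using h(2)[of x] by simp_all
    qed
    have le1: "ennreal ((norm (indicator A x - complex_of_real (h x)))\<^sup>2) \<le> 1"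
      using n1 by (auto simp: indicator_def power_le_one)
    show "ennreal ((norm (indicator A x - complex_of_real (h x)))\<^sup>2) \<le> indicator (U0 - A) x + indicator (W - (cball c R - A)) x"
    proof (cases "x \<in> K \<or> x \<notin> U")
      case True
      then have "indicator A x - complex_of_real (h x) = 0" using h(3,4) KA AU by (auto simp: indicator_def)
      then show ?thesis by simp
    next
      case False
      then have "x \<in> U0 - A \<or> x \<in> W - (cball c R - A)" by (auto simp: U_def K_def)
      then have "1 \<le> (indicator (U0 - A) x + indicator (W - (cball c R - A)) x :: ennreal)" by (auto simp: indicator_def)
      then show ?thesis using le1 by (rule order_trans[rotated])
    qed
  qed
  also have "\<dots> = emeasure lborel (U0 - A) + emeasure lborel (W - (cball c R - A))"
    using sm by (subst nn_integral_add) auto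
  also have "\<dots> \<le> ennreal (e / 2) + ennreal (e / 2)" using U0 W by (intro add_mono) auto
  also have "\<dots> = ennreal e" using e by (simp add: ennreal_plus[symmetric] del: ennreal_plus)
  finally show "\<exists>g. test_function g \<and> (\<forall>x. x \<notin> cball c R \<longrightarrow> g x = 0) \<and> (\<integral>\<^sup>+x. ennreal ((norm (indicator A x - g x))\<^sup>2) \<partial>lborel) \<le> ennreal e"
    using test_functionI[OF h(1) compact_cball[of c R]] hb by (intro exI[of _ "\<lambda>x. complex_of_real (h x)"]) auto
qed

text \<open>The approximating simple functions satisfy
  \<open>norm (F i x) \<le> 2 * norm (f x)\<close>. They vanish where \<open>f\<close> does, so
  their nonzero level sets lie in the ball and are covered by the case of indicators.\<close>

lemma L2_approximable_supported:
  fixes f :: "'a::euclidean_space \<Rightarrow> complex"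
  assumes f: "f \<in> borel_measurable borel" "(\<integral>\<^sup>+x. ennreal ((norm (f x))\<^sup>2) \<partial>lborel) < \<infinity>"
    and z: "\<And>x. x \<notin> ball c R \<Longrightarrow> f x = 0"
  shows "L2_approximable (cball c R) f"
proof -
  obtain F where F: "\<And>i. simple_function borel (F i)" "\<And>x. (\<lambda>i. F i x) \<longlonglongrightarrow> f x"
      "\<And>i x. norm (F i x) \<le> 2 * norm (f x)"
    using borel_measurable_implies_sequence_metric[OF f(1), of 0] by auto
  have Fm: "F i \<in> borel_measurable borel" for i using F(1) by (rule borel_measurable_simple_function)
  have FA: "L2_approximable (cball c R) (F i)" for i
  proof -
    have fin: "finite (range (F i))" using F(1)[of i] by (simp add: simple_function_def)
    have "L2_approximable (cball c R) (\<lambda>x. \<Sum>y\<in>range (F i). y * indicator (F i -` {y}) x)"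
    proof (rule L2_approximable_sum[OF fin])
      fix y assume "y \<in> range (F i)"
      have s: "F i -` {y} \<in> sets borel" using measurable_sets[OF Fm, of "{y}" i] by simp
      show m: "(\<lambda>x. y * indicator (F i -` {y}) x) \<in> borel_measurable borel" using s by auto
      show "L2_approximable (cball c R) (\<lambda>x. y * indicator (F i -` {y}) x)"
      proof (cases "y = 0")
        case True then show ?thesis using L2_approximable_0 by simp
      next
        case False
        have "F i -` {y} \<subseteq> ball c R"
        proof
          fix x assume x: "x \<in> F i -` {y}"
          show "x \<in> ball c R"
          proof (rule ccontr)
            assume "x \<notin> ball c R"
            then show False using z[of x] F(3)[of i x] x False by auto
          qed
        qed
        then show ?thesis using s by (intro L2_approximable_cmult L2_approximable_indicator) auto
      qed
    qed
    also have "(\<lambda>x. \<Sum>y\<in>range (F i). y * indicator (F i -` {y}) x) = F i"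
    proof
      fix x
      have "(\<Sum>y\<in>range (F i). y * indicator (F i -` {y}) x) = (\<Sum>y\<in>range (F i). if F i x = y then y else 0)"
        by (intro sum.cong) (auto simp: indicator_def)
      also have "\<dots> = F i x" by (subst sum.delta'[OF fin]) simp
      finally show "(\<Sum>y\<in>range (F i). y * indicator (F i -` {y}) x) = F i x" .
    qed
    finally show ?thesis .
  qed
  have lim: "(\<lambda>i. \<integral>\<^sup>+x. ennreal ((norm (f x - F i x))\<^sup>2) \<partial>lborel) \<longlonglongrightarrow> (\<integral>\<^sup>+(x::'a). 0 \<partial>lborel)"
  \<comment> \<open>The distance from \<open>F i x\<close> to \<open>f x\<close> is at most three
    times \<open>norm (f x)\<close>, and 9 is the square of 3.\<close>
  proof (rule nn_integral_dominated_convergence[where w="\<lambda>x. 9 * ennreal ((norm (f x))\<^sup>2)"])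
    show "(\<lambda>x. ennreal ((norm (f x - F i x))\<^sup>2)) \<in> borel_measurable lborel" for i using f(1) Fm by simp
    show "(\<lambda>x. 9 * ennreal ((norm (f x))\<^sup>2)) \<in> borel_measurable lborel" using f(1) by simp
    show "(\<integral>\<^sup>+x. 9 * ennreal ((norm (f x))\<^sup>2) \<partial>lborel) < \<infinity>"
      using f by (auto simp: nn_integral_cmult ennreal_mult_less_top)
    have "ennreal ((norm (f x - F i x))\<^sup>2) \<le> 9 * ennreal ((norm (f x))\<^sup>2)" for i x
    proof -
      have "norm (f x - F i x) \<le> 3 * norm (f x)" using norm_triangle_ineq4[of "f x" "F i x"] F(3)[of i x] by linarith
      then have "(norm (f x - F i x))\<^sup>2 \<le> (3 * norm (f x))\<^sup>2" by (intro power_mono) auto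
      then have "ennreal ((norm (f x - F i x))\<^sup>2) \<le> ennreal (9 * (norm (f x))\<^sup>2)"
        by (intro ennreal_leI) (simp add: power_mult_distrib)
      then show ?thesis by (simp add: ennreal_mult)
    qed
    then show "AE x in lborel. ennreal ((norm (f x - F i x))\<^sup>2) \<le> 9 * ennreal ((norm (f x))\<^sup>2)" for i by simp
    have "(\<lambda>i. ennreal ((norm (f x - F i x))\<^sup>2)) \<longlonglongrightarrow> ennreal ((norm (f x - f x))\<^sup>2)" for x
      by (intro tendsto_ennrealI tendsto_intros F)
    then show "AE x in lborel. (\<lambda>i. ennreal ((norm (f x - F i x))\<^sup>2)) \<longlonglongrightarrow> 0" by simp
  qed simp
  show ?thesis unfolding L2_approximable_def
  proof (intro allI impI)
    fix e :: real assume e: "e > 0"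
    then have "0 < ennreal (e / 4)" by simp
    then obtain i where i: "(\<integral>\<^sup>+x. ennreal ((norm (f x - F i x))\<^sup>2) \<partial>lborel) < ennreal (e / 4)"
      using order_tendstoD(2)[OF lim, of "ennreal (e / 4)"] by (auto dest: eventually_happens)
    obtain g where g: "test_function g" "\<And>x. x \<notin> cball c R \<Longrightarrow> g x = 0" "(\<integral>\<^sup>+x. ennreal ((norm (F i x - g x))\<^sup>2) \<partial>lborel) \<le> ennreal (e / 4)"
      using FA[of i] e unfolding L2_approximable_def by (meson divide_pos_pos zero_less_numeral)
    have "(\<integral>\<^sup>+x. ennreal ((norm ((f x - F i x) + (F i x - g x)))\<^sup>2) \<partial>lborel) \<le>
      2 * (\<integral>\<^sup>+x. ennreal ((norm (f x - F i x))\<^sup>2) \<partial>lborel) + 2 * (\<integral>\<^sup>+x. ennreal ((norm (F i x - g x))\<^sup>2) \<partial>lborel)"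
      using f(1) Fm test_function_measurable[OF g(1)]
      by (intro nn_integral_norm_add_squared_le borel_measurable_diff) auto
    also have "\<dots> \<le> 2 * ennreal (e / 4) + 2 * ennreal (e / 4)"
      using i g by (intro add_mono mult_left_mono) auto
    also have "\<dots> = ennreal e"
    using e by (rule four_quarters)
    finally show "\<exists>g. test_function g \<and> (\<forall>x. x \<notin> cball c R \<longrightarrow> g x = 0) \<and> (\<integral>\<^sup>+x. ennreal ((norm (f x - g x))\<^sup>2) \<partial>lborel) \<le> ennreal e"
      using g by auto
  qed
qed

subsection \<open>Smooth functions and sections on the manifold\<close>

context hermitian_bundle
begin

lemma smooth_transition:
  assumes c: "c \<in> atlas X" and d: "d \<in> atlas X"
  shows "smooth_on (coord d ` (patch d \<inter> patch c)) (\<lambda>y. coord c (coord_inv d y))"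
    "p < rk d \<Longrightarrow> q < rk c \<Longrightarrow>
      smooth_on (coord c ` (patch c \<inter> patch d)) (\<lambda>y. triv d (coord_inv c y) (frame X c q (coord_inv c y)) p)"
proof -
  have "compatible_charts X d c" "compatible_charts X c d"
    using vbundle c d by (auto simp: smooth_vector_bundle_def)
  then show "smooth_on (coord d ` (patch d \<inter> patch c)) (\<lambda>y. coord c (coord_inv d y))"
    "p < rk d \<Longrightarrow> q < rk c \<Longrightarrow>
      smooth_on (coord c ` (patch c \<inter> patch d)) (\<lambda>y. triv d (coord_inv c y) (frame X c q (coord_inv c y)) p)"
    unfolding compatible_charts_def comp_def by auto
qed

lemma overlap_eq:
  assumes c: "c \<in> atlas X"
  shows "coord c ` (patch c \<inter> W) = {y \<in> img c. coord_inv c y \<in> W}"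
  using coord_inv_coord[OF c] coord_coord_inv[OF c] coord_inv_patch[OF c] coord_img[OF c]
  by (auto simp: image_iff) (metis IntI)

lemma open_overlap:
  assumes c: "c \<in> atlas X" and W: "open W"
  shows "open {y \<in> img c. coord_inv c y \<in> W}"
  using continuous_open_preimage[OF continuous_coord_inv[OF c] open_img[OF c] W]
  by (simp add: vimage_def Int_def)

text \<open>The chart domain \<open>img d\<close> is the union of two open sets: the overlap with
  \<open>patch c\<close>, where the transition map is smooth, and the complement of the preimage of
  \<open>K\<close>, where the extension vanishes. The preimage is compact and thus closed because
  the manifold is Hausdorff.\<close>

lemma smooth_change_chart:
  fixes G :: "'a \<Rightarrow> complex"
  assumes c: "c \<in> atlas X" and d: "d \<in> atlas X" and K: "compact K" "K \<subseteq> img c"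
    and G: "smooth_on (coord c ` (patch c \<inter> patch d)) G" and z: "\<And>y. y \<notin> K \<Longrightarrow> G y = 0"
  shows "smooth_on (img d) (\<lambda>y. if coord_inv d y \<in> patch c then G (coord c (coord_inv d y)) else 0)" (is "smooth_on _ ?f")
proof -
  define O1 where "O1 = {y \<in> img d. coord_inv d y \<in> patch c}"
  define O2 where "O2 = {y \<in> img d. coord_inv d y \<in> - {x \<in> patch c. coord c x \<in> K}}"
  have o: "open O1" "open O2"
    unfolding O1_def O2_def
    by (intro open_overlap d open_patch c, intro open_overlap d open_Compl compact_preimage(2) c K)
  have oc: "open (coord c ` (patch c \<inter> patch d))"
    unfolding overlap_eq[OF c] by (intro open_overlap c open_patch d)
  have "smooth_on O1 (\<lambda>y. G (coord c (coord_inv d y)))"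
  proof (rule smooth_on_compose[OF o(1) oc _ G])
    show "smooth_on O1 (\<lambda>y. coord c (coord_inv d y))"
      using smooth_transition(1)[OF c d] unfolding overlap_eq[OF d] O1_def .
    show "(\<lambda>y. coord c (coord_inv d y)) ` O1 \<subseteq> coord c ` (patch c \<inter> patch d)"
      using coord_inv_patch[OF d] by (auto simp: O1_def)
  qed
  then have "smooth_on O1 ?f" by (rule smooth_on_cong[OF o(1), rotated]) (auto simp: O1_def)
  moreover have "smooth_on O2 ?f" using o(2) z by (intro smooth_on_vanishing) (auto simp: O2_def)
  moreover have "O1 \<union> O2 = img d" by (auto simp: O1_def O2_def)
  ultimately show ?thesis using smooth_on_Un by metis
qed

section \<open>Smooth functions and smooth sections in charts\<close>

definition smooth_fun :: "('m \<Rightarrow> complex) \<Rightarrow> bool" where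
  "smooth_fun \<phi> \<longleftrightarrow> (\<forall>c\<in>atlas X. smooth_on (img c) (\<lambda>y. \<phi> (coord_inv c y)))"

lemma smooth_fun_const: "smooth_fun (\<lambda>_. z)"
  by (simp add: smooth_fun_def smooth_on_const)

lemma smooth_fun_diff: "smooth_fun f \<Longrightarrow> smooth_fun g \<Longrightarrow> smooth_fun (\<lambda>x. f x - g x)"
  unfolding smooth_fun_def by (auto intro: smooth_on_diff open_img)

lemma smooth_fun_mult: "smooth_fun f \<Longrightarrow> smooth_fun g \<Longrightarrow> smooth_fun (\<lambda>x. f x * g x)"
  unfolding smooth_fun_def by (auto intro: smooth_on_mult open_img)

lemma smooth_fun_prod: "(\<And>i. i \<in> A \<Longrightarrow> smooth_fun (f i)) \<Longrightarrow> smooth_fun (\<lambda>x. \<Prod>i\<in>A. f i x)"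
  unfolding smooth_fun_def by (auto intro: smooth_on_prod open_img)

lemma smooth_fun_chart:
  assumes c: "c \<in> atlas X" and K: "compact K" "K \<subseteq> img c" and h: "smooth_on (img c) h" "\<And>y. y \<notin> K \<Longrightarrow> h y = 0"
  shows "smooth_fun (\<lambda>x. if x \<in> patch c then h (coord c x) else 0)"
  unfolding smooth_fun_def
proof
  fix d assume d: "d \<in> atlas X"
  have "smooth_on (coord c ` (patch c \<inter> patch d)) h"
    by (rule smooth_on_subset[OF h(1)]) (use coord_img[OF c] in auto)
  from smooth_change_chart[OF c d K this h(2)]
  show "smooth_on (img d) (\<lambda>y. if coord_inv d y \<in> patch c then h (coord c (coord_inv d y)) else 0)" .
qed

lemma smooth_sections_fib: "u \<in> smooth_sections X \<Longrightarrow> u x \<in> fib X x"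
  by (simp add: smooth_sections_def)

lemma smooth_lcomp:
  assumes u: "u \<in> smooth_sections X" and c: "c \<in> atlas X"
  shows "smooth_on (img c) (lcomp c p u)"
proof (cases "p < rk c")
  case True
  then show ?thesis using u c unfolding smooth_sections_def lcomp_def[abs_def] by blast
next
  case False
  then show ?thesis
    using triv_ge_rk[OF c coord_inv_patch[OF c] smooth_sections_fib[OF u]]
    by (intro smooth_on_vanishing open_img c) (auto simp: lcomp_def)
qed

lemma smooth_sectionsI:
  assumes "\<And>x. u x \<in> fib X x" "\<And>c p. c \<in> atlas X \<Longrightarrow> p < rk c \<Longrightarrow> smooth_on (img c) (lcomp c p u)"
  shows "u \<in> smooth_sections X"
  using assms unfolding smooth_sections_def lcomp_def[abs_def] by blast

lemma smooth_sections_add: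
  assumes u: "u \<in> smooth_sections X" and v: "v \<in> smooth_sections X"
  shows "u + v \<in> smooth_sections X"
proof (rule smooth_sectionsI)
  show "(u + v) x \<in> fib X x" for x using smooth_sections_fib[OF u] smooth_sections_fib[OF v] fibre.V_add by simp
  fix c p assume c: "c \<in> atlas X"
  show "smooth_on (img c) (lcomp c p (u + v))"
    by (rule smooth_on_cong[OF open_img[OF c] _ smooth_on_add[OF open_img[OF c] smooth_lcomp[OF u c] smooth_lcomp[OF v c]]])
      (use triv_add[OF c coord_inv_patch[OF c] smooth_sections_fib[OF u] smooth_sections_fib[OF v]] in \<open>simp add: lcomp_def\<close>)
qed

lemma smooth_sections_mult:
  assumes u: "u \<in> smooth_sections X" and \<phi>: "smooth_fun \<phi>"
  shows "(\<lambda>x. scal X (\<phi> x) (u x)) \<in> smooth_sections X"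
proof (rule smooth_sectionsI)
  show "scal X (\<phi> x) (u x) \<in> fib X x" for x using smooth_sections_fib[OF u] fibre.V_sc by simp
  fix c p assume c: "c \<in> atlas X"
  have \<phi>c: "smooth_on (img c) (\<lambda>y. \<phi> (coord_inv c y))" using \<phi> c by (simp add: smooth_fun_def)
  show "smooth_on (img c) (lcomp c p (\<lambda>x. scal X (\<phi> x) (u x)))"
    by (rule smooth_on_cong[OF open_img[OF c] _ smooth_on_mult[OF open_img[OF c] \<phi>c smooth_lcomp[OF u c, of p]]])
      (use triv_scal[OF c coord_inv_patch[OF c] smooth_sections_fib[OF u]] in \<open>simp add: lcomp_def\<close>)
qed

lemma smooth_sections_scal: "u \<in> smooth_sections X \<Longrightarrow> (\<lambda>x. scal X z (u x)) \<in> smooth_sections X"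
  using smooth_sections_mult smooth_fun_const by blast

lemma smooth_sections_0: "0 \<in> smooth_sections X"
proof (rule smooth_sectionsI)
  show "0 x \<in> fib X x" for x by (simp add: fibre.V_0)
  fix c p assume c: "c \<in> atlas X"
  show "smooth_on (img c) (lcomp c p 0)"
    using triv_0[OF c coord_inv_patch[OF c]] by (intro smooth_on_vanishing open_img c) (simp add: lcomp_def)
qed

lemma smooth_sections_sum: "(\<And>i. i \<in> A \<Longrightarrow> u i \<in> smooth_sections X) \<Longrightarrow> (\<Sum>i\<in>A. u i) \<in> smooth_sections X"
  by (induction A rule: infinite_finite_induct) (auto intro: smooth_sections_0 smooth_sections_add)

definition chart_section :: "('m, 'a, 'f) bundle_chart \<Rightarrow> nat \<Rightarrow> ('a \<Rightarrow> complex) \<Rightarrow> 'm \<Rightarrow> 'f" where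
  "chart_section c q h = (\<lambda>x. if x \<in> patch c then scal X (h (coord c x)) (frame X c q x) else 0)"

lemma chart_section_fib: "c \<in> atlas X \<Longrightarrow> q < rk c \<Longrightarrow> chart_section c q h x \<in> fib X x"
  using frame_fib fibre.V_sc fibre.V_0 by (auto simp: chart_section_def)

text \<open>In another chart the components are \<open>h\<close> times the transition functions of
  the frames, extended by zero as in \<open>smooth_change_chart\<close>.\<close>

lemma chart_section_smooth:
  assumes c: "c \<in> atlas X" and q: "q < rk c" and K: "compact K" "K \<subseteq> img c"
    and h: "smooth_on (img c) h" "\<And>y. y \<notin> K \<Longrightarrow> h y = 0"
  shows "chart_section c q h \<in> smooth_sections X"
proof (rule smooth_sectionsI)
  show "chart_section c q h x \<in> fib X x" for x using c q by (rule chart_section_fib)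
  fix d p assume d: "d \<in> atlas X" and p: "p < rk d"
  let ?T = "\<lambda>y. triv d (coord_inv c y) (frame X c q (coord_inv c y)) p"
  have oc: "open (coord c ` (patch c \<inter> patch d))"
    unfolding overlap_eq[OF c] by (intro open_overlap c open_patch d)
  have "smooth_on (coord c ` (patch c \<inter> patch d)) (\<lambda>y. h y * ?T y)"
    using smooth_transition(2)[OF c d p q] h(1) coord_img[OF c]
    by (intro smooth_on_mult oc) (auto intro: smooth_on_subset)
  then have "smooth_on (img d) (\<lambda>y. if coord_inv d y \<in> patch c then h (coord c (coord_inv d y)) * ?T (coord c (coord_inv d y)) else 0)"
    by (rule smooth_change_chart[OF c d K]) (simp add: h)
  then show "smooth_on (img d) (lcomp d p (chart_section c q h))"
  proof (rule smooth_on_cong[OF open_img[OF d], rotated])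
    fix y assume y: "y \<in> img d"
    show "(if coord_inv d y \<in> patch c then h (coord c (coord_inv d y)) * ?T (coord c (coord_inv d y)) else 0) = lcomp d p (chart_section c q h) y"
      using triv_scal[OF d coord_inv_patch[OF d y] frame_fib[OF c _ q]] triv_0[OF d coord_inv_patch[OF d y]]
        coord_inv_coord[OF c] by (auto simp: lcomp_def chart_section_def)
  qed
qed

lemma lcomp_chart_section:
  assumes c: "c \<in> atlas X" and q: "q < rk c" and y: "y \<in> img c"
  shows "lcomp c p (chart_section c q h) y = (if p = q then h y else 0)"
  using triv_scal[OF c coord_inv_patch[OF c y] frame_fib[OF c coord_inv_patch[OF c y] q]]
    triv_frame[OF c coord_inv_patch[OF c y] q] coord_inv_patch[OF c y] coord_coord_inv[OF c y]
  by (simp add: lcomp_def chart_section_def)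

lemma smooth_sections_measurable:
  assumes u: "u \<in> smooth_sections X"
  shows "u \<in> measurable_sections X"
  unfolding measurable_sections_def
proof (intro CollectI conjI ballI allI impI)
  show "u x \<in> fib X x" for x using u by (rule smooth_sections_fib)
  fix c p assume c: "c \<in> atlas X"
  have "continuous_on (patch c) (\<lambda>x. lcomp c p u (coord c x))"
    by (rule continuous_on_compose2[OF smooth_on_continuous[OF smooth_lcomp[OF u c]] continuous_coord[OF c]])
      (auto simp: coord_img[OF c])
  then have "continuous_on (patch c) (\<lambda>x. triv c x (u x) p)"
    by (rule continuous_on_eq) (simp add: lcomp_def coord_inv_coord[OF c])
  then show "(\<lambda>x. if x \<in> patch c then triv c x (u x) p else 0) \<in> borel_measurable borel"
    by (rule measurable_if_continuous[OF open_patch[OF c]])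
qed

end

context bundle_cover
begin

lemma nn_integral_cover_le:
  assumes f: "f \<in> borel_measurable borel" and s: "s \<ge> 1"
  shows "(\<integral>\<^sup>+x. f x \<partial>dens X) \<le> (\<Sum>k<N. \<integral>\<^sup>+x. f x * indicator (zone k (cball (ctr k) (s * rad k))) x \<partial>dens X)"
proof -
  have "(\<integral>\<^sup>+x. f x \<partial>dens X) \<le> (\<integral>\<^sup>+x. (\<Sum>k<N. f x * indicator (zone k (cball (ctr k) (s * rad k))) x) \<partial>dens X)"
  proof (rule nn_integral_mono)
    fix x
    obtain k where k: "k < N" "x \<in> patch (ch k)" "dist (ctr k) (coord (ch k) x) < rad k" using cover by blast
    have "rad k \<le> s * rad k" using s rad[OF k(1)] by simp
    then have "f x = f x * indicator (zone k (cball (ctr k) (s * rad k))) x" using k by (auto simp: zone_def)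
    also have "\<dots> \<le> (\<Sum>k<N. f x * indicator (zone k (cball (ctr k) (s * rad k))) x)"
      using k by (intro member_le_sum) auto
    finally show "f x \<le> (\<Sum>k<N. f x * indicator (zone k (cball (ctr k) (s * rad k))) x)" .
  qed
  also have "\<dots> = (\<Sum>k<N. \<integral>\<^sup>+x. f x * indicator (zone k (cball (ctr k) (s * rad k))) x \<partial>dens X)"
    using f zone_measurable
    by (intro nn_integral_sum borel_measurable_times) (auto simp: borel_measurable_dens sets_dens intro!: borel_measurable_indicator)
  finally show ?thesis .
qed

text \<open>On each of the finitely many covering balls the components are continuous on a compact
  set, hence bounded.\<close>

lemma smooth_sections_L2:
  assumes u: "u \<in> smooth_sections X"
  shows "u \<in> L2 X"
proof -
  have um: "u \<in> measurable_sections X" by (rule smooth_sections_measurable[OF u])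
  let ?f = "\<lambda>x. ennreal (fsq x (u x))"
  have "(\<integral>\<^sup>+x. ?f x * indicator (zone k (cball (ctr k) (1 * rad k))) x \<partial>dens X) < \<infinity>" if k: "k < N" for k
  proof -
    let ?S = "cball (ctr k) (1 * rad k)"
    have S: "?S \<subseteq> img (ch k)" "?S \<subseteq> cball (ctr k) (7 * rad k)"
      using cball_img[OF k, of 1] rad[OF k] by auto
    obtain C where C: "(\<integral>\<^sup>+x. ?f x * indicator (zone k ?S) x \<partial>dens X) \<le> ennreal C * local_norm k ?S u"
    proof -
      obtain C where "\<forall>u\<in>measurable_sections X. \<forall>S\<in>sets borel. S \<subseteq> cball (ctr k) (7 * rad k) \<longrightarrow>
        (\<integral>\<^sup>+x. ennreal (fsq x (u x)) * indicator (zone k S) x \<partial>dens X) \<le> ennreal C * local_norm k S u \<and>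
        local_norm k S u \<le> ennreal C * (\<integral>\<^sup>+x. ennreal (fsq x (u x)) * indicator (zone k S) x \<partial>dens X)"
        using local_norm_bounds[OF k] by blast
      from this[rule_format, OF um _ S(2)] show thesis using that[of C] by simp
    qed
    have "(\<integral>\<^sup>+y. ennreal ((norm (lcomp (ch k) p u y))\<^sup>2) * indicator ?S y \<partial>lborel) < \<infinity>" for p
    proof -
      have "bounded (lcomp (ch k) p u ` ?S)"
        using smooth_on_continuous[OF smooth_lcomp[OF u ch[OF k]]] S(1)
        by (intro compact_imp_bounded compact_continuous_image compact_cball) (auto intro: continuous_on_subset)
      then obtain B where "\<forall>z\<in>lcomp (ch k) p u ` ?S. norm z \<le> B" unfolding bounded_iff by blast
      then have B: "\<And>y. y \<in> ?S \<Longrightarrow> norm (lcomp (ch k) p u y) \<le> B" by blast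
      have "(\<integral>\<^sup>+y. ennreal ((norm (lcomp (ch k) p u y))\<^sup>2) * indicator ?S y \<partial>lborel) \<le> (\<integral>\<^sup>+y. ennreal (B\<^sup>2) * indicator ?S y \<partial>lborel)"
        using B by (intro nn_integral_mono) (auto simp: indicator_def intro!: ennreal_leI power_mono)
      also have "\<dots> = ennreal (B\<^sup>2) * emeasure lborel ?S" by (rule nn_integral_cmult_indicator) simp
      also have "\<dots> < \<infinity>" using emeasure_lborel_cball_finite[of "ctr k" "1 * rad k"] by (auto simp: ennreal_mult_less_top)
      finally show ?thesis .
    qed
    then have "local_norm k ?S u < \<infinity>" unfolding local_norm_def by simp
    then show ?thesis using C by (auto simp: ennreal_mult_less_top intro: le_less_trans)
  qed
  then have "(\<Sum>k<N. \<integral>\<^sup>+x. ?f x * indicator (zone k (cball (ctr k) (1 * rad k))) x \<partial>dens X) < \<infinity>" by simp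
  then have "(\<integral>\<^sup>+x. ?f x \<partial>dens X) < \<infinity>"
    using nn_integral_cover_le[of ?f 1] measurable_fsq[OF um] by (auto intro: le_less_trans)
  then show ?thesis using um by (simp add: L2_iff)
qed

lemma smooth_sections_subspace: "L2.subspace (smooth_sections X)"
  unfolding L2.subspace_def
  using smooth_sections_0 smooth_sections_add smooth_sections_scal by (auto simp: sscal_def)

lemma L2_norm_sum_le:
  assumes "finite A" "\<And>i. i \<in> A \<Longrightarrow> u i \<in> L2 X"
  shows "L2_norm X (\<Sum>i\<in>A. u i) \<le> (\<Sum>i\<in>A. L2_norm X (u i))"
  using assms
proof (induction A)
  case empty then show ?case using L2.nrm_sc[OF L2_0, of 0] by (simp add: L2_nrm zero_fun_def)
next
  case (insert i A)
  have "(\<Sum>i\<in>A. u i) \<in> L2 X" using insert by (intro L2.subspace_sum[OF L2.V_sub]) auto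
  then have "L2_norm X (u i + (\<Sum>i\<in>A. u i)) \<le> L2_norm X (u i) + L2_norm X (\<Sum>i\<in>A. u i)"
    using L2.nrm_triangle[of "u i" "\<Sum>i\<in>A. u i"] insert by (simp add: L2_nrm)
  also have "\<dots> \<le> L2_norm X (u i) + (\<Sum>i\<in>A. L2_norm X (u i))" using insert by simp
  finally show ?case unfolding sum.insert[OF insert(1,2)] .
qed

lemma sum_fun_apply: "(\<Sum>i\<in>A. f i) x = (\<Sum>i\<in>A. f i x)" for f :: "'i \<Rightarrow> 'm \<Rightarrow> 'f"
  by (induction A rule: infinite_finite_induct) auto

text \<open>The section is cut sharply into finitely many measurable pieces, each in one coordinate
  ball. The components of a piece are approximated by test functions in Euclidean space, and the
  approximants are carried back through the frame.\<close>

lemma smooth_sections_dense: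
  assumes u: "u \<in> L2 X" and e: "e > 0"
  shows "\<exists>w\<in>smooth_sections X. L2_norm X (u - w) < e"
proof -
  have um: "u \<in> measurable_sections X" by (rule L2_measurable[OF u])
  \<comment> \<open>The covering balls made disjoint, so that the pieces of \<open>u\<close> add up
    to \<open>u\<close>.\<close>
  define B where "B k = zone k (ball (ctr k) (rad k)) - (\<Union>i<k. zone i (ball (ctr i) (rad i)))" for k
  have Bm: "B k \<in> sets borel" if "k < N" for k
    unfolding B_def using that by (intro sets.Diff sets.finite_UN zone_measurable) auto
  have BN: "\<exists>k<N. x \<in> B k" for x
  proof -
    define P where "P k \<longleftrightarrow> k < N \<and> x \<in> zone k (ball (ctr k) (rad k))" for k
    have "\<exists>k. P k" using cover[of x] by (auto simp: P_def zone_def)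
    define j where "j = (LEAST k. P k)"
    have "P j" unfolding j_def using \<open>\<exists>k. P k\<close> by (rule LeastI_ex)
    moreover have "\<not> P i" if "i < j" for i using that unfolding j_def by (rule not_less_Least)
    ultimately show ?thesis by (intro exI[of _ j]) (auto simp: B_def P_def)
  qed
  have Bdisj: "i = k" if "x \<in> B i" "x \<in> B k" for i k x
    using that by (cases i k rule: linorder_cases) (auto simp: B_def)
  \<comment> \<open>With this tolerance the sum of \<open>N\<close> errors stays strictly below
    \<open>e\<close>; the added 1 keeps the denominator positive for \<open>N = 0\<close>.\<close>
  have piece: "\<exists>w\<in>smooth_sections X. (\<lambda>x. if x \<in> B k then u x else 0) - w \<in> L2 X \<and>
      L2_norm X ((\<lambda>x. if x \<in> B k then u x else 0) - w) \<le> e / (2 * (real N + 1))" if k: "k < N" for k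
  proof -
    define c where "c = ch k"
    have c: "c \<in> atlas X" using ch[OF k] by (simp add: c_def)
    define S where "S = cball (ctr k) (rad k)"
    have S: "S \<in> sets borel" "S \<subseteq> cball (ctr k) (7 * rad k)" "S \<subseteq> img c" "compact S"
      using cball_img[OF k, of 1] rad[OF k] by (auto simp: S_def c_def)
    obtain C where C: "C > 0" "\<And>v T. v \<in> measurable_sections X \<Longrightarrow> T \<in> sets borel \<Longrightarrow> T \<subseteq> cball (ctr k) (7 * rad k) \<Longrightarrow>
        (\<integral>\<^sup>+x. ennreal (fsq x (v x)) * indicator (zone k T) x \<partial>dens X) \<le> ennreal C * local_norm k T v \<and>
        local_norm k T v \<le> ennreal C * (\<integral>\<^sup>+x. ennreal (fsq x (v x)) * indicator (zone k T) x \<partial>dens X)"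
      using local_norm_bounds[OF k] by blast
    define uB where "uB x = (if x \<in> B k then u x else 0)" for x
    have uBm: "uB \<in> measurable_sections X"
      unfolding measurable_sections_def
    proof (intro CollectI conjI ballI allI impI)
      show "uB x \<in> fib X x" for x using L2_fib[OF u] fibre.V_0 by (simp add: uB_def)
      fix d p assume d: "d \<in> atlas X" "p < rk d"
      have "(\<lambda>x. if x \<in> B k then (if x \<in> patch d then triv d x (u x) p else 0) else 0) \<in> borel_measurable borel"
        by (rule measurable_If_set) (use Bm[OF k] measurable_sections_triv[OF um d(1)] in auto)
      also have "(\<lambda>x. if x \<in> B k then (if x \<in> patch d then triv d x (u x) p else 0) else 0) = (\<lambda>x. if x \<in> patch d then triv d x (uB x) p else 0)"
        using triv_0[OF d(1)] by (auto simp: uB_def)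
      finally show "(\<lambda>x. if x \<in> patch d then triv d x (uB x) p else 0) \<in> borel_measurable borel" .
    qed
    define f where "f q y = (if y \<in> img c then lcomp c q uB y else 0)" for q y
    have fm: "f q \<in> borel_measurable borel" for q unfolding f_def by (rule measurable_lcomp[OF uBm c])
    have fz: "f q y = 0" if "y \<notin> ball (ctr k) (rad k)" for q y
      using that triv_0[OF c coord_inv_patch[OF c]] coord_coord_inv[OF c]
      by (auto simp: f_def lcomp_def uB_def B_def zone_def c_def)
    have ffin: "(\<integral>\<^sup>+y. ennreal ((norm (f q y))\<^sup>2) \<partial>lborel) < \<infinity>" if q: "q < rk c" for q
    proof -
      have "(\<integral>\<^sup>+y. ennreal ((norm (f q y))\<^sup>2) \<partial>lborel) = (\<integral>\<^sup>+y. ennreal ((norm (lcomp c q uB y))\<^sup>2) * indicator S y \<partial>lborel)"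
      proof (rule nn_integral_cong)
        fix y
        show "ennreal ((norm (f q y))\<^sup>2) = ennreal ((norm (lcomp c q uB y))\<^sup>2) * indicator S y"
          using fz[of y q] S(3) by (cases "y \<in> S") (auto simp: f_def S_def split: if_splits)
      qed
      also have "\<dots> \<le> local_norm k S uB" unfolding local_norm_def c_def[symmetric]
        using q by (intro member_le_sum[of q "{..<rk c}" "\<lambda>q. \<integral>\<^sup>+y. ennreal ((norm (lcomp c q uB y))\<^sup>2) * indicator S y \<partial>lborel"]) auto
      also have "\<dots> \<le> ennreal C * (\<integral>\<^sup>+x. ennreal (fsq x (uB x)) * indicator (zone k S) x \<partial>dens X)"
        using C(2)[OF uBm S(1,2)] by blast
      also have "\<dots> \<le> ennreal C * (\<integral>\<^sup>+x. ennreal (fsq x (u x)) \<partial>dens X)"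
        by (intro mult_left_mono nn_integral_mono) (auto simp: uB_def indicator_def fsq_0)
      also have "\<dots> < \<infinity>" using u by (auto simp: L2_iff ennreal_mult_less_top)
      finally show ?thesis .
    qed
    define M where "M = e / (2 * (real N + 1))"
    have M: "M > 0" using e by (simp add: M_def)
    \<comment> \<open>\<open>local_norm\<close> adds up \<open>rk c\<close> squared errors and
      \<open>C\<close> converts it to the norm of the bundle, so the total stays below
      \<open>M\<close> squared.\<close>
    define \<delta> where "\<delta> = M\<^sup>2 / (C * (real (rk c) + 1))"
    have \<delta>: "\<delta> > 0" using M C by (simp add: \<delta>_def)
    have "\<exists>g. test_function g \<and> (\<forall>y. y \<notin> S \<longrightarrow> g y = 0) \<and> (\<integral>\<^sup>+y. ennreal ((norm (f q y - g y))\<^sup>2) \<partial>lborel) \<le> ennreal \<delta>"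
      if "q < rk c" for q
      using L2_approximable_supported[OF fm ffin[OF that] fz] \<delta> unfolding L2_approximable_def S_def by blast
    then obtain g where g: "\<And>q. q < rk c \<Longrightarrow> test_function (g q)" "\<And>q y. q < rk c \<Longrightarrow> y \<notin> S \<Longrightarrow> g q y = 0"
        "\<And>q. q < rk c \<Longrightarrow> (\<integral>\<^sup>+y. ennreal ((norm (f q y - g q y))\<^sup>2) \<partial>lborel) \<le> ennreal \<delta>" by metis
    define w where "w = (\<Sum>q<rk c. chart_section c q (g q))"
    have wq: "chart_section c q (g q) \<in> smooth_sections X" if "q < rk c" for q
      using g(1,2)[OF that] by (intro chart_section_smooth[OF c that S(4,3)]) (auto simp: test_function_def intro: smooth_on_subset)
    have w: "w \<in> smooth_sections X" unfolding w_def by (rule smooth_sections_sum) (use wq in auto)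
    have dm: "uB - w \<in> measurable_sections X"
    proof -
      have "uB + sscal (-1) w \<in> measurable_sections X"
        unfolding sscal_def by (intro measurable_sections_add measurable_sections_scal uBm smooth_sections_measurable w)
      moreover have "uB + sscal (-1) w = uB - w" by (simp add: fun_eq_iff sscal_def)
      ultimately show ?thesis by simp
    qed
    have lw: "lcomp c p w y = g p y" if "y \<in> img c" "p < rk c" for p y
    proof -
      have "lcomp c p w y = (\<Sum>q<rk c. lcomp c p (chart_section c q (g q)) y)"
        unfolding lcomp_def w_def sum_fun_apply
        using that chart_section_fib[OF c] by (intro triv_sum[OF c coord_inv_patch[OF c]]) auto
      also have "\<dots> = (\<Sum>q<rk c. if p = q then g q y else 0)"
        using lcomp_chart_section[OF c _ that(1)] by (intro sum.cong) auto
      also have "\<dots> = g p y" using that by simp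
      finally show ?thesis .
    qed
    have ld: "lcomp c p (uB - w) y = f p y - g p y" if "y \<in> img c" "p < rk c" for p y
      using triv_diff[OF c coord_inv_patch[OF c that(1)] measurable_sections_fib[OF uBm] smooth_sections_fib[OF w]] lw[OF that] that
      by (simp add: lcomp_def f_def)
    have zero: "(uB - w) x = 0" if "x \<notin> zone k S" for x
    proof -
      have "uB x = 0" using that by (auto simp: uB_def B_def zone_def S_def)
      moreover have "w x = 0"
        unfolding w_def sum_fun_apply using that g(2)
        by (intro sum.neutral) (auto simp: chart_section_def zone_def c_def)
      ultimately show ?thesis by simp
    qed
    have "(\<integral>\<^sup>+x. ennreal (fsq x ((uB - w) x)) \<partial>dens X) = (\<integral>\<^sup>+x. ennreal (fsq x ((uB - w) x)) * indicator (zone k S) x \<partial>dens X)"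
      using zero by (intro nn_integral_cong) (auto simp: indicator_def fsq_0)
    also have "\<dots> \<le> ennreal C * local_norm k S (uB - w)" using C(2)[OF dm S(1,2)] by blast
    also have "local_norm k S (uB - w) \<le> (\<Sum>p<rk c. ennreal \<delta>)"
      unfolding local_norm_def c_def[symmetric]
    proof (rule sum_mono)
      fix p assume p: "p \<in> {..<rk c}"
      have "(\<integral>\<^sup>+y. ennreal ((norm (lcomp c p (uB - w) y))\<^sup>2) * indicator S y \<partial>lborel) \<le> (\<integral>\<^sup>+y. ennreal ((norm (f p y - g p y))\<^sup>2) \<partial>lborel)"
        using ld p S(3) by (intro nn_integral_mono) (auto simp: indicator_def)
      also have "\<dots> \<le> ennreal \<delta>" using g(3) p by simp
      finally show "(\<integral>\<^sup>+y. ennreal ((norm (lcomp c p (uB - w) y))\<^sup>2) * indicator S y \<partial>lborel) \<le> ennreal \<delta>" .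
    qed
    also have "ennreal C * (\<Sum>p<rk c. ennreal \<delta>) = ennreal (C * (real (rk c) * \<delta>))"
      using C \<delta> by (subst sum_ennreal) (auto simp: ennreal_mult)
    also have "\<dots> \<le> ennreal (M\<^sup>2)"
    proof (rule ennreal_leI)
      have "C * (real (rk c) * \<delta>) \<le> C * ((real (rk c) + 1) * \<delta>)" using C \<delta> by (intro mult_left_mono mult_right_mono) auto
      also have "\<dots> = M\<^sup>2" using C by (simp add: \<delta>_def)
      finally show "C * (real (rk c) * \<delta>) \<le> M\<^sup>2" .
    qed
    finally have fin: "(\<integral>\<^sup>+x. ennreal (fsq x ((uB - w) x)) \<partial>dens X) \<le> ennreal (M\<^sup>2)"
      by (simp add: mult_left_mono)
    have mem: "uB - w \<in> L2 X" using dm fin by (auto simp: L2_iff intro: le_less_trans)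
    have "L2_norm X (uB - w) \<le> M" by (rule L2_norm_le[OF mem _ fin]) (use M in simp)
    then show ?thesis using mem w unfolding M_def uB_def by blast
  qed
  then have "\<forall>k\<in>{..<N}. \<exists>w. w \<in> smooth_sections X \<and> (\<lambda>x. if x \<in> B k then u x else 0) - w \<in> L2 X \<and>
      L2_norm X ((\<lambda>x. if x \<in> B k then u x else 0) - w) \<le> e / (2 * (real N + 1))" by blast
  from bchoice[OF this] obtain w where "\<forall>k\<in>{..<N}. w k \<in> smooth_sections X \<and> (\<lambda>x. if x \<in> B k then u x else 0) - w k \<in> L2 X \<and>
      L2_norm X ((\<lambda>x. if x \<in> B k then u x else 0) - w k) \<le> e / (2 * (real N + 1))" by blast
  then have w: "\<And>k. k < N \<Longrightarrow> w k \<in> smooth_sections X"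
      "\<And>k. k < N \<Longrightarrow> (\<lambda>x. if x \<in> B k then u x else 0) - w k \<in> L2 X"
      "\<And>k. k < N \<Longrightarrow> L2_norm X ((\<lambda>x. if x \<in> B k then u x else 0) - w k) \<le> e / (2 * (real N + 1))" by blast+
  have "u = (\<Sum>k<N. (\<lambda>x. if x \<in> B k then u x else 0))"
  proof
    fix x
    obtain j where j: "j < N" "x \<in> B j" using BN by blast
    have "(\<Sum>k<N. if x \<in> B k then u x else 0) = (\<Sum>k<N. if k = j then u x else 0)"
      using Bdisj j by (intro sum.cong) auto
    then show "u x = (\<Sum>k<N. (\<lambda>x. if x \<in> B k then u x else 0)) x" using j by (simp add: sum_fun_apply)
  qed
  then have "u - (\<Sum>k<N. w k) = (\<Sum>k<N. (\<lambda>x. if x \<in> B k then u x else 0) - w k)" by (simp only: sum_subtractf)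
  then have "L2_norm X (u - (\<Sum>k<N. w k)) \<le> (\<Sum>k<N. L2_norm X ((\<lambda>x. if x \<in> B k then u x else 0) - w k))"
    using L2_norm_sum_le[of "{..<N}" "\<lambda>k. (\<lambda>x. if x \<in> B k then u x else 0) - w k"] w by simp
  also have "\<dots> \<le> (\<Sum>k<N. e / (2 * (real N + 1)))" using w by (intro sum_mono) auto
  also have "\<dots> < e" using e by (simp add: field_simps add_nonneg_pos)
  finally show ?thesis using smooth_sections_sum[of "{..<N}" w] w by blast
qed

sublocale L2D: dense_subspace sscal "L2 X" "L2_inner X" "smooth_sections X"
proof
  show "L2.subspace (smooth_sections X)" by (rule smooth_sections_subspace)
  show "smooth_sections X \<subseteq> L2 X" using smooth_sections_L2 by blast
  show "\<exists>w\<in>smooth_sections X. L2.nrm (u - w) < e" if "u \<in> L2 X" "e > 0" for u e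
    using smooth_sections_dense[OF that] by (simp add: L2_nrm)
  show "\<exists>l\<in>L2 X. (\<lambda>n. L2.nrm (x n - l)) \<longlonglongrightarrow> 0"
    if "\<And>n::nat. x n \<in> L2 X" "\<And>n. L2.nrm (x (Suc n) - x n) \<le> c * (1 / 2) ^ n" for x c
    using L2_complete[of x c] that by (simp add: L2_nrm)
qed

end

section \<open>Boundedness of pseudodifferential operators of negative order\<close>

text \<open>The seminorm is a supremum in the reals, which bounds its family only because membership
  in the symbol class makes that family bounded above.\<close>

lemma symbol_seminorm_bound:
  assumes "a \<in> symbol_class m" "set \<beta> \<subseteq> Basis"
  shows "norm (symbol_pderivs [] \<beta> a (x, \<xi>)) \<le> symbol_seminorm m [] \<beta> a * (1 + norm \<xi>) powr (m - real (length \<beta>))"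
proof -
  have all: "\<forall>\<alpha> \<beta>. set \<alpha> \<subseteq> Basis \<and> set \<beta> \<subseteq> Basis \<longrightarrow>
      (\<exists>C. \<forall>x \<xi>. norm (symbol_pderivs \<alpha> \<beta> a (x, \<xi>)) \<le> C * (1 + norm \<xi>) powr (m - real (length \<beta>)))"
    using assms(1) by (simp add: symbol_class_def)
  obtain C where C: "\<And>x \<xi>. norm (symbol_pderivs [] \<beta> a (x, \<xi>)) \<le> C * (1 + norm \<xi>) powr (m - real (length \<beta>))"
    using all[rule_format, of "[]" \<beta>] assms(2) by auto
  have pos: "(1 + norm \<xi>) powr r > 0" for r and \<xi> :: 'a
  proof -
    have "1 + norm \<xi> \<noteq> 0" using norm_ge_zero[of \<xi>] by linarith
    then show ?thesis by simp
  qed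
  have "bdd_above (range (\<lambda>z. norm (symbol_pderivs [] \<beta> a z) / (1 + norm (snd z)) powr (m - real (length \<beta>))))"
  proof (rule bdd_aboveI2[where M=C])
    show "norm (symbol_pderivs [] \<beta> a z) / (1 + norm (snd z)) powr (m - real (length \<beta>)) \<le> C" for z
      using C[of "fst z" "snd z"] pos[of "snd z" "m - real (length \<beta>)"] by (simp add: pos_divide_le_eq)
  qed
  then have "norm (symbol_pderivs [] \<beta> a (x, \<xi>)) / (1 + norm (snd (x, \<xi>))) powr (m - real (length \<beta>)) \<le> symbol_seminorm m [] \<beta> a"
    unfolding symbol_seminorm_def by (intro cSUP_upper UNIV_I)
  then show ?thesis using pos[of \<xi> "m - real (length \<beta>)"] by (simp add: pos_divide_le_eq)
qed

lemma kernel_seminorm_bound: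
  assumes "test_function K" shows "norm (K z) \<le> kernel_seminorm [] K"
proof -
  obtain B where "\<And>z. norm (K z) \<le> B" using test_function_bounded[OF assms] by blast
  then have "bdd_above (range (\<lambda>z. norm (K z)))" by (rule bdd_aboveI2)
  then show ?thesis unfolding kernel_seminorm_def by (auto intro: cSUP_upper)
qed

text \<open>A Hilbert-Schmidt estimate: the Cauchy-Schwarz inequality in \<open>y\<close> over
  \<open>B\<close> gives a bound that does not depend on \<open>x\<close>, which is then integrated
  over \<open>S\<close>.\<close>

lemma kernel_L2_bound:
  fixes t :: "'a::euclidean_space \<Rightarrow> complex"
  assumes K: "test_function K" "\<And>z. norm (K z) \<le> \<epsilon>" and t: "t \<in> borel_measurable borel" "\<And>y. y \<notin> B \<Longrightarrow> t y = 0"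
    and B: "B \<in> sets borel" and S: "S \<in> sets borel"
  shows "(\<integral>\<^sup>+x. ennreal ((norm (LINT y|lborel. K (x, y) * t y))\<^sup>2) * indicator S x \<partial>lborel) \<le>
    ennreal (\<epsilon>\<^sup>2) * (emeasure lborel S * emeasure lborel B) * (\<integral>\<^sup>+y. ennreal ((norm (t y))\<^sup>2) \<partial>lborel)"
proof -
  have e0: "\<epsilon> \<ge> 0" using K(2)[of undefined] norm_ge_zero order_trans by blast
  let ?T = "\<integral>\<^sup>+y. ennreal ((norm (t y))\<^sup>2) \<partial>lborel"
  have pt: "ennreal ((norm (LINT y|lborel. K (x, y) * t y))\<^sup>2) \<le> ennreal (\<epsilon>\<^sup>2) * emeasure lborel B * ?T" for x
  proof -
    have "ennreal (norm (LINT y|lborel. K (x, y) * t y)) \<le> (\<integral>\<^sup>+y. ennreal (norm (K (x, y) * t y)) \<partial>lborel)"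
      by (rule norm_integral_le_nn_integral)
    also have "\<dots> \<le> (\<integral>\<^sup>+y. ennreal \<epsilon> * (indicator B y * ennreal (norm (t y))) \<partial>lborel)"
    proof (rule nn_integral_mono)
      fix y
      have "norm (K (x, y)) * norm (t y) \<le> \<epsilon> * norm (t y)" using K(2) by (rule mult_right_mono) simp
      then show "ennreal (norm (K (x, y) * t y)) \<le> ennreal \<epsilon> * (indicator B y * ennreal (norm (t y)))"
        using t(2)[of y] e0 by (cases "y \<in> B") (auto simp: norm_mult ennreal_mult[symmetric] intro: ennreal_leI)
    qed
    also have "\<dots> = ennreal \<epsilon> * (\<integral>\<^sup>+y. indicator B y * ennreal (norm (t y)) \<partial>lborel)"
      using t B by (intro nn_integral_cmult) auto
    finally have "(ennreal (norm (LINT y|lborel. K (x, y) * t y)))\<^sup>2 \<le> (ennreal \<epsilon> * (\<integral>\<^sup>+y. indicator B y * ennreal (norm (t y)) \<partial>lborel))\<^sup>2"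
      by (rule power_mono) simp
    also have "\<dots> = (ennreal \<epsilon>)\<^sup>2 * (\<integral>\<^sup>+y. indicator B y * ennreal (norm (t y)) \<partial>lborel)\<^sup>2" by (rule power_mult_distrib)
    also have "(\<integral>\<^sup>+y. indicator B y * ennreal (norm (t y)) \<partial>lborel)\<^sup>2 \<le>
        (\<integral>\<^sup>+y. (indicator B y)\<^sup>2 \<partial>lborel) * (\<integral>\<^sup>+y. (ennreal (norm (t y)))\<^sup>2 \<partial>lborel)"
      using t B by (intro Cauchy_Schwarz_nn_integral) auto
    also have "(\<integral>\<^sup>+y. (indicator B y)\<^sup>2 \<partial>lborel) = (\<integral>\<^sup>+y. indicator B y \<partial>lborel)"
      by (intro nn_integral_cong) (auto simp: indicator_def)
    also have "\<dots> = emeasure lborel B" using B by simp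
    finally show ?thesis using e0 by (simp add: ennreal_power mult_left_mono mult.assoc)
  qed
  have "(\<integral>\<^sup>+x. ennreal ((norm (LINT y|lborel. K (x, y) * t y))\<^sup>2) * indicator S x \<partial>lborel) \<le>
      (\<integral>\<^sup>+x. (ennreal (\<epsilon>\<^sup>2) * emeasure lborel B * ?T) * indicator S x \<partial>lborel)"
    using pt by (intro nn_integral_mono mult_right_mono) auto
  also have "\<dots> = (ennreal (\<epsilon>\<^sup>2) * emeasure lborel B * ?T) * emeasure lborel S"
    using S by (intro nn_integral_cmult_indicator) auto
  finally show ?thesis by (simp add: mult_ac)
qed

lemma sum_ennreal_mult:
  assumes "\<And>i. i \<in> A \<Longrightarrow> 0 \<le> f i" "0 \<le> (c :: real)"
  shows "(\<Sum>i\<in>A. ennreal (f i * c) * z) = ennreal ((\<Sum>i\<in>A. f i) * c) * z"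
proof -
  have "(\<Sum>i\<in>A. ennreal (f i * c) * z) = (\<Sum>i\<in>A. ennreal (f i * c)) * z" by (rule sum_distrib_right[symmetric])
  also have "(\<Sum>i\<in>A. ennreal (f i * c)) = ennreal (\<Sum>i\<in>A. f i * c)" using assms by (intro sum_ennreal) auto
  also have "(\<Sum>i\<in>A. f i * c) = (\<Sum>i\<in>A. f i) * c" by (rule sum_distrib_right[symmetric])
  finally show ?thesis .
qed

lemma norm_sum_squared_le:
  assumes "finite A"
  shows "(norm (\<Sum>i\<in>A. f i :: complex))\<^sup>2 \<le> real (card A) * (\<Sum>i\<in>A. (norm (f i))\<^sup>2)"
proof -
  have "(norm (\<Sum>i\<in>A. f i))\<^sup>2 \<le> (\<Sum>i\<in>A. norm (f i))\<^sup>2" by (intro power_mono norm_sum) auto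
  also have "\<dots> \<le> (\<Sum>i\<in>A. 1\<^sup>2) * (\<Sum>i\<in>A. (norm (f i))\<^sup>2)"
    using Cauchy_Schwarz_ineq_sum[of "\<lambda>_. 1" "\<lambda>i. norm (f i)" A] by simp
  finally show ?thesis by simp
qed

context bundle_cover
begin

definition linear_on_smooth :: "(('m \<Rightarrow> 'f) \<Rightarrow> 'm \<Rightarrow> 'f) \<Rightarrow> bool" where
  "linear_on_smooth A \<longleftrightarrow> (\<forall>u\<in>smooth_sections X. A u \<in> smooth_sections X) \<and>
     (\<forall>u\<in>smooth_sections X. \<forall>v\<in>smooth_sections X. A (u + v) = A u + A v) \<and>
     (\<forall>z. \<forall>u\<in>smooth_sections X. A (sscal z u) = sscal z (A u))"

lemma linear_on_smooth_sum:
  assumes A: "linear_on_smooth A" and u: "\<And>i. i \<in> I \<Longrightarrow> u i \<in> smooth_sections X"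
  shows "A (\<Sum>i\<in>I. u i) = (\<Sum>i\<in>I. A (u i))"
proof -
  have A0: "A 0 = 0"
  proof -
    have "A (sscal 0 0) = sscal 0 (A 0)" using A smooth_sections_0 unfolding linear_on_smooth_def by blast
    then show ?thesis by (simp add: sscal_def zero_fun_def)
  qed
  show ?thesis using u
  proof (induction I rule: infinite_finite_induct)
    case (insert i I)
    have "A (u i + (\<Sum>i\<in>I. u i)) = A (u i) + A (\<Sum>i\<in>I. u i)"
      using A insert smooth_sections_sum[of I u] unfolding linear_on_smooth_def by blast
    also have "A (\<Sum>i\<in>I. u i) = (\<Sum>i\<in>I. A (u i))" using insert by blast
    finally show ?case unfolding sum.insert[OF insert(1,2)] .
  next
    case (infinite I)
    show ?case unfolding sum.infinite[OF infinite(1)] by (rule A0)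
  next
    case empty
    show ?case unfolding sum.empty by (rule A0)
  qed
qed

subsection \<open>Cut-off functions adapted to the cover\<close>

definition zone_cut :: "nat \<Rightarrow> real \<Rightarrow> real \<Rightarrow> 'm \<Rightarrow> complex" where
  "zone_cut k s s' x = (if x \<in> patch (ch k) then plateau (ctr k) (s * rad k) (s' * rad k) (coord (ch k) x) else 0)"

lemma
  assumes k: "k < N" and s: "0 \<le> s" "s < s'" "s' \<le> 7"
  shows smooth_zone_cut: "smooth_fun (zone_cut k s s')"
    and zone_cut_0: "x \<notin> zone k (cball (ctr k) (s' * rad k)) \<Longrightarrow> zone_cut k s s' x = 0"
    and zone_cut_1: "x \<in> zone k (cball (ctr k) (s * rad k)) \<Longrightarrow> zone_cut k s s' x = 1"
proof -
  have r: "0 \<le> s * rad k" "s * rad k < s' * rad k" using rad[OF k] s by auto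
  show "smooth_fun (zone_cut k s s')" unfolding zone_cut_def[abs_def]
    by (rule smooth_fun_chart[OF ch[OF k] compact_cball cball_img[OF k s(3)] smooth_on_plateau])
      (use r in \<open>auto intro!: plateau_eq_0 simp: dist_commute\<close>)
  show "x \<notin> zone k (cball (ctr k) (s' * rad k)) \<Longrightarrow> zone_cut k s s' x = 0"
    using r by (auto simp: zone_cut_def zone_def dist_commute intro!: plateau_eq_0)
  show "x \<in> zone k (cball (ctr k) (s * rad k)) \<Longrightarrow> zone_cut k s s' x = 1"
    using r by (auto simp: zone_cut_def zone_def dist_commute intro!: plateau_eq_1)
qed

lemma closed_zone: "k < N \<Longrightarrow> s \<le> 7 \<Longrightarrow> closed (zone k (cball (ctr k) (s * rad k)))"
  and compact_zone: "k < N \<Longrightarrow> s \<le> 7 \<Longrightarrow> compact (zone k (cball (ctr k) (s * rad k)))"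
  unfolding zone_def using compact_preimage[OF ch compact_cball cball_img] by blast+

lemma supp_subset: "closed Z \<Longrightarrow> (\<And>x. x \<notin> Z \<Longrightarrow> f x = 0) \<Longrightarrow> supp f \<subseteq> Z"
  unfolding supp_def by (intro closure_minimal) auto

lemma cutoffI:
  assumes k: "k < N" and s: "s \<le> 7" and f: "smooth_fun f" "\<And>x. x \<notin> zone k (cball (ctr k) (s * rad k)) \<Longrightarrow> f x = 0"
  shows "cutoff (ch k) f"
proof -
  have sub: "supp f \<subseteq> zone k (cball (ctr k) (s * rad k))" by (rule supp_subset[OF closed_zone[OF k s] f(2)])
  moreover have "compact (supp f)"
    using compact_Int_closed[OF compact_zone[OF k s], of "supp f"] sub by (simp add: supp_def inf_absorb2)
  ultimately show ?thesis
    using f(1) ch[OF k] by (auto simp: cutoff_def smooth_fun_def zone_def comp_def)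
qed

definition phi :: "nat \<Rightarrow> 'm \<Rightarrow> complex" where "phi k = zone_cut k 1 2"

text \<open>Between radius 2, where \<open>phi k\<close> ends, and radius 3, up to which this
  function is 1, there is a gap. It makes the closed supports of \<open>phi k\<close> and
  \<open>1 - psi k\<close> disjoint, as the off-diagonal kernels require.\<close>

definition psi :: "nat \<Rightarrow> 'm \<Rightarrow> complex" where "psi k = zone_cut k 3 4"

text \<open>A partition of unity without division: partial sums telescope to one minus the product
  of \<open>1 - phi i\<close>, and at every point some factor vanishes.\<close>

definition eta :: "nat \<Rightarrow> 'm \<Rightarrow> complex" where "eta l x = phi l x * (\<Prod>i<l. 1 - phi i x)"

text \<open>Index \<open>N\<close> stands for the near-diagonal part \<open>psi k\<close>, the indices below \<open>N\<close> for the pieces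
  supported away from \<open>phi k\<close>.\<close>

definition piece_cut :: "nat \<Rightarrow> nat \<Rightarrow> 'm \<Rightarrow> complex" where
  "piece_cut k l = (if l = N then psi k else (\<lambda>x. (1 - psi k x) * eta l x))"

definition piece_index :: "nat \<Rightarrow> nat \<Rightarrow> nat" where
  "piece_index k l = (if l = N then k else l)"

lemma piece_index_less: "k < N \<Longrightarrow> l \<le> N \<Longrightarrow> piece_index k l < N"
  by (auto simp: piece_index_def)

lemma smooth_phi: "k < N \<Longrightarrow> smooth_fun (phi k)" and smooth_psi: "k < N \<Longrightarrow> smooth_fun (psi k)"
  by (auto simp: phi_def psi_def intro: smooth_zone_cut)

lemma smooth_eta: "l < N \<Longrightarrow> smooth_fun (eta l)"
  unfolding eta_def[abs_def] by (intro smooth_fun_mult smooth_fun_prod smooth_fun_diff smooth_fun_const smooth_phi) auto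

lemma sum_eta: "(\<Sum>l<N. eta l x) = 1"
proof -
  have tel: "(\<Sum>l<n. eta l x) = 1 - (\<Prod>i<n. 1 - phi i x)" for n
    by (induction n) (auto simp: eta_def algebra_simps)
  obtain k where k: "k < N" "x \<in> patch (ch k)" "dist (ctr k) (coord (ch k) x) < rad k" using cover by blast
  then have "phi k x = 1" unfolding phi_def by (intro zone_cut_1) (auto simp: zone_def)
  then have "\<exists>i\<in>{..<N}. 1 - phi i x = 0" using k by (intro bexI[of _ k]) auto
  then have "(\<Prod>i<N. 1 - phi i x) = 0" by simp
  then show ?thesis unfolding tel by simp
qed

lemma sum_piece_cut: "(\<Sum>l\<le>N. piece_cut k l x) = 1"
proof -
  have "(\<Sum>l\<le>N. piece_cut k l x) = (\<Sum>l<N. (1 - psi k x) * eta l x) + psi k x"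
    unfolding lessThan_Suc_atMost[symmetric] by (simp add: piece_cut_def)
  also have "\<dots> = 1" by (simp add: sum_distrib_left[symmetric] sum_eta)
  finally show ?thesis .
qed

lemma smooth_piece_cut: "k < N \<Longrightarrow> l \<le> N \<Longrightarrow> smooth_fun (piece_cut k l)"
  unfolding piece_cut_def using smooth_psi smooth_eta
  by (auto intro!: smooth_fun_mult smooth_fun_diff smooth_fun_const)

lemma piece_cut_0:
  assumes k: "k < N" and l: "l \<le> N" and x: "x \<notin> zone (piece_index k l) (cball (ctr (piece_index k l)) (4 * rad (piece_index k l)))"
  shows "piece_cut k l x = 0"
proof (cases "l = N")
  case True
  then show ?thesis using x k by (auto simp: piece_cut_def piece_index_def psi_def intro: zone_cut_0)
next
  case False
  then have ln: "l < N" using l by simp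
  have "x \<notin> zone l (cball (ctr l) (2 * rad l))"
    using x False rad[OF ln] by (auto simp: piece_index_def zone_def)
  then have "phi l x = 0" unfolding phi_def using ln by (intro zone_cut_0) auto
  then show ?thesis using False by (simp add: piece_cut_def eta_def)
qed

lemma cutoff_phi: "k < N \<Longrightarrow> cutoff (ch k) (phi k)"
  by (rule cutoffI[of k 2, OF _ _ smooth_phi]) (auto simp: phi_def intro: zone_cut_0)

lemma cutoff_piece: "k < N \<Longrightarrow> l \<le> N \<Longrightarrow> cutoff (ch (piece_index k l)) (piece_cut k l)"
  by (rule cutoffI[of "piece_index k l" 4, OF piece_index_less _ smooth_piece_cut]) (auto intro: piece_cut_0)

lemma supp_disjoint:
  assumes k: "k < N" and l: "l < N" shows "supp (phi k) \<inter> supp (piece_cut k l) = {}"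
proof -
  have "supp (phi k) \<subseteq> zone k (cball (ctr k) (2 * rad k))"
    using k by (intro supp_subset closed_zone) (auto simp: phi_def intro: zone_cut_0)
  also have "\<dots> \<subseteq> zone k (ball (ctr k) (3 * rad k))" using rad[OF k] by (auto simp: zone_def)
  finally have 1: "supp (phi k) \<subseteq> zone k (ball (ctr k) (3 * rad k))" .
  have o: "open (zone k (ball (ctr k) (3 * rad k)))"
    unfolding zone_def by (intro open_preimage ch k open_ball)
  have "supp (piece_cut k l) \<subseteq> - zone k (ball (ctr k) (3 * rad k))"
  proof (rule supp_subset)
    show "closed (- zone k (ball (ctr k) (3 * rad k)))" using o by (simp add: closed_Compl)
    fix x assume "x \<notin> - zone k (ball (ctr k) (3 * rad k))"
    then have "psi k x = 1" unfolding psi_def using k by (intro zone_cut_1) (auto simp: zone_def)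
    then show "piece_cut k l x = 0" using l by (simp add: piece_cut_def)
  qed
  then show ?thesis using 1 by blast
qed

section \<open>Pieces of an operator in local coordinates\<close>

text \<open>Local symbols and kernels act on test functions on the whole Euclidean space, so the
  components are cut off. The plateau is 1 up to radius 5, beyond radius 4 where all
  \<open>piece_cut\<close> vanish, hence the cut-off is invisible after multiplication by
  them.\<close>

definition local_comp :: "nat \<Rightarrow> nat \<Rightarrow> ('m \<Rightarrow> 'f) \<Rightarrow> 'a \<Rightarrow> complex" where
  "local_comp k q u y = (if y \<in> img (ch k) then plateau (ctr k) (5 * rad k) (6 * rad k) y * lcomp (ch k) q u y else 0)"

lemma local_comp_0: "k < N \<Longrightarrow> y \<notin> cball (ctr k) (6 * rad k) \<Longrightarrow> local_comp k q u y = 0"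
  using rad[of k] by (auto simp: local_comp_def dist_commute intro!: plateau_eq_0)

lemma test_function_local_comp:
  assumes u: "u \<in> smooth_sections X" and k: "k < N"
  shows "test_function (local_comp k q u)"
proof (rule test_functionI[of _ "cball (ctr k) (6 * rad k)"])
  have "smooth_on (img (ch k)) (\<lambda>y. plateau (ctr k) (5 * rad k) (6 * rad k) y * lcomp (ch k) q u y)"
    by (intro smooth_on_mult open_img ch k smooth_on_plateau smooth_lcomp u)
  then have "smooth_on (img (ch k)) (local_comp k q u)"
    by (rule smooth_on_cong[OF open_img[OF ch[OF k]], rotated]) (simp add: local_comp_def)
  moreover have "smooth_on (- cball (ctr k) (6 * rad k)) (local_comp k q u)"
    using local_comp_0[OF k] by (intro smooth_on_vanishing) auto
  moreover have "img (ch k) \<union> - cball (ctr k) (6 * rad k) = UNIV" using cball_img[OF k, of 6] by auto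
  ultimately show "smooth_on UNIV (local_comp k q u)" using smooth_on_Un by metis
qed (use local_comp_0[OF k] in auto)

lemma local_comp_bound:
  assumes k: "k < N"
  shows "\<exists>D\<ge>0. \<forall>u\<in>smooth_sections X. \<forall>q<rk (ch k).
    (\<integral>\<^sup>+y. ennreal ((norm (local_comp k q u y))\<^sup>2) \<partial>lborel) \<le> ennreal D * (\<integral>\<^sup>+x. ennreal (fsq x (u x)) \<partial>dens X)"
proof -
  let ?S = "cball (ctr k) (6 * rad k)"
  have S: "?S \<subseteq> img (ch k)" "?S \<subseteq> cball (ctr k) (7 * rad k)" "?S \<in> sets borel"
    using cball_img[OF k, of 6] rad[OF k] by auto
  obtain C where C: "C > 0" "\<forall>u\<in>measurable_sections X. \<forall>S\<in>sets borel. S \<subseteq> cball (ctr k) (7 * rad k) \<longrightarrow>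
    (\<integral>\<^sup>+x. ennreal (fsq x (u x)) * indicator (zone k S) x \<partial>dens X) \<le> ennreal C * local_norm k S u \<and>
    local_norm k S u \<le> ennreal C * (\<integral>\<^sup>+x. ennreal (fsq x (u x)) * indicator (zone k S) x \<partial>dens X)"
    using local_norm_bounds[OF k] by blast
  have "(\<integral>\<^sup>+y. ennreal ((norm (local_comp k q u y))\<^sup>2) \<partial>lborel) \<le> ennreal C * (\<integral>\<^sup>+x. ennreal (fsq x (u x)) \<partial>dens X)"
    if u: "u \<in> smooth_sections X" and q: "q < rk (ch k)" for u q
  proof -
    have "(\<integral>\<^sup>+y. ennreal ((norm (local_comp k q u y))\<^sup>2) \<partial>lborel) \<le>
        (\<integral>\<^sup>+y. ennreal ((norm (lcomp (ch k) q u y))\<^sup>2) * indicator ?S y \<partial>lborel)"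
    proof (rule nn_integral_mono)
      fix y
      have "norm (local_comp k q u y) \<le> norm (lcomp (ch k) q u y)"
        using mult_right_mono[OF norm_plateau_le_1[of "ctr k" "5 * rad k" "6 * rad k" y] norm_ge_zero[of "lcomp (ch k) q u y"]]
        by (simp add: local_comp_def norm_mult)
      then have "(norm (local_comp k q u y))\<^sup>2 \<le> (norm (lcomp (ch k) q u y))\<^sup>2" by (intro power_mono) auto
      then show "ennreal ((norm (local_comp k q u y))\<^sup>2) \<le> ennreal ((norm (lcomp (ch k) q u y))\<^sup>2) * indicator ?S y"
        using local_comp_0[OF k, of y q u] by (cases "y \<in> ?S") (auto intro: ennreal_leI)
    qed
    also have "\<dots> \<le> local_norm k ?S u" unfolding local_norm_def
      using q by (intro member_le_sum[of q "{..<rk (ch k)}" "\<lambda>q. \<integral>\<^sup>+y. ennreal ((norm (lcomp (ch k) q u y))\<^sup>2) * indicator ?S y \<partial>lborel"]) auto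
    also have "\<dots> \<le> ennreal C * (\<integral>\<^sup>+x. ennreal (fsq x (u x)) * indicator (zone k ?S) x \<partial>dens X)"
      using C(2)[rule_format, OF smooth_sections_measurable[OF u] S(3,2)] by blast
    also have "\<dots> \<le> ennreal C * (\<integral>\<^sup>+x. ennreal (fsq x (u x)) \<partial>dens X)"
      by (intro mult_left_mono nn_integral_mono) (auto simp: indicator_def)
    finally show ?thesis .
  qed
  then show ?thesis using C(1) by (intro exI[of _ C]) auto
qed

text \<open>The section \<open>s q\<close> has the form of the argument built inside
  \<open>localized\<close>. Thus a cut-off section becomes a sum of inputs whose images are
  described by local symbols and kernels acting on test functions.\<close>

lemma cut_section_expansion:
  assumes u: "u \<in> smooth_sections X" and l: "l < N" and \<theta>: "smooth_fun \<theta>"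
    and z: "\<And>x. x \<notin> zone l (cball (ctr l) (4 * rad l)) \<Longrightarrow> \<theta> x = 0"
  defines "s \<equiv> \<lambda>q y. if y \<in> patch (ch l) then scal X (\<theta> y * local_comp l q u (coord (ch l) y)) (frame X (ch l) q y) else 0"
  shows "q < rk (ch l) \<Longrightarrow> s q \<in> smooth_sections X"
    and "(\<lambda>x. scal X (\<theta> x) (u x)) = (\<Sum>q<rk (ch l). s q)"
proof -
  define c where "c = ch l"
  have c: "c \<in> atlas X" using ch[OF l] by (simp add: c_def)
  let ?S = "cball (ctr l) (6 * rad l)"
  show "s q \<in> smooth_sections X" if q: "q < rk (ch l)"
  proof -
    let ?h = "\<lambda>y. \<theta> (coord_inv c y) * local_comp l q u y"
    have "smooth_on (img c) ?h"
      using \<theta> c test_function_local_comp[OF u l, of q] unfolding smooth_fun_def test_function_def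
      by (intro smooth_on_mult open_img c) (auto intro: smooth_on_subset)
    then have "chart_section c q ?h \<in> smooth_sections X"
      using q cball_img[OF l, of 6] local_comp_0[OF l]
      by (intro chart_section_smooth[OF c, where K="?S"]) (auto simp: c_def)
    also have "chart_section c q ?h = s q"
      using coord_inv_coord[OF c] by (auto simp: chart_section_def s_def c_def)
    finally show ?thesis .
  qed
  show "(\<lambda>x. scal X (\<theta> x) (u x)) = (\<Sum>q<rk (ch l). s q)"
  proof
    fix x
    show "scal X (\<theta> x) (u x) = (\<Sum>q<rk (ch l). s q) x"
    proof (cases "x \<in> zone l (cball (ctr l) (4 * rad l))")
      case False
      then have "\<theta> x = 0" by (rule z)
      then show ?thesis by (auto simp: sum_fun_apply s_def intro!: sum.neutral)
    next
      case True
      then have x: "x \<in> patch c" "dist (coord c x) (ctr l) \<le> 5 * rad l"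
        using rad[OF l] by (auto simp: zone_def c_def dist_commute)
      have lc: "local_comp l q u (coord c x) = triv c x (u x) q" for q
        using x rad[OF l] coord_img[OF c x(1)] coord_inv_coord[OF c x(1)]
        by (simp add: local_comp_def lcomp_def plateau_eq_1 flip: c_def)
      have "scal X (\<theta> x) (u x) = scal X (\<theta> x) (\<Sum>q<rk c. scal X (triv c x (u x) q) (frame X c q x))"
        using frame_expansion[OF c x(1) smooth_sections_fib[OF u]] by simp
      also have "\<dots> = (\<Sum>q<rk c. s q x)"
        unfolding vs.scale_sum_right using x lc by (intro sum.cong) (auto simp: s_def simp flip: c_def)
      finally show ?thesis by (simp add: sum_fun_apply c_def)
    qed
  qed
qed

definition piece_op :: "nat \<Rightarrow> nat \<Rightarrow> nat \<Rightarrow> nat \<Rightarrow> (('m \<Rightarrow> 'f) \<Rightarrow> 'm \<Rightarrow> 'f) \<Rightarrow> ('m \<Rightarrow> 'f) \<Rightarrow> 'a \<Rightarrow> complex" where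
  "piece_op k p l q A u = localized X (ch k) (ch (piece_index k l)) (phi k) (piece_cut k l) p q A (local_comp (piece_index k l) q u)"

text \<open>On the ball of radius \<open>rad k\<close> the factor \<open>phi k\<close> is 1, so
  cutting off the output changes nothing there. The input is split by the partition
  \<open>piece_cut k\<close> and then by frame components.\<close>

lemma lcomp_decomposition:
  assumes A: "linear_on_smooth A" and u: "u \<in> smooth_sections X" and k: "k < N"
    and y: "y \<in> cball (ctr k) (1 * rad k)"
  shows "lcomp (ch k) p (A u) y = (\<Sum>(l, q)\<in>Sigma {..N} (\<lambda>l. {..<rk (ch (piece_index k l))}). piece_op k p l q A u y)"
proof -
  define c where "c = ch k"
  have c: "c \<in> atlas X" using ch[OF k] by (simp add: c_def)
  have yi: "y \<in> img c" using cball_img[OF k, of 1] y by (auto simp: c_def)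
  let ?x = "coord_inv c y"
  have x: "?x \<in> patch c" "coord c ?x = y" using coord_inv_patch[OF c yi] coord_coord_inv[OF c yi] by auto
  have ph: "phi k ?x = 1"
    unfolding phi_def using k x y by (intro zone_cut_1) (auto simp: zone_def c_def)
  define s where "s l q z = (if z \<in> patch (ch (piece_index k l)) then scal X (piece_cut k l z * local_comp (piece_index k l) q u (coord (ch (piece_index k l)) z)) (frame X (ch (piece_index k l)) q z) else 0)" for l q z
  have sm: "s l q \<in> smooth_sections X" if "l \<le> N" "q < rk (ch (piece_index k l))" for l q
    unfolding s_def[abs_def]
    by (rule cut_section_expansion(1)[OF u piece_index_less[OF k that(1)] smooth_piece_cut[OF k that(1)] piece_cut_0[OF k that(1)] that(2)])
  have exp: "(\<lambda>z. scal X (piece_cut k l z) (u z)) = (\<Sum>q<rk (ch (piece_index k l)). s l q)" if "l \<le> N" for l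
    unfolding s_def[abs_def]
    by (rule cut_section_expansion(2)[OF u piece_index_less[OF k that] smooth_piece_cut[OF k that] piece_cut_0[OF k that]])
  define J where "J = Sigma {..N} (\<lambda>l. {..<rk (ch (piece_index k l))})"
  have usum: "u = (\<Sum>j\<in>J. s (fst j) (snd j))"
  proof
    fix z
    have "u z = scal X (\<Sum>l\<le>N. piece_cut k l z) (u z)" by (simp add: sum_piece_cut)
    also have "\<dots> = (\<Sum>l\<le>N. scal X (piece_cut k l z) (u z))" by (rule vs.scale_sum_left)
    also have "\<dots> = (\<Sum>l\<le>N. \<Sum>q<rk (ch (piece_index k l)). s l q z)"
    proof (rule sum.cong[OF refl])
      fix l assume "l \<in> {..N}"
      then show "scal X (piece_cut k l z) (u z) = (\<Sum>q<rk (ch (piece_index k l)). s l q z)"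
        using fun_cong[OF exp[of l], of z] by (simp only: atMost_iff sum_fun_apply)
    qed
    also have "\<dots> = (\<Sum>j\<in>J. s (fst j) (snd j) z)" unfolding J_def by (subst sum.Sigma) (auto simp: case_prod_beta)
    finally show "u z = (\<Sum>j\<in>J. s (fst j) (snd j)) z" by (simp add: sum_fun_apply)
  qed
  have smJ: "s (fst j) (snd j) \<in> smooth_sections X" if "j \<in> J" for j using that sm by (auto simp: J_def)
  have ASm: "A (s (fst j) (snd j)) \<in> smooth_sections X" if "j \<in> J" for j
    using A smJ[OF that] unfolding linear_on_smooth_def by blast
  have "A u = (\<Sum>j\<in>J. A (s (fst j) (snd j)))"
    using linear_on_smooth_sum[OF A smJ] usum by simp
  then have "lcomp c p (A u) y = triv c ?x (\<Sum>j\<in>J. A (s (fst j) (snd j)) ?x) p"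
    by (simp add: lcomp_def sum_fun_apply)
  also have "\<dots> = (\<Sum>j\<in>J. triv c ?x (A (s (fst j) (snd j)) ?x) p)"
    using ASm smooth_sections_fib by (intro triv_sum[OF c x(1)]) blast
  also have "\<dots> = (\<Sum>j\<in>J. piece_op k p (fst j) (snd j) A u y)"
    by (intro sum.cong refl) (simp add: piece_op_def localized_def Let_def s_def[abs_def] yi[unfolded c_def] ph[unfolded c_def] c_def)
  finally show ?thesis by (simp add: c_def J_def case_prod_beta)
qed

lemma measurable_piece_op:
  assumes A: "linear_on_smooth A" and u: "u \<in> smooth_sections X" and k: "k < N" and l: "l \<le> N" and q: "q < rk (ch (piece_index k l))"
  shows "piece_op k p l q A u \<in> borel_measurable borel"
proof -
  let ?s = "\<lambda>z. if z \<in> patch (ch (piece_index k l)) then scal X (piece_cut k l z * local_comp (piece_index k l) q u (coord (ch (piece_index k l)) z)) (frame X (ch (piece_index k l)) q z) else 0"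
  have "?s \<in> smooth_sections X"
    by (rule cut_section_expansion(1)[OF u piece_index_less[OF k l] smooth_piece_cut[OF k l] piece_cut_0[OF k l] q])
  then have As: "A ?s \<in> smooth_sections X" using A unfolding linear_on_smooth_def by blast
  have "smooth_on (img (ch k)) (\<lambda>y. phi k (coord_inv (ch k) y) * lcomp (ch k) p (A ?s) y)"
    using smooth_phi[OF k] ch[OF k] by (intro smooth_on_mult open_img smooth_lcomp As) (auto simp: smooth_fun_def)
  from measurable_if_continuous[OF open_img[OF ch[OF k]] smooth_on_continuous[OF this], of 0]
  show ?thesis unfolding piece_op_def localized_def Let_def lcomp_def .
qed

text \<open>The finitely many seminorms of the topology of operators that control the norm on
  \<open>L2 X\<close>: one symbol seminorm without derivatives in \<open>x\<close> for each
  near-diagonal piece, and the supremum of the kernel for each off-diagonal piece.\<close>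

definition local_data_bound :: "real \<Rightarrow> 'a list \<Rightarrow> (('m \<Rightarrow> 'f) \<Rightarrow> 'm \<Rightarrow> 'f) \<Rightarrow> real \<Rightarrow> bool" where
  "local_data_bound \<rho> bs A \<epsilon> \<longleftrightarrow>
     (\<forall>k<N. \<forall>p<rk (ch k). \<forall>q<rk (ch k). \<exists>a. local_symbol X (- \<rho>) (ch k) (phi k) (piece_cut k N) p q A a \<and>
        symbol_seminorm (- \<rho>) [] bs a \<le> \<epsilon>) \<and>
     (\<forall>k<N. \<forall>l<N. \<forall>p<rk (ch k). \<forall>q<rk (ch l). \<exists>K. local_kernel X (ch k) (ch l) (phi k) (piece_cut k l) p q A K \<and>
        kernel_seminorm [] K \<le> \<epsilon>)"

text \<open>The near-diagonal piece, index \<open>N\<close>, is covered by the bound for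
  quantizations, the others by the Hilbert-Schmidt bound. \<open>E\<close> depends only on the cover
  and on \<open>C0\<close>, so it is common to all operators, and \<open>\<epsilon>\<close> occurs
  squared because the norms are squared.\<close>

lemma piece_op_bound:
  assumes k: "k < N" and l: "l \<le> N" and p: "p < rk (ch k)" and q: "q < rk (ch (piece_index k l))" and bs: "set bs \<subseteq> Basis"
    and C0: "\<And>a \<epsilon> (u :: 'a \<Rightarrow> complex). a \<in> symbol_class (- \<rho>) \<Longrightarrow>
      (\<And>x \<xi>. norm (symbol_pderivs [] bs a (x, \<xi>)) \<le> \<epsilon> * (1 + norm \<xi>) powr (- \<rho> - real (length bs))) \<Longrightarrow> test_function u \<Longrightarrow>
      (\<integral>\<^sup>+x. ennreal (norm (Op a u x)) ^ 2 \<partial>lborel) \<le> ennreal (C0 * \<epsilon>) ^ 2 * (\<integral>\<^sup>+y. ennreal (norm (u y)) ^ 2 \<partial>lborel)"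
    and C0nn: "C0 \<ge> 0"
  shows "\<exists>E\<ge>0. \<forall>A \<epsilon>. \<forall>u\<in>smooth_sections X. 0 \<le> \<epsilon> \<longrightarrow> local_data_bound \<rho> bs A \<epsilon> \<longrightarrow>
    (\<integral>\<^sup>+y. ennreal ((norm (piece_op k p l q A u y))\<^sup>2) * indicator (cball (ctr k) (1 * rad k)) y \<partial>lborel) \<le>
      ennreal (E * \<epsilon>\<^sup>2) * (\<integral>\<^sup>+x. ennreal (fsq x (u x)) \<partial>dens X)"
proof -
  let ?j = "piece_index k l"
  have j: "?j < N" by (rule piece_index_less[OF k l])
  obtain D where D: "D \<ge> 0" "\<And>u q. u \<in> smooth_sections X \<Longrightarrow> q < rk (ch ?j) \<Longrightarrow>
    (\<integral>\<^sup>+y. ennreal ((norm (local_comp ?j q u y))\<^sup>2) \<partial>lborel) \<le> ennreal D * (\<integral>\<^sup>+x. ennreal (fsq x (u x)) \<partial>dens X)"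
    using local_comp_bound[OF j] by blast
  let ?S = "cball (ctr k) (1 * rad k)"
  show ?thesis
  proof (cases "l = N")
    case True
    have "(\<integral>\<^sup>+y. ennreal ((norm (piece_op k p l q A u y))\<^sup>2) * indicator ?S y \<partial>lborel) \<le>
      ennreal (C0\<^sup>2 * D * \<epsilon>\<^sup>2) * (\<integral>\<^sup>+x. ennreal (fsq x (u x)) \<partial>dens X)"
      if u: "u \<in> smooth_sections X" and e: "0 \<le> \<epsilon>" and ld: "local_data_bound \<rho> bs A \<epsilon>" for A \<epsilon> u
    proof -
      obtain a where a: "local_symbol X (- \<rho>) (ch k) (phi k) (piece_cut k N) p q A a" "symbol_seminorm (- \<rho>) [] bs a \<le> \<epsilon>"
      proof -
        have qk: "q < rk (ch k)" using q True by (simp add: piece_index_def)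
        from ld[unfolded local_data_bound_def, THEN conjunct1, rule_format, OF k p qk] that show thesis by blast
      qed
      have ac: "a \<in> symbol_class (- \<rho>)" using a(1) by (simp add: local_symbol_def)
      have t: "test_function (local_comp k q u)" by (rule test_function_local_comp[OF u k])
      have po: "piece_op k p l q A u = Op a (local_comp k q u)"
        using a(1) t True by (simp add: piece_op_def piece_index_def local_symbol_def)
      have ab: "norm (symbol_pderivs [] bs a (x, \<xi>)) \<le> \<epsilon> * (1 + norm \<xi>) powr (- \<rho> - real (length bs))" for x \<xi>
        using symbol_seminorm_bound[OF ac bs, of x \<xi>] mult_right_mono[OF a(2), of "(1 + norm \<xi>) powr (- \<rho> - real (length bs))"]
        by simp
      have "(\<integral>\<^sup>+y. ennreal ((norm (piece_op k p l q A u y))\<^sup>2) * indicator ?S y \<partial>lborel) \<le>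
          (\<integral>\<^sup>+y. ennreal (norm (Op a (local_comp k q u) y)) ^ 2 \<partial>lborel)"
        unfolding po by (intro nn_integral_mono) (auto simp: indicator_def ennreal_power)
      also have "\<dots> \<le> ennreal (C0 * \<epsilon>) ^ 2 * (\<integral>\<^sup>+y. ennreal (norm (local_comp k q u y)) ^ 2 \<partial>lborel)"
        by (rule C0[OF ac ab t])
      also have "\<dots> \<le> ennreal (C0 * \<epsilon>) ^ 2 * (ennreal D * (\<integral>\<^sup>+x. ennreal (fsq x (u x)) \<partial>dens X))"
        using D(2)[OF u, of q] q True by (intro mult_left_mono) (auto simp: piece_index_def ennreal_power)
      also have "\<dots> = ennreal (C0\<^sup>2 * D * \<epsilon>\<^sup>2) * (\<integral>\<^sup>+x. ennreal (fsq x (u x)) \<partial>dens X)"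
        using C0nn D(1) e by (simp add: ennreal_power ennreal_mult[symmetric] mult.assoc[symmetric] power_mult_distrib) (simp add: mult_ac)
      finally show ?thesis .
    qed
    then show ?thesis using D(1) by (intro exI[of _ "C0\<^sup>2 * D"]) auto
  next
    case False
    then have ln: "l < N" "?j = l" using l by (auto simp: piece_index_def)
    let ?B = "cball (ctr l) (6 * rad l)"
    define V where "V = measure lborel ?S * measure lborel ?B"
    have V: "emeasure lborel ?S * emeasure lborel ?B = ennreal V" "V \<ge> 0"
      using emeasure_lborel_cball_finite[of "ctr k" "1 * rad k"] emeasure_lborel_cball_finite[of "ctr l" "6 * rad l"]
      by (auto simp: V_def emeasure_eq_ennreal_measure ennreal_mult less_top)
    have "(\<integral>\<^sup>+y. ennreal ((norm (piece_op k p l q A u y))\<^sup>2) * indicator ?S y \<partial>lborel) \<le>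
      ennreal (V * D * \<epsilon>\<^sup>2) * (\<integral>\<^sup>+x. ennreal (fsq x (u x)) \<partial>dens X)"
      if u: "u \<in> smooth_sections X" and e: "0 \<le> \<epsilon>" and ld: "local_data_bound \<rho> bs A \<epsilon>" for A \<epsilon> u
    proof -
      obtain K where K: "local_kernel X (ch k) (ch l) (phi k) (piece_cut k l) p q A K" "kernel_seminorm [] K \<le> \<epsilon>"
      proof -
        have ql: "q < rk (ch l)" using q ln by simp
        from ld[unfolded local_data_bound_def, THEN conjunct2, rule_format, OF k ln(1) p ql] that show thesis by blast
      qed
      have Kt: "test_function K" using K(1) by (simp add: local_kernel_def)
      have Kb: "norm (K z) \<le> \<epsilon>" for z using kernel_seminorm_bound[OF Kt, of z] K(2) by simp
      have t: "test_function (local_comp l q u)" by (rule test_function_local_comp[OF u ln(1)])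
      have po: "piece_op k p l q A u = (\<lambda>x. LINT y|lborel. K (x, y) * local_comp l q u y)"
        using K(1) t ln by (simp add: piece_op_def local_kernel_def)
      have "(\<integral>\<^sup>+y. ennreal ((norm (piece_op k p l q A u y))\<^sup>2) * indicator ?S y \<partial>lborel) \<le>
          ennreal (\<epsilon>\<^sup>2) * (emeasure lborel ?S * emeasure lborel ?B) * (\<integral>\<^sup>+y. ennreal ((norm (local_comp l q u y))\<^sup>2) \<partial>lborel)"
        unfolding po by (rule kernel_L2_bound[OF Kt Kb test_function_measurable[OF t] local_comp_0[OF ln(1)]]) auto
      also have "\<dots> \<le> ennreal (\<epsilon>\<^sup>2) * (emeasure lborel ?S * emeasure lborel ?B) * (ennreal D * (\<integral>\<^sup>+x. ennreal (fsq x (u x)) \<partial>dens X))"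
        using D(2)[OF u, of q] q ln by (intro mult_left_mono) auto
      also have "\<dots> = ennreal (V * D * \<epsilon>\<^sup>2) * (\<integral>\<^sup>+x. ennreal (fsq x (u x)) \<partial>dens X)"
        unfolding V(1) using V(2) D(1) e by (simp add: ennreal_mult[symmetric] mult.assoc[symmetric]) (simp add: mult_ac)
      finally show ?thesis .
    qed
    then show ?thesis using D(1) V(2) by (intro exI[of _ "V * D"]) auto
  qed
qed

text \<open>The bound is linear in the local data with a constant common to all operators. It is
  applied to \<open>H t\<close> for boundedness and to differences of two such operators for
  continuity in norm.\<close>

theorem operator_estimate:
  assumes \<rho>: "\<rho> > 0"
  shows "\<exists>bs C. set bs \<subseteq> Basis \<and> C \<ge> 0 \<and> (\<forall>A \<epsilon>. \<forall>u\<in>smooth_sections X. linear_on_smooth A \<longrightarrow> 0 \<le> \<epsilon> \<longrightarrow>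
    local_data_bound \<rho> bs A \<epsilon> \<longrightarrow> L2_norm X (A u) \<le> C * \<epsilon> * L2_norm X u)"
proof -
  obtain bs :: "'a list" and C0 where bs: "set bs \<subseteq> Basis" and C0nn: "0 \<le> C0" and
    C0: "\<And>a \<epsilon> (u :: 'a \<Rightarrow> complex). a \<in> symbol_class (- \<rho>) \<Longrightarrow>
      (\<And>x \<xi>. norm (symbol_pderivs [] bs a (x, \<xi>)) \<le> \<epsilon> * (1 + norm \<xi>) powr (- \<rho> - real (length bs))) \<Longrightarrow> test_function u \<Longrightarrow>
      (\<integral>\<^sup>+x. ennreal (norm (Op a u x)) ^ 2 \<partial>lborel) \<le> ennreal (C0 * \<epsilon>) ^ 2 * (\<integral>\<^sup>+y. ennreal (norm (u y)) ^ 2 \<partial>lborel)"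
    using Op_L2_bound[OF \<rho>, where 'a='a] by blast
  define Nu where "Nu u = (\<integral>\<^sup>+x. ennreal (fsq x (u x)) \<partial>dens X)" for u
  have patchwise: "\<exists>M\<ge>0. \<forall>A \<epsilon>. \<forall>u\<in>smooth_sections X. linear_on_smooth A \<longrightarrow> 0 \<le> \<epsilon> \<longrightarrow> local_data_bound \<rho> bs A \<epsilon> \<longrightarrow>
      (\<integral>\<^sup>+x. ennreal (fsq x (A u x)) * indicator (zone k (cball (ctr k) (1 * rad k))) x \<partial>dens X) \<le> ennreal (M * \<epsilon>\<^sup>2) * Nu u"
    if k: "k < N" for k
  proof -
    let ?S = "cball (ctr k) (1 * rad k)"
    have S: "?S \<subseteq> cball (ctr k) (7 * rad k)" "?S \<in> sets borel" using rad[OF k] by auto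
    define J where "J = Sigma {..N} (\<lambda>l. {..<rk (ch (piece_index k l))})"
    have finJ: "finite J" by (auto simp: J_def)
    obtain C where C: "C > 0" "\<forall>u\<in>measurable_sections X. \<forall>S\<in>sets borel. S \<subseteq> cball (ctr k) (7 * rad k) \<longrightarrow>
      (\<integral>\<^sup>+x. ennreal (fsq x (u x)) * indicator (zone k S) x \<partial>dens X) \<le> ennreal C * local_norm k S u \<and>
      local_norm k S u \<le> ennreal C * (\<integral>\<^sup>+x. ennreal (fsq x (u x)) * indicator (zone k S) x \<partial>dens X)"
      using local_norm_bounds[OF k] by blast
    define Q where "Q i E \<longleftrightarrow> E \<ge> 0 \<and> (\<forall>A \<epsilon>. \<forall>u\<in>smooth_sections X. 0 \<le> \<epsilon> \<longrightarrow> local_data_bound \<rho> bs A \<epsilon> \<longrightarrow>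
      (\<integral>\<^sup>+y. ennreal ((norm (piece_op k (fst i) (fst (snd i)) (snd (snd i)) A u y))\<^sup>2) * indicator ?S y \<partial>lborel) \<le>
        ennreal (E * \<epsilon>\<^sup>2) * (\<integral>\<^sup>+x. ennreal (fsq x (u x)) \<partial>dens X))" for i E
    have "\<forall>i\<in>{..<rk (ch k)} \<times> J. \<exists>E. Q i E"
    proof
      fix i assume i: "i \<in> {..<rk (ch k)} \<times> J"
      have l: "fst (snd i) \<le> N" and p: "fst i < rk (ch k)" and q: "snd (snd i) < rk (ch (piece_index k (fst (snd i))))"
        using i by (auto simp: J_def)
      show "\<exists>E. Q i E" unfolding Q_def using C0 by (rule piece_op_bound[OF k l p q bs _ C0nn])
    qed
    from bchoice[OF this] obtain E where EQ: "\<forall>i\<in>{..<rk (ch k)} \<times> J. Q i (E i)" by (rule exE)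
    have E: "\<And>i. i \<in> {..<rk (ch k)} \<times> J \<Longrightarrow> E i \<ge> 0"
      "\<And>i A \<epsilon> u. i \<in> {..<rk (ch k)} \<times> J \<Longrightarrow> u \<in> smooth_sections X \<Longrightarrow> 0 \<le> \<epsilon> \<Longrightarrow> local_data_bound \<rho> bs A \<epsilon> \<Longrightarrow>
      (\<integral>\<^sup>+y. ennreal ((norm (piece_op k (fst i) (fst (snd i)) (snd (snd i)) A u y))\<^sup>2) * indicator ?S y \<partial>lborel) \<le> ennreal (E i * \<epsilon>\<^sup>2) * Nu u"
    proof -
      fix i assume i: "i \<in> {..<rk (ch k)} \<times> J"
      note QE = EQ[rule_format, OF i, unfolded Q_def]
      show "E i \<ge> 0" by (rule QE[THEN conjunct1])
      fix A \<epsilon> u assume "u \<in> smooth_sections X" "0 \<le> \<epsilon>" "local_data_bound \<rho> bs A \<epsilon>"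
      then show "(\<integral>\<^sup>+y. ennreal ((norm (piece_op k (fst i) (fst (snd i)) (snd (snd i)) A u y))\<^sup>2) * indicator ?S y \<partial>lborel) \<le> ennreal (E i * \<epsilon>\<^sup>2) * Nu u"
        unfolding Nu_def by (rule QE[THEN conjunct2, rule_format])
    qed
    \<comment> \<open>\<open>C\<close> converts Euclidean norms to those of the bundle;
      \<open>card J\<close> arises from the square of a sum over the pieces in
      \<open>J\<close>.\<close>
    define M where "M = C * (\<Sum>p<rk (ch k). real (card J) * (\<Sum>j\<in>J. E (p, j)))"
    have M: "M \<ge> 0" unfolding M_def using C(1) E(1) by (intro mult_nonneg_nonneg sum_nonneg) auto
    have "(\<integral>\<^sup>+x. ennreal (fsq x (A u x)) * indicator (zone k ?S) x \<partial>dens X) \<le> ennreal (M * \<epsilon>\<^sup>2) * Nu u"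
      if u: "u \<in> smooth_sections X" and A: "linear_on_smooth A" and e: "0 \<le> \<epsilon>" and ld: "local_data_bound \<rho> bs A \<epsilon>" for A \<epsilon> u
    proof -
      have Au: "A u \<in> smooth_sections X" using A u unfolding linear_on_smooth_def by blast
      have comp: "(\<integral>\<^sup>+y. ennreal ((norm (lcomp (ch k) p (A u) y))\<^sup>2) * indicator ?S y \<partial>lborel) \<le>
          ennreal ((real (card J) * (\<Sum>j\<in>J. E (p, j))) * \<epsilon>\<^sup>2) * Nu u" if p: "p < rk (ch k)" for p
      proof -
        let ?T = "\<lambda>j. piece_op k p (fst j) (snd j) A u"
        have Tm: "?T j \<in> borel_measurable borel" if "j \<in> J" for j
          using that by (intro measurable_piece_op A u k) (auto simp: J_def)
        have "(\<integral>\<^sup>+y. ennreal ((norm (lcomp (ch k) p (A u) y))\<^sup>2) * indicator ?S y \<partial>lborel) \<le>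
            (\<integral>\<^sup>+y. ennreal (real (card J)) * (\<Sum>j\<in>J. ennreal ((norm (?T j y))\<^sup>2) * indicator ?S y) \<partial>lborel)"
        proof (rule nn_integral_mono)
          fix y
          show "ennreal ((norm (lcomp (ch k) p (A u) y))\<^sup>2) * indicator ?S y \<le>
            ennreal (real (card J)) * (\<Sum>j\<in>J. ennreal ((norm (?T j y))\<^sup>2) * indicator ?S y)"
          proof (cases "y \<in> ?S")
            case True
            have "lcomp (ch k) p (A u) y = (\<Sum>j\<in>J. ?T j y)"
              using lcomp_decomposition[OF A u k True, of p] by (simp add: J_def case_prod_beta)
            then have "(norm (lcomp (ch k) p (A u) y))\<^sup>2 \<le> real (card J) * (\<Sum>j\<in>J. (norm (?T j y))\<^sup>2)"
              using norm_sum_squared_le[OF finJ] by simp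
            then have "ennreal ((norm (lcomp (ch k) p (A u) y))\<^sup>2) \<le> ennreal (real (card J) * (\<Sum>j\<in>J. (norm (?T j y))\<^sup>2))"
              by (rule ennreal_leI)
            also have "\<dots> = ennreal (real (card J)) * (\<Sum>j\<in>J. ennreal ((norm (?T j y))\<^sup>2))"
              by (subst ennreal_mult) (auto simp: sum_nonneg sum_ennreal)
            finally show ?thesis using True by simp
          qed simp
        qed
        also have "\<dots> = ennreal (real (card J)) * (\<Sum>j\<in>J. \<integral>\<^sup>+y. ennreal ((norm (?T j y))\<^sup>2) * indicator ?S y \<partial>lborel)"
        proof -
          have m: "(\<lambda>y. ennreal ((norm (?T j y))\<^sup>2) * indicator ?S y) \<in> borel_measurable lborel" if "j \<in> J" for j
          proof -
            note [measurable] = Tm[OF that] S(2)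
            show ?thesis by measurable
          qed
          show ?thesis
            using m by (subst nn_integral_cmult) (auto intro!: borel_measurable_sum arg_cong[where f="\<lambda>z. _ * z"] nn_integral_sum)
        qed
        also have "\<dots> \<le> ennreal (real (card J)) * (\<Sum>j\<in>J. ennreal (E (p, j) * \<epsilon>\<^sup>2) * Nu u)"
        proof (intro mult_left_mono sum_mono)
          fix j assume "j \<in> J"
          then show "(\<integral>\<^sup>+y. ennreal ((norm (?T j y))\<^sup>2) * indicator ?S y \<partial>lborel) \<le> ennreal (E (p, j) * \<epsilon>\<^sup>2) * Nu u"
            using E(2)[of "(p, j)" u \<epsilon> A] p u e ld by simp
        qed simp
        also have "\<dots> = ennreal ((real (card J) * (\<Sum>j\<in>J. E (p, j))) * \<epsilon>\<^sup>2) * Nu u"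
        proof (subst sum_ennreal_mult)
          show "ennreal (real (card J)) * (ennreal ((\<Sum>j\<in>J. E (p, j)) * \<epsilon>\<^sup>2) * Nu u) = ennreal (real (card J) * (\<Sum>j\<in>J. E (p, j)) * \<epsilon>\<^sup>2) * Nu u"
            using E(1) p by (simp add: ennreal_mult' mult.assoc)
        qed (use E(1) p in auto)
        finally show ?thesis .
      qed
      have "(\<integral>\<^sup>+x. ennreal (fsq x (A u x)) * indicator (zone k ?S) x \<partial>dens X) \<le> ennreal C * local_norm k ?S (A u)"
        using C(2)[rule_format, OF smooth_sections_measurable[OF Au] S(2,1)] by blast
      also have "\<dots> \<le> ennreal C * (\<Sum>p<rk (ch k). ennreal ((real (card J) * (\<Sum>j\<in>J. E (p, j))) * \<epsilon>\<^sup>2) * Nu u)"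
        unfolding local_norm_def by (intro mult_left_mono sum_mono comp) auto
      also have "\<dots> = ennreal (M * \<epsilon>\<^sup>2) * Nu u"
      proof -
        have nn: "0 \<le> real (card J) * (\<Sum>j\<in>J. E (p, j))" if "p < rk (ch k)" for p
          using E(1) that by (intro mult_nonneg_nonneg sum_nonneg) auto
        then have nn2: "0 \<le> (\<Sum>p<rk (ch k). real (card J) * (\<Sum>j\<in>J. E (p, j)))" by (intro sum_nonneg) auto
        have "(\<Sum>p<rk (ch k). ennreal ((real (card J) * (\<Sum>j\<in>J. E (p, j))) * \<epsilon>\<^sup>2) * Nu u) =
            ennreal ((\<Sum>p<rk (ch k). real (card J) * (\<Sum>j\<in>J. E (p, j))) * \<epsilon>\<^sup>2) * Nu u"
          using nn by (intro sum_ennreal_mult) auto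
        then show ?thesis
          using C(1) nn2 by (simp only: M_def mult.assoc ennreal_mult' less_imp_le)
      qed
      finally show ?thesis .
    qed
    then show ?thesis using M by blast
  qed
  define P where "P k M \<longleftrightarrow> M \<ge> 0 \<and> (\<forall>A \<epsilon>. \<forall>u\<in>smooth_sections X. linear_on_smooth A \<longrightarrow> 0 \<le> \<epsilon> \<longrightarrow> local_data_bound \<rho> bs A \<epsilon> \<longrightarrow>
      (\<integral>\<^sup>+x. ennreal (fsq x (A u x)) * indicator (zone k (cball (ctr k) (1 * rad k))) x \<partial>dens X) \<le> ennreal (M * \<epsilon>\<^sup>2) * Nu u)" for k M
  have "\<forall>k\<in>{..<N}. \<exists>M. P k M"
  proof
    fix k assume "k \<in> {..<N}"
    then have k: "k < N" by simp
    show "\<exists>M. P k M" unfolding P_def by (rule patchwise[OF k])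
  qed
  from bchoice[OF this] obtain M where MP: "\<forall>k\<in>{..<N}. P k (M k)" by (rule exE)
  have M: "\<And>k. k < N \<Longrightarrow> M k \<ge> 0"
    "\<And>k A \<epsilon> u. k < N \<Longrightarrow> u \<in> smooth_sections X \<Longrightarrow> linear_on_smooth A \<Longrightarrow> 0 \<le> \<epsilon> \<Longrightarrow> local_data_bound \<rho> bs A \<epsilon> \<Longrightarrow>
      (\<integral>\<^sup>+x. ennreal (fsq x (A u x)) * indicator (zone k (cball (ctr k) (1 * rad k))) x \<partial>dens X) \<le> ennreal (M k * \<epsilon>\<^sup>2) * Nu u"
  proof -
    fix k assume "k < N"
    then have "P k (M k)" using MP by simp
    note PM = this[unfolded P_def]
    show "M k \<ge> 0" by (rule PM[THEN conjunct1])
    fix A \<epsilon> u assume "u \<in> smooth_sections X" "linear_on_smooth A" "0 \<le> \<epsilon>" "local_data_bound \<rho> bs A \<epsilon>"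
    then show "(\<integral>\<^sup>+x. ennreal (fsq x (A u x)) * indicator (zone k (cball (ctr k) (1 * rad k))) x \<partial>dens X) \<le> ennreal (M k * \<epsilon>\<^sup>2) * Nu u"
      by (rule PM[THEN conjunct2, rule_format])
  qed
  \<comment> \<open>The constants \<open>M k\<close> bound squared norms and are summed over the
    cover.\<close>
  define C where "C = sqrt (\<Sum>k<N. M k)"
  have "0 \<le> (\<Sum>k<N. M k)" using M(1) by (intro sum_nonneg) auto
  then have C2: "C\<^sup>2 = (\<Sum>k<N. M k)" "C \<ge> 0" by (simp_all add: C_def)
  have "L2_norm X (A u) \<le> C * \<epsilon> * L2_norm X u"
    if u: "u \<in> smooth_sections X" and A: "linear_on_smooth A" and e: "0 \<le> \<epsilon>" and ld: "local_data_bound \<rho> bs A \<epsilon>" for A \<epsilon> u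
  proof (rule L2_norm_le)
    have Au: "A u \<in> smooth_sections X" using A u unfolding linear_on_smooth_def by blast
    show "A u \<in> L2 X" by (rule smooth_sections_L2[OF Au])
    have uL: "u \<in> L2 X" by (rule smooth_sections_L2[OF u])
    show "0 \<le> C * \<epsilon> * L2_norm X u" using C2 e L2_norm_eq(2)[OF uL] by simp
    have "(\<integral>\<^sup>+x. ennreal (fsq x (A u x)) \<partial>dens X) \<le>
        (\<Sum>k<N. \<integral>\<^sup>+x. ennreal (fsq x (A u x)) * indicator (zone k (cball (ctr k) (1 * rad k))) x \<partial>dens X)"
      using measurable_fsq[OF smooth_sections_measurable[OF Au]] by (intro nn_integral_cover_le) auto
    also have "\<dots> \<le> (\<Sum>k<N. ennreal (M k * \<epsilon>\<^sup>2) * Nu u)"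
      by (intro sum_mono M(2) u A e ld) auto
    also have "\<dots> = ennreal ((\<Sum>k<N. M k) * \<epsilon>\<^sup>2) * Nu u"
      using M(1) by (intro sum_ennreal_mult) auto
    also have "\<dots> = ennreal ((C * \<epsilon> * L2_norm X u)\<^sup>2)"
      unfolding Nu_def L2_norm_eq(1)[OF uL, symmetric] C2(1)[symmetric]
      by (subst ennreal_mult[symmetric]) (auto simp: power_mult_distrib)
    finally show "(\<integral>\<^sup>+x. ennreal (fsq x (A u x)) \<partial>dens X) \<le> ennreal ((C * \<epsilon> * L2_norm X u)\<^sup>2)" .
  qed
  then show ?thesis using bs C2(2) by blast
qed

end

section \<open>Seminorm neighbourhoods in the topology of operators\<close>

lemma finite_uniform_bound:
  assumes "finite I" "\<And>i. i \<in> I \<Longrightarrow> \<exists>e. P i e" "\<And>i e e' :: real. P i e \<Longrightarrow> e \<le> e' \<Longrightarrow> P i e'"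
  shows "\<exists>e\<ge>0. \<forall>i\<in>I. P i e"
  using assms(1,2)
proof (induction I)
  case empty then show ?case by auto
next
  case (insert i I)
  then obtain e where e: "e \<ge> 0" "\<forall>i\<in>I. P i e" by auto
  obtain e1 where e1: "P i e1" using insert by blast
  have "\<forall>j\<in>insert i I. P j (max e e1)" using e(2) e1 assms(3) by (metis insert_iff max.cobounded1 max.cobounded2)
  then show ?case using e(1) by (intro exI[of _ "max e e1"]) auto
qed

lemma eventually_in_open:
  assumes H: "continuous_map (top_of_set I) T H" and W: "openin T W" and t: "t \<in> I" "H t \<in> W"
  shows "eventually (\<lambda>r. H r \<in> W) (at t within I)"
proof -
  have "openin (top_of_set I) {x \<in> topspace (top_of_set I). H x \<in> W}"
    by (rule openin_continuous_map_preimage[OF H W])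
  then obtain O' where O': "open O'" "{x \<in> I. H x \<in> W} = I \<inter> O'" by (auto simp: openin_open)
  then have "\<forall>r\<in>O'. r \<in> I \<longrightarrow> H r \<in> W" "t \<in> O'" using t by blast+
  then show ?thesis using O'(1) unfolding eventually_at_topological by blast
qed

lemma symbol_pderivs_zero: "symbol_pderivs \<alpha> \<beta> (\<lambda>_. 0) = (\<lambda>_. 0)"
  by (simp add: symbol_pderivs_def pderivs_zero)

lemma zero_in_symbol_class: "(\<lambda>_. 0) \<in> symbol_class m"
  by (auto simp: symbol_class_def smooth_on_const symbol_pderivs_zero intro!: exI[of _ 0])

lemma symbol_seminorm_zero: "symbol_seminorm m \<alpha> \<beta> (\<lambda>_. 0) = 0"
  by (simp add: symbol_seminorm_def symbol_pderivs_zero)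

lemma test_function_zero: "test_function (\<lambda>_. 0)"
  by (rule test_functionI[of _ "{}"]) (auto simp: smooth_on_const)

context bundle_cover
begin

lemma psido_linear:
  assumes "A \<in> psido X m" shows "linear_on_smooth A"
  using assms unfolding psido_def linear_on_smooth_def sscal_def plus_fun_def by blast

lemma linear_on_smooth_diff:
  assumes A: "linear_on_smooth A" and B: "linear_on_smooth B"
  shows "linear_on_smooth (\<lambda>u x. A u x - B u x)"
proof -
  have e: "(\<lambda>x. A u x - B u x) = A u - B u" for u by (simp add: fun_eq_iff)
  show ?thesis
    unfolding linear_on_smooth_def e
  proof (intro conjI ballI allI)
    fix u z assume u: "u \<in> smooth_sections X"
    then have AB: "A u \<in> smooth_sections X" "B u \<in> smooth_sections X"
      using A B unfolding linear_on_smooth_def by blast+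
    then show "A u - B u \<in> smooth_sections X" by (rule L2.subspace_diff[OF smooth_sections_subspace])
    show "A (sscal z u) - B (sscal z u) = sscal z (A u - B u)"
      using A B u unfolding linear_on_smooth_def L2.scale_right_diff_distrib by simp
    fix v assume v: "v \<in> smooth_sections X"
    have "A (u + v) = A u + A v" "B (u + v) = B u + B v" using A B u v unfolding linear_on_smooth_def by blast+
    then show "A (u + v) - B (u + v) = (A u - B u) + (A v - B v)" by (simp only: add_diff_add)
  qed
qed

lemma diagonal_data_cover:
  "k < N \<Longrightarrow> p < rk (ch k) \<Longrightarrow> q < rk (ch k) \<Longrightarrow> diagonal_data X (ch k) (phi k) (piece_cut k N) p q"
  using cutoff_piece[of k N] by (simp add: diagonal_data_def ch cutoff_phi piece_index_def)

lemma off_diagonal_data_cover: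
  "k < N \<Longrightarrow> l < N \<Longrightarrow> p < rk (ch k) \<Longrightarrow> q < rk (ch l) \<Longrightarrow>
    off_diagonal_data X (ch k) (ch l) (phi k) (piece_cut k l) p q"
  using cutoff_piece[of k l] by (simp add: off_diagonal_data_def ch cutoff_phi piece_index_def supp_disjoint)

text \<open>Together with \<open>kernel_bound\<close> this recasts the two halves of
  \<open>local_data_bound\<close> over single finite index sets, so that bounds and eventual
  statements can be combined over all indices at once.\<close>

definition symbol_bound :: "real \<Rightarrow> 'a list \<Rightarrow> (('m \<Rightarrow> 'f) \<Rightarrow> 'm \<Rightarrow> 'f) \<Rightarrow> nat \<times> nat \<times> nat \<Rightarrow> real \<Rightarrow> bool" where
  "symbol_bound \<rho> bs A = (\<lambda>(k, p, q) \<epsilon>. \<exists>a. local_symbol X (- \<rho>) (ch k) (phi k) (piece_cut k N) p q A a \<and>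
        symbol_seminorm (- \<rho>) [] bs a \<le> \<epsilon>)"

definition kernel_bound :: "(('m \<Rightarrow> 'f) \<Rightarrow> 'm \<Rightarrow> 'f) \<Rightarrow> (nat \<times> nat) \<times> nat \<times> nat \<Rightarrow> real \<Rightarrow> bool" where
  "kernel_bound A = (\<lambda>((k, l), p, q) \<epsilon>. \<exists>K. local_kernel X (ch k) (ch l) (phi k) (piece_cut k l) p q A K \<and>
        kernel_seminorm [] K \<le> \<epsilon>)"

definition symbol_indices :: "(nat \<times> nat \<times> nat) set" where
  "symbol_indices = Sigma {..<N} (\<lambda>k. {..<rk (ch k)} \<times> {..<rk (ch k)})"

definition kernel_indices :: "((nat \<times> nat) \<times> nat \<times> nat) set" where
  "kernel_indices = Sigma ({..<N} \<times> {..<N}) (\<lambda>(k, l). {..<rk (ch k)} \<times> {..<rk (ch l)})"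

lemma finite_indices: "finite symbol_indices" "finite kernel_indices"
  by (auto simp: symbol_indices_def kernel_indices_def)

lemma local_data_bound_iff:
  "local_data_bound \<rho> bs A \<epsilon> \<longleftrightarrow>
    (\<forall>i\<in>symbol_indices. symbol_bound \<rho> bs A i \<epsilon>) \<and> (\<forall>i\<in>kernel_indices. kernel_bound A i \<epsilon>)"
  unfolding local_data_bound_def symbol_bound_def kernel_bound_def symbol_indices_def kernel_indices_def
  by auto

lemma symbol_bound_mono: "symbol_bound \<rho> bs A i e \<Longrightarrow> e \<le> e' \<Longrightarrow> symbol_bound \<rho> bs A i e'"
  unfolding symbol_bound_def by (cases i) (auto intro: order_trans)

lemma kernel_bound_mono: "kernel_bound A i e \<Longrightarrow> e \<le> e' \<Longrightarrow> kernel_bound A i e'"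
  unfolding kernel_bound_def by (cases i) (auto intro: order_trans)

lemma psido_local_data_bound:
  assumes A: "A \<in> psido X (- \<rho>)"
  shows "\<exists>\<epsilon>\<ge>0. local_data_bound \<rho> bs A \<epsilon>"
proof -
  have sym: "diagonal_data X c \<phi> \<psi> p q \<Longrightarrow> \<exists>a. local_symbol X (- \<rho>) c \<phi> \<psi> p q A a"
    and ker: "off_diagonal_data X c d \<phi> \<psi> p q \<Longrightarrow> \<exists>K. local_kernel X c d \<phi> \<psi> p q A K" for c d \<phi> \<psi> p q
    using A unfolding psido_def by blast+
  have "\<exists>e\<ge>0. \<forall>i\<in>symbol_indices. symbol_bound \<rho> bs A i e"
  proof (rule finite_uniform_bound[OF finite_indices(1)])
    fix i assume "i \<in> symbol_indices"
    then obtain k p q where i: "i = (k, p, q)" "k < N" "p < rk (ch k)" "q < rk (ch k)" by (auto simp: symbol_indices_def)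
    obtain a where a: "local_symbol X (- \<rho>) (ch k) (phi k) (piece_cut k N) p q A a"
      using sym[OF diagonal_data_cover[OF i(2-4)]] by blast
    show "\<exists>e. symbol_bound \<rho> bs A i e"
      unfolding symbol_bound_def i(1) prod.case
      by (rule exI[of _ "symbol_seminorm (- \<rho>) [] bs a"], rule exI[of _ a]) (simp add: a)
  qed (rule symbol_bound_mono)
  then obtain e1 where e1: "e1 \<ge> 0" "\<forall>i\<in>symbol_indices. symbol_bound \<rho> bs A i e1" by blast
  have "\<exists>e\<ge>0. \<forall>i\<in>kernel_indices. kernel_bound A i e"
  proof (rule finite_uniform_bound[OF finite_indices(2)])
    fix i assume "i \<in> kernel_indices"
    then obtain k l p q where i: "i = ((k, l), p, q)" "k < N" "l < N" "p < rk (ch k)" "q < rk (ch l)" by (auto simp: kernel_indices_def)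
    obtain K where K: "local_kernel X (ch k) (ch l) (phi k) (piece_cut k l) p q A K"
      using ker[OF off_diagonal_data_cover[OF i(2-5)]] by blast
    show "\<exists>e. kernel_bound A i e"
      unfolding kernel_bound_def i(1) prod.case
      by (rule exI[of _ "kernel_seminorm [] K"], rule exI[of _ K]) (simp add: K)
  qed (rule kernel_bound_mono)
  then obtain e2 where e2: "e2 \<ge> 0" "\<forall>i\<in>kernel_indices. kernel_bound A i e2" by blast
  have "local_data_bound \<rho> bs A (max e1 e2)"
    unfolding local_data_bound_iff
    using e1(2) e2(2) symbol_bound_mono[of \<rho> bs A _ e1 "max e1 e2"] kernel_bound_mono[of A _ e2 "max e1 e2"] by simp
  then show ?thesis using e1(1) by (intro exI[of _ "max e1 e2"]) auto
qed

text \<open>Serves to show that an operator belongs to the seminorm balls centred at itself: its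
  difference with itself has local symbol and local kernel 0.\<close>

lemma localized_zero:
  assumes c: "c \<in> atlas X" shows "localized X c d \<phi> \<psi> p q (\<lambda>u x. A u x - A u x) u = (\<lambda>_. 0)"
  using triv_0[OF c coord_inv_patch[OF c]] by (auto simp: localized_def Let_def)

text \<open>The relevant balls centred at \<open>H t\<close> are open and contain
  \<open>H t\<close>, and there are finitely many of them, so the continuity of \<open>H\<close>
  makes \<open>H r\<close> lie in all of them for \<open>r\<close> near \<open>t\<close>.\<close>

lemma eventually_local_data_bound:
  assumes H: "continuous_map (top_of_set I) (psido_topology X (- \<rho>)) H" and t: "t \<in> I" and Ht: "H t \<in> psido X (- \<rho>)"
    and bs: "set bs \<subseteq> Basis" and e: "e > 0"
  shows "eventually (\<lambda>r. local_data_bound \<rho> bs (\<lambda>u x. H r u x - H t u x) e) (at t within I)"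
  unfolding local_data_bound_iff
proof (intro eventually_conj eventually_ball_finite finite_indices ballI)
  fix i assume "i \<in> symbol_indices"
  then obtain k p q where i: "i = (k, p, q)" "k < N" "p < rk (ch k)" "q < rk (ch k)" by (auto simp: symbol_indices_def)
  note dd = diagonal_data_cover[OF i(2-4)]
  let ?W = "symbol_ball X (- \<rho>) (ch k) (phi k) (piece_cut k N) p q [] bs (H t) e"
  have "local_symbol X (- \<rho>) (ch k) (phi k) (piece_cut k N) p q (\<lambda>u x. H t u x - H t u x) (\<lambda>_. 0)"
    unfolding local_symbol_def using localized_zero[OF ch[OF i(2)]] zero_in_symbol_class by (auto simp: Op_def)
  then have mem: "H t \<in> ?W"
    unfolding symbol_ball_def using Ht e symbol_seminorm_zero[of "- \<rho>" "[]" bs] by auto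
  have "openin (psido_topology X (- \<rho>)) ?W"
    unfolding psido_topology_def
    by (rule topology_generated_by_Basis, rule UnI1, rule UnI2, rule CollectI, (rule exI)+, rule conjI[OF refl])
      (use dd bs Ht e in auto)
  from eventually_in_open[OF H this t mem]
  show "eventually (\<lambda>r. symbol_bound \<rho> bs (\<lambda>u x. H r u x - H t u x) i e) (at t within I)"
    by eventually_elim (auto simp: symbol_ball_def symbol_bound_def i(1) intro: less_imp_le)
next
  fix i assume "i \<in> kernel_indices"
  then obtain k l p q where i: "i = ((k, l), p, q)" "k < N" "l < N" "p < rk (ch k)" "q < rk (ch l)" by (auto simp: kernel_indices_def)
  note dd = off_diagonal_data_cover[OF i(2-5)]
  let ?W = "kernel_ball X (- \<rho>) (ch k) (ch l) (phi k) (piece_cut k l) p q [] (H t) e"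
  have "local_kernel X (ch k) (ch l) (phi k) (piece_cut k l) p q (\<lambda>u x. H t u x - H t u x) (\<lambda>_. 0)"
    unfolding local_kernel_def using localized_zero[OF ch[OF i(2)]] test_function_zero by auto
  then have mem: "H t \<in> ?W"
    unfolding kernel_ball_def using Ht e by (auto simp: kernel_seminorm_def intro!: exI[of _ "\<lambda>_. 0"])
  have "openin (psido_topology X (- \<rho>)) ?W"
    unfolding psido_topology_def
    by (rule topology_generated_by_Basis, rule UnI2, rule CollectI, (rule exI)+, rule conjI[OF refl])
      (use dd Ht e in auto)
  from eventually_in_open[OF H this t mem]
  show "eventually (\<lambda>r. kernel_bound (\<lambda>u x. H r u x - H t u x) i e) (at t within I)"
    by eventually_elim (auto simp: kernel_ball_def kernel_bound_def i(1) intro: less_imp_le)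
qed

lemma has_deriv_iff: "L2.has_deriv v g t S \<longleftrightarrow> L2_has_derivative X v g t S"
proof -
  have "sscal z (u - w) - h = (\<lambda>x. scal X z (u x - w x) - h x)" for z u w h
    by (simp add: sscal_def fun_eq_iff)
  then show ?thesis unfolding L2.has_deriv_def L2_has_derivative_def L2_nrm by simp
qed

text \<open>The whole space is one of the generating sets, so continuity of \<open>H\<close> into
  this topology includes that every \<open>H t\<close> is a pseudodifferential operator.\<close>

lemma topspace_psido: "topspace (psido_topology X m) = psido X m"
  unfolding psido_topology_def topology_generated_by_topspace
  by (auto simp: symbol_ball_def kernel_ball_def)

end

theorem proposition5p15:
  fixes X :: "('m::t2_space, 'a::euclidean_space, 'f::ab_group_add) hbundle"
    and a b \<rho> :: real
    and H :: "real \<Rightarrow> ('m \<Rightarrow> 'f) \<Rightarrow> 'm \<Rightarrow> 'f"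
    and U :: "real \<Rightarrow> real \<Rightarrow> ('m \<Rightarrow> 'f) \<Rightarrow> 'm \<Rightarrow> 'f"
  assumes "compact (UNIV :: 'm set)"
    and "smooth_vector_bundle X"
    and "hermitian_metric X"
    and "smooth_positive_density X"
    and "a \<le> b"
    and "\<rho> > 0"
    and "continuous_map (top_of_set {a..b}) (psido_topology X (- \<rho>)) H"
    and "\<And>t. t \<in> {a..b} \<Longrightarrow> symmetric_operator X (H t)"
    and "generates_unitary_propagator X {a..b} H U"
  shows "\<exists>Hb.
    (\<forall>t\<in>{a..b}. L2_bounded X (Hb t) \<and> (\<forall>u\<in>smooth_sections X. L2_eq X (Hb t u) (H t u))) \<and>
    (\<forall>t\<in>{a..b}. ((\<lambda>r. L2_onorm X (\<lambda>u x. Hb r u x - Hb t u x)) \<longlongrightarrow> 0) (at t within {a..b})) \<and>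
    (\<forall>u\<in>L2 X. L2_continuous_on X ({a..b} \<times> {a..b}) (\<lambda>(t, s). U t s u)) \<and>
    (\<forall>u\<in>L2 X. \<forall>s\<in>{a..b}.
       strong_solution X {a..b} (\<lambda>t v f. L2_eq X (Hb t v) f) (\<lambda>t. U t s u))"
proof -
  interpret hermitian_bundle X by unfold_locales (use assms in auto)
  obtain N ch ctr rad where cov: "\<forall>k<N::nat. ch k \<in> atlas X \<and> rad k > 0 \<and> cball (ctr k) (7 * rad k) \<subseteq> img (ch k)"
    "\<forall>x. \<exists>k<N. x \<in> patch (ch k) \<and> dist (ctr k) (coord (ch k) x) < rad k"
    using ex_cover by blast
  interpret bundle_cover X N ch ctr rad by unfold_locales (use cov in blast)+
  let ?I = "{a..b}"
  obtain bs C where bs: "set bs \<subseteq> Basis" and C: "C \<ge> 0"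
    and est: "\<And>A \<epsilon> u. u \<in> smooth_sections X \<Longrightarrow> linear_on_smooth A \<Longrightarrow> 0 \<le> \<epsilon> \<Longrightarrow> local_data_bound \<rho> bs A \<epsilon> \<Longrightarrow>
      L2_norm X (A u) \<le> C * \<epsilon> * L2_norm X u"
    using operator_estimate[OF assms(6)] by blast
  have Hp: "H t \<in> psido X (- \<rho>)" if "t \<in> ?I" for t
    using continuous_map_funspace[OF assms(7)] that by (auto simp: topspace_psido)
  have lin: "linear_on_smooth (H t)" if "t \<in> ?I" for t using psido_linear[OF Hp[OF that]] .
  have bdd: "\<exists>M\<ge>0. \<forall>u\<in>smooth_sections X. L2_norm X (H t u) \<le> M * L2_norm X u" if t: "t \<in> ?I" for t
  proof -
    obtain \<epsilon> where "\<epsilon> \<ge> 0" "local_data_bound \<rho> bs (H t) \<epsilon>" using psido_local_data_bound[OF Hp[OF t]] by blast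
    then show ?thesis using est[OF _ lin[OF t]] C by (intro exI[of _ "C * \<epsilon>"]) auto
  qed
  have cont: "eventually (\<lambda>r. \<forall>u\<in>smooth_sections X. L2_norm X (H r u - H t u) \<le> e * L2_norm X u) (at t within ?I)"
    if t: "t \<in> ?I" and e: "e > 0" for t e
  proof -
    \<comment> \<open>The added 1 keeps the tolerance meaningful when \<open>C = 0\<close>.\<close>
    have pos: "e / (C + 1) > 0" using e C by simp
    have "eventually (\<lambda>r. r \<in> ?I) (at t within ?I)" by (simp add: eventually_at_filter)
    with eventually_local_data_bound[OF assms(7) t Hp[OF t] bs pos]
    show ?thesis
    proof eventually_elim
      fix r assume ld: "local_data_bound \<rho> bs (\<lambda>u x. H r u x - H t u x) (e / (C + 1))" and r: "r \<in> ?I"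
      show "\<forall>u\<in>smooth_sections X. L2_norm X (H r u - H t u) \<le> e * L2_norm X u"
      proof
        fix u assume u: "u \<in> smooth_sections X"
        have nn: "L2_norm X u \<ge> 0" by (rule L2_norm_eq(2)[OF smooth_sections_L2[OF u]])
        have "L2_norm X (\<lambda>x. H r u x - H t u x) \<le> C * (e / (C + 1)) * L2_norm X u"
          using pos by (intro est[OF u linear_on_smooth_diff[OF lin[OF r] lin[OF t]] _ ld]) simp
        also have "\<dots> \<le> e * L2_norm X u"
          using e C nn by (intro mult_right_mono) (auto simp: field_simps)
        finally show "L2_norm X (H r u - H t u) \<le> e * L2_norm X u" by (simp add: fun_diff_def)
      qed
    qed
  qed
  have bsym: "L2D.bounded_symmetric (H t)" if t: "t \<in> ?I" for t
    unfolding L2D.bounded_symmetric_def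
  proof (intro conjI ballI)
    fix u assume u: "u \<in> smooth_sections X"
    show "H t u \<in> smooth_sections X" using lin[OF t] u unfolding linear_on_smooth_def by blast
    fix v assume v: "v \<in> smooth_sections X"
    show "L2_inner X (H t u) v = L2_inner X u (H t v)"
      using assms(8)[OF t] u v unfolding symmetric_operator_def by blast
    \<comment> \<open>Linearity is available for sums and scalar multiples, so the difference is
      written with the scalar -1.\<close>
    have mv: "sscal (-1) v \<in> smooth_sections X" unfolding sscal_def by (rule smooth_sections_scal[OF v])
    have "H t (u + sscal (-1) v) = H t u + H t (sscal (-1) v)" "H t (sscal (-1) v) = sscal (-1) (H t v)"
      using lin[OF t] u v mv unfolding linear_on_smooth_def by blast+
    then show "H t (u - v) = H t u - H t v" by simp
  next
    show "\<exists>C. \<forall>u\<in>smooth_sections X. L2.nrm (H t u) \<le> C * L2.nrm u"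
      using bdd[OF t] unfolding L2_nrm by blast
  qed
  \<comment> \<open>The values of \<open>H t\<close> away from smooth sections are arbitrary; the
    extension depends only on its restriction to smooth sections.\<close>
  define Hb where "Hb t = L2D.weak_ext (H t)" for t
  have HbL: "Hb t u \<in> L2 X" if "t \<in> ?I" "u \<in> L2 X" for t u
    unfolding Hb_def by (rule L2D.weak_ext(1)[OF bsym[OF that(1)] that(2)])
  have Hbip: "L2_inner X (H t w) u = L2_inner X w (Hb t u)" if "t \<in> ?I" "u \<in> L2 X" "w \<in> smooth_sections X" for t u w
    unfolding Hb_def by (rule L2D.weak_ext(2)[OF bsym[OF that(1)] that(2,3)])
  have smL: "w \<in> L2 X" if "w \<in> smooth_sections X" for w using smooth_sections_L2[OF that] .
  have HsL: "H t w \<in> L2 X" if "t \<in> ?I" "w \<in> smooth_sections X" for t w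
    using bsym[OF that(1)] that(2) smL unfolding L2D.bounded_symmetric_def by blast
  \<comment> \<open>Pairings with smooth sections determine the extension almost everywhere. Both
    its linearity and its agreement with \<open>H t\<close> on smooth sections are read off from
    this.\<close>
  have uniq: "L2_eq X (Hb t u) f" if "t \<in> ?I" "u \<in> L2 X" "f \<in> L2 X"
    "\<And>w. w \<in> smooth_sections X \<Longrightarrow> L2_inner X (H t w) u = L2_inner X w f" for t u f
    using L2D.weak_ext_unique[OF bsym[OF that(1)] that(2,3,4)] L2_eq_iff[OF HbL[OF that(1,2)] that(3)]
    by (simp add: L2_nrm Hb_def)
  have Hb_bound: "\<exists>M\<ge>0. \<forall>u\<in>L2 X. L2_norm X (Hb t u) \<le> M * L2_norm X u" if t: "t \<in> ?I" for t
  proof -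
    obtain M where M: "M \<ge> 0" "\<And>u. u \<in> smooth_sections X \<Longrightarrow> L2_norm X (H t u) \<le> M * L2_norm X u" using bdd[OF t] by blast
    show ?thesis
      using L2D.weak_ext_bound_0[OF bsym[OF t] M(1)] M unfolding L2_nrm Hb_def by (intro exI[of _ M]) blast
  qed
  have bounded: "L2_bounded X (Hb t)" if t: "t \<in> ?I" for t
    unfolding L2_bounded_def L2_linear_def
  proof (intro conjI ballI allI)
    fix u assume u: "u \<in> L2 X"
    show "Hb t u \<in> L2 X" by (rule HbL[OF t u])
    show "L2_eq X (Hb t (\<lambda>x. scal X z (u x))) (\<lambda>x. scal X z (Hb t u x))" for z
      using L2.ip_sc[OF smL HbL[OF t u]] L2.ip_sc[OF HsL[OF t] u] Hbip[OF t u] L2.V_sc[OF u] L2.V_sc[OF HbL[OF t u]]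
      unfolding sscal_def by (intro uniq t) simp_all
    fix v assume v: "v \<in> L2 X"
    have "L2_eq X (Hb t (u + v)) (Hb t u + Hb t v)"
      using L2.ip_add[OF smL HbL[OF t u] HbL[OF t v]] L2.ip_add[OF HsL[OF t] u v] Hbip[OF t u] Hbip[OF t v]
      by (intro uniq t L2.V_add u v HbL) simp_all
    then show "L2_eq X (Hb t (\<lambda>x. u x + v x)) (\<lambda>x. Hb t u x + Hb t v x)" by (simp add: plus_fun_def)
  next
    show "\<exists>C. \<forall>u\<in>L2 X. L2_norm X (Hb t u) \<le> C * L2_norm X u" using Hb_bound[OF t] by blast
  qed
  have extends: "L2_eq X (Hb t u) (H t u)" if t: "t \<in> ?I" and u: "u \<in> smooth_sections X" for t u
  proof (rule uniq[OF t smL[OF u] HsL[OF t u]])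
    show "L2_inner X (H t w) u = L2_inner X w (H t u)" if "w \<in> smooth_sections X" for w
      using bsym[OF t] u that unfolding L2D.bounded_symmetric_def by blast
  qed
  have onorm: "((\<lambda>r. L2_onorm X (\<lambda>u x. Hb r u x - Hb t u x)) \<longlongrightarrow> 0) (at t within ?I)" if t: "t \<in> ?I" for t
  proof (rule tendstoI)
    fix e :: real assume e: "e > 0"
    then have e2: "e / 2 > 0" by simp
    have "eventually (\<lambda>r. r \<in> ?I) (at t within ?I)" by (simp add: eventually_at_filter)
    with cont[OF t e2] show "eventually (\<lambda>r. dist (L2_onorm X (\<lambda>u x. Hb r u x - Hb t u x)) 0 < e) (at t within ?I)"
    proof eventually_elim
      fix r assume close: "\<forall>u\<in>smooth_sections X. L2_norm X (H r u - H t u) \<le> e / 2 * L2_norm X u" and r: "r \<in> ?I"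
      let ?B = "{u \<in> L2 X. L2_norm X u \<le> 1}"
      have le: "L2_norm X (\<lambda>x. Hb r u x - Hb t u x) \<le> e / 2" if u: "u \<in> ?B" for u
      proof -
        have "L2_norm X (Hb r u - Hb t u) \<le> e / 2 * L2_norm X u"
          using L2D.weak_ext_diff_bound[OF bsym[OF r] bsym[OF t], of "e / 2" u] close e2 u
          unfolding L2_nrm Hb_def by auto
        also have "\<dots> \<le> e / 2 * 1" using u e2 by (intro mult_left_mono) auto
        finally show ?thesis by (simp add: fun_diff_def)
      qed
      have nn: "0 \<le> L2_norm X (\<lambda>x. Hb r u x - Hb t u x)" if "u \<in> ?B" for u
        using L2_norm_eq(2)[OF L2.V_diff[OF HbL[OF r] HbL[OF t]], of u u] that by (simp add: fun_diff_def)
      \<comment> \<open>The operator norm is a real supremum; the zero section makes its index set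
        nonempty and gives the lower bound 0.\<close>
      have zero: "0 \<in> ?B" using L2_0 L2.nrm_sc[OF L2_0, of 0] by (simp add: L2_nrm)
      have "L2_onorm X (\<lambda>u x. Hb r u x - Hb t u x) \<le> e / 2"
        unfolding L2_onorm_def using zero le by (intro cSUP_least) auto
      moreover have "0 \<le> L2_onorm X (\<lambda>u x. Hb r u x - Hb t u x)"
      proof -
        have "bdd_above ((\<lambda>u. L2_norm X (\<lambda>x. Hb r u x - Hb t u x)) ` ?B)"
          by (rule bdd_aboveI2[where M="e / 2"]) (rule le)
        from cSUP_upper[OF zero this] nn[OF zero] show ?thesis
          unfolding L2_onorm_def by (rule order_trans[rotated])
      qed
      ultimately show "dist (L2_onorm X (\<lambda>u x. Hb r u x - Hb t u x)) 0 < e" using e by simp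
    qed
  qed
  note gen = assms(9)[unfolded generates_unitary_propagator_def]
  have unit: "L2_unitary X (U t s)" if "t \<in> ?I" "s \<in> ?I" for t s using gen that by blast
  have UL: "U t s u \<in> L2 X" if "t \<in> ?I" "s \<in> ?I" "u \<in> L2 X" for t s u
    using unit[OF that(1,2)] that(3) unfolding L2_unitary_def L2_linear_def by blast
  have Ucont: "L2_continuous_on X (?I \<times> ?I) (\<lambda>(t, s). U t s u)" if "u \<in> L2 X" for u using gen that by blast
  have sol: "strong_solution X ?I (\<lambda>t v f. L2_eq X (Hb t v) f) (\<lambda>t. U t s u)" if u: "u \<in> L2 X" and s: "s \<in> ?I" for u s
    unfolding strong_solution_def
  proof (intro ballI conjI)
    fix t assume t: "t \<in> ?I"
    show "U t s u \<in> L2 X" by (rule UL[OF t s u])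
    have "L2.has_deriv (\<lambda>t. U t s u) (sscal (- \<i>) (L2D.weak_ext (H t) (U t s u))) t ?I"
    proof (rule L2D.strong_derivative[where A=H and U="\<lambda>t. U t s"])
      show "L2D.bounded_symmetric (H t)" if "t \<in> ?I" for t by (rule bsym[OF that])
      show "eventually (\<lambda>r. \<forall>u\<in>smooth_sections X. L2.nrm (H r u - H t u) \<le> e * L2.nrm u) (at t within ?I)"
        if "t \<in> ?I" "e > 0" for t e using cont[OF that] by (simp add: L2_nrm)
      show "U t s u \<in> L2 X" if "t \<in> ?I" "u \<in> L2 X" for t u by (rule UL[OF that(1) s that(2)])
      show "L2_inner X (U t s u) (U t s v) = L2_inner X u v" if "t \<in> ?I" "u \<in> L2 X" "v \<in> L2 X" for t u v
        using unit[OF that(1) s] that unfolding L2_unitary_def by blast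
      show "((\<lambda>r. L2.nrm (U r s u - U t s u)) \<longlongrightarrow> 0) (at t within ?I)" if t: "t \<in> ?I" and u: "u \<in> L2 X" for t u
      proof -
        \<comment> \<open>Joint continuity in both times is restricted to the slice with the second
          time equal to \<open>s\<close>.\<close>
        have "((\<lambda>r. L2_norm X (\<lambda>x. (case r of (t, s) \<Rightarrow> U t s u) x - (case (t, s) of (t, s) \<Rightarrow> U t s u) x)) \<longlongrightarrow> 0) (at (t, s) within ?I \<times> ?I)"
          using Ucont[OF u] t s unfolding L2_continuous_on_def by blast
        moreover have "filterlim (\<lambda>r. (r, s)) (at (t, s) within ?I \<times> ?I) (at t within ?I)"
          unfolding filterlim_at using s
          by (auto intro!: tendsto_Pair tendsto_ident_at tendsto_const simp: eventually_at_filter)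
        ultimately have "((\<lambda>r. L2_norm X (\<lambda>x. (case (r, s) of (t, s) \<Rightarrow> U t s u) x - (case (t, s) of (t, s) \<Rightarrow> U t s u) x)) \<longlongrightarrow> 0) (at t within ?I)"
          by (rule filterlim_compose)
        then show ?thesis by (simp add: L2_nrm fun_diff_def)
      qed
      show "\<exists>g\<in>L2 X. L2.has_deriv (\<lambda>t. U t s u) g t ?I \<and>
          (\<forall>w\<in>smooth_sections X. L2_inner X (H t w) (U t s u) = L2_inner X w (sscal \<i> g))"
        if "t \<in> ?I" "u \<in> smooth_sections X" for t u
      proof -
        \<comment> \<open>For smooth data the equation is assumed in the distributional sense, which
          is precisely the pairing condition that characterizes the extension.\<close>
        have "strong_solution X ?I (\<lambda>t. distributional_image X (H t)) (\<lambda>t. U t s u)" using gen s that by blast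
        then show ?thesis using that(1)
          unfolding strong_solution_def distributional_image_def has_deriv_iff sscal_def by blast
      qed
    qed (use u t in auto)
    then have "L2_has_derivative X (\<lambda>t. U t s u) (sscal (- \<i>) (Hb t (U t s u))) t ?I"
      by (simp add: has_deriv_iff Hb_def)
    moreover have "L2_eq X (Hb t (U t s u)) (\<lambda>x. scal X \<i> (sscal (- \<i>) (Hb t (U t s u)) x))"
      by (simp add: L2_eq_def sscal_def)
    ultimately show "\<exists>g\<in>L2 X. L2_has_derivative X (\<lambda>t. U t s u) g t ?I \<and> L2_eq X (Hb t (U t s u)) (\<lambda>x. scal X \<i> (g x))"
      using L2_scal[OF HbL[OF t UL[OF t s u]]] by blast
  qed
  show ?thesis
    using bounded extends onorm Ucont sol by (intro exI[of _ Hb]) blast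
qed

end
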